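(* Assume (Amax), (Amin), (Aint) and (Areg). Let $M>0$. Then ($\mathbb P^*$-a.s.) the function $\ell^{\mathrm{int}}$ is continuous on $\bigcup_{K'=1}^K\Sigma^{\sigma_-}_{K'}\times\Gamma^{K'}\times\mathrm{Cl}(\mathcal D(M))^{K'}\times(\mathcal B^* )^{K'}$, and $\mathbb P^*$-almost surely $$\sup_{\theta\in\Theta^{OK}_n(M)}\Big|\tfrac1n\ell_n(\theta)-\ell^{\mathrm{int}}\big(Q^\theta,\gamma^\theta,(D^{\theta,n}_x)_{x\in[K^\theta]},\mathbf b^\theta\big)\Big|\xrightarrow[n\to\infty]{}0.$$
   Context: Setting. Fix integers $K\ge1$, $d\ge1$ and $\sigma_-\in(0,1)$. $[K']=\{1,\dots,K'\}$; $\Delta_{K'}$ = probability vectors on $[K']$; $\Sigma^{\sigma_-}_{K'}$ = $K'\times K'$ stochastic matrices with all entries $\ge\sigma_-$; $\mathbb R_d[X]$ = real polynomials of degree $\le d$ on $\mathbb R_+$; $\Gamma$ a set of probability densities on $\mathbb R$, compact for pointwise convergence. $\Theta=\bigcup_{K'=1}^K\{[K']\}\times\Delta_{K'}\times\Sigma^{\sigma_-}_{K'}\times\Gamma^{K'}\times(\mathbb R_d[X])^{K'}$, elements $\theta=(K^\theta,\pi^\theta,Q^\theta,\gamma^\theta,T^\theta)$; $\ell_n(\theta)=\log\sum_{x_1^n\in[K^\theta]^n}\pi^\theta(x_1)\prod_{t=2}^nQ^\theta(x_{t-1},x_t)\prod_{t=1}^n\gamma^\theta_{x_t}(Y_t-T^\theta_{x_t}(t))$.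 True parameter $\theta^*=(K^*,\pi^*,Q^*,\gamma^*,T^* )\in\Theta$; under $\mathbb P^*$, $(X_t)$ is a Markov chain on $[K^*]$ with $(\pi^*,Q^* )$, $(Z^x_t)_{t\ge1}$ i.i.d. with density $\gamma^*_x$, mutually independent over $x$ and independent of $(X_t)$, $Z_t=Z^{X_t}_t$, $Z^{\max}_t=\max_x|Z^x_t|$, $Y_t=Z_t+T^*_{X_t}(t)$. Assumptions. (Amax): nonincreasing $g:\mathbb R_+\to\mathbb R_+$, $g\to0$ at $\infty$, $\gamma(z)\le g(|z|)$ for all $\gamma\in\Gamma$. (Amin): nonincreasing $m$ with $\gamma(z)\ge m(|z|)>0$ for all $\gamma\in\Gamma$. (Aint): $\mathbb E^*|\log m(M+Z^{\max}_1)|<\infty$ for all $M>0$. (Areg): there are a modulus of continuity $\omega$ (nondecreasing, continuous at 0, $\omega(0)=0$) and a nondecreasing $L$ with $|\log(\gamma(z+\eta)/\gamma(z))|\le L(|z|)\omega(|\eta|)$ for all $z,\eta,\gamma\in\Gamma$, and $\mathbb E^*[L(M+Z^{\max}_1)]<\infty$ for all $M>0$. Blocks. $x\mathcal R^*x'$ iff $T^*_x-T^*_{x'}$ is constant; $\mathcal B^*=[K^*]/\mathcal R^*$, $\mathbf b^*$ the quotient map, $B_t=\mathbf b^*(X_t)$, $\mathbb T^*_b=T^*_{\min b}$, $\Delta(x)=T^*_x(1)-\mathbb T^*_{\mathbf b^*(x)}(1)$, $\|\Delta\|_\infty=\max_x|\Delta(x)|$; $E(t)=\min_{b\ne b'}|\mathbb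 T^*_b(t)-\mathbb T^*_{b'}(t)|$, $n_1(M)=\inf\{n:\forall t\ge n,E(t)>2M\}$. $\Theta^{OK}_n(M)$: the $\theta$ such that each $x^*\in[K^*]$ has $x\in[K^\theta]$ with $\sup_{[0,n]}|T^*_{x^*}-T^\theta_x|\le M$ and each $x\in[K^\theta]$ has $x^*$ with the same bound. For $n\ge n_1(M+\|\Delta\|_\infty)$, $\theta\in\Theta^{OK}_n(M)$: $\mathbf b^\theta(x)$ is the unique $b$ with $\max_{t\in\{1..n\}}|\mathbb T^*_b(t)-T^\theta_x(t)|\le M+\|\Delta\|_\infty$, and $D^{\theta,n}_x(u)=T^\theta_x(nu)-\mathbb T^*_{\mathbf b^\theta(x)}(nu)$, $u\in[0,1]$. $\mathcal D(M)=\bigcup_{n\ge\max(4K(d+1),n_1(M+\|\Delta\|_\infty))}\{D^{\theta,n}_x:\theta\in\Theta^{OK}_n(M),x\in[K^\theta]\}$, $\mathrm{Cl}$ = closure in sup norm (the sup in the claim is over $n$ large enough for these objects to be defined). Homogeneous log-likelihood. $Z'_t=Y_t-\mathbb T^*_{B_t}(t)$. For $K'\ge1$, $\pi\in\Delta_{K'}$, $Q$ a $K'\times K'$ stochastic matrix, $\gamma=(\gamma_x)_{x\in[K']}$ functions on $\mathbb R$, $\mathbf b:[K']\to\mathcal B^*$: $\ell^{\mathrm{hom}}_n(\pi,Q,\gamma,\mathbf b)\{(\tilde z,\tilde b)_1^n\}=\log\sum_{x_1^n}\pi(x_1)\prod_{t=2}^nQ(x_{t-1},x_t)\prod_{t=1}^n\gamma_{x_t}(\tilde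 z_t)\mathbf 1\{\mathbf b(x_t)=\tilde b_t\}$, and $\ell^{\mathrm{hom}}(Q,\gamma,\mathbf b)=\lim_n\frac1n\ell^{\mathrm{hom}}_n(\pi,Q,\gamma,\mathbf b)\{(Z',B)_1^n\}$ (which a.s. exists, is finite and independent of $\pi$ for $Q\in\Sigma^{\sigma_-}_{K'}$, $\gamma$ a translate of an element of $\Gamma^{K'}$). For $\mathbf D\in\mathbb R^{K'}$, $\tau(\gamma,\mathbf D)=(z\mapsto\gamma_x(z-D_x))_x$. Integrated log-likelihood: $\ell^{\mathrm{int}}(Q,\gamma,\mathfrak D,\mathbf b)=\int_0^1\ell^{\mathrm{hom}}(Q,\tau(\gamma,\mathfrak D(u)),\mathbf b)\,du$ for $\mathfrak D=(D_x)_{x\in[K']}$ bounded functions on $[0,1]$. *)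

theory Defs
  imports "HOL-Probability.Probability" "HOL-Computational_Algebra.Polynomial"
begin

text \<open>A parameter theta = (K, pi, Q, gamma, T). Hidden states are 1..K (natural numbers);
  values of pi, Q, gamma, T outside the index range 1..K are irrelevant.\<close>

record hmmpar =
  Kp  :: nat
  pip :: "nat \<Rightarrow> real"
  Qp  :: "nat \<Rightarrow> nat \<Rightarrow> real"
  gp  :: "nat \<Rightarrow> real \<Rightarrow> real"
  Tp  :: "nat \<Rightarrow> real poly"

definition pvec :: "nat \<Rightarrow> (nat \<Rightarrow> real) \<Rightarrow> bool" where
  "pvec K' p \<longleftrightarrow> (\<forall>x\<in>{1..K'}. 0 \<le> p x) \<and> (\<Sum>x=1..K'. p x) = 1"

definition stochmat :: "real \<Rightarrow> nat \<Rightarrow> (nat \<Rightarrow> nat \<Rightarrow> real) \<Rightarrow> bool" where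
  "stochmat s K' Q \<longleftrightarrow> (\<forall>x\<in>{1..K'}. \<forall>y\<in>{1..K'}. s \<le> Q x y) \<and>
                       (\<forall>x\<in>{1..K'}. (\<Sum>y=1..K'. Q x y) = 1)"

definition Theta :: "nat \<Rightarrow> nat \<Rightarrow> real \<Rightarrow> (real \<Rightarrow> real) set \<Rightarrow> hmmpar set" where
  "Theta K d s \<Gamma> = {\<theta>. 1 \<le> Kp \<theta> \<and> Kp \<theta> \<le> K \<and> pvec (Kp \<theta>) (pip \<theta>) \<and>
      stochmat s (Kp \<theta>) (Qp \<theta>) \<and> (\<forall>x\<in>{1..Kp \<theta>}. gp \<theta> x \<in> \<Gamma>) \<and>
      (\<forall>x\<in>{1..Kp \<theta>}. degree (Tp \<theta> x) \<le> d)}"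

definition paths :: "nat \<Rightarrow> nat \<Rightarrow> (nat \<Rightarrow> nat) set" where
  "paths n K' = PiE {1..n} (\<lambda>_. {1..K'})"

definition loglik :: "nat \<Rightarrow> hmmpar \<Rightarrow> (nat \<Rightarrow> real) \<Rightarrow> real" where
  "loglik n \<theta> y = ln (\<Sum>xs\<in>paths n (Kp \<theta>).
      pip \<theta> (xs 1) * (\<Prod>t\<in>{2..n}. Qp \<theta> (xs (t - 1)) (xs t)) *
      (\<Prod>t\<in>{1..n}. gp \<theta> (xs t) (y t - poly (Tp \<theta> (xs t)) (real t))))"

text \<open>Ks, Ts: number of states and trends of the true parameter.\<close>
definition rel_trend :: "(nat \<Rightarrow> real poly) \<Rightarrow> nat \<Rightarrow> nat \<Rightarrow> bool" where
  "rel_trend Ts x x' \<longleftrightarrow> (\<exists>c. \<forall>u\<ge>0. poly (Ts x) u - poly (Ts x') u = c)"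

definition blockof :: "nat \<Rightarrow> (nat \<Rightarrow> real poly) \<Rightarrow> nat \<Rightarrow> nat set" where
  "blockof Ks Ts x = {x'\<in>{1..Ks}. rel_trend Ts x x'}"

definition Blocks :: "nat \<Rightarrow> (nat \<Rightarrow> real poly) \<Rightarrow> nat set set" where
  "Blocks Ks Ts = blockof Ks Ts ` {1..Ks}"

definition bigT :: "(nat \<Rightarrow> real poly) \<Rightarrow> nat set \<Rightarrow> real poly" where
  "bigT Ts b = Ts (Min b)"

definition Delta :: "nat \<Rightarrow> (nat \<Rightarrow> real poly) \<Rightarrow> nat \<Rightarrow> real" where
  "Delta Ks Ts x = poly (Ts x) 1 - poly (bigT Ts (blockof Ks Ts x)) 1"

definition normDelta :: "nat \<Rightarrow> (nat \<Rightarrow> real poly) \<Rightarrow> real" where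
  "normDelta Ks Ts = Max ((\<lambda>x. \<bar>Delta Ks Ts x\<bar>) ` {1..Ks})"

text \<open>n_1(M) = inf {n. for all t >= n, E(t) > 2M}, with E(t) the minimal gap between
  distinct block trends (E(t) = +infinity if there is a single block).\<close>
definition n1 :: "nat \<Rightarrow> (nat \<Rightarrow> real poly) \<Rightarrow> real \<Rightarrow> nat" where
  "n1 Ks Ts M = (LEAST n. \<forall>t\<ge>n. \<forall>b\<in>Blocks Ks Ts. \<forall>b'\<in>Blocks Ks Ts. b \<noteq> b' \<longrightarrow>
       2 * M < \<bar>poly (bigT Ts b) (real t) - poly (bigT Ts b') (real t)\<bar>)"

definition ThetaOK :: "nat \<Rightarrow> nat \<Rightarrow> real \<Rightarrow> (real \<Rightarrow> real) set \<Rightarrow> nat \<Rightarrow> (nat \<Rightarrow> real poly)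
    \<Rightarrow> nat \<Rightarrow> real \<Rightarrow> hmmpar set" where
  "ThetaOK K d s \<Gamma> Ks Ts n M = {\<theta>\<in>Theta K d s \<Gamma>.
      (\<forall>xs\<in>{1..Ks}. \<exists>x\<in>{1..Kp \<theta>}. \<forall>u\<in>{0..real n}. \<bar>poly (Ts xs) u - poly (Tp \<theta> x) u\<bar> \<le> M) \<and>
      (\<forall>x\<in>{1..Kp \<theta>}. \<exists>xs\<in>{1..Ks}. \<forall>u\<in>{0..real n}. \<bar>poly (Ts xs) u - poly (Tp \<theta> x) u\<bar> \<le> M)}"

text \<open>The block b^theta(x) (unique for n large enough).\<close>
definition bth :: "nat \<Rightarrow> (nat \<Rightarrow> real poly) \<Rightarrow> nat \<Rightarrow> real \<Rightarrow> hmmpar \<Rightarrow> nat \<Rightarrow> nat set" where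
  "bth Ks Ts n M \<theta> x = (THE b. b \<in> Blocks Ks Ts \<and>
      (\<forall>t\<in>{1..n}. \<bar>poly (bigT Ts b) (real t) - poly (Tp \<theta> x) (real t)\<bar> \<le> M + normDelta Ks Ts))"

text \<open>D^{theta,n}_x(u) = T^theta_x(nu) - TT*_{b^theta(x)}(nu), meaningful for u in [0,1].\<close>
definition Dfun :: "nat \<Rightarrow> (nat \<Rightarrow> real poly) \<Rightarrow> nat \<Rightarrow> real \<Rightarrow> hmmpar \<Rightarrow> nat \<Rightarrow> real \<Rightarrow> real" where
  "Dfun Ks Ts n M \<theta> x = (\<lambda>u. poly (Tp \<theta> x) (real n * u) -
                               poly (bigT Ts (bth Ks Ts n M \<theta> x)) (real n * u))"

definition DM :: "nat \<Rightarrow> nat \<Rightarrow> real \<Rightarrow> (real \<Rightarrow> real) set \<Rightarrow> nat \<Rightarrow> (nat \<Rightarrow> real poly)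
    \<Rightarrow> real \<Rightarrow> (real \<Rightarrow> real) set" where
  "DM K d s \<Gamma> Ks Ts M = (\<Union>n\<in>{max (4 * K * (d + 1)) (n1 Ks Ts (M + normDelta Ks Ts))..}.
      {Dfun Ks Ts n M \<theta> x | \<theta> x. \<theta> \<in> ThetaOK K d s \<Gamma> Ks Ts n M \<and> x \<in> {1..Kp \<theta>}})"

text \<open>Closure in the sup norm over [0,1] (functions are only relevant on [0,1]).\<close>
definition supcl :: "(real \<Rightarrow> real) set \<Rightarrow> (real \<Rightarrow> real) set" where
  "supcl S = {f. \<forall>\<epsilon>>0. \<exists>g\<in>S. \<forall>u\<in>{0..1}. \<bar>f u - g u\<bar> < \<epsilon>}"

definition Zobs :: "(nat \<Rightarrow> 'a \<Rightarrow> nat) \<Rightarrow> (nat \<Rightarrow> nat \<Rightarrow> 'a \<Rightarrow> real) \<Rightarrow> nat \<Rightarrow> 'a \<Rightarrow> real" where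
  "Zobs X Zx t \<omega> = Zx (X t \<omega>) t \<omega>"

definition Zmax :: "nat \<Rightarrow> (nat \<Rightarrow> nat \<Rightarrow> 'a \<Rightarrow> real) \<Rightarrow> nat \<Rightarrow> 'a \<Rightarrow> real" where
  "Zmax Ks Zx t \<omega> = Max ((\<lambda>x. \<bar>Zx x t \<omega>\<bar>) ` {1..Ks})"

definition Yobs :: "hmmpar \<Rightarrow> (nat \<Rightarrow> 'a \<Rightarrow> nat) \<Rightarrow> (nat \<Rightarrow> nat \<Rightarrow> 'a \<Rightarrow> real) \<Rightarrow> nat \<Rightarrow> 'a \<Rightarrow> real" where
  "Yobs \<theta>s X Zx t \<omega> = Zobs X Zx t \<omega> + poly (Tp \<theta>s (X t \<omega>)) (real t)"

definition Bproc :: "hmmpar \<Rightarrow> (nat \<Rightarrow> 'a \<Rightarrow> nat) \<Rightarrow> nat \<Rightarrow> 'a \<Rightarrow> nat set" where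
  "Bproc \<theta>s X t \<omega> = blockof (Kp \<theta>s) (Tp \<theta>s) (X t \<omega>)"

definition Zprime :: "hmmpar \<Rightarrow> (nat \<Rightarrow> 'a \<Rightarrow> nat) \<Rightarrow> (nat \<Rightarrow> nat \<Rightarrow> 'a \<Rightarrow> real) \<Rightarrow> nat \<Rightarrow> 'a \<Rightarrow> real" where
  "Zprime \<theta>s X Zx t \<omega> = Yobs \<theta>s X Zx t \<omega> - poly (bigT (Tp \<theta>s) (Bproc \<theta>s X t \<omega>)) (real t)"

definition lhom_n :: "nat \<Rightarrow> nat \<Rightarrow> (nat \<Rightarrow> real) \<Rightarrow> (nat \<Rightarrow> nat \<Rightarrow> real) \<Rightarrow> (nat \<Rightarrow> real \<Rightarrow> real)
    \<Rightarrow> (nat \<Rightarrow> nat set) \<Rightarrow> (nat \<Rightarrow> real) \<Rightarrow> (nat \<Rightarrow> nat set) \<Rightarrow> real" where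
  "lhom_n n K' p Q \<gamma> bb z bt = ln (\<Sum>xs\<in>paths n K'.
      p (xs 1) * (\<Prod>t\<in>{2..n}. Q (xs (t - 1)) (xs t)) *
      (\<Prod>t\<in>{1..n}. \<gamma> (xs t) (z t) * (if bb (xs t) = bt t then 1 else 0)))"

text \<open>ell^hom(Q, gamma, b): the (almost sure, deterministic) limit of (1/n) ell^hom_n
  evaluated at (Z', B); the initial law is taken uniform (the limit does not depend on it).\<close>
definition lhom :: "'a measure \<Rightarrow> hmmpar \<Rightarrow> (nat \<Rightarrow> 'a \<Rightarrow> nat) \<Rightarrow> (nat \<Rightarrow> nat \<Rightarrow> 'a \<Rightarrow> real)
    \<Rightarrow> nat \<Rightarrow> (nat \<Rightarrow> nat \<Rightarrow> real) \<Rightarrow> (nat \<Rightarrow> real \<Rightarrow> real) \<Rightarrow> (nat \<Rightarrow> nat set) \<Rightarrow> real" where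
  "lhom P \<theta>s X Zx K' Q \<gamma> bb = (THE c. AE \<omega> in P.
      (\<lambda>n. lhom_n n K' (\<lambda>_. 1 / real K') Q \<gamma> bb (\<lambda>t. Zprime \<theta>s X Zx t \<omega>) (\<lambda>t. Bproc \<theta>s X t \<omega>)
           / real n) \<longlonglongrightarrow> c)"

definition lint :: "'a measure \<Rightarrow> hmmpar \<Rightarrow> (nat \<Rightarrow> 'a \<Rightarrow> nat) \<Rightarrow> (nat \<Rightarrow> nat \<Rightarrow> 'a \<Rightarrow> real)
    \<Rightarrow> nat \<Rightarrow> (nat \<Rightarrow> nat \<Rightarrow> real) \<Rightarrow> (nat \<Rightarrow> real \<Rightarrow> real) \<Rightarrow> (nat \<Rightarrow> real \<Rightarrow> real)
    \<Rightarrow> (nat \<Rightarrow> nat set) \<Rightarrow> real" where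
  "lint P \<theta>s X Zx K' Q \<gamma> D bb =
     integral {0..1} (\<lambda>u. lhom P \<theta>s X Zx K' Q (\<lambda>x z. \<gamma> x (z - D x u)) bb)"

definition lint_dom :: "real \<Rightarrow> (real \<Rightarrow> real) set \<Rightarrow> (real \<Rightarrow> real) set \<Rightarrow> nat set set \<Rightarrow> nat
    \<Rightarrow> ((nat \<Rightarrow> nat \<Rightarrow> real) \<times> (nat \<Rightarrow> real \<Rightarrow> real) \<times> (nat \<Rightarrow> real \<Rightarrow> real) \<times> (nat \<Rightarrow> nat set)) set" where
  "lint_dom s \<Gamma> C B K' = {(Q, \<gamma>, D, bb). stochmat s K' Q \<and> (\<forall>x\<in>{1..K'}. \<gamma> x \<in> \<Gamma>) \<and>
      (\<forall>x\<in>{1..K'}. D x \<in> C) \<and> (\<forall>x\<in>{1..K'}. bb x \<in> B)}"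

text \<open>Continuity for the product topology: K' and b discrete, Q euclidean (entries in [K']),
  gamma for pointwise convergence (product topology on functions), D for the sup norm on [0,1].\<close>
definition cont_on_dom :: "nat \<Rightarrow> real \<Rightarrow> (real \<Rightarrow> real) set \<Rightarrow> (real \<Rightarrow> real) set \<Rightarrow> nat set set
    \<Rightarrow> (nat \<Rightarrow> (nat \<Rightarrow> nat \<Rightarrow> real) \<Rightarrow> (nat \<Rightarrow> real \<Rightarrow> real) \<Rightarrow> (nat \<Rightarrow> real \<Rightarrow> real)
        \<Rightarrow> (nat \<Rightarrow> nat set) \<Rightarrow> real) \<Rightarrow> bool" where
  "cont_on_dom K s \<Gamma> C B f \<longleftrightarrow>
    (\<forall>K'\<in>{1..K}. \<forall>Q \<gamma> D bb. (Q, \<gamma>, D, bb) \<in> lint_dom s \<Gamma> C B K' \<longrightarrow>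
      (\<forall>\<epsilon>>0. \<exists>\<delta>>0. \<exists>U. open U \<and> \<gamma> \<in> U \<and>
         (\<forall>Q' \<gamma>' D'. (Q', \<gamma>', D', bb) \<in> lint_dom s \<Gamma> C B K' \<and>
            (\<forall>x\<in>{1..K'}. \<forall>y\<in>{1..K'}. \<bar>Q' x y - Q x y\<bar> < \<delta>) \<and> \<gamma>' \<in> U \<and>
            (\<forall>x\<in>{1..K'}. \<forall>u\<in>{0..1}. \<bar>D' x u - D x u\<bar> < \<delta>) \<longrightarrow>
            \<bar>f K' Q' \<gamma>' D' bb - f K' Q \<gamma> D bb\<bar> < \<epsilon>)))"

end

theory Submission
  imports Defs
begin

text \<open>Since the transition probabilities lie in [sigma, 1], the log-likelihood is almost additive in
  time: cutting a time interval in two changes it by at most - ln sigma. This replaces any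
  exponential forgetting argument. Cutting time into blocks of length l determines the growth rate up
  to O(1/l) from averages of functions of a block, and after quantising the noise these averages
  converge by a law of large numbers for finite Markov chains satisfying a Doeblin condition; the
  quantisation error and all large values of the noise are controlled by averages of tails of an
  integrable i.i.d. sequence. By (Areg) the log-densities are equicontinuous, so the parameter space is
  totally bounded and the convergence of the homogeneous log-likelihood is uniform over it.

  For the trend model, the distinct block trends separate, so that hidden states in the wrong block
  contribute negligibly. What remains is a homogeneous model whose densities are translated by the
  slowly varying D(t/n): polynomials of bounded degree that are bounded on [0,1] are uniformly
  Lipschitz, hence D is nearly constant on each of J time blocks, almost additivity splits the
  log-likelihood over these blocks, and the result is a Riemann sum of the integral over [0,1].\<close>

text \<open>Two obstacles shape the argument: the log-likelihood is not a sum over time, and the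
  noise is unbounded. Against the first, every segment starts from weight 1 on each state instead of
  a probability vector. It then depends on its own observations only, and the cost of a cut is
  independent of the emissions, even of those that vanish on wrong blocks. Against the second, the
  noise at time t belongs to a random state, so its tail is dominated by the sum over all states x
  of the tails of \<open>Zx x t\<close>. Each is i.i.d. in t, and averaging them requires no
  knowledge of the hidden chain. Hence one almost sure event, \<open>good\<close>, carries all
  estimates that must hold for every parameter at once; the chain itself only enters the existence
  of limits.

  In the trend model a time block starts at a time that grows with n, whereas the limit theorem
  concerns segments starting at 0. The growth over a block is therefore taken as the difference of
  two initial segments, up to one cut. This is why convergence is made uniform over all lengths k at
  most n, with an error proportional to n.\<close>

section \<open>Forward recursion and almost additivity\<close>

text \<open>pv n y is the total weight of the hidden paths up to time n that then move to y. As the rows of Q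
  sum to 1, its sum over y is the likelihood of the first n observations. Here e t x stands for the
  emission density of state x at the t-th observation.\<close>

primrec pv :: "nat \<Rightarrow> (nat \<Rightarrow> nat \<Rightarrow> real) \<Rightarrow> (nat \<Rightarrow> nat \<Rightarrow> real) \<Rightarrow> (nat \<Rightarrow> real) \<Rightarrow> nat \<Rightarrow> nat \<Rightarrow> real" where
  "pv K Q e p 0 = p"
| "pv K Q e p (Suc n) = (\<lambda>y. \<Sum>x=1..K. pv K Q e p n x * e (Suc n) x * Q x y)"

definition lik :: "nat \<Rightarrow> (nat \<Rightarrow> nat \<Rightarrow> real) \<Rightarrow> (nat \<Rightarrow> nat \<Rightarrow> real) \<Rightarrow> (nat \<Rightarrow> real) \<Rightarrow> nat \<Rightarrow> real" where
  "lik K Q e p n = (\<Sum>y=1..K. pv K Q e p n y)"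

text \<open>The total initial weight is K and not 1; this is where the constants ln K of the later
  estimates come from.\<close>

definition seglik :: "nat \<Rightarrow> (nat \<Rightarrow> nat \<Rightarrow> real) \<Rightarrow> (nat \<Rightarrow> nat \<Rightarrow> real) \<Rightarrow> nat \<Rightarrow> nat \<Rightarrow> real" where
  "seglik K Q e a k = ln (lik K Q (\<lambda>t. e (a + t)) (\<lambda>_. 1) k)"

lemma pv_nonneg:
  assumes "\<And>x. x \<in> {1..K} \<Longrightarrow> 0 \<le> p x"
    and "\<And>x y. x \<in> {1..K} \<Longrightarrow> y \<in> {1..K} \<Longrightarrow> 0 \<le> Q x y"
    and "\<And>t x. t \<in> {1..n} \<Longrightarrow> x \<in> {1..K} \<Longrightarrow> 0 \<le> e t x"
    and "y \<in> {1..K}"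
  shows "0 \<le> pv K Q e p n y"
  using assms(3,4)
proof (induction n arbitrary: y)
  case 0
  then show ?case using assms(1) by simp
next
  case (Suc n)
  have "0 \<le> pv K Q e p n x * e (Suc n) x * Q x y" if "x \<in> {1..K}" for x
    using that Suc assms(2) by (intro mult_nonneg_nonneg) auto
  then show ?case by (auto intro!: sum_nonneg)
qed

text \<open>The recursion has nonnegative terms only, so factors between initial weights,
  transitions and emissions simply multiply. With \<open>a\<close> alone this compares different
  starting weights, which gives the cost of a cut and of the initial law; with \<open>q\<close> and
  \<open>c\<close> it compares different parameters.\<close>

lemma pv_le:
  assumes p: "\<And>x. x \<in> {1..K} \<Longrightarrow> 0 \<le> p x" "\<And>x. x \<in> {1..K} \<Longrightarrow> p x \<le> a * p' x" and a: "0 \<le> a"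
    and p': "\<And>x. x \<in> {1..K} \<Longrightarrow> 0 \<le> p' x"
    and Q: "\<And>x y. x \<in> {1..K} \<Longrightarrow> y \<in> {1..K} \<Longrightarrow> 0 \<le> Q x y \<and> 0 \<le> Q' x y \<and> Q x y \<le> q * Q' x y" and q: "0 \<le> q"
    and e: "\<And>t x. t \<in> {1..n} \<Longrightarrow> x \<in> {1..K} \<Longrightarrow> 0 \<le> e t x \<and> 0 \<le> e' t x \<and> e t x \<le> c t * e' t x"
    and c: "\<And>t. t \<in> {1..n} \<Longrightarrow> 0 \<le> c t"
    and y: "y \<in> {1..K}"
  shows "pv K Q e p n y \<le> a * (\<Prod>t=1..n. c t) * q ^ n * pv K Q' e' p' n y"
  using e c y
proof (induction n arbitrary: y)
  case 0
  then show ?case using p by simp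
next
  case (Suc n)
  have IH: "pv K Q e p n x \<le> a * (\<Prod>t=1..n. c t) * q ^ n * pv K Q' e' p' n x" if "x \<in> {1..K}" for x
    using that Suc.prems by (intro Suc.IH) auto
  have nn: "0 \<le> pv K Q e p n x" if "x \<in> {1..K}" for x
    using that Suc.prems p Q by (intro pv_nonneg) auto
  have nn': "0 \<le> pv K Q' e' p' n x" if "x \<in> {1..K}" for x
    using that Suc.prems p' Q by (intro pv_nonneg) auto
  have pc: "0 \<le> (\<Prod>t=1..n. c t)" using Suc.prems by (intro prod_nonneg) auto
  have "pv K Q e p n x * e (Suc n) x * Q x y \<le>
     (a * (\<Prod>t=1..n. c t) * q ^ n * pv K Q' e' p' n x) * (c (Suc n) * e' (Suc n) x) * (q * Q' x y)"
    if x: "x \<in> {1..K}" for x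
    using IH[OF x] nn[OF x] nn'[OF x] Suc.prems(1)[of "Suc n" x] Suc.prems(2)[of "Suc n"] Q[OF x Suc.prems(3)] x pc a q
    by (intro mult_mono mult_nonneg_nonneg) auto
  then have "pv K Q e p (Suc n) y \<le> (\<Sum>x=1..K. (a * (\<Prod>t=1..n. c t) * q ^ n * pv K Q' e' p' n x) * (c (Suc n) * e' (Suc n) x) * (q * Q' x y))"
    by (auto intro!: sum_mono)
  also have "\<dots> = a * (\<Prod>t=1..Suc n. c t) * q ^ Suc n * pv K Q' e' p' (Suc n) y"
    by (simp add: sum_distrib_left mult_ac)
  finally show ?case .
qed

lemma pv_add: "pv K Q e p (n + k) = pv K Q (\<lambda>t. e (n + t)) (pv K Q e p n) k"
  by (induction k) auto

lemma pv_cong: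
  assumes "\<And>t x. t \<in> {1..n} \<Longrightarrow> x \<in> {1..K} \<Longrightarrow> e t x = e' t x"
  shows "pv K Q e p n = pv K Q e' p n"
  using assms
proof (induction n)
  case (Suc n)
  then have "pv K Q e p n = pv K Q e' p n" by auto
  then show ?case using Suc.prems[of "Suc n"] by (auto intro!: sum.cong ext)
qed simp

lemma pv_scale: "pv K Q e (\<lambda>x. c * p x) n = (\<lambda>y. c * pv K Q e p n y)"
  by (induction n) (auto simp: sum_distrib_left mult_ac)

lemma lik_scale: "lik K Q e (\<lambda>x. c * p x) n = c * lik K Q e p n"
  by (simp add: lik_def pv_scale sum_distrib_left)

lemma lik_Suc:
  assumes "stochmat s K Q"
  shows "lik K Q e p (Suc n) = (\<Sum>x=1..K. pv K Q e p n x * e (Suc n) x)"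
proof -
  have "lik K Q e p (Suc n) = (\<Sum>y=1..K. \<Sum>x=1..K. pv K Q e p n x * e (Suc n) x * Q x y)"
    by (simp add: lik_def)
  also have "\<dots> = (\<Sum>x=1..K. \<Sum>y=1..K. pv K Q e p n x * e (Suc n) x * Q x y)"
    by (rule sum.swap)
  also have "\<dots> = (\<Sum>x=1..K. pv K Q e p n x * e (Suc n) x)"
    using assms by (intro sum.cong) (auto simp: stochmat_def simp flip: sum_distrib_left)
  finally show ?thesis .
qed

section \<open>Sums over hidden paths\<close>

lemma sum_paths_Suc:
  "(\<Sum>xs\<in>paths (Suc n) K. f xs) = (\<Sum>y=1..K. \<Sum>xs\<in>paths n K. f (xs(Suc n := y)))"
proof -
  have eq: "{1..Suc n} = insert (Suc n) {1..n}" by auto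
  have "(\<Sum>xs\<in>paths (Suc n) K. f xs) = (\<Sum>xs\<in>(\<lambda>(y, g). g(Suc n := y)) ` ({1..K} \<times> paths n K). f xs)"
    unfolding paths_def eq PiE_insert_eq ..
  also have "\<dots> = (\<Sum>z\<in>{1..K} \<times> paths n K. f ((\<lambda>(y, g). g(Suc n := y)) z))"
    unfolding paths_def by (subst sum.reindex) (auto intro!: inj_combinator)
  also have "\<dots> = (\<Sum>y=1..K. \<Sum>xs\<in>paths n K. f (xs(Suc n := y)))"
    by (simp add: sum.cartesian_product case_prod_unfold)
  finally show ?thesis .
qed

lemma finite_paths[simp]: "finite (paths n K)"
  by (simp add: paths_def finite_PiE)

text \<open>The test function \<open>h\<close> keeps the last state visible: in the induction the
  transition and the emission of a new state are absorbed into it.\<close>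

lemma pv_paths:
  "(\<Sum>xs\<in>paths (Suc n) K. p (xs 1) * (\<Prod>t\<in>{2..Suc n}. Q (xs (t - 1)) (xs t)) * (\<Prod>t\<in>{1..Suc n}. e t (xs t)) * h (xs (Suc n)))
     = (\<Sum>y=1..K. pv K Q e p n y * e (Suc n) y * h y)"
proof (induction n arbitrary: h)
  case 0
  have "paths 0 K = {\<lambda>_. undefined}" by (simp add: paths_def)
  then show ?case by (subst sum_paths_Suc) auto
next
  case (Suc n)
  have "(\<Sum>xs\<in>paths (Suc (Suc n)) K. p (xs 1) * (\<Prod>t\<in>{2..Suc (Suc n)}. Q (xs (t - 1)) (xs t)) * (\<Prod>t\<in>{1..Suc (Suc n)}. e t (xs t)) * h (xs (Suc (Suc n))))
    = (\<Sum>y=1..K. \<Sum>xs\<in>paths (Suc n) K. p (xs 1) * (\<Prod>t\<in>{2..Suc n}. Q (xs (t - 1)) (xs t)) * (\<Prod>t\<in>{1..Suc n}. e t (xs t)) * (Q (xs (Suc n)) y * e (Suc (Suc n)) y * h y))"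
  proof (subst sum_paths_Suc, intro sum.cong refl)
    fix y xs
    have a: "(\<Prod>t\<in>{2..Suc (Suc n)}. Q ((xs(Suc (Suc n) := y)) (t - 1)) ((xs(Suc (Suc n) := y)) t))
        = (\<Prod>t\<in>{2..Suc n}. Q (xs (t - 1)) (xs t)) * Q (xs (Suc n)) y"
      by (subst prod.nat_ivl_Suc') (auto intro!: prod.cong)
    have b: "(\<Prod>t\<in>{1..Suc (Suc n)}. e t ((xs(Suc (Suc n) := y)) t)) = (\<Prod>t\<in>{1..Suc n}. e t (xs t)) * e (Suc (Suc n)) y"
      by (subst prod.nat_ivl_Suc') (auto intro!: prod.cong)
    show "p ((xs(Suc (Suc n) := y)) 1) * (\<Prod>t\<in>{2..Suc (Suc n)}. Q ((xs(Suc (Suc n) := y)) (t - 1)) ((xs(Suc (Suc n) := y)) t)) *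
         (\<Prod>t\<in>{1..Suc (Suc n)}. e t ((xs(Suc (Suc n) := y)) t)) * h ((xs(Suc (Suc n) := y)) (Suc (Suc n))) =
       p (xs 1) * (\<Prod>t\<in>{2..Suc n}. Q (xs (t - 1)) (xs t)) * (\<Prod>t\<in>{1..Suc n}. e t (xs t)) * (Q (xs (Suc n)) y * e (Suc (Suc n)) y * h y)"
      unfolding a b by simp
  qed
  also have "\<dots> = (\<Sum>y=1..K. \<Sum>x=1..K. pv K Q e p n x * e (Suc n) x * (Q x y * e (Suc (Suc n)) y * h y))"
    by (intro sum.cong refl Suc.IH)
  also have "\<dots> = (\<Sum>y=1..K. pv K Q e p (Suc n) y * e (Suc (Suc n)) y * h y)"
    by (simp add: sum_distrib_left mult_ac)
  finally show ?case .
qed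

lemma lik_paths:
  assumes "stochmat s K Q" "n \<ge> 1"
  shows "(\<Sum>xs\<in>paths n K. p (xs 1) * (\<Prod>t\<in>{2..n}. Q (xs (t - 1)) (xs t)) * (\<Prod>t\<in>{1..n}. e t (xs t))) = lik K Q e p n"
proof -
  obtain k where n: "n = Suc k" using assms(2) by (cases n) auto
  show ?thesis using pv_paths[where p=p and Q=Q and e=e and h="\<lambda>_. 1" and n=k and K=K] unfolding n by (simp add: lik_Suc[OF assms(1)])
qed

section \<open>Transition probabilities bounded below\<close>

lemma stochmat_le1:
  assumes "stochmat s K Q" "0 \<le> s" "x \<in> {1..K}" "y \<in> {1..K}"
  shows "Q x y \<le> 1"
proof -
  have "Q x y \<le> (\<Sum>y=1..K. Q x y)"
    using assms unfolding stochmat_def by (intro member_le_sum) (auto intro: order.trans)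
  then show ?thesis using assms by (auto simp: stochmat_def)
qed

lemma stochmat_ge: "stochmat s K Q \<Longrightarrow> x \<in> {1..K} \<Longrightarrow> y \<in> {1..K} \<Longrightarrow> s \<le> Q x y"
  by (auto simp: stochmat_def)

lemma stochmat_card:
  assumes "stochmat s K Q" "1 \<le> K"
  shows "real K * s \<le> 1"
proof -
  have "(\<Sum>y=1..K. s) \<le> (\<Sum>y=1..K. Q 1 y)"
    using assms by (intro sum_mono) (auto simp: stochmat_def)
  then show ?thesis using assms by (auto simp: stochmat_def)
qed

text \<open>Emissions may vanish, as they do for states in the wrong block. \<open>e_pos\<close> is
  what keeps the likelihood positive, so that its logarithm is never the default value of
  \<open>ln\<close> at 0.\<close>

locale hmmseq =
  fixes s :: real and K :: nat and Q :: "nat \<Rightarrow> nat \<Rightarrow> real" and e :: "nat \<Rightarrow> nat \<Rightarrow> real"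
  assumes s: "0 < s" and K: "1 \<le> K" and Q: "stochmat s K Q"
    and e_nonneg: "\<And>t x. 1 \<le> t \<Longrightarrow> x \<in> {1..K} \<Longrightarrow> 0 \<le> e t x"
    and e_pos: "\<And>t. 1 \<le> t \<Longrightarrow> \<exists>x\<in>{1..K}. 0 < e t x"
begin

lemma Q_bounds: "x \<in> {1..K} \<Longrightarrow> y \<in> {1..K} \<Longrightarrow> s \<le> Q x y \<and> 0 < Q x y \<and> Q x y \<le> 1"
  using stochmat_le1[OF Q] stochmat_ge[OF Q] s by (metis less_eq_real_def less_le_trans)

lemma s_le1: "s \<le> 1"
proof -
  have "s * 1 \<le> s * real K" using K s by (intro mult_left_mono) auto
  then show ?thesis using stochmat_card[OF Q K] by (simp add: mult.commute)
qed

lemma shift: "hmmseq s K Q (\<lambda>t. e (a + t))"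
  using s K Q e_nonneg e_pos by unfold_locales auto

lemma pv1_pos: "y \<in> {1..K} \<Longrightarrow> 0 < pv K Q e (\<lambda>_. 1) n y"
proof (induction n arbitrary: y)
  case (Suc n)
  obtain x where x: "x \<in> {1..K}" "0 < e (Suc n) x" using e_pos[of "Suc n"] by auto
  have "0 < pv K Q e (\<lambda>_. 1) n x * e (Suc n) x * Q x y"
    using x Suc Q_bounds[of x y] by auto
  also have "\<dots> \<le> (\<Sum>x=1..K. pv K Q e (\<lambda>_. 1) n x * e (Suc n) x * Q x y)"
    using x Suc Q_bounds e_nonneg
    by (intro member_le_sum) (auto intro!: mult_nonneg_nonneg simp: less_imp_le)
  finally show ?case by simp
qed simp

lemma lik1_pos: "0 < lik K Q e (\<lambda>_. 1) n"
  unfolding lik_def using pv1_pos K by (intro sum_pos) auto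

text \<open>The last transition has probability between s and 1 whatever its origin, so all weights
  are comparable to their total. For n = 0 the total is K and the bound reads s K \<le> 1.\<close>

lemma pv_bounds:
  assumes y: "y \<in> {1..K}"
  shows "s * lik K Q e (\<lambda>_. 1) n \<le> pv K Q e (\<lambda>_. 1) n y" "pv K Q e (\<lambda>_. 1) n y \<le> lik K Q e (\<lambda>_. 1) n"
proof -
  show "pv K Q e (\<lambda>_. 1) n y \<le> lik K Q e (\<lambda>_. 1) n"
    unfolding lik_def using y pv1_pos by (intro member_le_sum) (auto simp: less_imp_le)
  show "s * lik K Q e (\<lambda>_. 1) n \<le> pv K Q e (\<lambda>_. 1) n y"
  proof (cases n)
    case 0
    then show ?thesis using stochmat_card[OF Q K] by (simp add: lik_def mult.commute)
  next
    case (Suc k)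
    have "s * lik K Q e (\<lambda>_. 1) n = (\<Sum>x=1..K. pv K Q e (\<lambda>_. 1) k x * e (Suc k) x * s)"
      unfolding Suc lik_Suc[OF Q] by (simp add: sum_distrib_left mult_ac)
    also have "\<dots> \<le> (\<Sum>x=1..K. pv K Q e (\<lambda>_. 1) k x * e (Suc k) x * Q x y)"
      using y Q_bounds pv1_pos e_nonneg
      by (intro sum_mono mult_left_mono mult_nonneg_nonneg) (auto simp: less_imp_le)
    finally show ?thesis unfolding Suc by simp
  qed
qed

text \<open>By \<open>pv_bounds\<close> the weights at time n lie between s \<open>?A\<close> and
  \<open>?A\<close>, where \<open>?A\<close> is the likelihood up to n. Replacing them by a constant
  restarts the second segment from weight 1; the upper bound is free and the lower one costs a
  factor s.\<close>

lemma seglik_add: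
  "seglik K Q e 0 (n + k) \<le> seglik K Q e 0 n + seglik K Q e n k"
  "seglik K Q e 0 n + seglik K Q e n k + ln s \<le> seglik K Q e 0 (n + k)"
proof -
  let ?A = "lik K Q e (\<lambda>_. 1) n" and ?B = "lik K Q (\<lambda>t. e (n + t)) (\<lambda>_. 1) k"
  interpret sh: hmmseq s K Q "\<lambda>t. e (n + t)" by (rule shift)
  have A: "?A > 0" and B: "?B > 0" and AB: "lik K Q e (\<lambda>_. 1) (n+k) > 0"
    by (rule lik1_pos sh.lik1_pos)+
  have q1: "pv K Q (\<lambda>t. e (n + t)) (pv K Q e (\<lambda>_. 1) n) k y \<le> ?A * pv K Q (\<lambda>t. e (n + t)) (\<lambda>_. 1) k y"
    if "y \<in> {1..K}" for y
    using pv_le[of K "pv K Q e (\<lambda>_. 1) n" ?A "\<lambda>_. 1" Q Q 1 k "\<lambda>t. e (n + t)" "\<lambda>t. e (n + t)" "\<lambda>_. 1" y]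
      that pv_bounds pv1_pos Q_bounds sh.e_nonneg A by (auto simp: less_imp_le)
  have q2: "s * ?A * pv K Q (\<lambda>t. e (n + t)) (\<lambda>_. 1) k y \<le> pv K Q (\<lambda>t. e (n + t)) (pv K Q e (\<lambda>_. 1) n) k y"
    if "y \<in> {1..K}" for y
  proof -
    \<comment> \<open>The factor is the one that makes the starting weights comparable: 1 is at most
      1 / (s \<open>?A\<close>) times the weight at the cut.\<close>
    have "pv K Q (\<lambda>t. e (n + t)) (\<lambda>_. 1) k y \<le> (1 / (s * ?A)) * (\<Prod>t=1..k. 1) * 1 ^ k * pv K Q (\<lambda>t. e (n + t)) (pv K Q e (\<lambda>_. 1) n) k y"
      using that pv_bounds pv1_pos Q_bounds sh.e_nonneg A s
      by (intro pv_le) (auto simp: less_imp_le field_simps)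
    then show ?thesis using A s by (simp add: field_simps)
  qed
  have "lik K Q e (\<lambda>_. 1) (n+k) \<le> ?A * ?B"
    unfolding lik_def[of K Q e _ "n+k"] lik_def[of K Q "\<lambda>t. e (n + t)"] pv_add sum_distrib_left
    using q1 by (intro sum_mono) auto
  then have "ln (lik K Q e (\<lambda>_. 1) (n+k)) \<le> ln (?A * ?B)"
    using A B AB by (subst ln_le_cancel_iff) auto
  then show "seglik K Q e 0 (n + k) \<le> seglik K Q e 0 n + seglik K Q e n k"
    using A B by (simp add: seglik_def ln_mult)
  have "s * ?A * ?B \<le> lik K Q e (\<lambda>_. 1) (n+k)"
    unfolding lik_def[of K Q e _ "n+k"] lik_def[of K Q "\<lambda>t. e (n + t)"] pv_add sum_distrib_left
    using q2 by (intro sum_mono) auto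
  then have "ln (s * ?A * ?B) \<le> ln (lik K Q e (\<lambda>_. 1) (n+k))"
    using A B AB s by (subst ln_le_cancel_iff) auto
  then show "seglik K Q e 0 n + seglik K Q e n k + ln s \<le> seglik K Q e 0 (n + k)"
    using A B s by (simp add: seglik_def ln_mult)
qed

lemma seglik_add_abs: "\<bar>seglik K Q e 0 (n + k) - seglik K Q e 0 n - seglik K Q e n k\<bar> \<le> - ln s"
  using seglik_add[of n k] s_le1 s by (auto simp: abs_le_iff)

text \<open>One cut is paid per block. The term ln K is the value of the empty segment from which
  the induction starts.\<close>

lemma seglik_blocks:
  assumes b0: "b 0 = 0" and b: "\<And>j. b j \<le> b (Suc j)"
  shows "\<bar>seglik K Q e 0 (b J) - (\<Sum>j<J. seglik K Q e (b j) (b (Suc j) - b j))\<bar> \<le> ln K + J * (- ln s)"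
proof (induction J)
  case 0
  then show ?case using b0 K by (simp add: seglik_def lik_def)
next
  case (Suc J)
  have "b (Suc J) = b J + (b (Suc J) - b J)" using b[of J] by simp
  then have "\<bar>seglik K Q e 0 (b (Suc J)) - seglik K Q e 0 (b J) - seglik K Q e (b J) (b (Suc J) - b J)\<bar> \<le> - ln s"
    using seglik_add_abs[of "b J" "b (Suc J) - b J"] by simp
  with Suc show ?case by (simp add: algebra_simps)
qed

text \<open>For the lower bound a single state with a good emission is enough at each time, since by
  \<open>pv_bounds\<close> it carries at least a share s of the total weight. This accounts for the
  summand - ln s.\<close>

lemma seglik_bound:
  assumes "\<And>t x. t \<in> {a+1..a+k} \<Longrightarrow> x \<in> {1..K} \<Longrightarrow> e t x \<le> exp (c t)"
    and "\<And>t. t \<in> {a+1..a+k} \<Longrightarrow> \<exists>x\<in>{1..K}. exp (- c t) \<le> e t x"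
    and c: "\<And>t. t \<in> {a+1..a+k} \<Longrightarrow> 0 \<le> c t"
  shows "\<bar>seglik K Q e a k\<bar> \<le> ln K + (\<Sum>t\<in>{a+1..a+k}. c t - ln s)"
  using assms
proof (induction k)
  case 0
  then show ?case using K by (simp add: seglik_def lik_def)
next
  case (Suc k)
  interpret sh: hmmseq s K Q "\<lambda>t. e (a + t)" by (rule shift)
  let ?L = "\<lambda>k. lik K Q (\<lambda>t. e (a + t)) (\<lambda>_. 1) k"
  let ?p = "\<lambda>x. pv K Q (\<lambda>t. e (a + t)) (\<lambda>_. 1) k x"
  have eq: "?L (Suc k) = (\<Sum>x=1..K. ?p x * e (a + Suc k) x)"
    by (rule lik_Suc[OF Q])
  have "?L (Suc k) \<le> (\<Sum>x=1..K. ?p x * exp (c (a + Suc k)))"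
    unfolding eq using Suc.prems(1) sh.pv1_pos by (intro sum_mono mult_left_mono) (auto simp: less_imp_le)
  also have "\<dots> = ?L k * exp (c (a + Suc k))" by (simp add: lik_def sum_distrib_right)
  finally have u: "?L (Suc k) \<le> ?L k * exp (c (a + Suc k))" .
  obtain x where x: "x \<in> {1..K}" "exp (- c (a + Suc k)) \<le> e (a + Suc k) x"
    using Suc.prems(2)[of "a + Suc k"] by auto
  have "s * ?L k * exp (- c (a + Suc k)) \<le> ?p x * e (a + Suc k) x"
    using x sh.pv_bounds[of x k] sh.pv1_pos s sh.lik1_pos[of k] by (intro mult_mono) (auto simp: less_imp_le)
  also have "\<dots> \<le> ?L (Suc k)"
    unfolding eq using x sh.pv1_pos sh.e_nonneg[of "Suc k"]
    by (intro member_le_sum) (auto intro!: mult_nonneg_nonneg simp: less_imp_le)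
  finally have l: "s * ?L k * exp (- c (a + Suc k)) \<le> ?L (Suc k)" .
  have "ln (?L (Suc k)) \<le> ln (?L k * exp (c (a + Suc k)))"
    using u sh.lik1_pos by (subst ln_le_cancel_iff) auto
  then have u': "ln (?L (Suc k)) \<le> ln (?L k) + c (a + Suc k)"
    using sh.lik1_pos[of k] by (simp add: ln_mult)
  have "ln (s * ?L k * exp (- c (a + Suc k))) \<le> ln (?L (Suc k))"
    using l s sh.lik1_pos by (subst ln_le_cancel_iff) auto
  then have l': "ln s + ln (?L k) - c (a + Suc k) \<le> ln (?L (Suc k))"
    using sh.lik1_pos[of k] s by (simp add: ln_mult)
  have IH: "\<bar>seglik K Q e a k\<bar> \<le> ln K + (\<Sum>t\<in>{a+1..a+k}. c t - ln s)"
    using Suc.prems by (intro Suc.IH) auto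
  have ls: "ln s \<le> 0" using s s_le1 by simp
  have "{a+1..a+Suc k} = insert (a + Suc k) {a+1..a+k}" by auto
  then have "(\<Sum>t\<in>{a+1..a+Suc k}. c t - ln s) = (c (a + Suc k) - ln s) + (\<Sum>t\<in>{a+1..a+k}. c t - ln s)"
    by simp
  moreover have "0 \<le> c (a + Suc k)" using Suc.prems by auto
  ultimately show ?case using u' l' IH ls unfolding seglik_def by linarith
qed

end

section \<open>Comparison of segments, forbidden states, initial laws\<close>

lemma seglik_cong:
  assumes "\<And>t x. t \<in> {a+1..a+k} \<Longrightarrow> x \<in> {1..K} \<Longrightarrow> e t x = e' t x"
  shows "seglik K Q e a k = seglik K Q e' a k"
proof -
  have "pv K Q (\<lambda>t. e (a + t)) (\<lambda>_. 1) k = pv K Q (\<lambda>t. e' (a + t)) (\<lambda>_. 1) k"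
    using assms by (intro pv_cong) auto
  then show ?thesis by (simp add: seglik_def lik_def)
qed

lemma seglik_le:
  assumes 1: "hmmseq s K Q e" and 2: "hmmseq s K Q' e'"
    and Q: "\<And>x y. x \<in> {1..K} \<Longrightarrow> y \<in> {1..K} \<Longrightarrow> Q x y \<le> exp q * Q' x y"
    and e: "\<And>t x. t \<in> {a+1..a+k} \<Longrightarrow> x \<in> {1..K} \<Longrightarrow> e t x \<le> exp (c t) * e' t x"
  shows "seglik K Q e a k \<le> seglik K Q' e' a k + (\<Sum>t\<in>{a+1..a+k}. c t) + k * q"
proof -
  interpret h1: hmmseq s K Q "\<lambda>t. e (a + t)" by (rule hmmseq.shift[OF 1])
  interpret h2: hmmseq s K Q' "\<lambda>t. e' (a + t)" by (rule hmmseq.shift[OF 2])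
  have pr: "(\<Prod>t=1..k. exp (c (a + t))) = exp (\<Sum>t\<in>{a+1..a+k}. c t)"
    by (subst exp_sum) (auto intro!: prod.reindex_bij_witness[of _ "\<lambda>t. t - a" "\<lambda>t. t + a"] simp: add.commute)
  have "pv K Q (\<lambda>t. e (a + t)) (\<lambda>_. 1) k y \<le> 1 * (\<Prod>t=1..k. exp (c (a + t))) * exp q ^ k * pv K Q' (\<lambda>t. e' (a + t)) (\<lambda>_. 1) k y"
    if "y \<in> {1..K}" for y
    using that Q e h1.Q_bounds h2.Q_bounds h1.e_nonneg h2.e_nonneg
    by (intro pv_le) (auto simp: less_imp_le)
  then have "lik K Q (\<lambda>t. e (a + t)) (\<lambda>_. 1) k \<le> exp (\<Sum>t\<in>{a+1..a+k}. c t) * exp (k * q) * lik K Q' (\<lambda>t. e' (a + t)) (\<lambda>_. 1) k"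
    unfolding lik_def sum_distrib_left by (intro sum_mono) (simp add: pr[simplified] exp_of_nat_mult)
  then have "ln (lik K Q (\<lambda>t. e (a + t)) (\<lambda>_. 1) k) \<le> ln (exp (\<Sum>t\<in>{a+1..a+k}. c t) * exp (k * q) * lik K Q' (\<lambda>t. e' (a + t)) (\<lambda>_. 1) k)"
    using h1.lik1_pos h2.lik1_pos by (subst ln_le_cancel_iff) auto
  then show ?thesis using h2.lik1_pos[of k] by (simp add: seglik_def ln_mult)
qed

text \<open>A state that is not allowed at time t can be swapped for an allowed one, at the price of the
  two adjacent transition probabilities.\<close>
lemma pv_restrict:
  assumes 1: "hmmseq s K Q e" and 2: "hmmseq s K Q (\<lambda>t x. if G t x then e t x else 0)"
    and r: "\<And>t. t \<in> {1..n} \<Longrightarrow> 0 \<le> r t \<and> (\<exists>x'\<in>{1..K}. G t x' \<and> (\<Sum>x\<in>{x\<in>{1..K}. \<not> G t x}. e t x) \<le> r t * s\<^sup>2 * e t x')"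
    and y: "y \<in> {1..K}"
  shows "pv K Q e (\<lambda>_. 1) n y \<le> (\<Prod>t=1..n. 1 + r t) * pv K Q (\<lambda>t x. if G t x then e t x else 0) (\<lambda>_. 1) n y"
  using r y
proof (induction n arbitrary: y)
  case 0
  then show ?case by simp
next
  case (Suc n)
  interpret h1: hmmseq s K Q e by (rule 1)
  interpret h2: hmmseq s K Q "\<lambda>t x. if G t x then e t x else 0" by (rule 2)
  let ?e = "\<lambda>t x. if G t x then e t x else 0"
  let ?p = "\<lambda>x. pv K Q ?e (\<lambda>_. 1) n x"
  let ?L = "lik K Q ?e (\<lambda>_. 1) n"
  let ?C = "\<Prod>t=1..n. 1 + r t"
  have C: "0 \<le> ?C" using Suc.prems by (intro prod_nonneg) (auto simp: add_nonneg_nonneg)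
  obtain x' where x': "x' \<in> {1..K}" "G (Suc n) x'" "(\<Sum>x\<in>{x\<in>{1..K}. \<not> G (Suc n) x}. e (Suc n) x) \<le> r (Suc n) * s\<^sup>2 * e (Suc n) x'"
    and r0: "0 \<le> r (Suc n)"
    using Suc.prems(1)[of "Suc n"] by auto
  let ?f = "\<lambda>x. ?p x * e (Suc n) x * Q x y"
  have IH: "pv K Q e (\<lambda>_. 1) n x \<le> ?C * ?p x" if "x \<in> {1..K}" for x
    using that Suc.prems by (intro Suc.IH) auto
  have "pv K Q e (\<lambda>_. 1) (Suc n) y \<le> (\<Sum>x=1..K. ?C * ?f x)"
    using IH h1.e_nonneg[of "Suc n"] h1.Q_bounds[OF _ Suc.prems(2)]
    by (auto intro!: sum_mono mult_right_mono simp: less_imp_le simp flip: mult.assoc)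
  also have "\<dots> = ?C * (\<Sum>x=1..K. ?f x)" by (simp add: sum_distrib_left)
  also have "(\<Sum>x=1..K. ?f x) = (\<Sum>x\<in>{x\<in>{1..K}. G (Suc n) x}. ?f x) + (\<Sum>x\<in>{x\<in>{1..K}. \<not> G (Suc n) x}. ?f x)"
    by (subst sum.union_disjoint[symmetric]) (auto intro!: sum.cong)
  also have "(\<Sum>x\<in>{x\<in>{1..K}. \<not> G (Suc n) x}. ?f x) \<le> (\<Sum>x\<in>{x\<in>{1..K}. \<not> G (Suc n) x}. ?L * e (Suc n) x * 1)"
    using h1.e_nonneg[of "Suc n"] h1.Q_bounds[OF _ Suc.prems(2)] h2.pv_bounds h2.lik1_pos[of n]
    by (intro sum_mono mult_mono mult_nonneg_nonneg) (auto simp: less_imp_le)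
  also have "\<dots> = ?L * (\<Sum>x\<in>{x\<in>{1..K}. \<not> G (Suc n) x}. e (Suc n) x)"
    by (simp add: sum_distrib_left)
  also have "\<dots> \<le> ?L * (r (Suc n) * s\<^sup>2 * e (Suc n) x')"
    using x' h2.lik1_pos[of n] by (intro mult_left_mono) (auto simp: less_imp_le)
  \<comment> \<open>The two factors s are spent here: one turns the total \<open>?L\<close> into the
    weight of x', the other is a lower bound for the transition from x' to y.\<close>
  also have "\<dots> = r (Suc n) * ((s * ?L) * e (Suc n) x' * s)" by (simp add: power2_eq_square)
  also have "\<dots> \<le> r (Suc n) * ?f x'"
    using h1.e_nonneg[of "Suc n" x'] h1.Q_bounds[OF x'(1) Suc.prems(2)] h2.pv_bounds[OF x'(1), of n] h2.lik1_pos[of n] r0 x' h1.s h2.pv1_pos[OF x'(1), of n]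
    by (intro mult_left_mono mult_mono mult_nonneg_nonneg) (auto simp: less_imp_le)
  also have "\<dots> \<le> r (Suc n) * (\<Sum>x\<in>{x\<in>{1..K}. G (Suc n) x}. ?f x)"
    using x' r0 h2.pv1_pos h1.e_nonneg[of "Suc n"] h1.Q_bounds[OF _ Suc.prems(2)]
    by (intro mult_left_mono member_le_sum mult_nonneg_nonneg) (auto simp: less_imp_le)
  finally have "pv K Q e (\<lambda>_. 1) (Suc n) y \<le> ?C * ((\<Sum>x\<in>{x\<in>{1..K}. G (Suc n) x}. ?f x) + r (Suc n) * (\<Sum>x\<in>{x\<in>{1..K}. G (Suc n) x}. ?f x))"
    using C by (simp add: mult_left_mono)
  also have "(\<Sum>x\<in>{x\<in>{1..K}. G (Suc n) x}. ?f x) = pv K Q ?e (\<lambda>_. 1) (Suc n) y"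
    by (auto intro!: sum.mono_neutral_cong_left split: if_splits)
  also have "?C * (pv K Q ?e (\<lambda>_. 1) (Suc n) y + r (Suc n) * pv K Q ?e (\<lambda>_. 1) (Suc n) y)
      = (?C * (1 + r (Suc n))) * pv K Q ?e (\<lambda>_. 1) (Suc n) y"
    by (simp only: distrib_left distrib_right mult_1_left mult_1_right mult.assoc)
  also have "?C * (1 + r (Suc n)) = (\<Prod>t=1..Suc n. 1 + r t)" by simp
  finally show ?case .
qed

lemma seglik_restrict:
  assumes 1: "hmmseq s K Q e" and 2: "hmmseq s K Q (\<lambda>t x. if G t x then e t x else 0)"
    and r: "\<And>t. t \<in> {1..n} \<Longrightarrow> 0 \<le> r t \<and> (\<exists>x'\<in>{1..K}. G t x' \<and> (\<Sum>x\<in>{x\<in>{1..K}. \<not> G t x}. e t x) \<le> r t * s\<^sup>2 * e t x')"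
  shows "seglik K Q (\<lambda>t x. if G t x then e t x else 0) 0 n \<le> seglik K Q e 0 n"
    and "seglik K Q e 0 n \<le> seglik K Q (\<lambda>t x. if G t x then e t x else 0) 0 n + (\<Sum>t=1..n. ln (1 + r t))"
proof -
  interpret h1: hmmseq s K Q e by (rule 1)
  interpret h2: hmmseq s K Q "\<lambda>t x. if G t x then e t x else 0" by (rule 2)
  let ?e = "\<lambda>t x. if G t x then e t x else 0"
  show "seglik K Q ?e 0 n \<le> seglik K Q e 0 n"
    using seglik_le[OF 2 1, of 0 0 n "\<lambda>_. 0"] h1.e_nonneg by simp
  have "lik K Q e (\<lambda>_. 1) n \<le> (\<Prod>t=1..n. 1 + r t) * lik K Q ?e (\<lambda>_. 1) n"
    unfolding lik_def sum_distrib_left using r by (intro sum_mono pv_restrict[OF 1 2]) auto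
  moreover have rp: "0 < 1 + r t" if "t \<in> {1..n}" for t using r[OF that] by (simp add: add_pos_nonneg)
  moreover from rp have C: "0 < (\<Prod>t=1..n. 1 + r t)" by (intro prod_pos) auto
  ultimately have "ln (lik K Q e (\<lambda>_. 1) n) \<le> ln ((\<Prod>t=1..n. 1 + r t) * lik K Q ?e (\<lambda>_. 1) n)"
    using h1.lik1_pos h2.lik1_pos by (subst ln_le_cancel_iff) auto
  also have "\<dots> = ln (\<Prod>t=1..n. 1 + r t) + ln (lik K Q ?e (\<lambda>_. 1) n)"
    using C h2.lik1_pos[of n] by (intro ln_mult_pos)
  also have "ln (\<Prod>t=1..n. 1 + r t) = (\<Sum>t=1..n. ln (1 + r t))"
    using rp by (intro ln_prod) force+
  finally show "seglik K Q e 0 n \<le> seglik K Q ?e 0 n + (\<Sum>t=1..n. ln (1 + r t))"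
    by (simp add: seglik_def add.commute cong: if_cong)
qed

text \<open>An initial law may give weight 0 to some states, so the comparison is made one step
  later: after the first transition every weight is at least a s under \<open>p\<close> and at most
  b K under initial weight 1. From then on the ratio is preserved by \<open>pv_le\<close>.\<close>

lemma lik_init:
  assumes 1: "hmmseq s K Q e" and p: "pvec K p" and n: "1 \<le> n"
    and a: "0 < a" "\<And>x. x \<in> {1..K} \<Longrightarrow> a \<le> e 1 x \<and> e 1 x \<le> b"
  shows "ln (lik K Q e p n) \<le> seglik K Q e 0 n"
    and "seglik K Q e 0 n + ln (a * s / (b * K)) \<le> ln (lik K Q e p n)"
proof -
  interpret h1: hmmseq s K Q e by (rule 1)
  obtain k where nk: "n = 1 + k" using n by (metis le_Suc_ex)
  have b: "0 < b" using a(1) a(2)[of 1] h1.K by force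
  have p0: "0 \<le> p x" "p x \<le> 1" if "x \<in> {1..K}" for x
  proof -
    show "0 \<le> p x" using p that by (auto simp: pvec_def)
    have "p x \<le> (\<Sum>x=1..K. p x)" using p that by (intro member_le_sum) (auto simp: pvec_def)
    then show "p x \<le> 1" using p by (auto simp: pvec_def)
  qed
  have e1: "0 \<le> e 1 x" "e 1 x \<le> b" if "x \<in> {1..K}" for x
    using a(1) a(2)[OF that] by linarith+
  let ?c = "a * s / (b * K)"
  have c: "?c > 0" using a b h1.s h1.K by simp
  have le: "pv K Q e p n y \<le> 1 * (\<Prod>t=1..n. 1) * 1 ^ n * pv K Q e (\<lambda>_. 1) n y" if "y \<in> {1..K}" for y
    using that p0 h1.Q_bounds h1.e_nonneg by (intro pv_le) (auto simp: less_imp_le)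
  have l1: "pv K Q e (\<lambda>_. 1) 1 y \<le> (1 / ?c) * pv K Q e p 1 y" if y: "y \<in> {1..K}" for y
  proof -
    have "pv K Q e (\<lambda>_. 1) 1 y \<le> (\<Sum>x=1..K. b * 1)"
      using e1 h1.Q_bounds[OF _ y] b
      by (auto intro!: sum_mono mult_mono simp: less_imp_le simp del: mult_1_right sum_constant)
    then have *: "pv K Q e (\<lambda>_. 1) 1 y \<le> b * K" by (simp add: mult.commute)
    have "(\<Sum>x=1..K. p x) * (a * s) \<le> pv K Q e p 1 y"
      unfolding sum_distrib_right using a e1 h1.Q_bounds[OF _ y] p0 h1.s
      by (auto intro!: sum_mono mult_mono mult_left_mono simp: less_imp_le mult.assoc)
    then have "a * s \<le> pv K Q e p 1 y" using p by (simp add: pvec_def)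
    then have "1 \<le> pv K Q e p 1 y / (a * s)" using a h1.s by (simp add: field_simps)
    then have "b * K * 1 \<le> b * K * (pv K Q e p 1 y / (a * s))" using b by (intro mult_left_mono) auto
    with * show ?thesis by (simp add: field_simps)
  qed
  have nn1: "0 \<le> pv K Q e p 1 y" if "y \<in> {1..K}" for y
    using that p0 h1.Q_bounds h1.e_nonneg by (intro pv_nonneg) (auto simp: less_imp_le)
  have ge: "pv K Q e (\<lambda>_. 1) n y \<le> (1 / ?c) * (\<Prod>t=1..k. 1) * 1 ^ k * pv K Q e p n y" if "y \<in> {1..K}" for y
    unfolding nk pv_add using that h1.pv1_pos[of _ 1] l1 nn1 h1.Q_bounds h1.e_nonneg a(1) b h1.s
    by (intro pv_le) (simp_all add: less_imp_le del: pv.simps)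
  have "lik K Q e (\<lambda>_. 1) n \<le> (1 / ?c) * lik K Q e p n"
    unfolding lik_def sum_distrib_left using ge by (intro sum_mono) simp
  then have g: "?c * lik K Q e (\<lambda>_. 1) n \<le> lik K Q e p n"
    using c h1.s a b h1.K by (simp add: field_simps)
  moreover have g0: "0 < ?c * lik K Q e (\<lambda>_. 1) n" using c h1.lik1_pos by (intro mult_pos_pos)
  ultimately have pos: "0 < lik K Q e p n" by linarith
  have "lik K Q e p n \<le> lik K Q e (\<lambda>_. 1) n"
    unfolding lik_def using le by (intro sum_mono) simp
  then show "ln (lik K Q e p n) \<le> seglik K Q e 0 n"
    unfolding seglik_def using pos h1.lik1_pos by (simp add: ln_le_cancel_iff)
  have "ln (?c * lik K Q e (\<lambda>_. 1) n) \<le> ln (lik K Q e p n)"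
    using g g0 pos by (subst ln_le_cancel_iff) auto
  then show "seglik K Q e 0 n + ln ?c \<le> ln (lik K Q e p n)"
    using ln_mult_pos[OF c h1.lik1_pos[of n]] by (simp add: seglik_def)
qed

section \<open>Laws of large numbers\<close>

text \<open>By monotone convergence the sum of all \<open>T k\<close> has finite expectation; it is
  therefore almost surely finite, and the terms of a convergent series vanish.\<close>

lemma (in prob_space) AE_tendsto_0_if_summable_expectation:
  fixes T :: "nat \<Rightarrow> 'a \<Rightarrow> real"
  assumes int: "\<And>k. integrable M (T k)" and nn: "\<And>k \<omega>. \<omega> \<in> space M \<Longrightarrow> 0 \<le> T k \<omega>"
    and sm: "summable (\<lambda>k. expectation (T k))"
  shows "AE \<omega> in M. (\<lambda>k. T k \<omega>) \<longlonglongrightarrow> 0"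
proof -
  have [measurable]: "T k \<in> borel_measurable M" for k using int by (rule borel_measurable_integrable)
  have "(\<integral>\<^sup>+\<omega>. (\<Sum>k. ennreal (T k \<omega>)) \<partial>M) = (\<Sum>k. \<integral>\<^sup>+\<omega>. ennreal (T k \<omega>) \<partial>M)"
    by (rule nn_integral_suminf) simp
  also have "\<dots> = (\<Sum>k. ennreal (expectation (T k)))"
    by (intro suminf_cong nn_integral_eq_integral int) (auto intro!: AE_I2 nn)
  also have "\<dots> = ennreal (\<Sum>k. expectation (T k))"
    by (intro suminf_ennreal2 sm integral_nonneg_AE) (auto intro!: AE_I2 nn)
  also have "\<dots> < \<infinity>" by simp
  finally have "(\<integral>\<^sup>+\<omega>. (\<Sum>k. ennreal (T k \<omega>)) \<partial>M) \<noteq> \<infinity>" by simp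
  then have "AE \<omega> in M. (\<Sum>k. ennreal (T k \<omega>)) \<noteq> \<infinity>"
    by (intro nn_integral_PInf_AE) auto
  then show ?thesis
  proof (rule AE_mp, intro AE_I2 impI)
    fix \<omega> assume w: "\<omega> \<in> space M" "(\<Sum>k. ennreal (T k \<omega>)) \<noteq> \<infinity>"
    have "summable (\<lambda>k. T k \<omega>)"
      using w nn[OF w(1)] by (intro summable_suminf_not_top) auto
    then show "(\<lambda>k. T k \<omega>) \<longlonglongrightarrow> 0" by (rule summable_LIMSEQ_zero)
  qed
qed

lemma (in prob_space) expectation_sum_square:
  fixes G :: "nat \<Rightarrow> 'a \<Rightarrow> real"
  assumes G: "\<And>i. random_variable borel (G i)" "\<And>i \<omega>. \<omega> \<in> space M \<Longrightarrow> \<bar>G i \<omega>\<bar> \<le> B"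
  shows "integrable M (\<lambda>\<omega>. (\<Sum>i<N. G i \<omega>)\<^sup>2)"
    and "expectation (\<lambda>\<omega>. (\<Sum>i<N. G i \<omega>)\<^sup>2) = (\<Sum>i<N. \<Sum>j<N. expectation (\<lambda>\<omega>. G i \<omega> * G j \<omega>))"
proof -
  note [measurable] = G(1)
  have int: "integrable M (\<lambda>\<omega>. G i \<omega> * G j \<omega>)" for i j
  proof (rule integrable_const_bound[where B="B * B"])
    show "AE \<omega> in M. norm (G i \<omega> * G j \<omega>) \<le> B * B"
    proof (rule AE_I2)
      fix \<omega> assume w: "\<omega> \<in> space M"
      have "\<bar>G i \<omega>\<bar> * \<bar>G j \<omega>\<bar> \<le> B * B"
        using G(2)[OF w, of i] G(2)[OF w, of j] by (intro mult_mono) auto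
      then show "norm (G i \<omega> * G j \<omega>) \<le> B * B" by (simp add: abs_mult)
    qed
  qed simp
  have eq: "(\<lambda>\<omega>. (\<Sum>i<N. G i \<omega>)\<^sup>2) = (\<lambda>\<omega>. \<Sum>i<N. \<Sum>j<N. G i \<omega> * G j \<omega>)"
    by (simp add: power2_eq_square sum_product)
  show "integrable M (\<lambda>\<omega>. (\<Sum>i<N. G i \<omega>)\<^sup>2)" unfolding eq using int by auto
  show "expectation (\<lambda>\<omega>. (\<Sum>i<N. G i \<omega>)\<^sup>2) = (\<Sum>i<N. \<Sum>j<N. expectation (\<lambda>\<omega>. G i \<omega> * G j \<omega>))"
    unfolding eq using int by (simp add: Bochner_Integration.integral_sum)
qed

lemma sum_geometric_dist_le:
  fixes r :: real
  assumes "0 \<le> r" "r < 1" "i < N"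
  shows "(\<Sum>j<N. r ^ (if i \<le> j then j - i else i - j)) \<le> 2 / (1 - r)"
proof -
  have sm: "summable (\<lambda>n. r ^ n)" using assms by (intro summable_geometric) auto
  have S: "(\<Sum>n<m. r ^ n) \<le> 1 / (1 - r)" for m
    using sum_le_suminf[OF sm, of "{..<m}"] assms by (simp add: suminf_geometric)
  have "(\<Sum>j<N. r ^ (if i \<le> j then j - i else i - j)) \<le> (\<Sum>j\<in>{..<i}. r ^ (i - j)) + (\<Sum>j\<in>{i..<N}. r ^ (j - i))"
  proof -
    have eq: "{..<N} = {..<i} \<union> {i..<N}" using assms by auto
    have "(\<Sum>j<N. r ^ (if i \<le> j then j - i else i - j)) = (\<Sum>j\<in>{..<i}. r ^ (if i \<le> j then j - i else i - j)) + (\<Sum>j\<in>{i..<N}. r ^ (if i \<le> j then j - i else i - j))"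
      unfolding eq by (rule sum.union_disjoint) auto
    also have "\<dots> = (\<Sum>j\<in>{..<i}. r ^ (i - j)) + (\<Sum>j\<in>{i..<N}. r ^ (j - i))"
      by (intro arg_cong2[where f="(+)"] sum.cong) auto
    finally show ?thesis by simp
  qed
  also have "(\<Sum>j\<in>{i..<N}. r ^ (j - i)) = (\<Sum>n<N - i. r ^ n)"
    by (rule sum.reindex_bij_witness[of _ "\<lambda>n. n + i" "\<lambda>j. j - i"]) auto
  also have "(\<Sum>j\<in>{..<i}. r ^ (i - j)) \<le> (\<Sum>j\<in>{..<i}. r ^ (i - Suc j))"
    using assms by (intro sum_mono power_decreasing) auto
  also have "\<dots> = (\<Sum>n<i. r ^ n)"
    by (rule sum.reindex_bij_witness[of _ "\<lambda>n. i - Suc n" "\<lambda>j. i - Suc j"]) auto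
  finally show ?thesis using S[of i] S[of "N - i"] by simp
qed

lemma squares_bracket: obtains k :: nat where "k\<^sup>2 \<le> N" "N < (Suc k)\<^sup>2"
proof -
  define k where "k = Max {k. k\<^sup>2 \<le> N}"
  have fin: "finite {k. k\<^sup>2 \<le> N}"
    by (rule finite_subset[of _ "{..N}"]) (auto intro: order.trans[OF power2_nat_le_imp_le] simp: power2_nat_le_imp_le)
  have "k \<in> {k. k\<^sup>2 \<le> N}" unfolding k_def using fin by (intro Max_in) (auto intro!: exI[of _ 0])
  moreover have "\<not> (Suc k)\<^sup>2 \<le> N"
  proof
    assume "(Suc k)\<^sup>2 \<le> N"
    then have "Suc k \<le> k" using fin unfolding k_def by (intro Max_ge) auto
    then show False by simp
  qed
  ultimately show ?thesis by (intro that[of k]) auto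
qed

text \<open>Between the squares of k and k + 1 a sum of bounded terms moves by O(k) only, which is
  small against k squared. The factor 5 in the proof is a generous bound for the length 2k + 1 of
  the gap.\<close>

lemma avg_tendsto_0_from_squares:
  fixes g :: "nat \<Rightarrow> real"
  assumes g: "\<And>i. \<bar>g i\<bar> \<le> B" and lim: "(\<lambda>k. (\<Sum>i<(Suc k)\<^sup>2. g i) / real ((Suc k)\<^sup>2)) \<longlonglongrightarrow> 0"
  shows "(\<lambda>N. (\<Sum>i<N. g i) / real N) \<longlonglongrightarrow> 0"
proof (rule LIMSEQ_I)
  fix \<epsilon> :: real assume eps: "0 < \<epsilon>"
  have B: "0 \<le> B" using g[of 0] by linarith
  have "(\<lambda>k. \<bar>(\<Sum>i<(Suc k)\<^sup>2. g i) / real ((Suc k)\<^sup>2)\<bar> + B * (5 * inverse (real (Suc k)))) \<longlonglongrightarrow> \<bar>0\<bar> + B * (5 * 0)"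
    by (intro tendsto_intros lim LIMSEQ_inverse_real_of_nat)
  then have "eventually (\<lambda>k. \<bar>(\<Sum>i<(Suc k)\<^sup>2. g i) / real ((Suc k)\<^sup>2)\<bar> + B * (5 * inverse (real (Suc k))) < \<epsilon>) sequentially"
    using eps by (intro order_tendstoD) auto
  then obtain k0 where k0: "\<And>k. k \<ge> k0 \<Longrightarrow> \<bar>(\<Sum>i<(Suc k)\<^sup>2. g i) / real ((Suc k)\<^sup>2)\<bar> + B * (5 * inverse (real (Suc k))) < \<epsilon>"
    by (auto simp: eventually_sequentially)
  show "\<exists>no. \<forall>N\<ge>no. norm ((\<Sum>i<N. g i) / real N - 0) < \<epsilon>"
  proof (intro exI[of _ "(Suc k0)\<^sup>2"] allI impI)
    fix N assume N: "(Suc k0)\<^sup>2 \<le> N"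
    obtain k' where k': "k'\<^sup>2 \<le> N" "N < (Suc k')\<^sup>2" by (rule squares_bracket)
    have "Suc k0 < Suc k'"
      using N k' by (metis le_less_trans power2_less_imp_less zero_le)
    then obtain k where k: "k' = Suc k" "k0 \<le> k" by (cases k') auto
    have "{..<N} = {..<k'\<^sup>2} \<union> {k'\<^sup>2..<N}" using k' by auto
    then have "(\<Sum>i<N. g i) = (\<Sum>i<k'\<^sup>2. g i) + (\<Sum>i\<in>{k'\<^sup>2..<N}. g i)"
      by (simp add: sum.union_disjoint ivl_disj_int)
    moreover have "\<bar>\<Sum>i\<in>{k'\<^sup>2..<N}. g i\<bar> \<le> (\<Sum>i\<in>{k'\<^sup>2..<N}. B)"
      using g by (intro order.trans[OF sum_abs] sum_mono) auto
    moreover have "(\<Sum>i\<in>{k'\<^sup>2..<N}. B) = real (N - k'\<^sup>2) * B" by simp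
    moreover have "N - k'\<^sup>2 \<le> 5 * k'" using k' k by (auto simp: power2_eq_square)
    then have "real (N - k'\<^sup>2) * B \<le> real (5 * k') * B"
      using B by (intro mult_right_mono) (auto simp: of_nat_le_iff simp del: of_nat_mult)
    ultimately have le: "\<bar>\<Sum>i<N. g i\<bar> \<le> \<bar>\<Sum>i<k'\<^sup>2. g i\<bar> + 5 * real k' * B" by simp
    have kp: "0 < real k'" using k by simp
    then have pos: "0 < real (k'\<^sup>2)" by simp
    have "norm ((\<Sum>i<N. g i) / real N - 0) = \<bar>\<Sum>i<N. g i\<bar> / real N" by simp
    also have "\<dots> \<le> (\<bar>\<Sum>i<k'\<^sup>2. g i\<bar> + 5 * real k' * B) / real (k'\<^sup>2)"
    proof (rule frac_le)
      show "real (k'\<^sup>2) \<le> real N" using k'(1) by (simp only: of_nat_le_iff)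
    qed (use le pos B in auto)
    also have "\<dots> = \<bar>(\<Sum>i<k'\<^sup>2. g i) / real (k'\<^sup>2)\<bar> + B * (5 * inverse (real k'))"
    proof -
      have "(x + 5 * c * B) / c\<^sup>2 = x / c\<^sup>2 + B * (5 * inverse c)" if "0 < c" for x c :: real
        using that by (simp add: field_simps power2_eq_square)
      from this[OF kp] show ?thesis by simp
    qed
    also have "\<dots> < \<epsilon>" using k0[OF k(2)] unfolding k(1) .
    finally show "norm ((\<Sum>i<N. g i) / real N - 0) < \<epsilon>" .
  qed
qed

text \<open>Geometric decay makes the variance of a sum of N terms O(N). Along squares the variances
  of the averages are then summable, and the gaps are filled by boundedness.\<close>

lemma (in prob_space) lln_covariance_decay:
  fixes F :: "nat \<Rightarrow> 'a \<Rightarrow> real"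
  assumes F: "\<And>i. random_variable borel (F i)" "\<And>i \<omega>. \<omega> \<in> space M \<Longrightarrow> \<bar>F i \<omega>\<bar> \<le> 1"
    and r: "0 \<le> r" "r < 1"
    and cov: "\<And>i j. i \<le> j \<Longrightarrow> expectation (\<lambda>\<omega>. F i \<omega> * F j \<omega>) - expectation (F i) * expectation (F j) \<le> C * r ^ (j - i)"
  shows "AE \<omega> in M. (\<lambda>N. (\<Sum>i<N. F i \<omega> - expectation (F i)) / real N) \<longlonglongrightarrow> 0"
proof -
  note [measurable] = F(1)
  define G where "G i \<omega> = F i \<omega> - expectation (F i)" for i \<omega>
  have intF: "integrable M (F i)" for i
    using F by (intro integrable_const_bound[where B=1]) (auto intro!: AE_I2)
  have E1: "\<bar>expectation (F i)\<bar> \<le> 1" for i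
  proof -
    have "\<bar>expectation (F i)\<bar> \<le> expectation (\<lambda>\<omega>. \<bar>F i \<omega>\<bar>)" using integral_norm_bound[of M "F i"] by simp
    also have "\<dots> \<le> expectation (\<lambda>_. 1)" using intF F by (intro integral_mono) auto
    finally show ?thesis by (simp add: prob_space)
  qed
  have Gm[measurable]: "random_variable borel (G i)" for i unfolding G_def by measurable
  have Gb: "\<bar>G i \<omega>\<bar> \<le> 2" if "\<omega> \<in> space M" for i \<omega>
    using F(2)[OF that, of i] E1[of i] unfolding G_def by linarith
  have intFF: "integrable M (\<lambda>\<omega>. F i \<omega> * F j \<omega>)" for i j
  proof (rule integrable_const_bound[where B=1])
    show "AE \<omega> in M. norm (F i \<omega> * F j \<omega>) \<le> 1"
      by (rule AE_I2) (use F(2) in \<open>auto simp: abs_mult intro!: mult_le_one\<close>)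
  qed simp
  have EG: "expectation (\<lambda>\<omega>. G i \<omega> * G j \<omega>) = expectation (\<lambda>\<omega>. F i \<omega> * F j \<omega>) - expectation (F i) * expectation (F j)" for i j
  proof -
    have "(\<lambda>\<omega>. G i \<omega> * G j \<omega>) = (\<lambda>\<omega>. F i \<omega> * F j \<omega> - expectation (F i) * F j \<omega> - expectation (F j) * F i \<omega> + expectation (F i) * expectation (F j))"
      by (auto simp: G_def algebra_simps)
    then show ?thesis using intFF intF by (simp add: prob_space)
  qed
  \<comment> \<open>The constant bounds a variance, the case i = j of the hypothesis.\<close>
  have C: "0 \<le> C"
  proof -
    have "0 \<le> expectation (\<lambda>\<omega>. G 0 \<omega> * G 0 \<omega>)" by (rule Bochner_Integration.integral_nonneg) auto
    also have "\<dots> \<le> C * r ^ (0 - 0)" unfolding EG by (rule cov) simp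
    finally show ?thesis by simp
  qed
  have cov': "expectation (\<lambda>\<omega>. G i \<omega> * G j \<omega>) \<le> C * r ^ (if i \<le> j then j - i else i - j)" for i j
  proof (cases "i \<le> j")
    case False
    then have "j \<le> i" by simp
    then show ?thesis using cov[of j i] False unfolding EG by (simp add: mult.commute)
  qed (use cov[of i j] EG in auto)
  have var: "expectation (\<lambda>\<omega>. (\<Sum>i<N. G i \<omega>)\<^sup>2) \<le> real N * (C * (2 / (1 - r)))" for N
  proof -
    have "expectation (\<lambda>\<omega>. (\<Sum>i<N. G i \<omega>)\<^sup>2) \<le> (\<Sum>i<N. \<Sum>j<N. C * r ^ (if i \<le> j then j - i else i - j))"
      unfolding expectation_sum_square(2)[where G=G and B=2, OF Gm Gb, simplified] by (intro sum_mono cov')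
    also have "\<dots> \<le> (\<Sum>i<N. C * (2 / (1 - r)))"
      unfolding sum_distrib_left[symmetric] using sum_geometric_dist_le[OF r] C by (intro sum_mono mult_left_mono) auto
    finally show ?thesis by simp
  qed
  define T where "T k \<omega> = ((\<Sum>i<(Suc k)\<^sup>2. G i \<omega>) / real ((Suc k)\<^sup>2))\<^sup>2" for k \<omega>
  have T_eq: "T k \<omega> = (\<Sum>i<(Suc k)\<^sup>2. G i \<omega>)\<^sup>2 / (real ((Suc k)\<^sup>2))\<^sup>2" for k \<omega>
    by (simp add: T_def power_divide)
  have T_int: "integrable M (T k)" for k
    unfolding T_eq using expectation_sum_square(1)[OF Gm Gb] by (intro integrable_divide) auto
  have T_E: "expectation (T k) \<le> C * (2 / (1 - r)) * (1 / (real (Suc k))\<^sup>2)" for k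
  proof -
    have "expectation (T k) = expectation (\<lambda>\<omega>. (\<Sum>i<(Suc k)\<^sup>2. G i \<omega>)\<^sup>2) / (real ((Suc k)\<^sup>2))\<^sup>2"
      unfolding T_eq by simp
    also have "\<dots> \<le> (real ((Suc k)\<^sup>2) * (C * (2 / (1 - r)))) / (real ((Suc k)\<^sup>2))\<^sup>2"
      by (intro divide_right_mono var) auto
    also have "\<dots> = C * (2 / (1 - r)) * (1 / (real (Suc k))\<^sup>2)"
    proof -
      have "(m\<^sup>2 * c) / (m\<^sup>2)\<^sup>2 = c * (1 / m\<^sup>2)" if "0 < m" for m c :: real
        using that by (simp add: power2_eq_square)
      from this[of "real (Suc k)" "C * (2 / (1 - r))"] show ?thesis unfolding of_nat_power by linarith
    qed
    finally show ?thesis .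
  qed
  have "summable (\<lambda>k. expectation (T k))"
  proof (rule summable_comparison_test)
    have "summable (\<lambda>n. 1 / (real n)\<^sup>2)"
      using inverse_power_summable[of 2, where 'a=real] by (simp add: inverse_eq_divide)
    then have "summable (\<lambda>k. 1 / (real (Suc k))\<^sup>2)"
      by (subst summable_Suc_iff)
    then show "summable (\<lambda>k. C * (2 / (1 - r)) * (1 / (real (Suc k))\<^sup>2))" by (rule summable_mult)
    have "0 \<le> expectation (T k)" for k by (rule Bochner_Integration.integral_nonneg) (auto simp: T_def)
    then show "\<exists>N. \<forall>n\<ge>N. norm (expectation (T n)) \<le> C * (2 / (1 - r)) * (1 / (real (Suc n))\<^sup>2)"
      using T_E by auto
  qed
  moreover have "0 \<le> T k \<omega>" for k \<omega> by (simp add: T_def)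
  ultimately have "AE \<omega> in M. (\<lambda>k. T k \<omega>) \<longlonglongrightarrow> 0"
    by (intro AE_tendsto_0_if_summable_expectation T_int)
  then show ?thesis
  proof (rule AE_mp, intro AE_I2 impI)
    fix \<omega> assume w: "\<omega> \<in> space M" and lim: "(\<lambda>k. T k \<omega>) \<longlonglongrightarrow> 0"
    have "(\<lambda>k. sqrt (T k \<omega>)) \<longlonglongrightarrow> sqrt 0" by (intro tendsto_intros lim)
    then have "(\<lambda>k. \<bar>(\<Sum>i<(Suc k)\<^sup>2. G i \<omega>) / real ((Suc k)\<^sup>2)\<bar>) \<longlonglongrightarrow> 0"
      by (simp add: T_def del: of_nat_power power_Suc)
    then have "(\<lambda>k. (\<Sum>i<(Suc k)\<^sup>2. G i \<omega>) / real ((Suc k)\<^sup>2)) \<longlonglongrightarrow> 0"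
      by (rule tendsto_rabs_zero_cancel)
    then show "(\<lambda>N. (\<Sum>i<N. F i \<omega> - expectation (F i)) / real N) \<longlonglongrightarrow> 0"
      unfolding G_def[symmetric] by (rule avg_tendsto_0_from_squares[OF Gb[OF w]])
  qed
qed

section \<open>Averages of integrable variables: truncation along powers of 2\<close>

lemma sum_powers_below_le:
  fixes v :: real assumes "0 \<le> v"
  shows "(\<Sum>k<N. if 2 ^ k < v then 2 ^ k else 0) \<le> 2 * v"
proof -
  \<comment> \<open>The bound \<open>2 ^ N\<close> drives the induction: a new term
    \<open>2 ^ N\<close> below v at most doubles it, and the double is still below 2 v.\<close>
  have "(\<Sum>k<N. if 2 ^ k < v then 2 ^ k else 0) \<le> min (2 ^ N) (2 * v)"
    using assms by (induction N) (auto simp: min_def split: if_splits)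
  then show ?thesis by simp
qed

text \<open>Levels below v contribute a geometric sum dominated by its largest term, levels above v
  a geometric tail; each is at most 2 v. This is what converts a first moment into summable
  variances of truncated averages.\<close>

lemma sum_truncated_squares_le:
  fixes v :: real assumes v: "0 \<le> v"
  shows "(\<Sum>k<N. (min v (2 ^ k))\<^sup>2 / 2 ^ k) \<le> 4 * v"
proof -
  \<comment> \<open>The subtracted term is the remainder of the geometric series; keeping it makes
    the induction close.\<close>
  have A: "(\<Sum>k<N. if v \<le> 2 ^ k then v\<^sup>2 / 2 ^ k else 0) \<le> (if v \<le> 2 ^ N then 2 * v - 2 * v\<^sup>2 / 2 ^ N else 0)"
  proof (induction N)
    case 0
    then show ?case using v by (auto simp: power2_eq_square mult_left_le)
  next
    case (Suc N)
    consider "v \<le> 2 ^ N" | "2 ^ N < v" "v \<le> 2 ^ Suc N" | "2 ^ Suc N < v" by linarith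
    then show ?case
    proof cases
      case 1
      then have "v \<le> 2 ^ Suc N" using v by simp
      moreover have "2 * v\<^sup>2 / 2 ^ Suc N = v\<^sup>2 / 2 ^ N" "2 * v\<^sup>2 / 2 ^ N = 2 * (v\<^sup>2 / 2 ^ N)" by simp_all
      moreover have "(\<Sum>k<N. if v \<le> 2 ^ k then v\<^sup>2 / 2 ^ k else 0) \<le> 2 * v - 2 * v\<^sup>2 / 2 ^ N" using 1 Suc by simp
      ultimately show ?thesis using 1 by simp
    next
      case 2
      have "v * v \<le> v * 2 ^ Suc N" using 2 v by (intro mult_left_mono) auto
      then have "2 * v\<^sup>2 / 2 ^ Suc N \<le> 2 * v" by (simp add: field_simps power2_eq_square)
      then show ?thesis using 2 Suc by simp
    next
      case 3
      moreover have "(2::real) ^ N \<le> 2 ^ Suc N" by simp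
      ultimately have "2 ^ N < v" by linarith
      then show ?thesis using 3 Suc by simp
    qed
  qed
  have "(min v (2 ^ k))\<^sup>2 / 2 ^ k = (if 2 ^ k < v then 2 ^ k else 0) + (if v \<le> 2 ^ k then v\<^sup>2 / 2 ^ k else 0)" for k
    by (auto simp: min_def power2_eq_square)
  then have "(\<Sum>k<N. (min v (2 ^ k))\<^sup>2 / 2 ^ k) = (\<Sum>k<N. if 2 ^ k < v then 2 ^ k else 0) + (\<Sum>k<N. if v \<le> 2 ^ k then v\<^sup>2 / 2 ^ k else 0)"
    by (simp add: sum.distrib)
  also have "\<dots> \<le> 2 * v + 2 * v"
    using sum_powers_below_le[OF v, of N] A v by (intro add_mono) (auto split: if_splits intro: order.trans)
  finally show ?thesis by simp
qed

lemma powers_bracket: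
  fixes n :: nat
  assumes "1 \<le> n" obtains k :: nat where "2 ^ k \<le> n" "n < 2 ^ Suc k"
  using ex_power_ivl1[of 2 n] assms by auto

text \<open>Only the upper half of the strong law is needed, and a factor 2 is harmless; this allows to
  work along powers of 2 with truncation at the same level.\<close>
lemma (in prob_space) iid_average_upper:
  fixes V :: "nat \<Rightarrow> 'a \<Rightarrow> real"
  assumes V: "\<And>t. random_variable borel (V t)" "\<And>t \<omega>. 0 \<le> V t \<omega>"
    and int: "integrable M (V 0)"
    and id: "\<And>t. distr M borel (V t) = distr M borel (V 0)"
    and indep: "\<And>s t. s \<noteq> t \<Longrightarrow> indep_var borel (V s) borel (V t)"
    and \<delta>: "0 < \<delta>"
  shows "AE \<omega> in M. \<forall>\<^sub>F n in sequentially. (\<Sum>t<n. V t \<omega>) / real n \<le> 2 * expectation (V 0) + \<delta>"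
proof -
  note [measurable] = V(1)
  have E_id: "expectation (\<lambda>\<omega>. f (V t \<omega>)) = expectation (\<lambda>\<omega>. f (V 0 \<omega>))"
    if [measurable]: "f \<in> borel_measurable borel" for t and f :: "real \<Rightarrow> real"
    using integral_distr[of "V t" M borel f] integral_distr[of "V 0" M borel f] id[of t] by simp
  define Y where "Y k t \<omega> = min (V t \<omega>) (2 ^ k)" for k t and \<omega> :: 'a
  define \<mu> where "\<mu> k = expectation (Y k 0)" for k
  have Y01: "0 \<le> Y k t \<omega>" "Y k t \<omega> \<le> 2 ^ k" for k t \<omega> using V(2) by (auto simp: Y_def)
  have Ym[measurable]: "random_variable borel (Y k t)" for k t unfolding Y_def by measurable
  have Y_int: "integrable M (Y k t)" for k t
    using Y01 by (intro integrable_const_bound[where B="2 ^ k"]) auto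
  have Y2_int: "integrable M (\<lambda>\<omega>. (Y k t \<omega>)\<^sup>2)" for k t
    using Y01 by (intro integrable_const_bound[where B="(2 ^ k)\<^sup>2"]) (auto intro!: power_mono)
  have Y_E: "expectation (Y k t) = \<mu> k" for k t
    unfolding \<mu>_def Y_def by (rule E_id) simp
  have Y2_E: "expectation (\<lambda>\<omega>. (Y k t \<omega>)\<^sup>2) = expectation (\<lambda>\<omega>. (Y k 0 \<omega>)\<^sup>2)" for k t
    unfolding \<mu>_def Y_def by (rule E_id) simp
  have mu0: "0 \<le> \<mu> k" for k unfolding \<mu>_def using Y01 by (intro Bochner_Integration.integral_nonneg) auto
  have mu_le: "\<mu> k \<le> expectation (V 0)" for k
    unfolding \<mu>_def using Y_int int by (intro integral_mono) (auto simp: Y_def)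
  have mu_le2: "\<mu> k \<le> 2 ^ k" for k
  proof -
    have "\<mu> k \<le> expectation (\<lambda>_. 2 ^ k)" unfolding \<mu>_def using Y_int Y01 by (intro integral_mono) auto
    then show ?thesis by (simp add: prob_space)
  qed
  define G where "G k t \<omega> = Y k t \<omega> - \<mu> k" for k t \<omega>
  have Gm[measurable]: "random_variable borel (G k t)" for k t unfolding G_def by measurable
  have Gb: "\<bar>G k t \<omega>\<bar> \<le> 2 ^ k" for k t \<omega>
    using Y01[of k t \<omega>] mu0[of k] mu_le2[of k] unfolding G_def by linarith
  have EGG: "expectation (\<lambda>\<omega>. G k s \<omega> * G k t \<omega>) \<le> (if s = t then expectation (\<lambda>\<omega>. (Y k 0 \<omega>)\<^sup>2) else 0)" for k s t
  proof (cases "s = t")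
    case True
    have "(\<lambda>\<omega>. G k t \<omega> * G k t \<omega>) = (\<lambda>\<omega>. (Y k t \<omega>)\<^sup>2 - 2 * \<mu> k * Y k t \<omega> + (\<mu> k)\<^sup>2)"
      by (auto simp: G_def power2_eq_square algebra_simps)
    then have "expectation (\<lambda>\<omega>. G k t \<omega> * G k t \<omega>) = expectation (\<lambda>\<omega>. (Y k 0 \<omega>)\<^sup>2) - (\<mu> k)\<^sup>2"
      using Y_int Y2_int Y2_E Y_E by (simp add: prob_space power2_eq_square)
    then show ?thesis using True by simp
  next
    case False
    have ind: "indep_var borel (G k s) borel (G k t)"
      using indep_var_compose[OF indep[OF False], of "\<lambda>x. min x (2 ^ k) - \<mu> k" borel "\<lambda>x. min x (2 ^ k) - \<mu> k" borel]
      by (simp add: comp_def G_def[abs_def] Y_def[abs_def])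
    have int: "integrable M (G k t)" for t unfolding G_def using Y_int by auto
    have E0: "expectation (G k t) = 0" for t
      using Y_int Y_E by (simp add: G_def[abs_def] prob_space)
    show ?thesis using indep_var_lebesgue_integral[OF ind int int] E0 False by simp
  qed
  define T where "T k \<omega> = ((\<Sum>t<2 ^ k. G k t \<omega>) / 2 ^ k)\<^sup>2" for k \<omega>
  have T_eq: "T k = (\<lambda>\<omega>. (\<Sum>t<2 ^ k. G k t \<omega>)\<^sup>2 / (2 ^ k)\<^sup>2)" for k
    by (auto simp: T_def power_divide)
  have T_int: "integrable M (T k)" for k
    unfolding T_eq using expectation_sum_square(1)[OF Gm Gb] by (intro integrable_divide) auto
  \<comment> \<open>Independence leaves only the diagonal terms, so the variance of the average of
    \<open>2 ^ k\<close> truncated variables is at most the expectation of a summand of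
    \<open>sum_truncated_squares_le\<close>.\<close>
  have T_E: "expectation (T k) \<le> expectation (\<lambda>\<omega>. (min (V 0 \<omega>) (2 ^ k))\<^sup>2 / 2 ^ k)" for k
  proof -
    have "expectation (\<lambda>\<omega>. (\<Sum>t<2 ^ k. G k t \<omega>)\<^sup>2) \<le> (\<Sum>i<2 ^ k :: nat. \<Sum>j<2 ^ k. if i = j then expectation (\<lambda>\<omega>. (Y k 0 \<omega>)\<^sup>2) else 0)"
      unfolding expectation_sum_square(2)[where G="G k" and B="2 ^ k", OF Gm Gb] by (intro sum_mono EGG)
    also have "\<dots> = 2 ^ k * expectation (\<lambda>\<omega>. (Y k 0 \<omega>)\<^sup>2)" by simp
    finally have *: "expectation (\<lambda>\<omega>. (\<Sum>t<2 ^ k. G k t \<omega>)\<^sup>2) \<le> 2 ^ k * expectation (\<lambda>\<omega>. (Y k 0 \<omega>)\<^sup>2)" .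
    have "expectation (T k) = expectation (\<lambda>\<omega>. (\<Sum>t<2 ^ k. G k t \<omega>)\<^sup>2) / (2 ^ k)\<^sup>2"
      unfolding T_eq by simp
    also have "\<dots> \<le> (2 ^ k * expectation (\<lambda>\<omega>. (Y k 0 \<omega>)\<^sup>2)) / (2 ^ k)\<^sup>2"
      using * by (intro divide_right_mono) auto
    also have "\<dots> = expectation (\<lambda>\<omega>. (Y k 0 \<omega>)\<^sup>2) / 2 ^ k" by (simp add: power2_eq_square)
    finally show ?thesis by (simp add: Y_def)
  qed
  have "summable (\<lambda>k. expectation (T k))"
  proof (rule summableI_nonneg_bounded)
    show "0 \<le> expectation (T k)" for k by (rule Bochner_Integration.integral_nonneg) (auto simp: T_def)
    fix N
    have ii: "integrable M (\<lambda>\<omega>. (min (V 0 \<omega>) (2 ^ k))\<^sup>2 / 2 ^ k)" for k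
      using Y2_int[of k 0] unfolding Y_def by (rule integrable_divide)
    have "(\<Sum>k<N. expectation (T k)) \<le> (\<Sum>k<N. expectation (\<lambda>\<omega>. (min (V 0 \<omega>) (2 ^ k))\<^sup>2 / 2 ^ k))"
      by (intro sum_mono T_E)
    also have "\<dots> = expectation (\<lambda>\<omega>. \<Sum>k<N. (min (V 0 \<omega>) (2 ^ k))\<^sup>2 / 2 ^ k)"
      using ii by (intro Bochner_Integration.integral_sum[symmetric])
    also have "\<dots> \<le> expectation (\<lambda>\<omega>. 4 * V 0 \<omega>)"
      using ii int V(2) sum_truncated_squares_le by (intro integral_mono integrable_sum integrable_mult_right) auto
    finally show "(\<Sum>k<N. expectation (T k)) \<le> 4 * expectation (V 0)" by simp
  qed
  moreover have "0 \<le> T k \<omega>" for k \<omega> by (simp add: T_def)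
  ultimately have T0: "AE \<omega> in M. (\<lambda>k. T k \<omega>) \<longlonglongrightarrow> 0"
    by (intro AE_tendsto_0_if_summable_expectation T_int)
  \<comment> \<open>\<open>U\<close> counts the variables among the first \<open>2 ^ k\<close> that
    exceed the truncation level. Its expectations are summable by
    \<open>sum_powers_below_le\<close>, and once the count is below 1 no variable is
    truncated.\<close>
  define U where "U k \<omega> = (\<Sum>t<2 ^ k. if 2 ^ k < V t \<omega> then 1 else 0 :: real)" for k :: nat and \<omega>
  have ind_int: "integrable M (\<lambda>\<omega>. if 2 ^ k < V t \<omega> then 1 else 0 :: real)" for k t
    by (intro integrable_const_bound[where B=1]) auto
  have U_int: "integrable M (U k)" for k unfolding U_def using ind_int by auto
  have U_E: "expectation (U k) = expectation (\<lambda>\<omega>. if 2 ^ k < V 0 \<omega> then 2 ^ k else 0)" for k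
  proof -
    have "expectation (U k) = (\<Sum>t<2 ^ k. expectation (\<lambda>\<omega>. if 2 ^ k < V t \<omega> then 1 else 0 :: real))"
      unfolding U_def using ind_int by (simp add: Bochner_Integration.integral_sum)
    also have "\<dots> = (\<Sum>t<2 ^ k :: nat. expectation (\<lambda>\<omega>. if 2 ^ k < V 0 \<omega> then 1 else 0 :: real))"
      by (intro sum.cong refl E_id) simp
    also have "\<dots> = expectation (\<lambda>\<omega>. 2 ^ k * (if 2 ^ k < V 0 \<omega> then 1 else 0 :: real))" by simp
    also have "(\<lambda>\<omega>. 2 ^ k * (if 2 ^ k < V 0 \<omega> then 1 else 0 :: real)) = (\<lambda>\<omega>. if 2 ^ k < V 0 \<omega> then 2 ^ k else 0)" by auto
    finally show ?thesis .
  qed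
  have "summable (\<lambda>k. expectation (U k))"
  proof (rule summableI_nonneg_bounded)
    show "0 \<le> expectation (U k)" for k by (rule Bochner_Integration.integral_nonneg) (auto simp: U_def intro!: sum_nonneg)
    fix N
    have ii: "integrable M (\<lambda>\<omega>. if 2 ^ k < V 0 \<omega> then 2 ^ k else 0 :: real)" for k
      by (intro integrable_const_bound[where B="2 ^ k"]) auto
    have "(\<Sum>k<N. expectation (U k)) = expectation (\<lambda>\<omega>. \<Sum>k<N. if 2 ^ k < V 0 \<omega> then 2 ^ k else 0)"
      unfolding U_E using ii by (intro Bochner_Integration.integral_sum[symmetric])
    also have "\<dots> \<le> expectation (\<lambda>\<omega>. 2 * V 0 \<omega>)"
      using ii int V(2) sum_powers_below_le by (intro integral_mono integrable_sum integrable_mult_right) auto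
    finally show "(\<Sum>k<N. expectation (U k)) \<le> 2 * expectation (V 0)" by simp
  qed
  moreover have "0 \<le> U k \<omega>" for k \<omega> by (auto simp: U_def intro!: sum_nonneg)
  ultimately have U0: "AE \<omega> in M. (\<lambda>k. U k \<omega>) \<longlonglongrightarrow> 0"
    by (intro AE_tendsto_0_if_summable_expectation U_int)
  show ?thesis
    using T0 U0
  proof eventually_elim
    fix \<omega> assume T: "(\<lambda>k. T k \<omega>) \<longlonglongrightarrow> 0" and U: "(\<lambda>k. U k \<omega>) \<longlonglongrightarrow> 0"
    have "\<forall>\<^sub>F k in sequentially. T k \<omega> < (\<delta> / 2)\<^sup>2" using T \<delta> by (intro order_tendstoD) auto
    moreover have "\<forall>\<^sub>F k in sequentially. U k \<omega> < 1" using U by (intro order_tendstoD) auto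
    ultimately have "\<forall>\<^sub>F k in sequentially. (\<Sum>t<2 ^ k. V t \<omega>) \<le> 2 ^ k * (expectation (V 0) + \<delta> / 2)"
    proof eventually_elim
      fix k assume Tk: "T k \<omega> < (\<delta> / 2)\<^sup>2" and Uk: "U k \<omega> < 1"
      have "V t \<omega> \<le> 2 ^ k" if t: "t < 2 ^ k" for t
      proof (rule ccontr)
        assume "\<not> V t \<omega> \<le> 2 ^ k"
        then have "1 \<le> (if 2 ^ k < V t \<omega> then 1 else 0 :: real)" by simp
        also have "\<dots> \<le> U k \<omega>" unfolding U_def using t by (intro member_le_sum) auto
        finally show False using Uk by simp
      qed
      then have "(\<Sum>t<2 ^ k. V t \<omega>) = (\<Sum>t<2 ^ k. Y k t \<omega>)"
        by (intro sum.cong) (auto simp: Y_def)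
      also have "\<dots> = (\<Sum>t<2 ^ k. G k t \<omega>) + 2 ^ k * \<mu> k" by (simp add: G_def sum_subtractf)
      also have "(\<Sum>t<2 ^ k. G k t \<omega>) \<le> 2 ^ k * (\<delta> / 2)"
      proof -
        have "(\<Sum>t<2 ^ k. G k t \<omega>) / 2 ^ k < \<delta> / 2"
          by (rule power2_less_imp_less[OF Tk[unfolded T_def]]) (use \<delta> in simp)
        then show ?thesis by (simp add: field_simps)
      qed
      also have "2 ^ k * \<mu> k \<le> 2 ^ k * expectation (V 0)" using mu_le by simp
      finally show "(\<Sum>t<2 ^ k. V t \<omega>) \<le> 2 ^ k * (expectation (V 0) + \<delta> / 2)" by (simp add: algebra_simps)
    qed
    then obtain k0 where k0: "\<And>k. k \<ge> k0 \<Longrightarrow> (\<Sum>t<2 ^ k. V t \<omega>) \<le> 2 ^ k * (expectation (V 0) + \<delta> / 2)"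
      by (auto simp: eventually_sequentially)
    have EV: "0 \<le> expectation (V 0)" using V(2) by (intro Bochner_Integration.integral_nonneg) auto
    show "\<forall>\<^sub>F n in sequentially. (\<Sum>t<n. V t \<omega>) / real n \<le> 2 * expectation (V 0) + \<delta>"
    proof (rule eventually_sequentiallyI[of "2 ^ k0"])
      fix n :: nat assume n: "2 ^ k0 \<le> n"
      then have n1: "1 \<le> n" by (metis one_le_numeral one_le_power order.trans)
      \<comment> \<open>Since the variables are nonnegative, the sum up to n is at most the sum up
        to the next power of 2, which is at most 2 n; hence the factor 2.\<close>
      obtain k where k: "2 ^ k \<le> n" "n < 2 ^ Suc k" using powers_bracket[OF n1] .
      have "2 ^ k0 < (2::nat) ^ Suc k" using n k by linarith
      then have kk: "k0 \<le> Suc k" by (simp only: power_strict_increasing_iff)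
      have "(\<Sum>t<n. V t \<omega>) \<le> (\<Sum>t<2 ^ Suc k. V t \<omega>)"
        using k V(2) by (intro sum_mono2) auto
      also have "\<dots> \<le> 2 ^ Suc k * (expectation (V 0) + \<delta> / 2)" by (rule k0[OF kk])
      also have "\<dots> = real (2 ^ k) * (2 * expectation (V 0) + \<delta>)" by (simp add: algebra_simps)
      also have "\<dots> \<le> real n * (2 * expectation (V 0) + \<delta>)"
        using k EV \<delta> by (intro mult_right_mono) (auto simp only: of_nat_le_iff)
      finally show "(\<Sum>t<n. V t \<omega>) / real n \<le> 2 * expectation (V 0) + \<delta>"
        using n1 by (simp add: field_simps)
    qed
  qed
qed

section \<open>Finite Markov chains with a Doeblin condition\<close>

text \<open>Defined on lists so that one function serves both words of states and, in
  \<open>block_chain\<close>, words whose letters are themselves words.\<close>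

fun wt :: "('s \<Rightarrow> 's \<Rightarrow> real) \<Rightarrow> 's list \<Rightarrow> real" where
  "wt k [] = 1"
| "wt k [x] = 1"
| "wt k (x # y # zs) = k x y * wt k (y # zs)"

lemma wt_append: "xs \<noteq> [] \<Longrightarrow> ys \<noteq> [] \<Longrightarrow> wt k (xs @ ys) = wt k xs * k (last xs) (hd ys) * wt k ys"
proof (induction k xs rule: wt.induct)
  case (2 k x)
  then show ?case by (cases ys) auto
qed auto

lemma sum_lists_Suc:
  fixes f :: "'s list \<Rightarrow> real"
  assumes "finite S"
  shows "(\<Sum>ws | set ws \<subseteq> S \<and> length ws = Suc n. f ws) = (\<Sum>ws | set ws \<subseteq> S \<and> length ws = n. \<Sum>w\<in>S. f (ws @ [w]))"
proof -
  have "(\<Sum>ws | set ws \<subseteq> S \<and> length ws = Suc n. f ws) = (\<Sum>p\<in>{ws. set ws \<subseteq> S \<and> length ws = n} \<times> S. f (fst p @ [snd p]))"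
  proof (rule sum.reindex_bij_witness[of _ "\<lambda>p. fst p @ [snd p]" "\<lambda>ws. (butlast ws, last ws)"])
    fix ws assume a: "ws \<in> {ws. set ws \<subseteq> S \<and> length ws = Suc n}"
    then have ne: "ws \<noteq> []" by auto
    then show "fst (butlast ws, last ws) @ [snd (butlast ws, last ws)] = ws" by simp
    show "(butlast ws, last ws) \<in> {ws. set ws \<subseteq> S \<and> length ws = n} \<times> S"
      using a ne by (auto dest: in_set_butlastD)
    show "f (fst (butlast ws, last ws) @ [snd (butlast ws, last ws)]) = f ws" using ne by simp
  qed auto
  also have "\<dots> = (\<Sum>ws | set ws \<subseteq> S \<and> length ws = n. \<Sum>w\<in>S. f (ws @ [w]))"
    by (simp add: sum.cartesian_product case_prod_unfold)
  finally show ?thesis .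
qed

lemma sum_lists_0: "(\<Sum>ws | set ws \<subseteq> S \<and> length ws = 0. f ws) = (f [] :: real)"
proof -
  have "{ws. set ws \<subseteq> S \<and> length ws = 0} = {[]}" by auto
  then show ?thesis by simp
qed

lemma sum_lists_1: "finite S \<Longrightarrow> (\<Sum>ws | set ws \<subseteq> S \<and> length ws = Suc 0. f ws) = (\<Sum>w\<in>S. f [w] :: real)"
  by (simp only: sum_lists_Suc sum_lists_0 append_Nil)

text \<open>The difference of the two sequences has total mass 0, so subtracting
  \<open>\<epsilon> * \<rho> w\<close> from every row of the kernel does not change its evolution.
  The reduced kernel is nonnegative with row sums \<open>1 - \<epsilon>\<close>.\<close>

lemma tv_contraction:
  fixes a b :: "nat \<Rightarrow> 's \<Rightarrow> real"
  assumes S: "finite S"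
    and a: "\<And>m w. w \<in> S \<Longrightarrow> a (Suc m) w = (\<Sum>v\<in>S. a m v * k v w)"
    and b: "\<And>m w. w \<in> S \<Longrightarrow> b (Suc m) w = (\<Sum>v\<in>S. b m v * k v w)"
    and ab: "(\<Sum>w\<in>S. a 0 w) = (\<Sum>w\<in>S. b 0 w)"
    and k: "\<And>v. v \<in> S \<Longrightarrow> (\<Sum>w\<in>S. k v w) = 1" "\<And>v w. v \<in> S \<Longrightarrow> w \<in> S \<Longrightarrow> \<epsilon> * \<rho> w \<le> k v w"
    and \<rho>: "(\<Sum>w\<in>S. \<rho> w) = 1" and \<epsilon>: "\<epsilon> \<le> 1"
  shows "(\<Sum>w\<in>S. \<bar>a m w - b m w\<bar>) \<le> (1 - \<epsilon>) ^ m * (\<Sum>w\<in>S. \<bar>a 0 w - b 0 w\<bar>)"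
proof -
  define D where "D m w = a m w - b m w" for m w
  have Drec: "D (Suc m) w = (\<Sum>v\<in>S. D m v * k v w)" if "w \<in> S" for m w
    using a[OF that] b[OF that] by (simp add: D_def sum_subtractf left_diff_distrib)
  have D0: "(\<Sum>w\<in>S. D m w) = 0" for m
  proof (induction m)
    case 0
    then show ?case using ab by (simp add: D_def sum_subtractf)
  next
    case (Suc m)
    have "(\<Sum>w\<in>S. D (Suc m) w) = (\<Sum>w\<in>S. \<Sum>v\<in>S. D m v * k v w)" by (simp add: Drec)
    also have "\<dots> = (\<Sum>v\<in>S. \<Sum>w\<in>S. D m v * k v w)" by (rule sum.swap)
    also have "\<dots> = (\<Sum>v\<in>S. D m v)" by (simp add: k(1) flip: sum_distrib_left)
    finally show ?case using Suc by simp
  qed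
  have "(\<Sum>w\<in>S. \<bar>D m w\<bar>) \<le> (1 - \<epsilon>) ^ m * (\<Sum>w\<in>S. \<bar>D 0 w\<bar>)"
  proof (induction m)
    case (Suc m)
    have "\<bar>D (Suc m) w\<bar> \<le> (\<Sum>v\<in>S. \<bar>D m v\<bar> * (k v w - \<epsilon> * \<rho> w))" if w: "w \<in> S" for w
    proof -
      have "D (Suc m) w = (\<Sum>v\<in>S. D m v * (k v w - \<epsilon> * \<rho> w))"
        using D0[of m] unfolding Drec[OF w] by (simp add: right_diff_distrib sum_subtractf flip: sum_distrib_right)
      also have "\<bar>\<dots>\<bar> \<le> (\<Sum>v\<in>S. \<bar>D m v * (k v w - \<epsilon> * \<rho> w)\<bar>)" by (rule sum_abs)
      also have "\<dots> = (\<Sum>v\<in>S. \<bar>D m v\<bar> * (k v w - \<epsilon> * \<rho> w))"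
        using k(2) w by (intro sum.cong) (auto simp: abs_mult)
      finally show ?thesis .
    qed
    then have "(\<Sum>w\<in>S. \<bar>D (Suc m) w\<bar>) \<le> (\<Sum>w\<in>S. \<Sum>v\<in>S. \<bar>D m v\<bar> * (k v w - \<epsilon> * \<rho> w))" by (rule sum_mono)
    also have "\<dots> = (\<Sum>v\<in>S. \<Sum>w\<in>S. \<bar>D m v\<bar> * (k v w - \<epsilon> * \<rho> w))" by (rule sum.swap)
    also have "\<dots> = (\<Sum>v\<in>S. \<bar>D m v\<bar> * (1 - \<epsilon>))"
      using k(1) \<rho> by (intro sum.cong refl) (simp add: sum_subtractf flip: sum_distrib_left)
    also have "\<dots> = (1 - \<epsilon>) * (\<Sum>v\<in>S. \<bar>D m v\<bar>)" by (simp add: sum_distrib_left mult.commute)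
    also have "\<dots> \<le> (1 - \<epsilon>) * ((1 - \<epsilon>) ^ m * (\<Sum>w\<in>S. \<bar>D 0 w\<bar>))"
      using Suc \<epsilon> by (intro mult_left_mono) auto
    finally show ?case by simp
  qed simp
  then show ?thesis by (simp add: D_def)
qed

lemma Cesaro_tendsto:
  fixes x :: "nat \<Rightarrow> real" assumes "x \<longlonglongrightarrow> q"
  shows "(\<lambda>N. (\<Sum>i<N. x i) / real N) \<longlonglongrightarrow> q"
proof (rule LIMSEQ_I)
  fix e :: real assume e: "0 < e"
  then obtain N0 where N0: "\<And>n. n \<ge> N0 \<Longrightarrow> \<bar>x n - q\<bar> < e / 2"
    using LIMSEQ_D[OF assms, of "e/2"] by auto
  define C where "C = (\<Sum>i<N0. \<bar>x i - q\<bar>)"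
  obtain N1 :: nat where N1: "2 * C / e < real N1" using reals_Archimedean2 by blast
  show "\<exists>no. \<forall>n\<ge>no. norm ((\<Sum>i<n. x i) / real n - q) < e"
  proof (intro exI[of _ "max (Suc N0) (Suc N1)"] allI impI)
    fix n assume n: "max (Suc N0) (Suc N1) \<le> n"
    have np: "0 < real n" using n by auto
    have "(\<Sum>i<n. x i) / real n - q = (\<Sum>i<n. x i - q) / real n"
      using np by (simp add: sum_subtractf field_simps)
    also have "\<bar>\<dots>\<bar> \<le> (\<Sum>i<n. \<bar>x i - q\<bar>) / real n"
      using np by (simp add: divide_right_mono sum_abs)
    also have "(\<Sum>i<n. \<bar>x i - q\<bar>) = C + (\<Sum>i\<in>{N0..<n}. \<bar>x i - q\<bar>)"
      unfolding C_def using n by (subst sum.union_disjoint[symmetric]) (auto intro!: sum.cong)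
    also have "(\<Sum>i\<in>{N0..<n}. \<bar>x i - q\<bar>) \<le> (\<Sum>i\<in>{N0..<n}. e / 2)"
      using N0 by (intro sum_mono) (auto simp: less_imp_le)
    also have "\<dots> \<le> real n * (e / 2)" using e by (simp add: mult_right_mono)
    finally have "\<bar>(\<Sum>i<n. x i) / real n - q\<bar> \<le> (C + real n * (e / 2)) / real n"
      using np by (simp add: divide_right_mono)
    also have "\<dots> = C / real n + e / 2" using np by (simp add: field_simps)
    also have "C / real n < e / 2"
    proof -
      have "2 * C / e < real n" using N1 n by linarith
      then show ?thesis using np e by (simp add: field_simps)
    qed
    finally show "norm ((\<Sum>i<n. x i) / real n - q) < e" by simp
  qed
qed

text \<open>The law is prescribed for words over S only. As these words have total weight 1 in each
  length, the process almost surely stays in S. Measurability is asked of the level sets alone, so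
  the type of states carries no sigma-algebra.\<close>

locale doeblin_chain = prob_space M for M :: "'a measure" +
  fixes \<xi> :: "nat \<Rightarrow> 'a \<Rightarrow> 's" and S :: "'s set" and p :: "'s \<Rightarrow> real" and k :: "'s \<Rightarrow> 's \<Rightarrow> real"
    and \<rho> :: "'s \<Rightarrow> real" and \<epsilon> :: real
  assumes S: "finite S"
    and ev_meas: "\<And>n w. {\<omega>\<in>space M. \<xi> n \<omega> = w} \<in> events"
    and law: "\<And>ws. ws \<noteq> [] \<Longrightarrow> set ws \<subseteq> S \<Longrightarrow>
        prob {\<omega>\<in>space M. map (\<lambda>i. \<xi> i \<omega>) [0..<length ws] = ws} = p (hd ws) * wt k ws"
    and p: "\<And>w. w \<in> S \<Longrightarrow> 0 \<le> p w" "(\<Sum>w\<in>S. p w) = 1"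
    and k1: "\<And>v. v \<in> S \<Longrightarrow> (\<Sum>w\<in>S. k v w) = 1"
    and k2: "\<And>v w. v \<in> S \<Longrightarrow> w \<in> S \<Longrightarrow> \<epsilon> * \<rho> w \<le> k v w"
    and \<rho>: "\<And>w. w \<in> S \<Longrightarrow> 0 \<le> \<rho> w" "(\<Sum>w\<in>S. \<rho> w) = 1"
    and \<epsilon>: "0 < \<epsilon>" "\<epsilon> \<le> 1"
begin

definition words :: "nat \<Rightarrow> 's list set" where
  "words n = {ws. set ws \<subseteq> S \<and> length ws = n}"

abbreviation W :: "'s list \<Rightarrow> real" where "W ws \<equiv> p (hd ws) * wt k ws"

definition traj :: "nat \<Rightarrow> 'a \<Rightarrow> 's list" where "traj n \<omega> = map (\<lambda>i. \<xi> i \<omega>) [0..<n]"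

lemma k_nonneg: "v \<in> S \<Longrightarrow> w \<in> S \<Longrightarrow> 0 \<le> k v w"
  using k2[of v w] \<rho>(1)[of w] \<epsilon> by (meson less_imp_le mult_nonneg_nonneg order.trans)

lemma wt_nonneg: "set ws \<subseteq> S \<Longrightarrow> 0 \<le> wt k ws"
  by (induction ws rule: induct_list012) (auto intro!: mult_nonneg_nonneg k_nonneg)

lemma finite_words: "finite (words n)"
  unfolding words_def using finite_lists_length_eq[OF S] .

lemma W_snoc: "ws \<noteq> [] \<Longrightarrow> W (ws @ [w]) = W ws * k (last ws) w"
  by (simp add: wt_append)

lemma sum_words_Suc: "(\<Sum>ws\<in>words (Suc n). f ws) = (\<Sum>ws\<in>words n. \<Sum>w\<in>S. (f (ws @ [w]) :: real))"
  unfolding words_def by (rule sum_lists_Suc[OF S])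

lemma words_ne: "ws \<in> words (Suc n) \<Longrightarrow> ws \<noteq> [] \<and> last ws \<in> S \<and> hd ws \<in> S"
  by (auto simp: words_def) (metis last_in_set length_0_conv nat.distinct(1) subsetD, metis hd_in_set length_0_conv nat.distinct(1) subsetD)

lemma sum_W: "(\<Sum>ws\<in>words (Suc n). W ws) = 1"
proof (induction n)
  case 0
  show ?case using p(2) by (simp add: words_def sum_lists_1[OF S])
next
  case (Suc n)
  have "(\<Sum>ws\<in>words (Suc (Suc n)). W ws) = (\<Sum>ws\<in>words (Suc n). \<Sum>w\<in>S. W ws * k (last ws) w)"
    unfolding sum_words_Suc[of _ "Suc n"] using words_ne by (intro sum.cong refl W_snoc) auto
  also have "\<dots> = (\<Sum>ws\<in>words (Suc n). W ws)"
    using words_ne k1 by (intro sum.cong refl) (auto simp flip: sum_distrib_left)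
  finally show ?case using Suc by simp
qed

lemma segment_meas: "{\<omega>\<in>space M. map (\<lambda>i. \<xi> i \<omega>) [a..<b] = ws} \<in> events"
proof -
  have "{\<omega>\<in>space M. map (\<lambda>i. \<xi> i \<omega>) [a..<b] = ws} =
      (if length ws = b - a then {\<omega>\<in>space M. \<forall>i\<in>{..<b - a}. \<xi> (a + i) \<omega> = ws ! i} else {})"
    by (auto simp: list_eq_iff_nth_eq)
  moreover have "{\<omega>\<in>space M. \<forall>i\<in>{..<b - a}. \<xi> (a + i) \<omega> = ws ! i} \<in> events"
    using ev_meas by (intro sets.sets_Collect_finite_All) auto
  ultimately show ?thesis by auto
qed

lemma traj_meas: "{\<omega>\<in>space M. traj n \<omega> = ws} \<in> events"
  unfolding traj_def by (rule segment_meas)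

lemma prob_traj: "ws \<in> words (Suc n) \<Longrightarrow> prob {\<omega>\<in>space M. traj (Suc n) \<omega> = ws} = W ws"
  using law[of ws] words_ne[of ws n] unfolding words_def traj_def by auto

lemma prob_traj_in:
  assumes "B \<subseteq> words (Suc n)"
  shows "{\<omega>\<in>space M. traj (Suc n) \<omega> \<in> B} \<in> events" "prob {\<omega>\<in>space M. traj (Suc n) \<omega> \<in> B} = (\<Sum>ws\<in>B. W ws)"
proof -
  have fin: "finite B" using assms finite_words finite_subset by blast
  have eq: "{\<omega>\<in>space M. traj (Suc n) \<omega> \<in> B} = (\<Union>ws\<in>B. {\<omega>\<in>space M. traj (Suc n) \<omega> = ws})" by auto
  show "{\<omega>\<in>space M. traj (Suc n) \<omega> \<in> B} \<in> events" unfolding eq using fin traj_meas by auto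
  have "prob (\<Union>ws\<in>B. {\<omega>\<in>space M. traj (Suc n) \<omega> = ws}) = (\<Sum>ws\<in>B. prob {\<omega>\<in>space M. traj (Suc n) \<omega> = ws})"
    using fin traj_meas by (intro finite_measure_finite_Union) (auto simp: disjoint_family_on_def)
  also have "\<dots> = (\<Sum>ws\<in>B. W ws)" using assms prob_traj by (intro sum.cong) auto
  finally show "prob {\<omega>\<in>space M. traj (Suc n) \<omega> \<in> B} = (\<Sum>ws\<in>B. W ws)" unfolding eq .
qed

lemma AE_traj: "AE \<omega> in M. traj (Suc n) \<omega> \<in> words (Suc n)"
proof -
  have "prob {\<omega>\<in>space M. traj (Suc n) \<omega> \<in> words (Suc n)} = 1"
    using prob_traj_in(2)[of "words (Suc n)" n] sum_W by simp
  then show ?thesis using prob_traj_in(1)[of "words (Suc n)" n] by (simp add: prob_Collect_eq_1)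
qed

lemma AE_in_S: "AE \<omega> in M. \<forall>n. \<xi> n \<omega> \<in> S"
proof -
  have "AE \<omega> in M. \<forall>n. traj (Suc n) \<omega> \<in> words (Suc n)" unfolding AE_all_countable using AE_traj by blast
  then show ?thesis by (rule AE_mp) (auto simp: words_def traj_def)
qed

definition J :: "nat \<Rightarrow> 's \<Rightarrow> nat \<Rightarrow> 's \<Rightarrow> real" where
  "J i u n w = prob {\<omega>\<in>space M. \<xi> i \<omega> = u \<and> \<xi> n \<omega> = w}"

lemma J_eq: "i \<le> n \<Longrightarrow> J i u n w = (\<Sum>ws\<in>{ws\<in>words (Suc n). ws ! i = u \<and> last ws = w}. W ws)"
proof -
  assume i: "i \<le> n"
  let ?B = "{ws\<in>words (Suc n). ws ! i = u \<and> last ws = w}"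
  have tr: "traj (Suc n) \<omega> ! i = \<xi> i \<omega>" "last (traj (Suc n) \<omega>) = \<xi> n \<omega>" for \<omega>
    using i unfolding traj_def by (auto simp del: upt_Suc simp add: nth_map last_map)
  have "prob {\<omega>\<in>space M. \<xi> i \<omega> = u \<and> \<xi> n \<omega> = w} = prob {\<omega>\<in>space M. traj (Suc n) \<omega> \<in> ?B}"
  proof (rule finite_measure_eq_AE)
    show "AE x in M. (x \<in> {\<omega>\<in>space M. \<xi> i \<omega> = u \<and> \<xi> n \<omega> = w}) = (x \<in> {\<omega>\<in>space M. traj (Suc n) \<omega> \<in> ?B})"
      using AE_traj[of n] by (rule AE_mp) (auto simp: tr)
    have "{\<omega>\<in>space M. \<xi> i \<omega> = u \<and> \<xi> n \<omega> = w} = {\<omega>\<in>space M. \<xi> i \<omega> = u} \<inter> {\<omega>\<in>space M. \<xi> n \<omega> = w}" by auto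
    then show "{\<omega>\<in>space M. \<xi> i \<omega> = u \<and> \<xi> n \<omega> = w} \<in> events" using ev_meas by auto
    show "{\<omega>\<in>space M. traj (Suc n) \<omega> \<in> ?B} \<in> events" by (rule prob_traj_in) auto
  qed
  also have "\<dots> = (\<Sum>ws\<in>?B. W ws)" by (rule prob_traj_in) auto
  finally show ?thesis by (simp add: J_def)
qed

lemma J_Suc:
  assumes "i \<le> n" "w \<in> S"
  shows "J i u (Suc n) w = (\<Sum>v\<in>S. J i u n v * k v w)"
proof -
  let ?f = "\<lambda>ws. if ws ! i = u \<and> last ws = w then W ws else 0"
  have "J i u (Suc n) w = (\<Sum>ws\<in>words (Suc (Suc n)). ?f ws)"
    using assms by (subst J_eq) (auto simp: sum.inter_filter finite_words)
  also have "\<dots> = (\<Sum>ws\<in>words (Suc n). \<Sum>w'\<in>S. ?f (ws @ [w']))" by (rule sum_words_Suc)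
  also have "\<dots> = (\<Sum>ws\<in>words (Suc n). if ws ! i = u then W ws * k (last ws) w else 0)"
  proof (intro sum.cong refl)
    fix ws assume ws: "ws \<in> words (Suc n)"
    then have "(ws @ [w']) ! i = ws ! i" for w' using assms by (auto simp: words_def nth_append)
    then have "(\<Sum>w'\<in>S. ?f (ws @ [w'])) = (\<Sum>w'\<in>S. if w' = w then (if ws ! i = u then W (ws @ [w]) else 0) else 0)"
      by (intro sum.cong) auto
    also have "\<dots> = (if ws ! i = u then W ws * k (last ws) w else 0)"
      using S assms words_ne[OF ws] by (simp add: wt_append)
    finally show "(\<Sum>w'\<in>S. ?f (ws @ [w'])) = (if ws ! i = u then W ws * k (last ws) w else 0)" .
  qed
  also have "\<dots> = (\<Sum>ws\<in>words (Suc n). \<Sum>v\<in>S. if last ws = v then (if ws ! i = u then W ws * k v w else 0) else 0)"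
    using words_ne S by (intro sum.cong refl) simp
  also have "\<dots> = (\<Sum>v\<in>S. \<Sum>ws\<in>words (Suc n). if last ws = v then (if ws ! i = u then W ws * k v w else 0) else 0)"
    by (rule sum.swap)
  also have "\<dots> = (\<Sum>v\<in>S. J i u n v * k v w)"
    using assms by (intro sum.cong refl, subst J_eq)
      (auto simp: sum.inter_filter finite_words sum_distrib_right intro!: sum.cong)
  finally show ?thesis .
qed

definition \<mu> :: "nat \<Rightarrow> 's \<Rightarrow> real" where "\<mu> n w = prob {\<omega>\<in>space M. \<xi> n \<omega> = w}"

lemma J_nonneg: "0 \<le> J i u n w" by (simp add: J_def)
lemma mu_nonneg: "0 \<le> \<mu> n w" by (simp add: \<mu>_def)

lemma sum_J0: "i \<le> n \<Longrightarrow> (\<Sum>u\<in>S. J i u n w) = \<mu> n w"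
proof -
  assume "i \<le> n"
  have m: "{\<omega>\<in>space M. \<xi> i \<omega> = u \<and> \<xi> n \<omega> = w} \<in> events" for u
  proof -
    have "{\<omega>\<in>space M. \<xi> i \<omega> = u \<and> \<xi> n \<omega> = w} = {\<omega>\<in>space M. \<xi> i \<omega> = u} \<inter> {\<omega>\<in>space M. \<xi> n \<omega> = w}" by auto
    then show ?thesis using ev_meas by auto
  qed
  have "(\<Sum>u\<in>S. J i u n w) = prob (\<Union>u\<in>S. {\<omega>\<in>space M. \<xi> i \<omega> = u \<and> \<xi> n \<omega> = w})"
    unfolding J_def using S m by (intro finite_measure_finite_Union[symmetric]) (auto simp: disjoint_family_on_def)
  also have "\<dots> = \<mu> n w" unfolding \<mu>_def
  proof (rule finite_measure_eq_AE)
    show "AE x in M. (x \<in> (\<Union>u\<in>S. {\<omega>\<in>space M. \<xi> i \<omega> = u \<and> \<xi> n \<omega> = w})) = (x \<in> {\<omega>\<in>space M. \<xi> n \<omega> = w})"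
      using AE_in_S by (rule AE_mp) auto
    show "(\<Union>u\<in>S. {\<omega>\<in>space M. \<xi> i \<omega> = u \<and> \<xi> n \<omega> = w}) \<in> events" using S m by auto
  qed (rule ev_meas)
  finally show ?thesis .
qed

lemma sum_mu: "(\<Sum>w\<in>S. \<mu> n w) = 1"
proof -
  have "(\<Sum>w\<in>S. \<mu> n w) = prob (\<Union>w\<in>S. {\<omega>\<in>space M. \<xi> n \<omega> = w})"
    unfolding \<mu>_def using S ev_meas by (intro finite_measure_finite_Union[symmetric]) (auto simp: disjoint_family_on_def)
  also have "\<dots> = 1"
  proof (subst prob_eq_1)
    show "(\<Union>w\<in>S. {\<omega>\<in>space M. \<xi> n \<omega> = w}) \<in> events" using S ev_meas by auto
    show "AE x in M. x \<in> (\<Union>w\<in>S. {\<omega>\<in>space M. \<xi> n \<omega> = w})" using AE_in_S by (rule AE_mp) auto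
  qed
  finally show ?thesis .
qed

lemma mu_Suc: "w \<in> S \<Longrightarrow> \<mu> (Suc n) w = (\<Sum>v\<in>S. \<mu> n v * k v w)"
proof -
  assume w: "w \<in> S"
  have "\<mu> (Suc n) w = (\<Sum>u\<in>S. \<Sum>v\<in>S. J 0 u n v * k v w)"
    using w by (simp add: sum_J0[of 0, symmetric] J_Suc)
  also have "\<dots> = (\<Sum>v\<in>S. \<Sum>u\<in>S. J 0 u n v * k v w)" by (rule sum.swap)
  also have "\<dots> = (\<Sum>v\<in>S. \<mu> n v * k v w)" by (simp add: sum_J0[of 0, symmetric] sum_distrib_right)
  finally show ?thesis .
qed

lemma mu_ge: "w \<in> S \<Longrightarrow> \<epsilon> * \<rho> w \<le> \<mu> (Suc n) w"
proof -
  assume w: "w \<in> S"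
  have "\<epsilon> * \<rho> w = (\<Sum>v\<in>S. \<mu> n v * (\<epsilon> * \<rho> w))" by (simp add: sum_mu flip: sum_distrib_right)
  also have "\<dots> \<le> \<mu> (Suc n) w" unfolding mu_Suc[OF w] using k2 w mu_nonneg by (intro sum_mono mult_left_mono) auto
  finally show ?thesis .
qed

text \<open>The joint law with the event \<open>\<xi> i = u\<close> and the product of the marginals
  are two evolutions under the same kernel from time i on, both of mass \<open>\<mu> i u\<close>.
  Hence they merge geometrically, and 2 bounds their initial distance.\<close>

lemma covariance_bound:
  assumes u: "u \<in> S" and ij: "i \<le> j"
  shows "J i u j u - \<mu> i u * \<mu> j u \<le> 2 * (1 - \<epsilon>) ^ (j - i)"
proof -
  define a where "a m w = J i u (i + m) w" for m w
  define b where "b m w = \<mu> i u * \<mu> (i + m) w" for m w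
  have a0: "a 0 w = (if w = u then \<mu> i u else 0)" for w
  proof (cases "w = u")
    case False
    then have "{\<omega>\<in>space M. \<xi> i \<omega> = u \<and> \<xi> i \<omega> = w} = {}" by auto
    then have "J i u i w = prob {}" unfolding J_def by (rule arg_cong)
    with False show ?thesis by (simp add: a_def)
  qed (simp add: a_def J_def \<mu>_def)
  have "(\<Sum>w\<in>S. \<bar>a (j - i) w - b (j - i) w\<bar>) \<le> (1 - \<epsilon>) ^ (j - i) * (\<Sum>w\<in>S. \<bar>a 0 w - b 0 w\<bar>)"
  proof (rule tv_contraction[OF S, where k=k and \<rho>=\<rho>])
    show "w \<in> S \<Longrightarrow> a (Suc m) w = (\<Sum>v\<in>S. a m v * k v w)" for m w by (simp add: a_def J_Suc)
    show "w \<in> S \<Longrightarrow> b (Suc m) w = (\<Sum>v\<in>S. b m v * k v w)" for m w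
      by (simp add: b_def mu_Suc sum_distrib_left mult.assoc)
    show "(\<Sum>w\<in>S. a 0 w) = (\<Sum>w\<in>S. b 0 w)"
      using S u by (simp add: a0) (simp add: b_def sum_mu flip: sum_distrib_left)
  qed (use k1 k2 \<rho> \<epsilon> in auto)
  also have "(\<Sum>w\<in>S. \<bar>a 0 w - b 0 w\<bar>) \<le> (\<Sum>w\<in>S. a 0 w + b 0 w)"
  proof (rule sum_mono)
    fix w
    have "0 \<le> a 0 w" "0 \<le> b 0 w" by (auto simp: a_def b_def J_nonneg mu_nonneg)
    then show "\<bar>a 0 w - b 0 w\<bar> \<le> a 0 w + b 0 w" by linarith
  qed
  also have "\<dots> = \<mu> i u + \<mu> i u"
    using S u by (simp add: sum.distrib a0) (simp add: b_def sum_mu flip: sum_distrib_left)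
  also have "\<dots> \<le> 2" unfolding \<mu>_def using prob_le_1[of "{\<omega>\<in>space M. \<xi> i \<omega> = u}"] by linarith
  finally have "(\<Sum>w\<in>S. \<bar>a (j - i) w - b (j - i) w\<bar>) \<le> (1 - \<epsilon>) ^ (j - i) * 2"
    using \<epsilon> by (simp add: mult_left_mono)
  moreover have "\<bar>a (j - i) u - b (j - i) u\<bar> \<le> (\<Sum>w\<in>S. \<bar>a (j - i) w - b (j - i) w\<bar>)"
    using S u by (intro member_le_sum) auto
  ultimately show ?thesis using ij by (simp add: a_def b_def)
qed

text \<open>The laws read from time l and from time 0 evolve under the same kernel, so they merge at
  a rate independent of l, and the sequence is Cauchy. The lower bound on the limit later shows that
  every state is visited.\<close>

lemma mu_convergent:
  assumes u: "u \<in> S"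
  shows "\<exists>q. (\<lambda>n. \<mu> n u) \<longlonglongrightarrow> q \<and> \<epsilon> * \<rho> u \<le> q"
proof -
  have bd: "\<bar>\<mu> (l + n) u - \<mu> n u\<bar> \<le> 2 * (1 - \<epsilon>) ^ n" for l n
  proof -
    have "(\<Sum>w\<in>S. \<bar>\<mu> (l + n) w - \<mu> n w\<bar>) \<le> (1 - \<epsilon>) ^ n * (\<Sum>w\<in>S. \<bar>\<mu> (l + 0) w - \<mu> 0 w\<bar>)"
      by (rule tv_contraction[OF S, where k=k and \<rho>=\<rho> and a="\<lambda>m. \<mu> (l + m)" and b=\<mu>]) (use k1 k2 \<rho> \<epsilon> mu_Suc sum_mu in auto)
    also have "(\<Sum>w\<in>S. \<bar>\<mu> (l + 0) w - \<mu> 0 w\<bar>) \<le> (\<Sum>w\<in>S. \<mu> l w + \<mu> 0 w)"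
    proof (rule sum_mono)
      fix w show "\<bar>\<mu> (l + 0) w - \<mu> 0 w\<bar> \<le> \<mu> l w + \<mu> 0 w" using mu_nonneg[of l w] mu_nonneg[of 0 w] by simp
    qed
    also have "\<dots> = 2" by (simp add: sum.distrib sum_mu)
    finally have "(\<Sum>w\<in>S. \<bar>\<mu> (l + n) w - \<mu> n w\<bar>) \<le> (1 - \<epsilon>) ^ n * 2" using \<epsilon> by (simp add: mult_left_mono)
    moreover have "\<bar>\<mu> (l + n) u - \<mu> n u\<bar> \<le> (\<Sum>w\<in>S. \<bar>\<mu> (l + n) w - \<mu> n w\<bar>)"
      using S u by (intro member_le_sum) auto
    ultimately show ?thesis by simp
  qed
  have "(\<lambda>n. 2 * (1 - \<epsilon>) ^ n) \<longlonglongrightarrow> 2 * 0"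
    using \<epsilon> by (intro tendsto_intros LIMSEQ_realpow_zero) auto
  then have lim0: "(\<lambda>n. 2 * (1 - \<epsilon>) ^ n) \<longlonglongrightarrow> 0" by simp
  have "Cauchy (\<lambda>n. \<mu> n u)"
  proof (rule CauchyI')
    fix e :: real assume "0 < e"
    then obtain N where N: "\<And>n. n \<ge> N \<Longrightarrow> 2 * (1 - \<epsilon>) ^ n < e"
      using order_tendstoD(2)[OF lim0] by (auto simp: eventually_sequentially)
    show "\<exists>M. \<forall>m\<ge>M. \<forall>n>m. dist (\<mu> m u) (\<mu> n u) < e"
    proof (intro exI[of _ N] allI impI)
      fix m n assume "N \<le> m" "m < n"
      then have "\<bar>\<mu> (n - m + m) u - \<mu> m u\<bar> \<le> 2 * (1 - \<epsilon>) ^ m" by (intro bd)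
      then show "dist (\<mu> m u) (\<mu> n u) < e" using N[of m] \<open>N \<le> m\<close> \<open>m < n\<close> by (simp add: dist_real_def abs_minus_commute)
    qed
  qed
  then obtain q where q: "(\<lambda>n. \<mu> n u) \<longlonglongrightarrow> q" by (auto simp: Cauchy_convergent_iff convergent_def)
  moreover have "\<epsilon> * \<rho> u \<le> q"
    using LIMSEQ_Suc[OF q] mu_ge[OF u] by (intro LIMSEQ_le_const) auto
  ultimately show ?thesis by blast
qed

text \<open>Indicators of a state have geometrically decaying covariances, so their averages follow
  the averages of their means; the latter converge by \<open>mu_convergent\<close> and Cesaro
  summation.\<close>

lemma frequencies_converge:
  "\<exists>q. (\<forall>u\<in>S. \<epsilon> * \<rho> u \<le> q u) \<and>
    (AE \<omega> in M. \<forall>u\<in>S. (\<lambda>N. (\<Sum>i<N. if \<xi> i \<omega> = u then 1 else 0) / real N) \<longlonglongrightarrow> q u)"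
proof -
  from mu_convergent obtain q where q: "\<And>u. u \<in> S \<Longrightarrow> (\<lambda>n. \<mu> n u) \<longlonglongrightarrow> q u" "\<And>u. u \<in> S \<Longrightarrow> \<epsilon> * \<rho> u \<le> q u"
    by metis
  have "AE \<omega> in M. (\<lambda>N. (\<Sum>i<N. if \<xi> i \<omega> = u then 1 else 0) / real N) \<longlonglongrightarrow> q u" if u: "u \<in> S" for u
  proof -
    define F where "F i \<omega> = (if \<xi> i \<omega> = u then 1 else 0 :: real)" for i \<omega>
    have Fi: "F i \<omega> = indicator {\<omega>\<in>space M. \<xi> i \<omega> = u} \<omega>" if "\<omega> \<in> space M" for i \<omega>
      using that by (simp add: F_def)
    have Fm: "random_variable borel (F i)" for i
      by (subst measurable_cong[OF Fi]) (use ev_meas in auto)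
    have E: "expectation (F i) = \<mu> i u" for i
    proof -
      have "expectation (F i) = expectation (indicator {\<omega>\<in>space M. \<xi> i \<omega> = u})"
        by (rule Bochner_Integration.integral_cong) (auto simp: Fi)
      then show ?thesis using ev_meas[of i u] by (simp add: \<mu>_def)
    qed
    have E2: "expectation (\<lambda>\<omega>. F i \<omega> * F j \<omega>) = J i u j u" for i j
    proof -
      have "expectation (\<lambda>\<omega>. F i \<omega> * F j \<omega>) = expectation (indicator ({\<omega>\<in>space M. \<xi> i \<omega> = u} \<inter> {\<omega>\<in>space M. \<xi> j \<omega> = u}))"
        by (rule Bochner_Integration.integral_cong) (auto simp: Fi indicator_def)
      also have "\<dots> = prob ({\<omega>\<in>space M. \<xi> i \<omega> = u} \<inter> {\<omega>\<in>space M. \<xi> j \<omega> = u})"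
        using sets.Int[OF ev_meas[of i u] ev_meas[of j u]] by simp
      also have "{\<omega>\<in>space M. \<xi> i \<omega> = u} \<inter> {\<omega>\<in>space M. \<xi> j \<omega> = u} = {\<omega>\<in>space M. \<xi> i \<omega> = u \<and> \<xi> j \<omega> = u}" by auto
      finally show ?thesis by (simp add: J_def)
    qed
    have "AE \<omega> in M. (\<lambda>N. (\<Sum>i<N. F i \<omega> - expectation (F i)) / real N) \<longlonglongrightarrow> 0"
    proof (rule lln_covariance_decay[OF Fm, where r="1 - \<epsilon>" and C=2])
      show "expectation (\<lambda>\<omega>. F i \<omega> * F j \<omega>) - expectation (F i) * expectation (F j) \<le> 2 * (1 - \<epsilon>) ^ (j - i)" if "i \<le> j" for i j
        unfolding E E2 by (rule covariance_bound[OF u that])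
    qed (use \<epsilon> in \<open>auto simp: F_def\<close>)
    then show ?thesis
    proof (rule AE_mp, intro AE_I2 impI)
      fix \<omega> assume a: "(\<lambda>N. (\<Sum>i<N. F i \<omega> - expectation (F i)) / real N) \<longlonglongrightarrow> 0"
      have "(\<lambda>N. (\<Sum>i<N. F i \<omega> - expectation (F i)) / real N + (\<Sum>i<N. \<mu> i u) / real N) \<longlonglongrightarrow> 0 + q u"
        by (intro tendsto_add a Cesaro_tendsto q u)
      then show "(\<lambda>N. (\<Sum>i<N. if \<xi> i \<omega> = u then 1 else 0) / real N) \<longlonglongrightarrow> q u"
        unfolding E by (simp add: sum_subtractf F_def flip: add_divide_distrib)
    qed
  qed
  then have "AE \<omega> in M. \<forall>u\<in>S. (\<lambda>N. (\<Sum>i<N. if \<xi> i \<omega> = u then 1 else 0) / real N) \<longlonglongrightarrow> q u"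
    using S by (simp add: AE_finite_all)
  then show ?thesis using q by blast
qed

lemma averages_converge:
  fixes F :: "'s \<Rightarrow> real"
  shows "\<exists>c. AE \<omega> in M. (\<lambda>N. (\<Sum>i<N. F (\<xi> i \<omega>)) / real N) \<longlonglongrightarrow> c"
proof -
  obtain q where q: "AE \<omega> in M. \<forall>u\<in>S. (\<lambda>N. (\<Sum>i<N. if \<xi> i \<omega> = u then 1 else 0) / real N) \<longlonglongrightarrow> q u"
    using frequencies_converge by blast
  show ?thesis
  proof (intro exI[of _ "\<Sum>u\<in>S. F u * q u"])
    from q AE_in_S show "AE \<omega> in M. (\<lambda>N. (\<Sum>i<N. F (\<xi> i \<omega>)) / real N) \<longlonglongrightarrow> (\<Sum>u\<in>S. F u * q u)"
    proof eventually_elim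
      case (elim \<omega>)
      have "F (\<xi> i \<omega>) = (\<Sum>u\<in>S. F u * (if \<xi> i \<omega> = u then 1 else 0))" for i
        using elim(2) S by (simp add: if_distrib[of "(*) _"] cong: if_cong)
      then have "(\<Sum>i<N. F (\<xi> i \<omega>)) / real N = (\<Sum>u\<in>S. F u * ((\<Sum>i<N. if \<xi> i \<omega> = u then 1 else 0) / real N))" for N
        by (simp only: sum.swap[of _ "{..<N}" S] sum_divide_distrib sum_distrib_left times_divide_eq_right)
      moreover have "(\<lambda>N. \<Sum>u\<in>S. F u * ((\<Sum>i<N. if \<xi> i \<omega> = u then 1 else 0) / real N)) \<longlonglongrightarrow> (\<Sum>u\<in>S. F u * q u)"
        using elim(1) by (intro tendsto_intros) auto
      ultimately show ?case by simp
    qed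
  qed
qed

section \<open>Words of fixed length as a Markov chain\<close>

lemma block_concat:
  assumes "0 < l"
  shows "concat (map (\<lambda>i. map (\<lambda>j. \<xi> j \<omega>) [i * l..<i * l + l]) [0..<n]) = map (\<lambda>i. \<xi> i \<omega>) [0..<n * l]"
proof (induction n)
  case (Suc n)
  have "[0..<Suc n * l] = [0..<n * l] @ [n * l..<n * l + l]"
    by (metis add.commute le0 mult_Suc upt_add_eq_append add_0)
  then show ?case using Suc by simp
qed simp

lemma wt_concat:
  assumes "ws \<noteq> []" "\<forall>w\<in>set ws. w \<noteq> []"
  shows "wt k (concat ws) = wt k (hd ws) * wt (\<lambda>u w. k (last u) (hd w) * wt k w) ws"
  using assms
proof (induction "\<lambda>u w. k (last u) (hd w) * wt k w" ws rule: wt.induct)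
  case (3 x y zs)
  then have ne: "concat (y # zs) \<noteq> []" "hd (concat (y # zs)) = hd y" "x \<noteq> []" by auto
  have "wt k (x @ concat (y # zs)) = wt k x * k (last x) (hd y) * wt k (concat (y # zs))"
    unfolding wt_append[OF ne(3,1)] ne(2) ..
  with 3 show ?case by simp
qed auto

lemma sum_words_wt:
  assumes "v \<in> S"
  shows "(\<Sum>ws\<in>words (Suc n). k v (hd ws) * wt k ws) = 1"
proof (induction n)
  case 0
  show ?case using k1[OF assms] by (simp add: words_def sum_lists_1[OF S])
next
  case (Suc n)
  have "(\<Sum>ws\<in>words (Suc (Suc n)). k v (hd ws) * wt k ws) = (\<Sum>ws\<in>words (Suc n). \<Sum>w\<in>S. k v (hd ws) * wt k ws * k (last ws) w)"
    unfolding sum_words_Suc[of _ "Suc n"] using words_ne by (intro sum.cong refl) (auto simp: wt_append)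
  also have "\<dots> = (\<Sum>ws\<in>words (Suc n). k v (hd ws) * wt k ws)"
    using words_ne k1 by (intro sum.cong refl) (auto simp flip: sum_distrib_left)
  finally show ?case using Suc by simp
qed

lemma sum_words_rho: "(\<Sum>ws\<in>words (Suc n). \<rho> (hd ws) * wt k ws) = 1"
proof (induction n)
  case 0
  show ?case using \<rho>(2) by (simp add: words_def sum_lists_1[OF S])
next
  case (Suc n)
  have "(\<Sum>ws\<in>words (Suc (Suc n)). \<rho> (hd ws) * wt k ws) = (\<Sum>ws\<in>words (Suc n). \<Sum>w\<in>S. \<rho> (hd ws) * wt k ws * k (last ws) w)"
    unfolding sum_words_Suc[of _ "Suc n"] using words_ne by (intro sum.cong refl) (auto simp: wt_append)
  also have "\<dots> = (\<Sum>ws\<in>words (Suc n). \<rho> (hd ws) * wt k ws)"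
    using words_ne k1 by (intro sum.cong refl) (auto simp flip: sum_distrib_left)
  finally show ?case using Suc by simp
qed

text \<open>A word depends on the preceding one only through the transition from its last letter to
  the new first letter. Only this transition is minorised, so the Doeblin constant does not
  deteriorate with l.\<close>

lemma block_chain:
  assumes l: "0 < l"
  shows "doeblin_chain M (\<lambda>i \<omega>. map (\<lambda>j. \<xi> j \<omega>) [i * l..<i * l + l]) (words l)
    W (\<lambda>u w. k (last u) (hd w) * wt k w) (\<lambda>w. \<rho> (hd w) * wt k w) \<epsilon>"
proof -
  obtain n where n: "l = Suc n" using l by (cases l) auto
  have wl: "w \<noteq> []" "hd w \<in> S" "last w \<in> S" "set w \<subseteq> S" "length w = l" if "w \<in> words l" for w
    using words_ne[of w n] that unfolding n by (auto simp: words_def)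
  have law': "prob {\<omega>\<in>space M. map (\<lambda>i. map (\<lambda>j. \<xi> j \<omega>) [i * l..<i * l + l]) [0..<length ws] = ws}
      = W (hd ws) * wt (\<lambda>u w. k (last u) (hd w) * wt k w) ws" if ws: "ws \<noteq> []" "set ws \<subseteq> words l" for ws
  proof -
    have lw: "length w = l" "w \<noteq> []" "set w \<subseteq> S" if "w \<in> set ws" for w using wl[of w] that ws by auto
    have sub: "set (concat ws) \<subseteq> S" using lw(3) by fastforce
    have lc: "length (concat ws) = length ws * l"
      using lw(1) by (induction ws) auto
    have "(map (\<lambda>i. map (\<lambda>j. \<xi> j \<omega>) [i * l..<i * l + l]) [0..<length ws] = ws)
        = (map (\<lambda>i. \<xi> i \<omega>) [0..<length (concat ws)] = concat ws)" for \<omega>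
    proof -
      \<comment> \<open>All letters are words of the same length l, so concatenation loses no
        information and the event is one about the underlying trajectory.\<close>
      have "(concat (map (\<lambda>i. map (\<lambda>j. \<xi> j \<omega>) [i * l..<i * l + l]) [0..<length ws]) = concat ws) =
         (map (\<lambda>i. map (\<lambda>j. \<xi> j \<omega>) [i * l..<i * l + l]) [0..<length ws] = ws)"
        by (rule concat_eq_concat_iff) (auto simp: set_zip lw)
      then show ?thesis unfolding block_concat[OF l] lc by blast
    qed
    then have "prob {\<omega>\<in>space M. map (\<lambda>i. map (\<lambda>j. \<xi> j \<omega>) [i * l..<i * l + l]) [0..<length ws] = ws}
        = p (hd (concat ws)) * wt k (concat ws)"
      using law[of "concat ws"] ws lw(2) sub by simp
    also have "hd (concat ws) = hd (hd ws)" using ws lw by (cases ws) auto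
    also have "wt k (concat ws) = wt k (hd ws) * wt (\<lambda>u w. k (last u) (hd w) * wt k w) ws"
      using ws lw by (intro wt_concat) auto
    finally show ?thesis by simp
  qed
  show ?thesis
  proof unfold_locales
    show "finite (words l)" by (rule finite_words)
    show "{\<omega>\<in>space M. map (\<lambda>j. \<xi> j \<omega>) [i * l..<i * l + l] = w} \<in> events" for i w
      by (rule segment_meas)
    show "(\<Sum>w\<in>words l. W w) = 1" unfolding n by (rule sum_W)
    show "(\<Sum>w\<in>words l. k (last v) (hd w) * wt k w) = 1" if "v \<in> words l" for v
      unfolding n using wl(3)[OF that] by (rule sum_words_wt)
    show "(\<Sum>w\<in>words l. \<rho> (hd w) * wt k w) = 1" unfolding n by (rule sum_words_rho)
    show "0 \<le> W w" if "w \<in> words l" for w using wl[OF that] p(1) wt_nonneg by simp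
    show "0 \<le> \<rho> (hd w) * wt k w" if "w \<in> words l" for w using wl[OF that] \<rho>(1) wt_nonneg by simp
    show "\<epsilon> * (\<rho> (hd w) * wt k w) \<le> k (last v) (hd w) * wt k w" if "v \<in> words l" "w \<in> words l" for v w
      using wl[OF that(1)] wl[OF that(2)] k2 wt_nonneg by (auto simp flip: mult.assoc intro!: mult_right_mono)
  qed (use law' \<epsilon> in auto)
qed

lemma block_averages_converge:
  fixes F :: "'s list \<Rightarrow> real"
  assumes "0 < l"
  shows "\<exists>c. AE \<omega> in M. (\<lambda>N. (\<Sum>i<N. F (map (\<lambda>j. \<xi> j \<omega>) [i * l..<i * l + l])) / real N) \<longlonglongrightarrow> c"
  by (rule doeblin_chain.averages_converge[OF block_chain[OF assms]])

end

section \<open>The growth rate of the homogeneous log-likelihood\<close>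

lemma (in prob_space) indep_vars_pair:
  assumes X: "indep_vars M' X I" and ij: "i \<in> I" "j \<in> I" "i \<noteq> j"
  shows "indep_var (M' i) (X i) (M' j) (X j)"
  unfolding indep_var_eq indep_sets2_eq
proof (intro conjI ballI)
  let ?F = "\<lambda>i. sigma_sets (space M) {X i -` A \<inter> space M | A. A \<in> sets (M' i)}"
  have I: "indep_sets ?F I" and rv: "random_variable (M' i) (X i)" "random_variable (M' j) (X j)"
    using X ij unfolding indep_vars_def by auto
  show "random_variable (M' i) (X i)" "random_variable (M' j) (X j)" by (fact rv)+
  show "?F i \<subseteq> events" "?F j \<subseteq> events" using I ij unfolding indep_sets_def by auto
  fix a b assume "a \<in> ?F i" "b \<in> ?F j"
  then have "prob (\<Inter>k\<in>{i, j}. if k = i then a else b) = (\<Prod>k\<in>{i, j}. prob (if k = i then a else b))"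
    using ij by (intro indep_setsD[OF I]) auto
  then show "prob (a \<inter> b) = prob a * prob b" using ij by (auto simp: Int_commute)
qed

lemma (in prob_space) AE_ex: "AE \<omega> in M. Q \<omega> \<Longrightarrow> \<exists>\<omega>. Q \<omega>"
proof -
  assume a: "AE \<omega> in M. Q \<omega>"
  show ?thesis
  proof (rule ccontr)
    assume "\<not> ?thesis"
    then have "AE \<omega> in M. False" using a by (rule_tac AE_mp[OF a]) auto
    then show False by simp
  qed
qed

text \<open>A single point of the almost sure event compares any two of the constants
  \<open>a i\<close> and \<open>a j\<close>, so these form a Cauchy sequence. Its limit is
  deterministic because the \<open>a j\<close> are.\<close>

lemma (in prob_space) AE_approx_convergent:
  fixes s :: "nat \<Rightarrow> 'a \<Rightarrow> real"
  assumes \<epsilon>: "\<epsilon> \<longlonglongrightarrow> 0"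
    and ap: "\<And>j. AE \<omega> in M. \<forall>\<^sub>F n in sequentially. \<bar>s n \<omega> - a j\<bar> \<le> \<epsilon> j"
  shows "\<exists>L. AE \<omega> in M. (\<lambda>n. s n \<omega>) \<longlonglongrightarrow> L"
proof -
  have all: "AE \<omega> in M. \<forall>j. \<forall>\<^sub>F n in sequentially. \<bar>s n \<omega> - a j\<bar> \<le> \<epsilon> j"
    unfolding AE_all_countable using ap by blast
  then obtain \<omega>0 where w0: "\<And>j. \<forall>\<^sub>F n in sequentially. \<bar>s n \<omega>0 - a j\<bar> \<le> \<epsilon> j"
    using AE_ex by blast
  have aij: "\<bar>a i - a j\<bar> \<le> \<epsilon> i + \<epsilon> j" for i j
  proof -
    obtain n where "\<bar>s n \<omega>0 - a i\<bar> \<le> \<epsilon> i" "\<bar>s n \<omega>0 - a j\<bar> \<le> \<epsilon> j"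
      using eventually_happens'[OF _ eventually_conj[OF w0[of i] w0[of j]]] by auto
    then show ?thesis by linarith
  qed
  have "Cauchy a"
  proof (rule CauchyI')
    fix e :: real assume "0 < e"
    then have "\<forall>\<^sub>F j in sequentially. \<epsilon> j < e / 2" using \<epsilon> by (intro order_tendstoD) auto
    then obtain N where N: "\<And>j. j \<ge> N \<Longrightarrow> \<epsilon> j < e / 2" by (auto simp: eventually_sequentially)
    show "\<exists>M. \<forall>m\<ge>M. \<forall>n>m. dist (a m) (a n) < e"
    proof (intro exI[of _ N] allI impI)
      fix m n assume "N \<le> m" "m < n"
      then show "dist (a m) (a n) < e" using aij[of m n] N[of m] N[of n] by (simp add: dist_real_def)
    qed
  qed
  then obtain L where L: "a \<longlonglongrightarrow> L" by (auto simp: Cauchy_convergent_iff convergent_def)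
  show ?thesis
  proof (rule exI[of _ L], use all in \<open>rule AE_mp\<close>, intro AE_I2 impI)
    fix \<omega> assume w: "\<forall>j. \<forall>\<^sub>F n in sequentially. \<bar>s n \<omega> - a j\<bar> \<le> \<epsilon> j"
    show "(\<lambda>n. s n \<omega>) \<longlonglongrightarrow> L"
    proof (rule tendstoI)
      fix e :: real assume e: "0 < e"
      have "\<forall>\<^sub>F j in sequentially. \<epsilon> j < e / 2 \<and> dist (a j) L < e / 2"
        using \<epsilon> L e by (intro eventually_conj order_tendstoD tendstoD) auto
      then obtain j where j: "\<epsilon> j < e / 2" "dist (a j) L < e / 2"
        using eventually_happens'[OF trivial_limit_sequentially] by blast
      have "\<forall>\<^sub>F n in sequentially. \<bar>s n \<omega> - a j\<bar> \<le> \<epsilon> j" using w by blast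
      then show "\<forall>\<^sub>F n in sequentially. dist (s n \<omega>) L < e"
      proof eventually_elim
        case (elim n)
        then show ?case using j unfolding dist_real_def by linarith
      qed
    qed
  qed
qed

lemma wt_prod: "wt k ws = (\<Prod>i<length ws - 1. k (ws ! i) (ws ! Suc i))"
proof (induction ws rule: induct_list012)
  case (3 x y zs)
  have l: "length (x # y # zs) - 1 = Suc (length zs)" by simp
  have "(\<Prod>i<length (x # y # zs) - 1. k ((x # y # zs) ! i) ((x # y # zs) ! Suc i))
      = k x y * (\<Prod>i<length zs. k ((y # zs) ! i) ((y # zs) ! Suc i))"
    unfolding l prod.lessThan_Suc_shift by simp
  with 3 show ?case by simp
qed auto

text \<open>The true model once the block trends are removed: what remains at time t is the block
  label \<open>blk\<close> of the hidden state and its noise shifted by the constant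
  \<open>Dl\<close>. The envelope \<open>v\<close> is evaluated at the modulus of the noise plus
  \<open>dl\<close> because the shift moves the noise by at most \<open>dl\<close>.\<close>

locale hidden_chain = prob_space M for M :: "'a measure" +
  fixes Ks :: nat and s :: real and pis :: "nat \<Rightarrow> real" and Qs :: "nat \<Rightarrow> nat \<Rightarrow> real"
    and X :: "nat \<Rightarrow> 'a \<Rightarrow> nat" and Zx :: "nat \<Rightarrow> nat \<Rightarrow> 'a \<Rightarrow> real" and f0 :: "nat \<Rightarrow> real \<Rightarrow> real"
    and v :: "real \<Rightarrow> real" and w :: "real \<Rightarrow> real" and blk :: "nat \<Rightarrow> nat set" and Dl :: "nat \<Rightarrow> real" and dl :: real
  assumes Ks: "1 \<le> Ks" and s: "0 < s" and pis: "pvec Ks pis" and Qs: "stochmat s Ks Qs"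
    and X_meas: "\<And>t. X t \<in> measurable M (count_space UNIV)"
    and markov: "\<And>n xs. 1 \<le> n \<Longrightarrow> xs \<in> paths n Ks \<Longrightarrow>
        prob {\<omega>\<in>space M. \<forall>t\<in>{1..n}. X t \<omega> = xs t} = pis (xs 1) * (\<Prod>t\<in>{2..n}. Qs (xs (t - 1)) (xs t))"
    and Z_dens: "\<And>x t. x \<in> {1..Ks} \<Longrightarrow> 1 \<le> t \<Longrightarrow> distributed M lborel (Zx x t) (\<lambda>z. ennreal (f0 x z))"
    and Z_indep: "indep_vars (\<lambda>_. borel) (\<lambda>(x, t). Zx x t) ({1..Ks} \<times> {1..})"
    and XZ_indep: "indep_set
        (sigma_sets (space M) {X t -` A \<inter> space M | t A. 1 \<le> t})
        (sigma_sets (space M) {Zx x t -` A \<inter> space M | x t A. x \<in> {1..Ks} \<and> 1 \<le> t \<and> A \<in> sets borel})"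
    and v: "mono v" "\<And>r. 1 \<le> v r"
    and v_int: "\<And>x. x \<in> {1..Ks} \<Longrightarrow> integrable M (\<lambda>\<omega>. v (\<bar>Zx x 1 \<omega>\<bar> + dl))"
    and w: "\<And>r r'. 0 \<le> r \<Longrightarrow> r \<le> r' \<Longrightarrow> w r \<le> w r'" "w 0 = 0" "(w \<longlongrightarrow> 0) (at_right 0)"
    and Dl: "\<And>x. x \<in> {1..Ks} \<Longrightarrow> \<bar>Dl x\<bar> \<le> dl"
begin

lemma Z_meas: "x \<in> {1..Ks} \<Longrightarrow> 1 \<le> t \<Longrightarrow> random_variable borel (Zx x t)"
  using Z_dens distributed_measurable by fastforce

lemma Z_distr: "x \<in> {1..Ks} \<Longrightarrow> 1 \<le> t \<Longrightarrow> distr M borel (Zx x t) = distr M borel (Zx x 1)"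
proof -
  assume a: "x \<in> {1..Ks}" "1 \<le> t"
  have "distr M borel (Zx x t) = density lborel (\<lambda>z. ennreal (f0 x z))" if "1 \<le> t" for t
  proof -
    have "distr M borel (Zx x t) = distr M lborel (Zx x t)" by (rule distr_cong) auto
    then show ?thesis using distributed_distr_eq_density[OF Z_dens[OF a(1) that]] by simp
  qed
  then show ?thesis using a by simp
qed

lemma Z_prob:
  assumes "x \<in> {1..Ks}" "1 \<le> t" "A \<in> sets borel"
  shows "prob (Zx x t -` A \<inter> space M) = prob (Zx x 1 -` A \<inter> space M)"
  using arg_cong[OF Z_distr[OF assms(1,2)], of "\<lambda>N. measure N A"] Z_meas[OF assms(1,2)] Z_meas[OF assms(1), of 1] assms(3)
  by (simp add: measure_distr)

lemma X_law:
  assumes n: "0 < n" and f: "\<And>i. i < n \<Longrightarrow> f i \<in> {1..Ks}"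
  shows "prob {\<omega>\<in>space M. \<forall>i\<in>{..<n}. X (Suc i) \<omega> = f i} = pis (f 0) * (\<Prod>i<n - 1. Qs (f i) (f (Suc i)))"
proof -
  let ?xs = "\<lambda>t\<in>{1..n}. f (t - 1)"
  have mem: "?xs \<in> paths n Ks" using f by (auto simp: paths_def)
  have "prob {\<omega>\<in>space M. \<forall>t\<in>{1..n}. X t \<omega> = ?xs t} = pis (?xs 1) * (\<Prod>t\<in>{2..n}. Qs (?xs (t - 1)) (?xs t))"
    by (rule markov[OF _ mem]) (use n in simp)
  also have "{\<omega>\<in>space M. \<forall>t\<in>{1..n}. X t \<omega> = ?xs t} = {\<omega>\<in>space M. \<forall>i\<in>{..<n}. X (Suc i) \<omega> = f i}"
  proof (intro Collect_cong conj_cong refl)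
    fix \<omega>
    have "{1..n} = Suc ` {..<n}" by (simp add: image_Suc_lessThan)
    then show "(\<forall>t\<in>{1..n}. X t \<omega> = ?xs t) = (\<forall>i\<in>{..<n}. X (Suc i) \<omega> = f i)" by auto
  qed
  also have "(\<Prod>t\<in>{2..n}. Qs (?xs (t - 1)) (?xs t)) = (\<Prod>i<n - 1. Qs (f i) (f (Suc i)))"
    by (rule prod.reindex_bij_witness[of _ "\<lambda>i. i + 2" "\<lambda>t. t - 2"]) (auto simp: numeral_2_eq_2 Suc_diff_Suc)
  finally show ?thesis using n by simp
qed

text \<open>The noise is only controlled for states in range, so that it is reset to 0 on the null event
  where the hidden chain leaves its state space.\<close>

definition Zt :: "nat \<Rightarrow> 'a \<Rightarrow> real" where
  "Zt t \<omega> = (if X t \<omega> \<in> {1..Ks} then Zx (X t \<omega>) t \<omega> else 0)"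

section \<open>Quantised observations\<close>

context
  fixes q :: "real \<Rightarrow> int"
  assumes q_meas: "\<And>c. q -` {c} \<in> sets borel" and q_fin: "finite (range q)"
begin

definition qobs :: "nat \<Rightarrow> 'a \<Rightarrow> nat \<times> int" where
  "qobs t \<omega> = (X t \<omega>, q (Zt t \<omega>))"

definition qprob :: "nat \<Rightarrow> int \<Rightarrow> real" where
  "qprob x c = prob (Zx x 1 -` (q -` {c}) \<inter> space M)"

lemma sum_qprob: "x \<in> {1..Ks} \<Longrightarrow> (\<Sum>c\<in>range q. qprob x c) = 1"
proof -
  assume x: "x \<in> {1..Ks}"
  have "(\<Sum>c\<in>range q. qprob x c) = prob (\<Union>c\<in>range q. Zx x 1 -` (q -` {c}) \<inter> space M)"
    unfolding qprob_def using q_fin q_meas measurable_sets[OF Z_meas[OF x order.refl]]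
    by (intro finite_measure_finite_Union[symmetric]) (auto simp: disjoint_family_on_def)
  also have "(\<Union>c\<in>range q. Zx x 1 -` (q -` {c}) \<inter> space M) = space M" by auto
  finally show ?thesis by (simp add: prob_space)
qed

text \<open>On the event that the hidden path equals f, the noise is that of the prescribed states f
  i. The random index is thereby replaced by a fixed one, independence of chain and noise splits the
  probability, and the noise variables involved have distinct times.\<close>

lemma qobs_law:
  assumes n: "0 < n" and f: "\<And>i. i < n \<Longrightarrow> f i \<in> {1..Ks}"
  shows "prob {\<omega>\<in>space M. \<forall>i\<in>{..<n}. qobs (Suc i) \<omega> = (f i, c i)}
    = pis (f 0) * (\<Prod>i<n - 1. Qs (f i) (f (Suc i))) * (\<Prod>i<n. qprob (f i) (c i))"
proof -
  define A where "A = {\<omega>\<in>space M. \<forall>i\<in>{..<n}. X (Suc i) \<omega> = f i}"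
  define B where "B = {\<omega>\<in>space M. \<forall>i\<in>{..<n}. q (Zx (f i) (Suc i) \<omega>) = c i}"
  have eq: "{\<omega>\<in>space M. \<forall>i\<in>{..<n}. qobs (Suc i) \<omega> = (f i, c i)} = A \<inter> B"
  proof -
    have "qobs (Suc i) \<omega> = (f i, c i) \<longleftrightarrow> X (Suc i) \<omega> = f i \<and> q (Zx (f i) (Suc i) \<omega>) = c i" if "i < n" for i \<omega>
      using f[OF that] by (auto simp: qobs_def Zt_def)
    then show ?thesis by (auto simp: A_def B_def)
  qed
  let ?GA = "{X t -` A \<inter> space M | t A. 1 \<le> t}"
  let ?GB = "{Zx x t -` A \<inter> space M | x t A. x \<in> {1..Ks} \<and> 1 \<le> t \<and> A \<in> sets borel}"
  have "A \<in> sigma_sets (space M) ?GA"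
  proof -
    have sp: "?GA \<subseteq> Pow (space M)" by auto
    have "{\<omega>\<in>space (sigma (space M) ?GA). \<forall>i\<in>{..<n}. X (Suc i) \<omega> = f i} \<in> sets (sigma (space M) ?GA)"
    proof (intro sets.sets_Collect_finite_All)
      fix i
      have "X (Suc i) -` {f i} \<inter> space M \<in> ?GA" by (intro CollectI exI[of _ "Suc i"] exI[of _ "{f i}"]) auto
      moreover have "{\<omega>\<in>space (sigma (space M) ?GA). X (Suc i) \<omega> = f i} = X (Suc i) -` {f i} \<inter> space M"
        using sp by (auto simp: space_measure_of)
      ultimately show "{\<omega>\<in>space (sigma (space M) ?GA). X (Suc i) \<omega> = f i} \<in> sets (sigma (space M) ?GA)"
        using sp by (simp only: sets_measure_of) (rule sigma_sets.Basic)
    qed auto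
    then show ?thesis using sp by (simp add: A_def space_measure_of sets_measure_of)
  qed
  moreover have "B \<in> sigma_sets (space M) ?GB"
  proof -
    have sp: "?GB \<subseteq> Pow (space M)" by auto
    have "{\<omega>\<in>space (sigma (space M) ?GB). \<forall>i\<in>{..<n}. q (Zx (f i) (Suc i) \<omega>) = c i} \<in> sets (sigma (space M) ?GB)"
    proof (intro sets.sets_Collect_finite_All)
      fix i assume i: "i \<in> {..<n}"
      have "Zx (f i) (Suc i) -` (q -` {c i}) \<inter> space M \<in> ?GB"
        using f[of i] i q_meas by (intro CollectI exI[of _ "f i"] exI[of _ "Suc i"] exI[of _ "q -` {c i}"]) auto
      moreover have "{\<omega>\<in>space (sigma (space M) ?GB). q (Zx (f i) (Suc i) \<omega>) = c i} = Zx (f i) (Suc i) -` (q -` {c i}) \<inter> space M"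
        using sp by (auto simp: space_measure_of)
      ultimately show "{\<omega>\<in>space (sigma (space M) ?GB). q (Zx (f i) (Suc i) \<omega>) = c i} \<in> sets (sigma (space M) ?GB)"
        using sp by (simp only: sets_measure_of) (rule sigma_sets.Basic)
    qed auto
    then show ?thesis using sp by (simp add: B_def space_measure_of sets_measure_of)
  qed
  ultimately have AB: "prob (A \<inter> B) = prob A * prob B" by (rule indep_setD[OF XZ_indep])
  have "B = (\<Inter>j\<in>(\<lambda>i. (f i, Suc i)) ` {..<n}. (case j of (x, t) \<Rightarrow> Zx x t) -` (q -` {c (snd j - 1)}) \<inter> space M)"
    using n by (auto simp: B_def)
  also have "prob \<dots> = (\<Prod>j\<in>(\<lambda>i. (f i, Suc i)) ` {..<n}. prob ((case j of (x, t) \<Rightarrow> Zx x t) -` (q -` {c (snd j - 1)}) \<inter> space M))"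
    using n f q_meas by (intro indep_varsD[OF Z_indep]) auto
  also have "\<dots> = (\<Prod>i<n. prob (Zx (f i) (Suc i) -` (q -` {c i}) \<inter> space M))"
    by (subst prod.reindex) (auto simp: inj_on_def)
  also have "\<dots> = (\<Prod>i<n. qprob (f i) (c i))"
    unfolding qprob_def using f q_meas by (intro prod.cong refl Z_prob) auto
  finally have "prob B = (\<Prod>i<n. qprob (f i) (c i))" .
  moreover have "prob A = pis (f 0) * (\<Prod>i<n - 1. Qs (f i) (f (Suc i)))"
    unfolding A_def using n f by (rule X_law)
  ultimately show ?thesis unfolding eq AB by simp
qed

lemma qobs_event: "{\<omega>\<in>space M. qobs (Suc t) \<omega> = xc} \<in> events"
proof -
  obtain x c where xc: "xc = (x, c)" by (cases xc)
  have Xe: "X (Suc t) -` {x} \<inter> space M \<in> events" using measurable_sets[OF X_meas] by auto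
  show ?thesis
  proof (cases "x \<in> {1..Ks}")
    case True
    then have "{\<omega>\<in>space M. qobs (Suc t) \<omega> = xc} = (X (Suc t) -` {x} \<inter> space M) \<inter> (Zx x (Suc t) -` (q -` {c}) \<inter> space M)"
      by (auto simp: qobs_def Zt_def xc)
    also have "\<dots> \<in> events"
      by (intro sets.Int Xe measurable_sets[OF Z_meas[OF True]] q_meas) simp
    finally show ?thesis .
  next
    case False
    then have "{\<omega>\<in>space M. qobs (Suc t) \<omega> = xc} = (if q 0 = c then X (Suc t) -` {x} \<inter> space M else {})"
      by (auto simp: qobs_def Zt_def xc)
    then show ?thesis using Xe by auto
  qed
qed

text \<open>The kernel \<open>Qs x x' * qprob x' c'\<close> is at least
  \<open>s * qprob x' c'\<close>. Normalising the right-hand side over all states gives the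
  minorising law \<open>qprob / Ks\<close> and the Doeblin constant \<open>s * Ks\<close>.\<close>

lemma qobs_chain:
  "doeblin_chain M (\<lambda>i. qobs (Suc i)) ({1..Ks} \<times> range q) (\<lambda>(x, c). pis x * qprob x c)
    (\<lambda>(x, c) (x', c'). Qs x x' * qprob x' c') (\<lambda>(x, c). qprob x c / Ks) (s * Ks)"
proof unfold_locales
  have qp: "0 \<le> qprob x c" for x c by (simp add: qprob_def)
  have sumS: "(\<Sum>xc\<in>{1..Ks} \<times> range q. a (fst xc) * qprob (fst xc) (snd xc)) = (\<Sum>x=1..Ks. a x)" for a
  proof -
    have "(\<Sum>xc\<in>{1..Ks} \<times> range q. a (fst xc) * qprob (fst xc) (snd xc)) = (\<Sum>x=1..Ks. \<Sum>c\<in>range q. a x * qprob x c)"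
      by (simp add: sum.cartesian_product case_prod_unfold)
    also have "\<dots> = (\<Sum>x=1..Ks. a x)"
      by (intro sum.cong refl) (simp add: sum_qprob flip: sum_distrib_left)
    finally show ?thesis .
  qed
  show "finite ({1..Ks} \<times> range q)" using q_fin by simp
  show "{\<omega>\<in>space M. qobs (Suc n) \<omega> = xc} \<in> events" for n xc by (rule qobs_event)
  show "0 \<le> (case xc of (x, c) \<Rightarrow> pis x * qprob x c)" if "xc \<in> {1..Ks} \<times> range q" for xc
    using that pis qp by (auto simp: pvec_def)
  show "(\<Sum>xc\<in>{1..Ks} \<times> range q. case xc of (x, c) \<Rightarrow> pis x * qprob x c) = 1"
    using sumS[of pis] pis by (simp add: case_prod_unfold pvec_def)
  show "(\<Sum>w\<in>{1..Ks} \<times> range q. (case xc of (x, c) \<Rightarrow> \<lambda>(x', c'). Qs x x' * qprob x' c') w) = 1"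
    if "xc \<in> {1..Ks} \<times> range q" for xc
    using sumS[of "Qs (fst xc)"] Qs that by (auto simp: case_prod_unfold stochmat_def)
  show "s * real Ks * (case w of (x, c) \<Rightarrow> qprob x c / real Ks) \<le> (case xc of (x, c) \<Rightarrow> \<lambda>(x', c'). Qs x x' * qprob x' c') w"
    if "xc \<in> {1..Ks} \<times> range q" "w \<in> {1..Ks} \<times> range q" for xc w
    using that Qs Ks qp by (auto simp: stochmat_def intro!: mult_right_mono)
  show "0 \<le> (case w of (x, c) \<Rightarrow> qprob x c / real Ks)" for w using qp by (auto split: prod.splits)
  show "(\<Sum>w\<in>{1..Ks} \<times> range q. case w of (x, c) \<Rightarrow> qprob x c / real Ks) = 1"
    using sumS[of "\<lambda>_. 1 / real Ks"] Ks by (simp add: case_prod_unfold)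
  show "0 < s * real Ks" using s Ks by simp
  show "s * real Ks \<le> 1" using stochmat_card[OF Qs Ks] by (simp add: mult.commute)
  fix ws :: "(nat \<times> int) list" assume ws: "ws \<noteq> []" "set ws \<subseteq> {1..Ks} \<times> range q"
  let ?n = "length ws"
  have f: "fst (ws ! i) \<in> {1..Ks}" if "i < ?n" for i using nth_mem[OF that] ws by auto
  have "{\<omega>\<in>space M. map (\<lambda>i. qobs (Suc i) \<omega>) [0..<?n] = ws}
     = {\<omega>\<in>space M. \<forall>i\<in>{..<?n}. qobs (Suc i) \<omega> = (fst (ws ! i), snd (ws ! i))}"
  proof -
    have "(map g [0..<?n] = ws) = (\<forall>i\<in>{..<?n}. g i = ws ! i)" for g
      unfolding list_eq_iff_nth_eq by auto
    then show ?thesis unfolding prod.collapse by simp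
  qed
  then have "prob {\<omega>\<in>space M. map (\<lambda>i. qobs (Suc i) \<omega>) [0..<?n] = ws}
     = pis (fst (ws ! 0)) * (\<Prod>i<?n - 1. Qs (fst (ws ! i)) (fst (ws ! Suc i))) * (\<Prod>i<?n. qprob (fst (ws ! i)) (snd (ws ! i)))"
    using qobs_law[of ?n "\<lambda>i. fst (ws ! i)" "\<lambda>i. snd (ws ! i)"] f ws by simp
  \<comment> \<open>The kernel emits at the state of arrival, so the emission of the first state is
    split off and given to the initial law.\<close>
  also have "(\<Prod>i<?n. qprob (fst (ws ! i)) (snd (ws ! i))) = qprob (fst (ws ! 0)) (snd (ws ! 0)) * (\<Prod>i<?n - 1. qprob (fst (ws ! Suc i)) (snd (ws ! Suc i)))"
  proof -
    obtain m where m: "?n = Suc m" using ws by (cases ws) auto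
    show ?thesis unfolding m prod.lessThan_Suc_shift by simp
  qed
  finally show "prob {\<omega>\<in>space M. map (\<lambda>i. qobs (Suc i) \<omega>) [0..<?n] = ws} =
      (case hd ws of (x, c) \<Rightarrow> pis x * qprob x c) * wt (\<lambda>(x, c) (x', c'). Qs x x' * qprob x' c') ws"
    unfolding wt_prod by (simp add: case_prod_unfold prod.distrib hd_conv_nth[OF ws(1)])
qed

lemma qobs_block_averages:
  fixes F :: "(nat \<times> int) list \<Rightarrow> real"
  assumes "0 < l"
  shows "\<exists>c. AE \<omega> in M. (\<lambda>N. (\<Sum>i<N. F (map (\<lambda>j. qobs (Suc j) \<omega>) [i * l..<i * l + l])) / real N) \<longlonglongrightarrow> c"
  by (rule doeblin_chain.block_averages_converge[OF qobs_chain assms])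

lemma qobs_in: "AE \<omega> in M. \<forall>t\<ge>1. qobs t \<omega> \<in> {1..Ks} \<times> range q"
proof -
  have "AE \<omega> in M. \<forall>n. qobs (Suc n) \<omega> \<in> {1..Ks} \<times> range q"
    by (rule doeblin_chain.AE_in_S[OF qobs_chain])
  then show ?thesis
  proof (rule AE_mp, intro AE_I2 impI allI)
    fix \<omega> and t :: nat assume "\<forall>n. qobs (Suc n) \<omega> \<in> {1..Ks} \<times> range q" "1 \<le> t"
    then show "qobs t \<omega> \<in> {1..Ks} \<times> range q" by (cases t) auto
  qed
qed

lemma quantised_loglik_converges:
  fixes \<eta> :: "nat \<times> int \<Rightarrow> nat \<Rightarrow> real"
  assumes K': "1 \<le> K'" and Q: "stochmat s K' Q"
    and up: "\<And>c x. c \<in> {1..Ks} \<times> range q \<Longrightarrow> x \<in> {1..K'} \<Longrightarrow> 0 \<le> \<eta> c x \<and> \<eta> c x \<le> exp B"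
    and lo: "\<And>c. c \<in> {1..Ks} \<times> range q \<Longrightarrow> \<exists>x\<in>{1..K'}. exp (- B) \<le> \<eta> c x"
  shows "\<exists>L. AE \<omega> in M. (\<lambda>n. seglik K' Q (\<lambda>t. \<eta> (qobs t \<omega>)) 0 n / real n) \<longlonglongrightarrow> L"
proof -
  define F where "F l ws = ln (lik K' Q (\<lambda>t. \<eta> (ws ! (t - 1))) (\<lambda>_. 1) l)" for l and ws :: "(nat \<times> int) list"
  have Feq: "seglik K' Q (\<lambda>t. \<eta> (qobs t \<omega>)) (i * l) l = F l (map (\<lambda>j. qobs (Suc j) \<omega>) [i * l..<i * l + l])" for i l \<omega>
  proof -
    have "pv K' Q (\<lambda>t. \<eta> (qobs (i * l + t) \<omega>)) (\<lambda>_. 1) l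
        = pv K' Q (\<lambda>t. \<eta> (map (\<lambda>j. qobs (Suc j) \<omega>) [i * l..<i * l + l] ! (t - 1))) (\<lambda>_. 1) l"
      by (intro pv_cong) (auto simp: nth_append)
    then show ?thesis by (simp add: seglik_def F_def lik_def)
  qed
  have "\<forall>l. \<exists>c. 0 < l \<longrightarrow> (AE \<omega> in M. (\<lambda>N. (\<Sum>i<N. seglik K' Q (\<lambda>t. \<eta> (qobs t \<omega>)) (i * l) l) / real N) \<longlonglongrightarrow> c)"
    unfolding Feq using qobs_block_averages by blast
  from choice[OF this] obtain c where c: "\<forall>l. 0 < l \<longrightarrow> (AE \<omega> in M. (\<lambda>N. (\<Sum>i<N. seglik K' Q (\<lambda>t. \<eta> (qobs t \<omega>)) (i * l) l) / real N) \<longlonglongrightarrow> c l)"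
    by blast
  have B: "0 \<le> B"
  proof -
    obtain x c where "x \<in> {1..Ks}" "c \<in> range q" using Ks by fastforce
    then obtain y where "y \<in> {1..K'}" "exp (- B) \<le> \<eta> (x, c) y" "\<eta> (x, c) y \<le> exp B"
      using lo[of "(x, c)"] up[of "(x, c)"] by blast
    then have "exp (- B) \<le> exp B" by linarith
    then show ?thesis by simp
  qed
  let ?c = "- ln s"
  show ?thesis
  \<comment> \<open>Error for words of length l = \<open>Suc j\<close>: after division by n, each of
    the three parts is of order 1 / l. There is \<open>- ln s\<close> for the cuts, 1 for the word
    average once it is within 1 of its limit \<open>c l\<close>, and 1 that absorbs all terms not
    growing with n.\<close>
  proof (rule AE_approx_convergent[where \<epsilon>="\<lambda>j. (2 + ?c) * (1 / real (Suc j))" and a="\<lambda>j. c (Suc j) / real (Suc j)"])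
    have "(\<lambda>j. (2 + ?c) * (1 / real (Suc j))) \<longlonglongrightarrow> (2 + ?c) * 0"
      by (intro tendsto_intros) (use LIMSEQ_inverse_real_of_nat in \<open>simp add: inverse_eq_divide\<close>)
    then show "(\<lambda>j. (2 + ?c) * (1 / real (Suc j))) \<longlonglongrightarrow> 0" by simp
    fix j
    define l where "l = Suc j"
    have l: "0 < l" by (simp add: l_def)
    from c[rule_format, OF l] qobs_in show "AE \<omega> in M. \<forall>\<^sub>F n in sequentially. \<bar>seglik K' Q (\<lambda>t. \<eta> (qobs t \<omega>)) 0 n / real n - c (Suc j) / real (Suc j)\<bar> \<le> (2 + ?c) * (1 / real (Suc j))"
      unfolding l_def[symmetric]
    proof eventually_elim
      fix \<omega> assume lim: "(\<lambda>N. (\<Sum>i<N. seglik K' Q (\<lambda>t. \<eta> (qobs t \<omega>)) (i * l) l) / real N) \<longlonglongrightarrow> c l"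
        and qin: "\<forall>t\<ge>1. qobs t \<omega> \<in> {1..Ks} \<times> range q"
      let ?e = "\<lambda>t. \<eta> (qobs t \<omega>)"
      let ?S = "\<lambda>a k. seglik K' Q ?e a k"
      interpret h: hmmseq s K' Q ?e
      proof
        fix t :: nat assume "1 \<le> t"
        then show "\<exists>x\<in>{1..K'}. 0 < ?e t x" using lo[of "qobs t \<omega>"] qin exp_gt_zero[of "- B"] by (meson less_le_trans)
      qed (use s K' Q up qin in auto)
      define A where "A N = (\<Sum>i<N. ?S (i * l) l)" for N
      have cpos: "0 \<le> ?c" using h.s_le1 s by simp
      define C where "C = 2 * ln K' + ?c + l * (B + ?c) + \<bar>c l\<bar>"
      have split: "\<bar>?S 0 n - A (n div l)\<bar> \<le> 2 * ln K' + (n div l) * ?c + ?c + l * (B + ?c)" for n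
      proof -
        have gen: "(\<Sum>t\<in>{a + 1..a + r}. b) = real r * b" for a r :: nat and b :: real by simp
        let ?N = "n div l"
        have n: "n = ?N * l + n mod l" by simp
        have "\<bar>?S 0 (?N * l) - (\<Sum>i<?N. ?S (i * l) (Suc i * l - i * l))\<bar> \<le> ln K' + ?N * ?c"
          by (rule h.seglik_blocks) auto
        then have 1: "\<bar>?S 0 (?N * l) - A ?N\<bar> \<le> ln K' + ?N * ?c" by (simp add: A_def)
        have 2: "\<bar>?S 0 n - ?S 0 (?N * l) - ?S (?N * l) (n mod l)\<bar> \<le> ?c"
          using h.seglik_add_abs[of "?N * l" "n mod l"] by simp
        have "\<bar>?S (?N * l) (n mod l)\<bar> \<le> ln K' + (\<Sum>t\<in>{?N * l + 1..?N * l + n mod l}. B - ln s)"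
          using up lo qin B by (intro h.seglik_bound) auto
        also have "(\<Sum>t\<in>{?N * l + 1..?N * l + n mod l}. B - ln s) = real (n mod l) * (B - ln s)"
          by (rule gen)
        also have "\<dots> \<le> l * (B - ln s)" using l B cpos by (intro mult_right_mono) (auto simp: less_imp_le)
        also have "\<dots> = l * (B + ?c)" by simp
        finally show ?thesis using 1 2 by linarith
      qed
      have "\<forall>\<^sub>F N in sequentially. dist (A N / real N) (c l) < 1"
        using lim unfolding A_def by (rule tendstoD) simp
      then obtain N0 where N0: "\<And>N. N \<ge> N0 \<Longrightarrow> \<bar>A N / real N - c l\<bar> < 1"
        by (auto simp: eventually_sequentially dist_real_def)
      obtain n0 :: nat where n0: "C * l \<le> real n0" using real_arch_simple by blast
      show "\<forall>\<^sub>F n in sequentially. \<bar>?S 0 n / real n - c l / real l\<bar> \<le> (2 + ?c) * (1 / real l)"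
      proof (rule eventually_sequentiallyI[of "max (max 1 n0) (Suc N0 * l)"])
        fix n assume "max (max 1 n0) (Suc N0 * l) \<le> n"
        then have n: "1 \<le> n" "n0 \<le> n" "Suc N0 * l \<le> n" by auto
        let ?N = "n div l"
        have "Suc N0 \<le> ?N" using n(3) l by (simp add: less_eq_div_iff_mult_less_eq)
        then have NN: "N0 \<le> ?N" "0 < ?N" by auto
        have "\<bar>A ?N - ?N * c l\<bar> = \<bar>A ?N / ?N - c l\<bar> * ?N"
          using NN by (simp add: abs_mult[symmetric] field_simps flip: abs_mult_pos)
        also have "\<dots> \<le> 1 * real ?N" using N0[OF NN(1)] by (intro mult_right_mono) auto
        finally have a: "\<bar>A ?N - ?N * c l\<bar> \<le> ?N" by simp
        have Nl: "real ?N * l \<le> n" "real n \<le> real ?N * l + l"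
        proof -
          have "?N * l \<le> n" "n \<le> ?N * l + l" using l div_mult_mod_eq[of n l] mod_less_divisor[of l n] by linarith+
          then have "real (?N * l) \<le> real n" "real n \<le> real (?N * l + l)" by (simp_all only: of_nat_le_iff)
          then show "real ?N * l \<le> n" "real n \<le> real ?N * l + l" by simp_all
        qed
        then have N_le: "real ?N \<le> n / l" "n / l \<le> ?N + 1" using l by (simp_all add: field_simps)
        have "\<bar>real ?N * c l - n / l * c l\<bar> = \<bar>?N - n / l\<bar> * \<bar>c l\<bar>" by (simp only: left_diff_distrib[symmetric] abs_mult)
        also have "\<dots> \<le> 1 * \<bar>c l\<bar>" using N_le by (intro mult_right_mono) auto
        finally have b: "\<bar>real ?N * c l - n / l * c l\<bar> \<le> \<bar>c l\<bar>" by simp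
        have cN: "real ?N * ?c \<le> n / l * ?c" using N_le cpos by (intro mult_right_mono) auto
        have Cn: "C \<le> n / l"
        proof -
          have "C * l \<le> real n" using n0 n(2) by (meson of_nat_le_iff order.trans)
          then show ?thesis using l by (simp add: field_simps)
        qed
        have "\<bar>?S 0 n - n / l * c l\<bar> \<le> 2 * ln K' + (?N * ?c + ?c + l * (B + ?c)) + ?N + \<bar>c l\<bar>"
          using split[of n] a b by linarith
        also have "\<dots> \<le> n / l * ?c + n / l + C" using cN N_le unfolding C_def by linarith
        also have "\<dots> \<le> n / l * ?c + n / l + n / l" using Cn by simp
        also have "\<dots> = n * ((2 + ?c) * (1 / l))" using l by (simp add: field_simps)
        finally have "\<bar>?S 0 n - n / l * c l\<bar> / n \<le> (2 + ?c) * (1 / l)"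
          using n(1) by (simp add: field_simps)
        moreover have "\<bar>?S 0 n / real n - c l / real l\<bar> = \<bar>?S 0 n - n / l * c l\<bar> / n"
        proof -
          have "?S 0 n / real n - c l / real l = (?S 0 n - n / l * c l) / n" using n(1) by (simp add: diff_divide_distrib)
          then show ?thesis by simp
        qed
        ultimately show "\<bar>?S 0 n / real n - c l / real l\<bar> \<le> (2 + ?c) * (1 / real l)" by simp
      qed
    qed
  qed
qed

end

end

section \<open>Rounding and finite nets\<close>

lemma finite_net:
  assumes "finite (\<kappa> ` P)"
  shows "\<exists>N\<subseteq>P. finite N \<and> (\<forall>p\<in>P. \<exists>p'\<in>N. \<kappa> p = \<kappa> p')"
  using finite_subset_image[OF assms, of \<kappa> P] by (metis imageE image_eqI order.refl)

lemma floor_eq_close: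
  fixes a b \<delta> :: real
  assumes "\<lfloor>a / \<delta>\<rfloor> = \<lfloor>b / \<delta>\<rfloor>" "0 < \<delta>"
  shows "\<bar>a - b\<bar> \<le> \<delta>"
proof -
  have "\<bar>a / \<delta> - b / \<delta>\<bar> \<le> 1" using assms(1) by linarith
  then have "\<bar>(a - b) / \<delta>\<bar> \<le> 1" by (simp add: diff_divide_distrib)
  then show ?thesis using assms(2) by (simp add: abs_divide)
qed

lemma floor_grid_close:
  fixes z h :: real assumes "0 < h"
  shows "\<bar>z - h * of_int \<lfloor>z / h\<rfloor>\<bar> \<le> h"
proof -
  have "0 \<le> z / h - of_int \<lfloor>z / h\<rfloor>" "z / h - of_int \<lfloor>z / h\<rfloor> \<le> 1" by linarith+
  then have "0 \<le> h * (z / h - of_int \<lfloor>z / h\<rfloor>)" "h * (z / h - of_int \<lfloor>z / h\<rfloor>) \<le> h * 1"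
    using assms by (auto intro!: mult_left_mono)
  then show ?thesis using assms by (simp add: right_diff_distrib)
qed

text \<open>The lower bound s on b turns an additive error into a multiplicative one, the form in
  which \<open>seglik_le\<close> compares transition matrices.\<close>

lemma le_exp_if_close:
  fixes a b \<delta> s :: real
  assumes "\<bar>a - b\<bar> \<le> \<delta> * s" "s \<le> b" "0 \<le> \<delta>" "0 < s"
  shows "a \<le> exp \<delta> * b"
proof -
  have "a \<le> b + \<delta> * s" using assms by linarith
  also have "\<dots> \<le> b + \<delta> * b" using assms by (simp add: mult_left_mono)
  also have "\<dots> = (1 + \<delta>) * b" by (simp add: algebra_simps)
  also have "\<dots> \<le> exp \<delta> * b" using assms exp_ge_add_one_self[of \<delta>] by (intro mult_right_mono) auto
  finally show ?thesis .
qed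

lemma abs_ln_leD:
  fixes y B :: real
  assumes "0 < y" "\<bar>ln y\<bar> \<le> B"
  shows "exp (- B) \<le> y" "y \<le> exp B"
proof -
  have "exp (- B) \<le> exp (ln y)" "exp (ln y) \<le> exp B" using assms(2) unfolding exp_le_cancel_iff by linarith+
  then show "exp (- B) \<le> y" "y \<le> exp B" using assms(1) by simp_all
qed

section \<open>Control of large noise on one almost sure event\<close>

context hidden_chain
begin

lemma w_nonneg: "0 \<le> r \<Longrightarrow> 0 \<le> w r"
  using w(1)[of 0 r] w(2) by simp

lemma v_nonneg: "0 \<le> v r" using v(2)[of r] by linarith

lemma dl_nonneg: "0 \<le> dl" using Dl[of 1] Ks by simp

lemma w_small: assumes "0 < \<epsilon>" obtains h where "0 < h" "w h \<le> \<epsilon>"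
proof -
  have "\<forall>\<^sub>F h in at_right 0. w h < \<epsilon>" using w(3) assms by (intro order_tendstoD) auto
  then obtain b where "b > 0" "\<And>y. 0 < y \<Longrightarrow> y < b \<Longrightarrow> w y < \<epsilon>" by (auto simp: eventually_at_right_field)
  then show ?thesis using that[of "b / 2"] by (simp add: less_imp_le)
qed

definition Zp :: "nat \<Rightarrow> 'a \<Rightarrow> real" where "Zp t \<omega> = Zt t \<omega> + Dl (X t \<omega>)"

text \<open>The sum runs over all states and not just the current one. It thus dominates the
  envelope of the noise in force when that noise exceeds R, while its time averages only involve
  i.i.d. sequences.\<close>

definition tail :: "real \<Rightarrow> nat \<Rightarrow> 'a \<Rightarrow> real" where
  "tail R t \<omega> = (\<Sum>x=1..Ks. if R < \<bar>Zx x t \<omega>\<bar> then v (\<bar>Zx x t \<omega>\<bar> + dl) else 0)"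

text \<open>The asymptotic bound that \<open>iid_average_upper\<close> gives for averages of
  \<open>tail\<close>: its factor 2, and its slack taken as \<open>1 / real (Suc j)\<close>.\<close>

definition \<tau> :: "nat \<Rightarrow> real" where
  "\<tau> j = (\<Sum>x=1..Ks. 2 * expectation (\<lambda>\<omega>. if real j < \<bar>Zx x 1 \<omega>\<bar> then v (\<bar>Zx x 1 \<omega>\<bar> + dl) else 0) + 1 / real (Suc j))"

text \<open>For trajectories in this event the comparison estimates hold for all parameters
  simultaneously, which makes uniformity over an uncountable parameter set accessible.\<close>

definition good :: "'a \<Rightarrow> bool" where
  "good \<omega> \<longleftrightarrow> (\<forall>t\<ge>1. X t \<omega> \<in> {1..Ks}) \<and>
     (\<forall>j. \<forall>\<^sub>F n in sequentially. (\<Sum>t=1..n. tail (real j) t \<omega>) / real n \<le> \<tau> j)"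

lemma v_meas[measurable]: "v \<in> borel_measurable borel" using v(1) by (rule borel_measurable_mono)

lemma tau_tendsto: "\<tau> \<longlonglongrightarrow> 0"
proof -
  have "(\<lambda>j. expectation (\<lambda>\<omega>. if real j < \<bar>Zx x 1 \<omega>\<bar> then v (\<bar>Zx x 1 \<omega>\<bar> + dl) else 0)) \<longlonglongrightarrow> expectation (\<lambda>\<omega>. 0)"
    if x: "x \<in> {1..Ks}" for x
  proof (rule integral_dominated_convergence[where w="\<lambda>\<omega>. v (\<bar>Zx x 1 \<omega>\<bar> + dl)"])
    have [measurable]: "random_variable borel (Zx x 1)" using x by (rule Z_meas) simp
    show "(\<lambda>\<omega>. if real j < \<bar>Zx x 1 \<omega>\<bar> then v (\<bar>Zx x 1 \<omega>\<bar> + dl) else 0) \<in> borel_measurable M" for j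
      by measurable
    show "integrable M (\<lambda>\<omega>. v (\<bar>Zx x 1 \<omega>\<bar> + dl))" using x by (rule v_int)
    show "AE \<omega> in M. (\<lambda>j. if real j < \<bar>Zx x 1 \<omega>\<bar> then v (\<bar>Zx x 1 \<omega>\<bar> + dl) else 0) \<longlonglongrightarrow> 0"
    proof (rule AE_I2, rule tendsto_eventually)
      fix \<omega>
      obtain j0 :: nat where "\<bar>Zx x 1 \<omega>\<bar> \<le> real j0" using real_arch_simple by blast
      then show "\<forall>\<^sub>F j in sequentially. (if real j < \<bar>Zx x 1 \<omega>\<bar> then v (\<bar>Zx x 1 \<omega>\<bar> + dl) else 0) = 0"
        by (intro eventually_sequentiallyI[of j0]) auto
    qed
    show "AE \<omega> in M. norm (if real j < \<bar>Zx x 1 \<omega>\<bar> then v (\<bar>Zx x 1 \<omega>\<bar> + dl) else 0) \<le> v (\<bar>Zx x 1 \<omega>\<bar> + dl)" for j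
      using v_nonneg by (auto intro!: AE_I2)
  qed simp
  then have "\<tau> \<longlonglongrightarrow> (\<Sum>x=1..Ks. 2 * 0 + 0)"
    unfolding \<tau>_def using LIMSEQ_inverse_real_of_nat
    by (intro tendsto_sum tendsto_add tendsto_mult tendsto_const) (auto simp: inverse_eq_divide)
  then show ?thesis by simp
qed

lemma tau_nonneg: "0 \<le> \<tau> j"
  unfolding \<tau>_def using v_nonneg
  by (intro sum_nonneg add_nonneg_nonneg mult_nonneg_nonneg Bochner_Integration.integral_nonneg) auto

lemma AE_tail_x:
  assumes x: "x \<in> {1..Ks}"
  shows "AE \<omega> in M. \<forall>\<^sub>F n in sequentially. (\<Sum>t=1..n. if real j < \<bar>Zx x t \<omega>\<bar> then v (\<bar>Zx x t \<omega>\<bar> + dl) else 0) / real n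
     \<le> 2 * expectation (\<lambda>\<omega>. if real j < \<bar>Zx x 1 \<omega>\<bar> then v (\<bar>Zx x 1 \<omega>\<bar> + dl) else 0) + 1 / real (Suc j)"
proof -
  define g where "g z = (if real j < \<bar>z\<bar> then v (\<bar>z\<bar> + dl) else 0)" for z
  have [measurable]: "g \<in> borel_measurable borel" unfolding g_def by measurable
  have [measurable]: "random_variable borel (Zx x (Suc t))" for t using x by (intro Z_meas) auto
  have "AE \<omega> in M. \<forall>\<^sub>F n in sequentially. (\<Sum>t<n. g (Zx x (Suc t) \<omega>)) / real n \<le> 2 * expectation (\<lambda>\<omega>. g (Zx x (Suc 0) \<omega>)) + 1 / real (Suc j)"
  proof (rule iid_average_upper)
    show "0 \<le> g (Zx x (Suc t) \<omega>)" for t \<omega> using v_nonneg by (simp add: g_def)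
    show "integrable M (\<lambda>\<omega>. g (Zx x (Suc 0) \<omega>))"
    proof (rule Bochner_Integration.integrable_bound[OF v_int[OF x]])
      show "(\<lambda>\<omega>. g (Zx x (Suc 0) \<omega>)) \<in> borel_measurable M" by measurable
      show "AE \<omega> in M. norm (g (Zx x (Suc 0) \<omega>)) \<le> norm (v (\<bar>Zx x 1 \<omega>\<bar> + dl))"
        by (rule AE_I2) (simp add: g_def v_nonneg)
    qed
    show "distr M borel (\<lambda>\<omega>. g (Zx x (Suc t) \<omega>)) = distr M borel (\<lambda>\<omega>. g (Zx x (Suc 0) \<omega>))" for t
    proof -
      have "distr M borel (\<lambda>\<omega>. g (Zx x (Suc t) \<omega>)) = distr (distr M borel (Zx x (Suc t))) borel g" for t
        by (subst distr_distr) (auto simp: comp_def)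
      then show ?thesis using Z_distr[OF x, of "Suc t"] by simp
    qed
    show "indep_var borel (\<lambda>\<omega>. g (Zx x (Suc s) \<omega>)) borel (\<lambda>\<omega>. g (Zx x (Suc t) \<omega>))" if "s \<noteq> t" for s t
    proof -
      have "indep_var borel (Zx x (Suc s)) borel (Zx x (Suc t))"
        using indep_vars_pair[OF Z_indep, of "(x, Suc s)" "(x, Suc t)"] x that by simp
      from indep_var_compose[OF this, of g borel g borel] show ?thesis by (simp add: comp_def)
    qed
  qed auto
  moreover have eq: "(\<Sum>t<n. g (Zx x (Suc t) \<omega>)) = (\<Sum>t=1..n. g (Zx x t \<omega>))" for n \<omega>
    by (rule sum.reindex_bij_witness[of _ "\<lambda>t. t - 1" Suc]) auto
  ultimately have "AE \<omega> in M. \<forall>\<^sub>F n in sequentially. (\<Sum>t=1..n. g (Zx x t \<omega>)) / real n \<le> 2 * expectation (\<lambda>\<omega>. g (Zx x 1 \<omega>)) + 1 / real (Suc j)"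
    by (simp only: One_nat_def)
  then show ?thesis unfolding g_def .
qed

lemma AE_good: "AE \<omega> in M. good \<omega>"
proof -
  have "AE \<omega> in M. \<forall>x\<in>{1..Ks}. \<forall>\<^sub>F n in sequentially. (\<Sum>t=1..n. if real j < \<bar>Zx x t \<omega>\<bar> then v (\<bar>Zx x t \<omega>\<bar> + dl) else 0) / real n
     \<le> 2 * expectation (\<lambda>\<omega>. if real j < \<bar>Zx x 1 \<omega>\<bar> then v (\<bar>Zx x 1 \<omega>\<bar> + dl) else 0) + 1 / real (Suc j)" for j
    using AE_tail_x by (subst AE_finite_all) auto
  then have *: "AE \<omega> in M. \<forall>\<^sub>F n in sequentially. (\<Sum>t=1..n. tail (real j) t \<omega>) / real n \<le> \<tau> j" for j
  proof (rule AE_mp, intro AE_I2 impI)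
    fix j \<omega>
    assume "\<forall>x\<in>{1..Ks}. \<forall>\<^sub>F n in sequentially. (\<Sum>t=1..n. if real j < \<bar>Zx x t \<omega>\<bar> then v (\<bar>Zx x t \<omega>\<bar> + dl) else 0) / real n
     \<le> 2 * expectation (\<lambda>\<omega>. if real j < \<bar>Zx x 1 \<omega>\<bar> then v (\<bar>Zx x 1 \<omega>\<bar> + dl) else 0) + 1 / real (Suc j)"
    then have "\<forall>\<^sub>F n in sequentially. \<forall>x\<in>{1..Ks}. (\<Sum>t=1..n. if real j < \<bar>Zx x t \<omega>\<bar> then v (\<bar>Zx x t \<omega>\<bar> + dl) else 0) / real n
     \<le> 2 * expectation (\<lambda>\<omega>. if real j < \<bar>Zx x 1 \<omega>\<bar> then v (\<bar>Zx x 1 \<omega>\<bar> + dl) else 0) + 1 / real (Suc j)"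
      by (simp add: eventually_ball_finite_distrib)
    then show "\<forall>\<^sub>F n in sequentially. (\<Sum>t=1..n. tail (real j) t \<omega>) / real n \<le> \<tau> j"
    proof eventually_elim
      case (elim n)
      have "(\<Sum>t=1..n. tail (real j) t \<omega>) / real n = (\<Sum>x=1..Ks. (\<Sum>t=1..n. if real j < \<bar>Zx x t \<omega>\<bar> then v (\<bar>Zx x t \<omega>\<bar> + dl) else 0) / real n)"
        unfolding tail_def by (subst sum.swap) (simp add: sum_divide_distrib)
      also have "\<dots> \<le> \<tau> j" unfolding \<tau>_def using elim by (intro sum_mono) auto
      finally show ?case .
    qed
  qed
  \<comment> \<open>A constant quantiser forgets the noise, so this says that the hidden chain stays
    in its state space.\<close>
  have "AE \<omega> in M. \<forall>t\<ge>1. qobs (\<lambda>_. 0) t \<omega> \<in> {1..Ks} \<times> range (\<lambda>_::real. 0::int)"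
    by (rule qobs_in) (auto simp: vimage_def)
  moreover have "AE \<omega> in M. \<forall>j. \<forall>\<^sub>F n in sequentially. (\<Sum>t=1..n. tail (real j) t \<omega>) / real n \<le> \<tau> j"
    unfolding AE_all_countable using * by blast
  ultimately show ?thesis
  proof eventually_elim
    case (elim \<omega>)
    then show ?case by (auto simp: good_def qobs_def[where q="\<lambda>_. 0"])
  qed
qed

lemma tail_nonneg: "0 \<le> tail R t \<omega>"
  unfolding tail_def using v_nonneg by (intro sum_nonneg) auto

lemma good_tail:
  assumes "good \<omega>" "1 \<le> t" "R < \<bar>Zt t \<omega>\<bar>"
  shows "v (\<bar>Zt t \<omega>\<bar> + dl) \<le> tail R t \<omega>"
proof -
  let ?f = "\<lambda>x. if R < \<bar>Zx x t \<omega>\<bar> then v (\<bar>Zx x t \<omega>\<bar> + dl) else 0"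
  have x: "X t \<omega> \<in> {1..Ks}" using assms by (auto simp: good_def)
  then have "v (\<bar>Zt t \<omega>\<bar> + dl) = ?f (X t \<omega>)" using assms by (auto simp: Zt_def)
  also have "\<dots> \<le> tail R t \<omega>" unfolding tail_def using x v_nonneg by (intro member_le_sum) auto
  finally show ?thesis .
qed

lemma good_Zp: "good \<omega> \<Longrightarrow> 1 \<le> t \<Longrightarrow> \<bar>Zp t \<omega>\<bar> \<le> \<bar>Zt t \<omega>\<bar> + dl"
  using Dl[of "X t \<omega>"] by (auto simp: good_def Zp_def)

lemma v_le: "r \<le> r' \<Longrightarrow> v r \<le> v r'" using v(1) by (auto simp: mono_def)

lemma v_Zp: "good \<omega> \<Longrightarrow> 1 \<le> t \<Longrightarrow> v \<bar>Zp t \<omega>\<bar> \<le> v (\<bar>Zt t \<omega>\<bar> + dl)"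
  using good_Zp by (intro v_le)

lemma v_Zt_le: "good \<omega> \<Longrightarrow> 1 \<le> t \<Longrightarrow> v (\<bar>Zt t \<omega>\<bar> + dl) \<le> v (R + dl) + tail R t \<omega>"
  using good_tail[of \<omega> t R] tail_nonneg[of R t \<omega>] v_nonneg[of "R + dl"] v_le[of "\<bar>Zt t \<omega>\<bar> + dl" "R + dl"]
  by (cases "R < \<bar>Zt t \<omega>\<bar>") auto

text \<open>Bounds the long-run average of the envelope, by splitting the noise at R = 0. It becomes
  the Lipschitz constant of the growth rate \<open>lam\<close> in
  \<open>lam_diff_modulus\<close>.\<close>

definition CV :: real where "CV = v dl + \<tau> 0"

lemma CV_pos: "0 < CV" using v(2)[of dl] tau_nonneg[of 0] by (simp add: CV_def)

lemma good_CV: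
  assumes "good \<omega>"
  shows "\<forall>\<^sub>F n in sequentially. (\<Sum>t=1..n. v (\<bar>Zt t \<omega>\<bar> + dl)) \<le> real n * CV"
proof -
  have "\<forall>\<^sub>F n in sequentially. (\<Sum>t=1..n. tail (real 0) t \<omega>) / real n \<le> \<tau> 0" using assms unfolding good_def by blast
  then show ?thesis using eventually_gt_at_top[of 0]
  proof eventually_elim
    case (elim n)
    have "(\<Sum>t=1..n. v (\<bar>Zt t \<omega>\<bar> + dl)) \<le> (\<Sum>t=1..n. v dl + tail 0 t \<omega>)"
      using v_Zt_le[OF assms, of _ 0] by (intro sum_mono) auto
    also have "\<dots> = n * v dl + (\<Sum>t=1..n. tail 0 t \<omega>)" by (simp add: sum.distrib)
    also have "(\<Sum>t=1..n. tail 0 t \<omega>) \<le> n * \<tau> 0" using elim by (simp add: field_simps)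
    finally show ?case by (simp add: CV_def algebra_simps)
  qed
qed

text \<open>Admissible emission densities: here v and w play the roles of L and the modulus of continuity in
  (Areg), and v also dominates the log-densities themselves.\<close>

definition emc :: "nat \<Rightarrow> (nat \<Rightarrow> real \<Rightarrow> real) \<Rightarrow> bool" where
  "emc K' \<phi> \<longleftrightarrow> (\<forall>x\<in>{1..K'}. (\<forall>z. 0 < \<phi> x z \<and> \<bar>ln (\<phi> x z)\<bar> \<le> v \<bar>z\<bar>) \<and>
      (\<forall>z z'. \<bar>ln (\<phi> x z) - ln (\<phi> x z')\<bar> \<le> v \<bar>z\<bar> * w \<bar>z - z'\<bar>))"

lemma emcD:
  assumes "emc K' \<phi>" "x \<in> {1..K'}"
  shows "0 < \<phi> x z" "\<bar>ln (\<phi> x z)\<bar> \<le> v \<bar>z\<bar>" "\<bar>ln (\<phi> x z) - ln (\<phi> x z')\<bar> \<le> v \<bar>z\<bar> * w \<bar>z - z'\<bar>"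
  using assms unfolding emc_def by blast+

text \<open>Exactly the maps for which some state is always compatible with the observed block. For
  any other map the likelihood of the homogeneous model is eventually 0.\<close>

definition covers :: "nat \<Rightarrow> (nat \<Rightarrow> nat set) \<Rightarrow> bool" where
  "covers K' bb \<longleftrightarrow> (\<forall>x\<in>{1..Ks}. \<exists>y\<in>{1..K'}. bb y = blk x)"

definition em :: "(nat \<Rightarrow> real \<Rightarrow> real) \<Rightarrow> (nat \<Rightarrow> nat set) \<Rightarrow> 'a \<Rightarrow> nat \<Rightarrow> nat \<Rightarrow> real" where
  "em \<phi> bb \<omega> t x = \<phi> x (Zp t \<omega>) * (if bb x = blk (X t \<omega>) then 1 else 0)"

lemma em_hmmseq:
  assumes "good \<omega>" "1 \<le> K'" "stochmat s K' Q" "emc K' \<phi>" "covers K' bb"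
  shows "hmmseq s K' Q (em \<phi> bb \<omega>)"
proof
  show "0 \<le> em \<phi> bb \<omega> t x" if "1 \<le> t" "x \<in> {1..K'}" for t x
    using assms that by (auto simp: em_def emc_def less_imp_le)
  show "\<exists>x\<in>{1..K'}. 0 < em \<phi> bb \<omega> t x" if "1 \<le> t" for t
  proof -
    have "X t \<omega> \<in> {1..Ks}" using assms that by (auto simp: good_def)
    then obtain y where "y \<in> {1..K'}" "bb y = blk (X t \<omega>)" using assms unfolding covers_def by blast
    then show ?thesis using assms by (intro bexI[of _ y]) (auto simp: em_def emc_def)
  qed
qed (use assms s in auto)

text \<open>Emissions may vanish provided that they do so at the same places, as is the case for two
  models sharing a block map; elsewhere closeness of the logarithms gives the factors of
  \<open>seglik_le\<close> in both directions.\<close>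

lemma seglik_abs_diff:
  assumes 1: "hmmseq s K' Q e" and 2: "hmmseq s K' Q' e'"
    and Q: "\<And>x y. x \<in> {1..K'} \<Longrightarrow> y \<in> {1..K'} \<Longrightarrow> Q x y \<le> exp q * Q' x y \<and> Q' x y \<le> exp q * Q x y"
    and e: "\<And>t x. t \<in> {a+1..a+k} \<Longrightarrow> x \<in> {1..K'} \<Longrightarrow> e t x = 0 \<and> e' t x = 0 \<or> 0 < e t x \<and> 0 < e' t x \<and> \<bar>ln (e t x) - ln (e' t x)\<bar> \<le> c t"
  shows "\<bar>seglik K' Q e a k - seglik K' Q' e' a k\<bar> \<le> (\<Sum>t\<in>{a+1..a+k}. c t) + k * q"
proof -
  have *: "x \<le> exp c * y" if "0 < x" "0 < y" "\<bar>ln x - ln y\<bar> \<le> c" for x y c :: real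
  proof -
    have "ln x \<le> ln (exp c * y)" using that by (simp add: ln_mult abs_le_iff)
    then show ?thesis using that by simp
  qed
  have "e t x \<le> exp (c t) * e' t x \<and> e' t x \<le> exp (c t) * e t x" if "t \<in> {a+1..a+k}" "x \<in> {1..K'}" for t x
    using e[OF that] *[of "e t x" "e' t x"] *[of "e' t x" "e t x"] by (auto simp: abs_minus_commute)
  then have "seglik K' Q e a k \<le> seglik K' Q' e' a k + (\<Sum>t\<in>{a+1..a+k}. c t) + k * q"
    "seglik K' Q' e' a k \<le> seglik K' Q e a k + (\<Sum>t\<in>{a+1..a+k}. c t) + k * q"
    using Q by (blast intro: seglik_le[OF 1 2] seglik_le[OF 2 1])+
  then show ?thesis by linarith
qed

lemma em_diff:
  assumes "good \<omega>" "1 \<le> K'" "stochmat s K' Q" "emc K' \<phi>" "covers K' bb" "stochmat s K' Q'" "emc K' \<phi>'"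
    and Q: "\<And>x y. x \<in> {1..K'} \<Longrightarrow> y \<in> {1..K'} \<Longrightarrow> Q x y \<le> exp q * Q' x y \<and> Q' x y \<le> exp q * Q x y"
    and c: "\<And>t x. t \<in> {a+1..a+k} \<Longrightarrow> x \<in> {1..K'} \<Longrightarrow> \<bar>ln (\<phi> x (Zp t \<omega>)) - ln (\<phi>' x (Zp t \<omega>))\<bar> \<le> c t"
  shows "\<bar>seglik K' Q (em \<phi> bb \<omega>) a k - seglik K' Q' (em \<phi>' bb \<omega>) a k\<bar> \<le> (\<Sum>t\<in>{a+1..a+k}. c t) + k * q"
  using assms(4,7) c
  by (intro seglik_abs_diff em_hmmseq assms Q) (auto simp: em_def emc_def)

text \<open>Noise in [-j, j] is moved to a grid point, and for larger noise the emission is replaced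
  by 1, while block labels are kept exactly. The first change costs at most
  \<open>1 / real (Suc j)\<close> per observation, the second at most \<open>tail\<close>. A further
  \<open>1 / real (Suc j)\<close> is the distance of the quantised average from its own
  limit.\<close>

lemma loglik_converges:
  assumes K': "1 \<le> K'" and Q: "stochmat s K' Q" and \<phi>: "emc K' \<phi>" and bb: "covers K' bb"
  shows "\<exists>L. AE \<omega> in M. (\<lambda>n. seglik K' Q (em \<phi> bb \<omega>) 0 n / real n) \<longlonglongrightarrow> L"
proof -
  have "\<exists>L. AE \<omega> in M. \<forall>\<^sub>F n in sequentially. \<bar>seglik K' Q (em \<phi> bb \<omega>) 0 n / real n - L\<bar> \<le> 2 / real (Suc j) + \<tau> j" for j
  proof -
    \<comment> \<open>The mesh is chosen against the largest value of the envelope on the retained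
      range, so that the product in the modulus bound is at most
      \<open>1 / real (Suc j)\<close>.\<close>
    obtain h where h: "0 < h" "w h \<le> 1 / (real (Suc j) * v (real j + dl))"
      using w_small[of "1 / (real (Suc j) * v (real j + dl))"] v(2)[of "real j + dl"] by auto
    \<comment> \<open>A code larger than that of every cell meeting [-j, j], reserved for all larger
      noise.\<close>
    define cs where "cs = \<lfloor>real j / h\<rfloor> + 1"
    define q where "q z = (if \<bar>z\<bar> \<le> real j then \<lfloor>z / h\<rfloor> else cs)" for z
    have q1: "q z = \<lfloor>z / h\<rfloor> \<and> q z \<noteq> cs" if "\<bar>z\<bar> \<le> real j" for z
    proof -
      have "\<lfloor>z / h\<rfloor> \<le> \<lfloor>real j / h\<rfloor>" using that h by (intro floor_mono divide_right_mono) auto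
      then show ?thesis using that by (auto simp: q_def cs_def)
    qed
    have q_fin: "finite (range q)"
    proof (rule finite_subset)
      show "range q \<subseteq> {\<lfloor>- real j / h\<rfloor>..cs}"
      proof (rule image_subsetI)
        fix z
        have *: "\<lfloor>- real j / h\<rfloor> \<le> \<lfloor>y / h\<rfloor> \<and> \<lfloor>y / h\<rfloor> \<le> \<lfloor>real j / h\<rfloor>" if "\<bar>y\<bar> \<le> real j" for y
          using that h by (intro conjI floor_mono divide_right_mono) auto
        show "q z \<in> {\<lfloor>- real j / h\<rfloor>..cs}"
          using *[of z] *[of "real j"] by (auto simp: q_def cs_def)
      qed
    qed simp
    have q_meas: "q -` {c} \<in> sets borel" for c
    proof -
      have "q \<in> measurable borel (count_space UNIV)" unfolding q_def by measurable
      from measurable_sets[OF this, of "{c}"] show ?thesis by simp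
    qed
    \<comment> \<open>With the value 1 for the overflow code, the error there is the modulus of the
      log-density itself, which the tail dominates.\<close>
    define \<eta> where "\<eta> xc x = (if bb x = blk (fst xc) then (if snd xc = cs then 1 else \<phi> x (h * of_int (snd xc) + Dl (fst xc))) else 0)" for xc x
    define B where "B = v (real j + h + dl)"
    have \<eta>_b: "\<bar>ln (\<phi> x (h * of_int c + Dl x'))\<bar> \<le> B" if "c \<in> range q" "c \<noteq> cs" "x' \<in> {1..Ks}" "x \<in> {1..K'}" for c x x'
    proof -
      obtain z where z: "c = q z" using \<open>c \<in> range q\<close> by auto
      then have zj: "\<bar>z\<bar> \<le> real j" and c: "c = \<lfloor>z / h\<rfloor>" using that by (auto simp: q_def split: if_splits)
      have "\<bar>h * of_int c + Dl x'\<bar> \<le> real j + h + dl"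
        using floor_grid_close[OF h(1), of z] zj Dl[OF that(3)] unfolding c by linarith
      then have "v \<bar>h * of_int c + Dl x'\<bar> \<le> B" unfolding B_def by (rule v_le)
      then show ?thesis using emcD(2)[OF \<phi> that(4)] by (rule order.trans[rotated])
    qed
    have B0: "0 \<le> B" unfolding B_def by (rule v_nonneg)
    have up: "0 \<le> \<eta> c x \<and> \<eta> c x \<le> exp B" if "c \<in> {1..Ks} \<times> range q" "x \<in> {1..K'}" for c x
    proof -
      have "0 \<le> \<phi> x (h * of_int (snd c) + Dl (fst c)) \<and> \<phi> x (h * of_int (snd c) + Dl (fst c)) \<le> exp B" if "snd c \<noteq> cs"
        using abs_ln_leD(2)[OF emcD(1)[OF \<phi>] \<eta>_b] emcD(1)[OF \<phi>] \<open>c \<in> _\<close> \<open>x \<in> _\<close> that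
        by (auto simp: less_imp_le mem_Times_iff)
      then show ?thesis using B0 by (auto simp: \<eta>_def)
    qed
    have lo: "\<exists>x\<in>{1..K'}. exp (- B) \<le> \<eta> c x" if "c \<in> {1..Ks} \<times> range q" for c
    proof -
      have "fst c \<in> {1..Ks}" using that by auto
      then obtain y where y: "y \<in> {1..K'}" "bb y = blk (fst c)" using bb unfolding covers_def by blast
      have "exp (- B) \<le> \<phi> y (h * of_int (snd c) + Dl (fst c))" if "snd c \<noteq> cs"
        using \<open>c \<in> _\<close> that y by (intro abs_ln_leD(1) emcD(1)[OF \<phi>] \<eta>_b) (auto simp: mem_Times_iff)
      then show ?thesis using B0 y by (intro bexI[of _ y]) (auto simp: \<eta>_def)
    qed
    have "\<exists>L. AE \<omega> in M. (\<lambda>n. seglik K' Q (\<lambda>t. \<eta> (qobs q t \<omega>)) 0 n / real n) \<longlonglongrightarrow> L"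
      by (rule quantised_loglik_converges[where \<eta>=\<eta> and B=B, OF q_meas q_fin K' Q up lo])
    then obtain L where L: "AE \<omega> in M. (\<lambda>n. seglik K' Q (\<lambda>t. \<eta> (qobs q t \<omega>)) 0 n / real n) \<longlonglongrightarrow> L"
      by blast
    have "AE \<omega> in M. \<forall>\<^sub>F n in sequentially. \<bar>seglik K' Q (em \<phi> bb \<omega>) 0 n / real n - L\<bar> \<le> 2 / real (Suc j) + \<tau> j"
      using L AE_good qobs_in[of q, OF q_meas q_fin]
    proof eventually_elim
      fix \<omega> assume lim: "(\<lambda>n. seglik K' Q (\<lambda>t. \<eta> (qobs q t \<omega>)) 0 n / real n) \<longlonglongrightarrow> L"
        and g: "good \<omega>" and qin: "\<forall>t\<ge>1. qobs q t \<omega> \<in> {1..Ks} \<times> range q"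
      have h2: "hmmseq s K' Q (\<lambda>t. \<eta> (qobs q t \<omega>))"
      proof
        fix t :: nat assume "1 \<le> t"
        then show "\<exists>x\<in>{1..K'}. 0 < \<eta> (qobs q t \<omega>) x" using lo[of "qobs q t \<omega>"] qin exp_gt_zero[of "- B"] by (meson less_le_trans)
      qed (use s K' Q up qin in auto)
      have "\<bar>seglik K' Q (em \<phi> bb \<omega>) 0 n - seglik K' Q (\<lambda>t. \<eta> (qobs q t \<omega>)) 0 n\<bar>
          \<le> (\<Sum>t\<in>{0+1..0+n}. 1 / real (Suc j) + tail (real j) t \<omega>) + real n * 0" for n
      proof (rule seglik_abs_diff[OF em_hmmseq[OF g K' Q \<phi> bb] h2])
        fix t x assume t: "t \<in> {0+1..0+n}" and x: "x \<in> {1..K'}"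
        then have t1: "1 \<le> t" by simp
        have pos: "\<phi> x z > 0" for z using \<phi> x by (auto simp: emc_def)
        have "\<bar>ln (\<phi> x (Zp t \<omega>)) - ln (if q (Zt t \<omega>) = cs then 1 else \<phi> x (h * of_int (q (Zt t \<omega>)) + Dl (X t \<omega>)))\<bar> \<le> 1 / real (Suc j) + tail (real j) t \<omega>"
        proof (cases "\<bar>Zt t \<omega>\<bar> \<le> real j")
          case True
          have "\<bar>ln (\<phi> x (Zp t \<omega>)) - ln (\<phi> x (h * of_int (q (Zt t \<omega>)) + Dl (X t \<omega>)))\<bar>
              \<le> v \<bar>Zp t \<omega>\<bar> * w \<bar>Zp t \<omega> - (h * of_int (q (Zt t \<omega>)) + Dl (X t \<omega>))\<bar>"
            using \<phi> x by (auto simp: emc_def)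
          also have "\<dots> \<le> v (real j + dl) * w h"
          proof (intro mult_mono v_le w(1) v_nonneg w_nonneg abs_ge_zero)
            show "\<bar>Zp t \<omega>\<bar> \<le> real j + dl" using good_Zp[OF g t1] True by linarith
            show "\<bar>Zp t \<omega> - (h * of_int (q (Zt t \<omega>)) + Dl (X t \<omega>))\<bar> \<le> h"
              using floor_grid_close[OF h(1), of "Zt t \<omega>"] q1[OF True] by (simp add: Zp_def)
          qed
          also have "\<dots> \<le> v (real j + dl) * (1 / (real (Suc j) * v (real j + dl)))"
            using h v_nonneg by (intro mult_left_mono) auto
          also have "\<dots> = 1 / real (Suc j)" using v(2)[of "real j + dl"] by simp
          finally show ?thesis using q1[OF True] tail_nonneg[of "real j" t \<omega>] by simp
        next
          case False
          then have "\<bar>ln (\<phi> x (Zp t \<omega>))\<bar> \<le> tail (real j) t \<omega>"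
            using emcD(2)[OF \<phi> x, of "Zp t \<omega>"] v_Zp[OF g t1] good_tail[OF g t1, of "real j"] by linarith
          moreover have "0 \<le> 1 / real (Suc j)" by simp
          ultimately have "\<bar>ln (\<phi> x (Zp t \<omega>))\<bar> \<le> 1 / real (Suc j) + tail (real j) t \<omega>" by linarith
          then show ?thesis using False by (simp add: q_def)
        qed
        then show "em \<phi> bb \<omega> t x = 0 \<and> \<eta> (qobs q t \<omega>) x = 0 \<or> 0 < em \<phi> bb \<omega> t x \<and> 0 < \<eta> (qobs q t \<omega>) x \<and>
            \<bar>ln (em \<phi> bb \<omega> t x) - ln (\<eta> (qobs q t \<omega>) x)\<bar> \<le> 1 / real (Suc j) + tail (real j) t \<omega>"
          using pos by (auto simp: em_def \<eta>_def qobs_def[OF q_meas q_fin])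
      qed auto
      then have d: "\<bar>seglik K' Q (em \<phi> bb \<omega>) 0 n - seglik K' Q (\<lambda>t. \<eta> (qobs q t \<omega>)) 0 n\<bar>
          \<le> n * (1 / real (Suc j)) + (\<Sum>t=1..n. tail (real j) t \<omega>)" for n
        by (simp add: sum.distrib)
      have "\<forall>\<^sub>F n in sequentially. (\<Sum>t=1..n. tail (real j) t \<omega>) / real n \<le> \<tau> j" using g unfolding good_def by blast
      moreover have "\<forall>\<^sub>F n in sequentially. dist (seglik K' Q (\<lambda>t. \<eta> (qobs q t \<omega>)) 0 n / real n) L < 1 / real (Suc j)"
        using lim by (rule tendstoD) simp
      ultimately show "\<forall>\<^sub>F n in sequentially. \<bar>seglik K' Q (em \<phi> bb \<omega>) 0 n / real n - L\<bar> \<le> 2 / real (Suc j) + \<tau> j"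
        using eventually_gt_at_top[of 0]
      proof eventually_elim
        case (elim n)
        have "\<bar>seglik K' Q (em \<phi> bb \<omega>) 0 n / real n - seglik K' Q (\<lambda>t. \<eta> (qobs q t \<omega>)) 0 n / real n\<bar>
           = \<bar>seglik K' Q (em \<phi> bb \<omega>) 0 n - seglik K' Q (\<lambda>t. \<eta> (qobs q t \<omega>)) 0 n\<bar> / real n"
          by (simp flip: diff_divide_distrib)
        also have "\<dots> \<le> (n * (1 / real (Suc j)) + (\<Sum>t=1..n. tail (real j) t \<omega>)) / real n"
          using d by (intro divide_right_mono) auto
        also have "\<dots> = 1 / real (Suc j) + (\<Sum>t=1..n. tail (real j) t \<omega>) / real n"
          using elim by (simp add: add_divide_distrib)
        finally show ?case using elim unfolding dist_real_def by (simp add: add_divide_distrib)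
      qed
    qed
    then show ?thesis by blast
  qed
  then have "\<forall>j. \<exists>L. AE \<omega> in M. \<forall>\<^sub>F n in sequentially. \<bar>seglik K' Q (em \<phi> bb \<omega>) 0 n / real n - L\<bar> \<le> 2 / real (Suc j) + \<tau> j"
    by blast
  from choice[OF this] obtain a where "\<And>j. AE \<omega> in M. \<forall>\<^sub>F n in sequentially. \<bar>seglik K' Q (em \<phi> bb \<omega>) 0 n / real n - a j\<bar> \<le> 2 / real (Suc j) + \<tau> j"
    by blast
  moreover have "(\<lambda>j. 2 / real (Suc j) + \<tau> j) \<longlonglongrightarrow> 0"
  proof -
    have "(\<lambda>j. 2 * inverse (real (Suc j)) + \<tau> j) \<longlonglongrightarrow> 2 * 0 + 0"
      by (intro tendsto_intros tau_tendsto LIMSEQ_inverse_real_of_nat)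
    then show ?thesis by (simp add: inverse_eq_divide)
  qed
  ultimately show ?thesis by (intro AE_approx_convergent)
qed

definition lam :: "nat \<Rightarrow> (nat \<Rightarrow> nat \<Rightarrow> real) \<Rightarrow> (nat \<Rightarrow> real \<Rightarrow> real) \<Rightarrow> (nat \<Rightarrow> nat set) \<Rightarrow> real" where
  "lam K' Q \<phi> bb = (THE L. AE \<omega> in M. (\<lambda>n. seglik K' Q (em \<phi> bb \<omega>) 0 n / real n) \<longlonglongrightarrow> L)"

lemma AE_tendsto_unique:
  fixes a :: "nat \<Rightarrow> 'a \<Rightarrow> real"
  assumes "AE \<omega> in M. (\<lambda>n. a n \<omega>) \<longlonglongrightarrow> L" "AE \<omega> in M. (\<lambda>n. a n \<omega>) \<longlonglongrightarrow> L'"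
  shows "L = L'"
proof -
  have "AE \<omega> in M. (\<lambda>n. a n \<omega>) \<longlonglongrightarrow> L \<and> (\<lambda>n. a n \<omega>) \<longlonglongrightarrow> L'" using assms by eventually_elim auto
  then obtain \<omega> where "(\<lambda>n. a n \<omega>) \<longlonglongrightarrow> L \<and> (\<lambda>n. a n \<omega>) \<longlonglongrightarrow> L'" using AE_ex by blast
  then show ?thesis using LIMSEQ_unique by blast
qed

lemma lam_converges:
  assumes "1 \<le> K'" "stochmat s K' Q" "emc K' \<phi>" "covers K' bb"
  shows "AE \<omega> in M. (\<lambda>n. seglik K' Q (em \<phi> bb \<omega>) 0 n / real n) \<longlonglongrightarrow> lam K' Q \<phi> bb"
proof -
  obtain L where L: "AE \<omega> in M. (\<lambda>n. seglik K' Q (em \<phi> bb \<omega>) 0 n / real n) \<longlonglongrightarrow> L"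
    using loglik_converges[OF assms] by blast
  then show ?thesis unfolding lam_def
    by (rule theI[where a=L]) (rule AE_tendsto_unique[OF _ L])
qed

lemma lam_diff:
  assumes "1 \<le> K'" "stochmat s K' Q" "emc K' \<phi>" "covers K' bb" "stochmat s K' Q'" "emc K' \<phi>'"
    and d: "\<And>\<omega>. good \<omega> \<Longrightarrow> \<forall>\<^sub>F n in sequentially. \<bar>seglik K' Q (em \<phi> bb \<omega>) 0 n - seglik K' Q' (em \<phi>' bb \<omega>) 0 n\<bar> \<le> real n * c"
  shows "\<bar>lam K' Q \<phi> bb - lam K' Q' \<phi>' bb\<bar> \<le> c"
proof -
  have "AE \<omega> in M. \<bar>lam K' Q \<phi> bb - lam K' Q' \<phi>' bb\<bar> \<le> c"
    using lam_converges[OF assms(1-4)] lam_converges[OF assms(1,5,6,4)] AE_good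
  proof eventually_elim
    fix \<omega>
    assume a: "(\<lambda>n. seglik K' Q (em \<phi> bb \<omega>) 0 n / real n) \<longlonglongrightarrow> lam K' Q \<phi> bb"
      "(\<lambda>n. seglik K' Q' (em \<phi>' bb \<omega>) 0 n / real n) \<longlonglongrightarrow> lam K' Q' \<phi>' bb" and g: "good \<omega>"
    have "(\<lambda>n. \<bar>seglik K' Q (em \<phi> bb \<omega>) 0 n / real n - seglik K' Q' (em \<phi>' bb \<omega>) 0 n / real n\<bar>) \<longlonglongrightarrow> \<bar>lam K' Q \<phi> bb - lam K' Q' \<phi>' bb\<bar>"
      by (intro tendsto_intros a)
    moreover have "\<forall>\<^sub>F n in sequentially. \<bar>seglik K' Q (em \<phi> bb \<omega>) 0 n / real n - seglik K' Q' (em \<phi>' bb \<omega>) 0 n / real n\<bar> \<le> c"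
      using d[OF g] eventually_gt_at_top[of 0]
      by eventually_elim (simp add: field_simps abs_divide flip: diff_divide_distrib)
    ultimately show "\<bar>lam K' Q \<phi> bb - lam K' Q' \<phi>' bb\<bar> \<le> c" by (rule tendsto_upperbound) simp
  qed
  then show ?thesis using AE_ex by blast
qed

section \<open>Uniformity in the parameters\<close>

lemma stochmat_exp_close:
  assumes Q: "stochmat s K' Q" "stochmat s K' Q'" and \<delta>: "0 < \<delta>" and xy: "x \<in> {1..K'}" "y \<in> {1..K'}"
    and eq: "\<bar>Q x y - Q' x y\<bar> \<le> \<delta> * s"
  shows "Q x y \<le> exp \<delta> * Q' x y \<and> Q' x y \<le> exp \<delta> * Q x y"
proof
  show "Q x y \<le> exp \<delta> * Q' x y"
    using le_exp_if_close[OF eq stochmat_ge[OF Q(2) xy]] \<delta> s by simp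
  have "\<bar>Q' x y - Q x y\<bar> \<le> \<delta> * s" using eq by (simp add: abs_minus_commute)
  from le_exp_if_close[OF this stochmat_ge[OF Q(1) xy]] show "Q' x y \<le> exp \<delta> * Q x y" using \<delta> s by simp
qed

text \<open>Per unit of time, the transitions cost \<open>\<delta>\<close>, the densities cost
  \<open>\<delta>\<close> where the noise is at most j, and for larger noise each of the two
  log-densities is bounded by the tail, whence the factor 2.\<close>

lemma em_diff_close:
  assumes g: "good \<omega>" and p: "1 \<le> K'" "stochmat s K' Q" "emc K' \<phi>" "covers K' bb" "stochmat s K' Q'" "emc K' \<phi>'"
    and Q: "\<And>x y. x \<in> {1..K'} \<Longrightarrow> y \<in> {1..K'} \<Longrightarrow> Q x y \<le> exp \<delta> * Q' x y \<and> Q' x y \<le> exp \<delta> * Q x y"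
    and c: "\<And>x z. x \<in> {1..K'} \<Longrightarrow> \<bar>z\<bar> \<le> real j + dl \<Longrightarrow> \<bar>ln (\<phi> x z) - ln (\<phi>' x z)\<bar> \<le> \<delta>" and \<delta>: "0 \<le> \<delta>"
    and n: "0 < n" "(\<Sum>t=1..n. tail (real j) t \<omega>) / real n \<le> \<tau> j"
  shows "\<bar>seglik K' Q (em \<phi> bb \<omega>) 0 n - seglik K' Q' (em \<phi>' bb \<omega>) 0 n\<bar> \<le> real n * (2 * \<delta> + 2 * \<tau> j)"
proof -
  have "\<bar>seglik K' Q (em \<phi> bb \<omega>) 0 n - seglik K' Q' (em \<phi>' bb \<omega>) 0 n\<bar> \<le> (\<Sum>t\<in>{0+1..0+n}. \<delta> + 2 * tail (real j) t \<omega>) + real n * \<delta>"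
  proof (rule em_diff[OF g p Q])
    fix t x assume t: "t \<in> {0+1..0+n}" and x: "x \<in> {1..K'}"
    then have t1: "1 \<le> t" by simp
    show "\<bar>ln (\<phi> x (Zp t \<omega>)) - ln (\<phi>' x (Zp t \<omega>))\<bar> \<le> \<delta> + 2 * tail (real j) t \<omega>"
    proof (cases "\<bar>Zt t \<omega>\<bar> \<le> real j")
      case True
      then show ?thesis using c[OF x, of "Zp t \<omega>"] good_Zp[OF g t1] tail_nonneg[of "real j" t \<omega>] by linarith
    next
      case False
      then show ?thesis
        using emcD(2)[OF p(3) x, of "Zp t \<omega>"] emcD(2)[OF p(6) x, of "Zp t \<omega>"] v_Zp[OF g t1] good_tail[OF g t1, of "real j"] \<delta>
        by linarith
    qed
  qed
  also have "\<dots> = real n * (2 * \<delta>) + 2 * (\<Sum>t=1..n. tail (real j) t \<omega>)"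
    by (simp add: sum.distrib sum_distrib_left)
  also have "(\<Sum>t=1..n. tail (real j) t \<omega>) \<le> n * \<tau> j" using n by (simp add: field_simps)
  finally show ?thesis by (simp add: algebra_simps)
qed

lemma lam_diff_close:
  assumes p: "1 \<le> K'" "stochmat s K' Q" "emc K' \<phi>" "covers K' bb" "stochmat s K' Q'" "emc K' \<phi>'"
    and Q: "\<And>x y. x \<in> {1..K'} \<Longrightarrow> y \<in> {1..K'} \<Longrightarrow> Q x y \<le> exp \<delta> * Q' x y \<and> Q' x y \<le> exp \<delta> * Q x y"
    and c: "\<And>x z. x \<in> {1..K'} \<Longrightarrow> \<bar>z\<bar> \<le> real j + dl \<Longrightarrow> \<bar>ln (\<phi> x z) - ln (\<phi>' x z)\<bar> \<le> \<delta>" and \<delta>: "0 \<le> \<delta>"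
  shows "\<bar>lam K' Q \<phi> bb - lam K' Q' \<phi>' bb\<bar> \<le> 2 * \<delta> + 2 * \<tau> j"
proof (rule lam_diff[OF p])
  fix \<omega> assume g: "good \<omega>"
  then have "\<forall>\<^sub>F n in sequentially. (\<Sum>t=1..n. tail (real j) t \<omega>) / real n \<le> \<tau> j" unfolding good_def by blast
  then show "\<forall>\<^sub>F n in sequentially. \<bar>seglik K' Q (em \<phi> bb \<omega>) 0 n - seglik K' Q' (em \<phi>' bb \<omega>) 0 n\<bar> \<le> real n * (2 * \<delta> + 2 * \<tau> j)"
    using eventually_gt_at_top[of 0]
  proof eventually_elim
    case (elim n)
    show ?case by (rule em_diff_close[OF g p Q c \<delta> elim(2) elim(1)])
  qed
qed

text \<open>The weight \<open>v \<bar>z\<bar>\<close> of the error is averaged along the trajectory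
  by \<open>good_CV\<close>.\<close>

lemma lam_diff_modulus:
  assumes p: "1 \<le> K'" "stochmat s K' Q" "emc K' \<phi>" "covers K' bb" "emc K' \<phi>'"
    and c: "\<And>x z. x \<in> {1..K'} \<Longrightarrow> \<bar>ln (\<phi> x z) - ln (\<phi>' x z)\<bar> \<le> v \<bar>z\<bar> * \<eta>" and \<eta>: "0 \<le> \<eta>"
  shows "\<bar>lam K' Q \<phi> bb - lam K' Q \<phi>' bb\<bar> \<le> CV * \<eta>"
proof (rule lam_diff[OF p(1-4) p(2) p(5)])
  fix \<omega> assume g: "good \<omega>"
  show "\<forall>\<^sub>F n in sequentially. \<bar>seglik K' Q (em \<phi> bb \<omega>) 0 n - seglik K' Q (em \<phi>' bb \<omega>) 0 n\<bar> \<le> real n * (CV * \<eta>)"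
    using good_CV[OF g]
  proof eventually_elim
    case (elim n)
    have "\<bar>seglik K' Q (em \<phi> bb \<omega>) 0 n - seglik K' Q (em \<phi>' bb \<omega>) 0 n\<bar> \<le> (\<Sum>t\<in>{0+1..0+n}. v (\<bar>Zt t \<omega>\<bar> + dl) * \<eta>) + real n * 0"
    proof (rule em_diff[OF g p(1-4) p(2) p(5)])
      fix t x assume t: "t \<in> {0+1..0+n}" and x: "x \<in> {1..K'}"
      then have t1: "1 \<le> t" by simp
      have "v \<bar>Zp t \<omega>\<bar> * \<eta> \<le> v (\<bar>Zt t \<omega>\<bar> + dl) * \<eta>" using v_Zp[OF g t1] \<eta> by (rule mult_right_mono)
      then show "\<bar>ln (\<phi> x (Zp t \<omega>)) - ln (\<phi>' x (Zp t \<omega>))\<bar> \<le> v (\<bar>Zt t \<omega>\<bar> + dl) * \<eta>"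
        using c[OF x, of "Zp t \<omega>"] by linarith
    qed auto
    also have "\<dots> = (\<Sum>t=1..n. v (\<bar>Zt t \<omega>\<bar> + dl)) * \<eta>" by (simp add: sum_distrib_right)
    also have "\<dots> \<le> (real n * CV) * \<eta>" using elim \<eta> by (rule mult_right_mono)
    finally show ?case by simp
  qed
qed

text \<open>\<open>CV\<close> accounts for the emissions, \<open>- ln s\<close> for the transitions,
  and 1 absorbs ln K' / n.\<close>

definition CL :: real where "CL = CV - ln s + 1"

lemma em_seglik_bound:
  assumes g: "good \<omega>" and p: "1 \<le> K'" "stochmat s K' Q" "emc K' \<phi>" "covers K' bb"
  shows "\<bar>seglik K' Q (em \<phi> bb \<omega>) 0 n\<bar> \<le> ln K' + (\<Sum>t=1..n. v (\<bar>Zt t \<omega>\<bar> + dl) - ln s)"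
proof -
  interpret h: hmmseq s K' Q "em \<phi> bb \<omega>" by (rule em_hmmseq[OF g p])
  have ex: "exp (- v (\<bar>Zt t \<omega>\<bar> + dl)) \<le> \<phi> x (Zp t \<omega>) \<and> \<phi> x (Zp t \<omega>) \<le> exp (v (\<bar>Zt t \<omega>\<bar> + dl))"
    if "1 \<le> t" "x \<in> {1..K'}" for t x
  proof -
    have "\<bar>ln (\<phi> x (Zp t \<omega>))\<bar> \<le> v (\<bar>Zt t \<omega>\<bar> + dl)" using emcD(2)[OF p(3) that(2)] v_Zp[OF g that(1)] by (rule order.trans)
    then show ?thesis using abs_ln_leD[OF emcD(1)[OF p(3) that(2)]] by blast
  qed
  have "\<bar>seglik K' Q (em \<phi> bb \<omega>) 0 n\<bar> \<le> ln K' + (\<Sum>t\<in>{0+1..0+n}. v (\<bar>Zt t \<omega>\<bar> + dl) - ln s)"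
  proof (rule h.seglik_bound)
    fix t assume "t \<in> {0+1..0+n}"
    then have t: "1 \<le> t" by simp
    show "em \<phi> bb \<omega> t x \<le> exp (v (\<bar>Zt t \<omega>\<bar> + dl))" if "x \<in> {1..K'}" for x
      using ex[OF t that] by (auto simp: em_def)
    have "X t \<omega> \<in> {1..Ks}" using g t unfolding good_def by blast
    then obtain y where "y \<in> {1..K'}" "bb y = blk (X t \<omega>)" using p(4) unfolding covers_def by blast
    then show "\<exists>x\<in>{1..K'}. exp (- v (\<bar>Zt t \<omega>\<bar> + dl)) \<le> em \<phi> bb \<omega> t x"
      using ex[OF t, of y] by (intro bexI[of _ y]) (auto simp: em_def)
  qed (rule v_nonneg)
  then show ?thesis by simp
qed

lemma lam_bound:
  assumes p: "1 \<le> K'" "stochmat s K' Q" "emc K' \<phi>" "covers K' bb"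
  shows "\<bar>lam K' Q \<phi> bb\<bar> \<le> CL"
proof -
  have "AE \<omega> in M. \<bar>lam K' Q \<phi> bb\<bar> \<le> CL"
    using lam_converges[OF p] AE_good
  proof eventually_elim
    fix \<omega> assume lim: "(\<lambda>n. seglik K' Q (em \<phi> bb \<omega>) 0 n / real n) \<longlonglongrightarrow> lam K' Q \<phi> bb" and g: "good \<omega>"
    have "(\<lambda>n. \<bar>seglik K' Q (em \<phi> bb \<omega>) 0 n / real n\<bar>) \<longlonglongrightarrow> \<bar>lam K' Q \<phi> bb\<bar>" by (intro tendsto_intros lim)
    moreover obtain n0 :: nat where n0: "ln K' \<le> real n0" using real_arch_simple by blast
    have "\<forall>\<^sub>F n in sequentially. \<bar>seglik K' Q (em \<phi> bb \<omega>) 0 n / real n\<bar> \<le> CL"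
      using good_CV[OF g] eventually_ge_at_top[of "max 1 n0"]
    proof eventually_elim
      case (elim n)
      have "\<bar>seglik K' Q (em \<phi> bb \<omega>) 0 n\<bar> \<le> real n + (real n * CV + real n * (- ln s))"
        using em_seglik_bound[OF g p, of n] elim n0 by (simp add: sum_subtractf)
      also have "\<dots> = real n * CL" by (simp add: CL_def algebra_simps)
      finally show ?case using elim by (simp add: abs_divide field_simps)
    qed
    ultimately show "\<bar>lam K' Q \<phi> bb\<bar> \<le> CL" using tendsto_upperbound by fastforce
  qed
  then show ?thesis using AE_ex by blast
qed

text \<open>The net consists of representatives of the classes of parameters that have the same rounded
  values of Q and of the log-densities at the points of a grid.\<close>
lemma parameter_net:
  assumes \<delta>: "0 < \<delta>" and R: "0 \<le> R" and K': "1 \<le> K'"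
  shows "\<exists>N\<subseteq>{(Q, \<phi>). stochmat s K' Q \<and> emc K' \<phi>}. finite N \<and>
     (\<forall>Q \<phi>. stochmat s K' Q \<and> emc K' \<phi> \<longrightarrow> (\<exists>(Q', \<phi>')\<in>N.
        (\<forall>x\<in>{1..K'}. \<forall>y\<in>{1..K'}. Q x y \<le> exp \<delta> * Q' x y \<and> Q' x y \<le> exp \<delta> * Q x y) \<and>
        (\<forall>x\<in>{1..K'}. \<forall>z. \<bar>z\<bar> \<le> R \<longrightarrow> \<bar>ln (\<phi> x z) - ln (\<phi>' x z)\<bar> \<le> \<delta>)))"
proof -
  let ?P = "{(Q, \<phi>). stochmat s K' Q \<and> emc K' \<phi>}"
  obtain h where h: "0 < h" "w h \<le> (\<delta> / 3) / v R" using w_small[of "(\<delta> / 3) / v R"] v(2)[of R] \<delta> by auto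
  define I where "I = \<lceil>R / h\<rceil>"
  \<comment> \<open>Entries of Q are rounded at scale \<open>\<delta> * s\<close>, which by the
    lower bound s amounts to a factor \<open>exp \<delta>\<close>. Log-densities get a third of
    \<open>\<delta>\<close> at grid points; the other two thirds pay for moving each of the two
    densities from z to the grid.\<close>
  define \<kappa> where "\<kappa> p = (restrict (\<lambda>(x, y). \<lfloor>fst p x y / (\<delta> * s)\<rfloor>) ({1..K'} \<times> {1..K'}),
     restrict (\<lambda>(x, i). \<lfloor>ln (snd p x (h * of_int i)) / (\<delta> / 3)\<rfloor>) ({1..K'} \<times> {- I..I}))"
    for p :: "(nat \<Rightarrow> nat \<Rightarrow> real) \<times> (nat \<Rightarrow> real \<Rightarrow> real)"
  define V where "V = v (h * of_int I)"
  have ds: "0 < \<delta> * s" using \<delta> s by simp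
  have "\<kappa> ` ?P \<subseteq> (({1..K'} \<times> {1..K'}) \<rightarrow>\<^sub>E {0..\<lfloor>1 / (\<delta> * s)\<rfloor>}) \<times> (({1..K'} \<times> {- I..I}) \<rightarrow>\<^sub>E {\<lfloor>- V / (\<delta> / 3)\<rfloor>..\<lfloor>V / (\<delta> / 3)\<rfloor>})"
  proof (rule image_subsetI)
    fix p assume p: "p \<in> ?P"
    then have Q: "stochmat s K' (fst p)" and \<phi>: "emc K' (snd p)" by auto
    have "\<lfloor>fst p x y / (\<delta> * s)\<rfloor> \<in> {0..\<lfloor>1 / (\<delta> * s)\<rfloor>}" if "x \<in> {1..K'}" "y \<in> {1..K'}" for x y
    proof -
      have "s \<le> fst p x y" "fst p x y \<le> 1"
        using stochmat_ge[OF Q that] stochmat_le1[OF Q _ that] s by auto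
      then have "0 \<le> fst p x y / (\<delta> * s)" "fst p x y / (\<delta> * s) \<le> 1 / (\<delta> * s)"
        using ds s by (auto intro!: divide_right_mono divide_nonneg_pos)
      then show ?thesis by (auto intro!: floor_mono simp: zero_le_floor)
    qed
    moreover have "\<lfloor>ln (snd p x (h * of_int i)) / (\<delta> / 3)\<rfloor> \<in> {\<lfloor>- V / (\<delta> / 3)\<rfloor>..\<lfloor>V / (\<delta> / 3)\<rfloor>}"
      if x: "x \<in> {1..K'}" and i: "i \<in> {- I..I}" for x i
    proof -
      have "\<bar>of_int i\<bar> \<le> (of_int I :: real)" using i by (simp add: abs_le_iff)
      then have "\<bar>h * of_int i\<bar> \<le> h * of_int I" using h by (simp add: abs_mult)
      then have "\<bar>ln (snd p x (h * of_int i))\<bar> \<le> V"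
        unfolding V_def using emcD(2)[OF \<phi> x, of "h * of_int i"] v_le by (meson order.trans)
      then have "- V \<le> ln (snd p x (h * of_int i))" "ln (snd p x (h * of_int i)) \<le> V" by linarith+
      then have "- V / (\<delta> / 3) \<le> ln (snd p x (h * of_int i)) / (\<delta> / 3)" "ln (snd p x (h * of_int i)) / (\<delta> / 3) \<le> V / (\<delta> / 3)"
        by (intro divide_right_mono; use \<delta> in simp)+
      then show ?thesis by (auto intro!: floor_mono simp del: divide_divide_eq_right)
    qed
    ultimately show "\<kappa> p \<in> (({1..K'} \<times> {1..K'}) \<rightarrow>\<^sub>E {0..\<lfloor>1 / (\<delta> * s)\<rfloor>}) \<times> (({1..K'} \<times> {- I..I}) \<rightarrow>\<^sub>E {\<lfloor>- V / (\<delta> / 3)\<rfloor>..\<lfloor>V / (\<delta> / 3)\<rfloor>})"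
      unfolding \<kappa>_def by (intro SigmaI restrict_PiE_iff[THEN iffD2] ballI) (auto simp del: divide_divide_eq_right)
  qed
  then have "finite (\<kappa> ` ?P)" by (rule finite_subset) (intro finite_cartesian_product finite_PiE, auto)
  from finite_net[OF this] obtain N where N: "N \<subseteq> ?P" "finite N" "\<forall>p\<in>?P. \<exists>p'\<in>N. \<kappa> p = \<kappa> p'" by auto
  show ?thesis
  proof (intro exI[of _ N] conjI allI impI)
    fix Q \<phi> assume a: "stochmat s K' Q \<and> emc K' \<phi>"
    then have "(Q, \<phi>) \<in> ?P" by simp
    then obtain p' where p': "p' \<in> N" "\<kappa> (Q, \<phi>) = \<kappa> p'" using N(3) by blast
    obtain Q' \<phi>' where p'eq: "p' = (Q', \<phi>')" by (cases p')
    have a': "stochmat s K' Q'" "emc K' \<phi>'" using p' N(1) p'eq by auto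
    have k1: "restrict (\<lambda>(x, y). \<lfloor>Q x y / (\<delta> * s)\<rfloor>) ({1..K'} \<times> {1..K'}) = restrict (\<lambda>(x, y). \<lfloor>Q' x y / (\<delta> * s)\<rfloor>) ({1..K'} \<times> {1..K'})"
      and k2: "restrict (\<lambda>(x, i). \<lfloor>ln (\<phi> x (h * of_int i)) / (\<delta> / 3)\<rfloor>) ({1..K'} \<times> {- I..I}) = restrict (\<lambda>(x, i). \<lfloor>ln (\<phi>' x (h * of_int i)) / (\<delta> / 3)\<rfloor>) ({1..K'} \<times> {- I..I})"
      using p'(2) unfolding \<kappa>_def p'eq by simp_all
    have "Q x y \<le> exp \<delta> * Q' x y \<and> Q' x y \<le> exp \<delta> * Q x y" if "x \<in> {1..K'}" "y \<in> {1..K'}" for x y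
    proof -
      have "\<lfloor>Q x y / (\<delta> * s)\<rfloor> = \<lfloor>Q' x y / (\<delta> * s)\<rfloor>" using fun_cong[OF k1, of "(x, y)"] that by simp
      then show ?thesis using a a' \<delta> that by (intro stochmat_exp_close floor_eq_close ds) auto
    qed
    moreover have "\<bar>ln (\<phi> x z) - ln (\<phi>' x z)\<bar> \<le> \<delta>" if x: "x \<in> {1..K'}" and z: "\<bar>z\<bar> \<le> R" for x z
    proof -
      define i where "i = \<lfloor>z / h\<rfloor>"
      have "i \<in> {- I..I}"
      proof -
        have "- (R / h) \<le> z / h" "z / h \<le> R / h" using z h by (simp_all add: field_simps abs_le_iff)
        moreover have "of_int i \<le> z / h" "R / h \<le> of_int I" unfolding i_def I_def by linarith+
        moreover have "z / h < of_int i + 1" unfolding i_def by linarith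
        ultimately have "of_int i \<le> (of_int I :: real)" "of_int (- I) < (of_int (i + 1) :: real)" by simp_all
        then show ?thesis unfolding of_int_le_iff of_int_less_iff by simp
      qed
      then have "\<lfloor>ln (\<phi> x (h * of_int i)) / (\<delta> / 3)\<rfloor> = \<lfloor>ln (\<phi>' x (h * of_int i)) / (\<delta> / 3)\<rfloor>"
        using fun_cong[OF k2, of "(x, i)"] x by simp
      then have 1: "\<bar>ln (\<phi> x (h * of_int i)) - ln (\<phi>' x (h * of_int i))\<bar> \<le> \<delta> / 3"
        using \<delta> by (intro floor_eq_close) auto
      have 2: "\<bar>ln (\<psi> x z) - ln (\<psi> x (h * of_int i))\<bar> \<le> \<delta> / 3" if "emc K' \<psi>" for \<psi>
      proof -
        have "\<bar>ln (\<psi> x z) - ln (\<psi> x (h * of_int i))\<bar> \<le> v \<bar>z\<bar> * w \<bar>z - h * of_int i\<bar>" by (rule emcD(3)[OF that x])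
        also have "\<dots> \<le> v R * w h"
          using z floor_grid_close[OF h(1), of z] unfolding i_def
          by (intro mult_mono v_le w(1) v_nonneg w_nonneg) auto
        also have "\<dots> \<le> v R * ((\<delta> / 3) / v R)" using h v_nonneg by (intro mult_left_mono) auto
        also have "\<dots> = \<delta> / 3" using v(2)[of R] by simp
        finally show ?thesis .
      qed
      show ?thesis using 1 2[of \<phi>] 2[of \<phi>'] a a' by linarith
    qed
    ultimately show "\<exists>(Q', \<phi>')\<in>N.
        (\<forall>x\<in>{1..K'}. \<forall>y\<in>{1..K'}. Q x y \<le> exp \<delta> * Q' x y \<and> Q' x y \<le> exp \<delta> * Q x y) \<and>
        (\<forall>x\<in>{1..K'}. \<forall>z. \<bar>z\<bar> \<le> R \<longrightarrow> \<bar>ln (\<phi> x z) - ln (\<phi>' x z)\<bar> \<le> \<delta>)"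
      using p'(1) unfolding p'eq by (intro bexI[of _ "(Q', \<phi>')"]) auto
  qed (use N in auto)
qed

text \<open>The nets are deterministic, so pointwise convergence on all of them excludes a null set
  only. Passing from a parameter to its representative costs
  \<open>2 * \<delta> j + 2 * \<tau> j\<close> both in the log-likelihood and in the limit, on the
  event \<open>good\<close>, and j is chosen last.\<close>

lemma uniform_convergence:
  assumes K': "1 \<le> K'" and bb: "covers K' bb"
  shows "AE \<omega> in M. \<forall>\<epsilon>>0. \<forall>\<^sub>F n in sequentially. \<forall>Q \<phi>. stochmat s K' Q \<and> emc K' \<phi> \<longrightarrow>
     \<bar>seglik K' Q (em \<phi> bb \<omega>) 0 n - real n * lam K' Q \<phi> bb\<bar> \<le> real n * \<epsilon>"
proof -
  define \<delta> where "\<delta> j = 1 / real (Suc j)" for j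
  have \<delta>: "0 < \<delta> j" for j by (simp add: \<delta>_def)
  have "\<exists>N. N \<subseteq> {(Q, \<phi>). stochmat s K' Q \<and> emc K' \<phi>} \<and> finite N \<and>
     (\<forall>Q \<phi>. stochmat s K' Q \<and> emc K' \<phi> \<longrightarrow> (\<exists>(Q', \<phi>')\<in>N.
        (\<forall>x\<in>{1..K'}. \<forall>y\<in>{1..K'}. Q x y \<le> exp (\<delta> j) * Q' x y \<and> Q' x y \<le> exp (\<delta> j) * Q x y) \<and>
        (\<forall>x\<in>{1..K'}. \<forall>z. \<bar>z\<bar> \<le> real j + dl \<longrightarrow> \<bar>ln (\<phi> x z) - ln (\<phi>' x z)\<bar> \<le> \<delta> j)))" for j
    using parameter_net[OF \<delta>, of "real j + dl" K' j] dl_nonneg K' by auto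
  then have "\<forall>j. \<exists>N. N \<subseteq> {(Q, \<phi>). stochmat s K' Q \<and> emc K' \<phi>} \<and> finite N \<and>
     (\<forall>Q \<phi>. stochmat s K' Q \<and> emc K' \<phi> \<longrightarrow> (\<exists>(Q', \<phi>')\<in>N.
        (\<forall>x\<in>{1..K'}. \<forall>y\<in>{1..K'}. Q x y \<le> exp (\<delta> j) * Q' x y \<and> Q' x y \<le> exp (\<delta> j) * Q x y) \<and>
        (\<forall>x\<in>{1..K'}. \<forall>z. \<bar>z\<bar> \<le> real j + dl \<longrightarrow> \<bar>ln (\<phi> x z) - ln (\<phi>' x z)\<bar> \<le> \<delta> j)))" by blast
  from choice[OF this] obtain N where N0: "\<forall>j. N j \<subseteq> {(Q, \<phi>). stochmat s K' Q \<and> emc K' \<phi>} \<and> finite (N j) \<and>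
     (\<forall>Q \<phi>. stochmat s K' Q \<and> emc K' \<phi> \<longrightarrow> (\<exists>(Q', \<phi>')\<in>N j.
        (\<forall>x\<in>{1..K'}. \<forall>y\<in>{1..K'}. Q x y \<le> exp (\<delta> j) * Q' x y \<and> Q' x y \<le> exp (\<delta> j) * Q x y) \<and>
        (\<forall>x\<in>{1..K'}. \<forall>z. \<bar>z\<bar> \<le> real j + dl \<longrightarrow> \<bar>ln (\<phi> x z) - ln (\<phi>' x z)\<bar> \<le> \<delta> j)))" ..
  have N: "N j \<subseteq> {(Q, \<phi>). stochmat s K' Q \<and> emc K' \<phi>}" "finite (N j)" for j
    by (rule conjunct1[OF spec[OF N0]] conjunct1[OF conjunct2[OF spec[OF N0]]])+
  have N3: "\<exists>Q' \<phi>'. (Q', \<phi>') \<in> N j \<and>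
        (\<forall>x\<in>{1..K'}. \<forall>y\<in>{1..K'}. Q x y \<le> exp (\<delta> j) * Q' x y \<and> Q' x y \<le> exp (\<delta> j) * Q x y) \<and>
        (\<forall>x\<in>{1..K'}. \<forall>z. \<bar>z\<bar> \<le> real j + dl \<longrightarrow> \<bar>ln (\<phi> x z) - ln (\<phi>' x z)\<bar> \<le> \<delta> j)"
    if "stochmat s K' Q \<and> emc K' \<phi>" for j Q \<phi>
    using spec[OF N0, of j] that by (elim conjE allE[of _ Q] allE[of _ \<phi>]) fast
  have "AE \<omega> in M. \<forall>p\<in>N j. (\<lambda>n. seglik K' (fst p) (em (snd p) bb \<omega>) 0 n / real n) \<longlonglongrightarrow> lam K' (fst p) (snd p) bb" for j
  proof (subst AE_finite_all[OF N(2)], intro ballI)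
    fix p assume "p \<in> N j"
    then have "stochmat s K' (fst p)" "emc K' (snd p)" using N(1)[of j] by auto
    then show "AE \<omega> in M. (\<lambda>n. seglik K' (fst p) (em (snd p) bb \<omega>) 0 n / real n) \<longlonglongrightarrow> lam K' (fst p) (snd p) bb"
      using K' bb by (intro lam_converges)
  qed
  then have "AE \<omega> in M. \<forall>j. \<forall>p\<in>N j. (\<lambda>n. seglik K' (fst p) (em (snd p) bb \<omega>) 0 n / real n) \<longlonglongrightarrow> lam K' (fst p) (snd p) bb"
    unfolding AE_all_countable by blast
  then show ?thesis using AE_good
  proof eventually_elim
    fix \<omega> assume lim: "\<forall>j. \<forall>p\<in>N j. (\<lambda>n. seglik K' (fst p) (em (snd p) bb \<omega>) 0 n / real n) \<longlonglongrightarrow> lam K' (fst p) (snd p) bb"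
      and g: "good \<omega>"
    show "\<forall>\<epsilon>>0. \<forall>\<^sub>F n in sequentially. \<forall>Q \<phi>. stochmat s K' Q \<and> emc K' \<phi> \<longrightarrow>
       \<bar>seglik K' Q (em \<phi> bb \<omega>) 0 n - real n * lam K' Q \<phi> bb\<bar> \<le> real n * \<epsilon>"
    proof (intro allI impI)
      fix \<epsilon> :: real assume \<epsilon>: "0 < \<epsilon>"
      have "(\<lambda>j. 4 * inverse (real (Suc j)) + 4 * \<tau> j) \<longlonglongrightarrow> 4 * 0 + 4 * 0"
        by (intro tendsto_intros tau_tendsto LIMSEQ_inverse_real_of_nat)
      then have "\<forall>\<^sub>F j in sequentially. 4 * inverse (real (Suc j)) + 4 * \<tau> j < \<epsilon> / 2"
        using \<epsilon> by (intro order_tendstoD) auto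
      then obtain j where j: "4 * \<delta> j + 4 * \<tau> j < \<epsilon> / 2"
        using eventually_happens'[OF trivial_limit_sequentially] by (auto simp: \<delta>_def inverse_eq_divide)
      have "\<forall>\<^sub>F n in sequentially. \<forall>p\<in>N j. dist (seglik K' (fst p) (em (snd p) bb \<omega>) 0 n / real n) (lam K' (fst p) (snd p) bb) < \<epsilon> / 2"
        using lim \<epsilon> by (intro eventually_ball_finite N(2) ballI tendstoD) auto
      moreover have "\<forall>\<^sub>F n in sequentially. (\<Sum>t=1..n. tail (real j) t \<omega>) / real n \<le> \<tau> j" using g unfolding good_def by blast
      ultimately show "\<forall>\<^sub>F n in sequentially. \<forall>Q \<phi>. stochmat s K' Q \<and> emc K' \<phi> \<longrightarrow>
         \<bar>seglik K' Q (em \<phi> bb \<omega>) 0 n - real n * lam K' Q \<phi> bb\<bar> \<le> real n * \<epsilon>"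
        using eventually_gt_at_top[of 0]
      proof eventually_elim
        case (elim n)
        show ?case
        proof (intro allI impI)
          fix Q \<phi> assume a: "stochmat s K' Q \<and> emc K' \<phi>"
          then obtain Q' \<phi>' where p': "(Q', \<phi>') \<in> N j"
            and close: "\<And>x y. x \<in> {1..K'} \<Longrightarrow> y \<in> {1..K'} \<Longrightarrow> Q x y \<le> exp (\<delta> j) * Q' x y \<and> Q' x y \<le> exp (\<delta> j) * Q x y"
              "\<And>x z. x \<in> {1..K'} \<Longrightarrow> \<bar>z\<bar> \<le> real j + dl \<Longrightarrow> \<bar>ln (\<phi> x z) - ln (\<phi>' x z)\<bar> \<le> \<delta> j"
            using N3[OF a, of j] by blast
          have a': "stochmat s K' Q'" "emc K' \<phi>'" using p' N(1)[of j] by auto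
          have 1: "\<bar>seglik K' Q (em \<phi> bb \<omega>) 0 n - seglik K' Q' (em \<phi>' bb \<omega>) 0 n\<bar> \<le> real n * (2 * \<delta> j + 2 * \<tau> j)"
            using a a' \<delta>[of j] elim by (intro em_diff_close[OF g K' _ _ bb] close) auto
          have 2: "\<bar>lam K' Q \<phi> bb - lam K' Q' \<phi>' bb\<bar> \<le> 2 * \<delta> j + 2 * \<tau> j"
            using a a' K' bb close \<delta>[of j] by (intro lam_diff_close) auto
          have "\<bar>real n * lam K' Q \<phi> bb - real n * lam K' Q' \<phi>' bb\<bar> = real n * \<bar>lam K' Q \<phi> bb - lam K' Q' \<phi>' bb\<bar>"
            by (simp add: abs_mult flip: right_diff_distrib)
          also have "\<dots> \<le> real n * (2 * \<delta> j + 2 * \<tau> j)" using 2 by (rule mult_left_mono) simp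
          finally have lamd: "\<bar>real n * lam K' Q \<phi> bb - real n * lam K' Q' \<phi>' bb\<bar> \<le> real n * (2 * \<delta> j + 2 * \<tau> j)" .
          have "\<bar>seglik K' Q' (em \<phi>' bb \<omega>) 0 n / real n - lam K' Q' \<phi>' bb\<bar> < \<epsilon> / 2"
            using elim(1) p' unfolding dist_real_def by force
          then have "real n * \<bar>seglik K' Q' (em \<phi>' bb \<omega>) 0 n / real n - lam K' Q' \<phi>' bb\<bar> \<le> real n * (\<epsilon> / 2)"
            by (intro mult_left_mono) auto
          moreover have "real n * \<bar>seglik K' Q' (em \<phi>' bb \<omega>) 0 n / real n - lam K' Q' \<phi>' bb\<bar> = \<bar>seglik K' Q' (em \<phi>' bb \<omega>) 0 n - real n * lam K' Q' \<phi>' bb\<bar>"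
          proof -
            have "real n * \<bar>x\<bar> = \<bar>real n * x\<bar>" for x by (simp add: abs_mult)
            then show ?thesis using elim(3) by (simp add: right_diff_distrib)
          qed
          ultimately have 3: "\<bar>seglik K' Q' (em \<phi>' bb \<omega>) 0 n - real n * lam K' Q' \<phi>' bb\<bar> \<le> real n * (\<epsilon> / 2)" by simp
          have "real n * (4 * \<delta> j + 4 * \<tau> j) \<le> real n * (\<epsilon> / 2)" using j by (intro mult_left_mono) auto
          then have "real n * (2 * \<delta> j + 2 * \<tau> j) + real n * (2 * \<delta> j + 2 * \<tau> j) + real n * (\<epsilon> / 2) \<le> real n * \<epsilon>"
            by (simp add: algebra_simps)
          then show "\<bar>seglik K' Q (em \<phi> bb \<omega>) 0 n - real n * lam K' Q \<phi> bb\<bar> \<le> real n * \<epsilon>"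
            using 1 lamd 3 by linarith
        qed
      qed
    qed
  qed
qed

end

section \<open>Slowly varying emission densities\<close>

text \<open>Oscillation is measured from the left end of each step because that is where the
  emissions of a time block will be frozen.\<close>

lemma integral_step_approx:
  fixes f :: "real \<Rightarrow> real"
  assumes J: "0 < J" and f: "continuous_on {0..1} f"
    and osc: "\<And>j u. j < J \<Longrightarrow> real j / real J \<le> u \<Longrightarrow> u \<le> real (Suc j) / real J \<Longrightarrow> \<bar>f u - f (real j / real J)\<bar> \<le> \<eta>"
  shows "\<bar>integral {0..1} f - (\<Sum>j<J. f (real j / real J)) / real J\<bar> \<le> \<eta>"
proof -
  have part: "\<bar>integral {0..real k / real J} f - (\<Sum>j<k. f (real j / real J)) / real J\<bar> \<le> real k * (\<eta> / real J)" if "k \<le> J" for k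
    using that
  proof (induction k)
    case (Suc k)
    let ?a = "real k / real J" and ?b = "real (Suc k) / real J"
    have ab: "0 \<le> ?a" "?a \<le> ?b" "?b \<le> 1" "?b - ?a = 1 / real J"
      using Suc.prems J by (auto simp: divide_simps)
    have int: "f integrable_on {x..y}" if "0 \<le> x" "y \<le> 1" for x y
      using f that by (intro integrable_continuous_interval) (auto intro: continuous_on_subset)
    have "integral {0..?b} f = integral {0..?a} f + integral {?a..?b} f"
      using ab by (intro Henstock_Kurzweil_Integration.integral_combine[symmetric] int) auto
    moreover have "\<bar>integral {?a..?b} f - f ?a / real J\<bar> \<le> \<eta> / real J"
    proof -
      have "integral {?a..?b} (\<lambda>u. f u - f ?a) = integral {?a..?b} f - f ?a * (?b - ?a)"
        using ab int[of ?a ?b] by (subst Henstock_Kurzweil_Integration.integral_diff) (auto simp: mult.commute)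
      moreover have "norm (integral {?a..?b} (\<lambda>u. f u - f ?a)) \<le> \<eta> * (?b - ?a)"
      proof (rule integral_bound)
        have "continuous_on {?a..?b} f" 
          by (rule continuous_on_subset[OF f]) (use ab(1,3) in \<open>simp only: atLeastatMost_subset_iff simp_thms\<close>)
        then show "continuous_on {?a..?b} (\<lambda>u. f u - f ?a)" by (intro continuous_intros)
        show "norm (f u - f ?a) \<le> \<eta>" if "u \<in> {?a..?b}" for u using osc[of k u] Suc.prems that by simp
      qed (use ab in simp)
      ultimately show ?thesis using ab by simp
    qed
    moreover have "\<bar>integral {0..?a} f - (\<Sum>j<k. f (real j / real J)) / real J\<bar> \<le> real k * (\<eta> / real J)"
      using Suc by simp
    ultimately have "\<bar>integral {0..?b} f - ((\<Sum>j<k. f (real j / real J)) / real J + f ?a / real J)\<bar> \<le> real k * (\<eta> / real J) + \<eta> / real J"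
      by linarith
    then show ?case by (simp add: add_divide_distrib algebra_simps)
  qed simp
  show ?thesis using part[of J] J by simp
qed

context hidden_chain
begin

text \<open>The limiting frequency of a state is positive by the Doeblin lower bound, which excludes
  trajectories that never meet it. Again a constant quantiser reduces the observation to the hidden
  chain.\<close>

lemma AE_visits:
  assumes x: "x \<in> {1..Ks}"
  shows "AE \<omega> in M. \<exists>t\<ge>1. X t \<omega> = x"
proof -
  let ?q = "\<lambda>_::real. 0 :: int"
  have qm: "?q -` {c} \<in> sets borel" and qf: "finite (range ?q)" for c by (auto simp: vimage_def)
  interpret ch: doeblin_chain M "\<lambda>i. qobs ?q (Suc i)" "{1..Ks} \<times> range ?q" "\<lambda>(x, c). pis x * qprob ?q x c"
    "\<lambda>(x, c) (x', c'). Qs x x' * qprob ?q x' c'" "\<lambda>(x, c). qprob ?q x c / Ks" "s * Ks"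
    by (rule qobs_chain[OF qm qf])
  obtain q where q: "\<And>u. u \<in> {1..Ks} \<times> range ?q \<Longrightarrow> s * Ks * (case u of (x, c) \<Rightarrow> qprob ?q x c / Ks) \<le> q u"
    and lim: "AE \<omega> in M. \<forall>u\<in>{1..Ks} \<times> range ?q. (\<lambda>N. (\<Sum>i<N. if qobs ?q (Suc i) \<omega> = u then 1 else 0) / real N) \<longlonglongrightarrow> q u"
    using ch.frequencies_converge by blast
  have "qprob ?q x 0 = 1" using sum_qprob[OF qm qf x] by simp
  then have qx: "0 < q (x, 0)" using q[of "(x, 0)"] x Ks s by auto
  from lim show ?thesis
  proof eventually_elim
    fix \<omega> assume l: "\<forall>u\<in>{1..Ks} \<times> range ?q. (\<lambda>N. (\<Sum>i<N. if qobs ?q (Suc i) \<omega> = u then 1 else 0) / real N) \<longlonglongrightarrow> q u"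
    show "\<exists>t\<ge>1. X t \<omega> = x"
    proof (rule ccontr)
      assume "\<not> ?thesis"
      then have "qobs ?q (Suc i) \<omega> \<noteq> (x, 0)" for i by (auto simp: qobs_def[OF qm qf])
      moreover have "(\<lambda>N. (\<Sum>i<N. if qobs ?q (Suc i) \<omega> = (x, 0) then 1 else 0) / real N) \<longlonglongrightarrow> q (x, 0)"
        using l x by auto
      ultimately have "(\<lambda>N::nat. 0::real) \<longlonglongrightarrow> q (x, 0)" by simp
      then have "q (x, 0) = 0" by (simp add: LIMSEQ_const_iff)
      then show False using qx by simp
    qed
  qed
qed

definition uconv :: "nat \<Rightarrow> (nat \<Rightarrow> nat set) \<Rightarrow> 'a \<Rightarrow> bool" where
  "uconv K' bb \<omega> \<longleftrightarrow> (\<forall>\<epsilon>>0. \<forall>\<^sub>F n in sequentially. \<forall>Q \<phi>. stochmat s K' Q \<and> emc K' \<phi> \<longrightarrow>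
     \<bar>seglik K' Q (em \<phi> bb \<omega>) 0 n - real n * lam K' Q \<phi> bb\<bar> \<le> real n * \<epsilon>)"

text \<open>Lengths beyond a threshold are covered by \<open>uconv\<close>; below it both the
  log-likelihood and its limit are bounded by a constant independent of the parameters, which n
  \<open>\<epsilon>\<close> eventually exceeds.\<close>

lemma uconv_initial:
  assumes g: "good \<omega>" and K': "1 \<le> K'" and bb: "covers K' bb" and uc: "uconv K' bb \<omega>" and \<epsilon>: "0 < \<epsilon>"
  shows "\<forall>\<^sub>F n in sequentially. \<forall>k\<le>n. \<forall>Q \<phi>. stochmat s K' Q \<and> emc K' \<phi> \<longrightarrow>
     \<bar>seglik K' Q (em \<phi> bb \<omega>) 0 k - real k * lam K' Q \<phi> bb\<bar> \<le> real n * \<epsilon>"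
proof -
  obtain N where N: "\<And>k Q \<phi>. N \<le> k \<Longrightarrow> stochmat s K' Q \<and> emc K' \<phi> \<Longrightarrow>
     \<bar>seglik K' Q (em \<phi> bb \<omega>) 0 k - real k * lam K' Q \<phi> bb\<bar> \<le> real k * \<epsilon>"
    using uc \<epsilon> unfolding uconv_def eventually_sequentially by blast
  define C where "C = ln K' + (\<Sum>t=1..N. v (\<bar>Zt t \<omega>\<bar> + dl) + \<bar>ln s\<bar>) + real N * CL"
  obtain n0 :: nat where n0: "C / \<epsilon> \<le> real n0" using real_arch_simple by blast
  show ?thesis
  proof (rule eventually_sequentiallyI[of n0], intro allI impI)
    fix n k Q \<phi> assume n: "n0 \<le> n" and k: "k \<le> n" and a: "stochmat s K' Q \<and> emc K' \<phi>"
    have "C / \<epsilon> \<le> real n" using n0 n by (meson of_nat_le_iff order.trans)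
    then have Cn: "C \<le> real n * \<epsilon>" using \<epsilon> by (simp add: field_simps)
    show "\<bar>seglik K' Q (em \<phi> bb \<omega>) 0 k - real k * lam K' Q \<phi> bb\<bar> \<le> real n * \<epsilon>"
    proof (cases "N \<le> k")
      case True
      have "real k * \<epsilon> \<le> real n * \<epsilon>" using k \<epsilon> by simp
      then show ?thesis using N[OF True a] by linarith
    next
      case False
      have "\<bar>seglik K' Q (em \<phi> bb \<omega>) 0 k\<bar> \<le> ln K' + (\<Sum>t=1..k. v (\<bar>Zt t \<omega>\<bar> + dl) - ln s)"
        using a by (intro em_seglik_bound[OF g K' _ _ bb]) auto
      also have "(\<Sum>t=1..k. v (\<bar>Zt t \<omega>\<bar> + dl) - ln s) \<le> (\<Sum>t=1..k. v (\<bar>Zt t \<omega>\<bar> + dl) + \<bar>ln s\<bar>)"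
        by (intro sum_mono) linarith
      also have "\<dots> \<le> (\<Sum>t=1..N. v (\<bar>Zt t \<omega>\<bar> + dl) + \<bar>ln s\<bar>)"
        using False v_nonneg by (intro sum_mono2) (auto intro!: add_nonneg_nonneg)
      finally have 1: "\<bar>seglik K' Q (em \<phi> bb \<omega>) 0 k\<bar> \<le> ln K' + (\<Sum>t=1..N. v (\<bar>Zt t \<omega>\<bar> + dl) + \<bar>ln s\<bar>)" by simp
      have "\<bar>lam K' Q \<phi> bb\<bar> \<le> CL" using a by (intro lam_bound[OF K' _ _ bb]) auto
      then have "real k * \<bar>lam K' Q \<phi> bb\<bar> \<le> real N * CL" using False by (intro mult_mono) auto
      then have "\<bar>real k * lam K' Q \<phi> bb\<bar> \<le> real N * CL" by (simp add: abs_mult)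
      then show ?thesis using 1 Cn unfolding C_def by linarith
    qed
  qed
qed

text \<open>The emissions are frozen at the left end of each of J time blocks. Freezing changes the
  log-likelihood by at most n \<open>CV * \<eta>\<close>, and replacing the Riemann sum by the
  integral costs the same again; hence \<open>2 * CV * \<eta>\<close>. The threshold for n is chosen
  before Q, \<open>\<psi>\<close> and \<open>\<eta>\<close>.\<close>

lemma varying_emission:
  assumes g: "good \<omega>" and K': "1 \<le> K'" and bb: "covers K' bb" and uc: "uconv K' bb \<omega>" and \<epsilon>: "0 < \<epsilon>" and J: "0 < J"
  shows "\<forall>\<^sub>F n in sequentially. \<forall>Q \<psi> \<eta>. stochmat s K' Q \<longrightarrow> (\<forall>u\<in>{0..1}. emc K' (\<psi> u)) \<longrightarrow> 0 \<le> \<eta> \<longrightarrow>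
     (\<forall>u\<in>{0..1}. \<forall>u'\<in>{0..1}. \<bar>u - u'\<bar> \<le> 1 / real J \<longrightarrow> (\<forall>x\<in>{1..K'}. \<forall>z. \<bar>ln (\<psi> u x z) - ln (\<psi> u' x z)\<bar> \<le> v \<bar>z\<bar> * \<eta>)) \<longrightarrow>
     continuous_on {0..1} (\<lambda>u. lam K' Q (\<psi> u) bb) \<longrightarrow>
     \<bar>seglik K' Q (\<lambda>t. em (\<psi> (min 1 (real t / real n))) bb \<omega> t) 0 n - real n * integral {0..1} (\<lambda>u. lam K' Q (\<psi> u) bb)\<bar>
       \<le> real n * (\<epsilon> + 2 * CV * \<eta>)"
proof -
  \<comment> \<open>Each of the J blocks is a difference of two initial segments, so the errors add
    up to n \<open>\<epsilon>\<close> / 2.\<close>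
  have \<epsilon>': "0 < \<epsilon> / (4 * real J)" using \<epsilon> J by simp
  define C where "C = ln K' + 2 * real J * (- ln s) + real J * CL"
  obtain n0 :: nat where n0: "2 * C / \<epsilon> \<le> real n0" using real_arch_simple by blast
  show ?thesis
    using uconv_initial[OF g K' bb uc \<epsilon>'] good_CV[OF g] eventually_ge_at_top[of "max 1 n0"]
  proof eventually_elim
    fix n
    assume ub: "\<forall>k\<le>n. \<forall>Q \<phi>. stochmat s K' Q \<and> emc K' \<phi> \<longrightarrow>
     \<bar>seglik K' Q (em \<phi> bb \<omega>) 0 k - real k * lam K' Q \<phi> bb\<bar> \<le> real n * (\<epsilon> / (4 * real J))"
      and V: "(\<Sum>t=1..n. v (\<bar>Zt t \<omega>\<bar> + dl)) \<le> real n * CV" and n: "max 1 n0 \<le> n"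
    have n1: "0 < n" and "2 * C / \<epsilon> \<le> real n" using n n0 by auto
    then have Cn: "C \<le> real n * (\<epsilon> / 2)" using \<epsilon> by (simp add: field_simps)
    show "\<forall>Q \<psi> \<eta>. stochmat s K' Q \<longrightarrow> (\<forall>u\<in>{0..1}. emc K' (\<psi> u)) \<longrightarrow> 0 \<le> \<eta> \<longrightarrow>
     (\<forall>u\<in>{0..1}. \<forall>u'\<in>{0..1}. \<bar>u - u'\<bar> \<le> 1 / real J \<longrightarrow> (\<forall>x\<in>{1..K'}. \<forall>z. \<bar>ln (\<psi> u x z) - ln (\<psi> u' x z)\<bar> \<le> v \<bar>z\<bar> * \<eta>)) \<longrightarrow>
     continuous_on {0..1} (\<lambda>u. lam K' Q (\<psi> u) bb) \<longrightarrow>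
     \<bar>seglik K' Q (\<lambda>t. em (\<psi> (min 1 (real t / real n))) bb \<omega> t) 0 n - real n * integral {0..1} (\<lambda>u. lam K' Q (\<psi> u) bb)\<bar>
       \<le> real n * (\<epsilon> + 2 * CV * \<eta>)"
    proof (intro allI impI)
      fix Q \<psi> \<eta>
      assume Q: "stochmat s K' Q" and \<psi>: "\<forall>u\<in>{0..1}. emc K' (\<psi> u)" and \<eta>: "0 \<le> \<eta>"
        and md: "\<forall>u\<in>{0..1}. \<forall>u'\<in>{0..1}. \<bar>u - u'\<bar> \<le> 1 / real J \<longrightarrow> (\<forall>x\<in>{1..K'}. \<forall>z. \<bar>ln (\<psi> u x z) - ln (\<psi> u' x z)\<bar> \<le> v \<bar>z\<bar> * \<eta>)"
        and cont: "continuous_on {0..1} (\<lambda>u. lam K' Q (\<psi> u) bb)"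
      \<comment> \<open>The minimum with 1 only acts for t > n, outside the segment:
        \<open>hmmseq\<close> asks for admissible emissions at all times.\<close>
      define e where "e t = em (\<psi> (min 1 (real t / real n))) bb \<omega> t" for t
      define l where "l u = lam K' Q (\<psi> u) bb" for u
      define uj where "uj j = real j / real J" for j
      have uj01: "uj j \<in> {0..1}" if "j < J" for j using that J by (auto simp: uj_def divide_simps)
      have mt: "min 1 (real t / real n) \<in> {0..1}" for t by auto
      have h: "hmmseq s K' Q e"
      proof
        fix t :: nat assume t: "1 \<le> t"
        have "X t \<omega> \<in> {1..Ks}" using g t unfolding good_def by blast
        then obtain y where "y \<in> {1..K'}" "bb y = blk (X t \<omega>)" using bb unfolding covers_def by blast
        then show "\<exists>x\<in>{1..K'}. 0 < e t x" using emcD(1)[OF \<psi>[rule_format, OF mt]] by (intro bexI[of _ y]) (auto simp: e_def em_def)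
        show "0 \<le> e t x" if "x \<in> {1..K'}" for x
          using emcD(1)[OF \<psi>[rule_format, OF mt] that] by (auto simp: e_def em_def less_imp_le)
      qed (use s K' Q in auto)
      interpret h: hmmseq s K' Q e by (rule h)
      \<comment> \<open>The boundaries j n / J rounded down, so that block lengths differ from n / J
        by at most 1.\<close>
      define b where "b j = (j * n) div J" for j
      have b0: "b 0 = 0" and bJ: "b J = n" using J by (auto simp: b_def)
      have bm: "b j \<le> b (Suc j)" for j unfolding b_def by (intro div_le_mono mult_right_mono) auto
      have br: "real (b j) \<le> real j * real n / real J" "real j * real n / real J < real (b j) + 1" for j
      proof -
        have eq: "real_of_int \<lfloor>real (j * n) / real J\<rfloor> = real (b j)" unfolding b_def floor_divide_of_nat_eq by simp
        have "real_of_int \<lfloor>real (j * n) / real J\<rfloor> \<le> real (j * n) / real J" "real (j * n) / real J < real_of_int \<lfloor>real (j * n) / real J\<rfloor> + 1"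
          by linarith+
        then show "real (b j) \<le> real j * real n / real J" "real j * real n / real J < real (b j) + 1" unfolding eq by simp_all
      qed
      have bn: "b j \<le> n" if "j \<le> J" for j
      proof -
        have "j * n \<le> J * n" using that by simp
        then have "b j \<le> (J * n) div J" unfolding b_def by (rule div_le_mono)
        then show ?thesis using J by simp
      qed
      let ?S = "\<lambda>j. seglik K' Q (em (\<psi> (uj j)) bb \<omega>)"
      let ?len = "\<lambda>j. b (Suc j) - b j"
      let ?V = "\<lambda>j. \<Sum>t\<in>{b j + 1..b j + ?len j}. v (\<bar>Zt t \<omega>\<bar> + dl)"
      have blk1: "\<bar>seglik K' Q e (b j) (?len j) - ?S j (b j) (?len j)\<bar> \<le> ?V j * \<eta>" if j: "j < J" for j
      proof -
        have "\<bar>seglik K' Q e (b j) (?len j) - ?S j (b j) (?len j)\<bar> \<le> (\<Sum>t\<in>{b j + 1..b j + ?len j}. v (\<bar>Zt t \<omega>\<bar> + dl) * \<eta>) + real (?len j) * 0"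
        proof (rule seglik_abs_diff[OF h em_hmmseq[OF g K' Q \<psi>[rule_format, OF uj01[OF j]] bb]])
          fix t x assume t: "t \<in> {b j + 1..b j + ?len j}" and x: "x \<in> {1..K'}"
          then have t1: "1 \<le> t" "b j + 1 \<le> t" "t \<le> b (Suc j)" using bm[of j] by auto
          have tn: "t \<le> n" using t1(3) bn[of "Suc j"] j by simp
          then have m1: "min 1 (real t / real n) = real t / real n" using n1 by simp
          have lo: "real j * real n / real J \<le> real t" using br(2)[of j] t1(2) by linarith
          have hi: "real t \<le> real (Suc j) * real n / real J" using br(1)[of "Suc j"] t1(3) by linarith
          have "real j / real J \<le> real t / real n" "real t / real n \<le> real (Suc j) / real J"
            using lo hi n1 J by (simp_all add: field_simps)
          then have "\<bar>real t / real n - uj j\<bar> \<le> 1 / real J"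
            unfolding uj_def by (simp add: add_divide_distrib)
          then have "\<bar>ln (\<psi> (real t / real n) x (Zp t \<omega>)) - ln (\<psi> (uj j) x (Zp t \<omega>))\<bar> \<le> v \<bar>Zp t \<omega>\<bar> * \<eta>"
            using md uj01[OF j] mt[of t] x unfolding m1 by blast
          also have "\<dots> \<le> v (\<bar>Zt t \<omega>\<bar> + dl) * \<eta>" using v_Zp[OF g t1(1)] \<eta> by (rule mult_right_mono)
          finally show "e t x = 0 \<and> em (\<psi> (uj j)) bb \<omega> t x = 0 \<or> 0 < e t x \<and> 0 < em (\<psi> (uj j)) bb \<omega> t x \<and>
             \<bar>ln (e t x) - ln (em (\<psi> (uj j)) bb \<omega> t x)\<bar> \<le> v (\<bar>Zt t \<omega>\<bar> + dl) * \<eta>"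
            using emcD(1)[OF \<psi>[rule_format, OF mt[of t]] x] emcD(1)[OF \<psi>[rule_format, OF uj01[OF j]] x]
            unfolding e_def em_def m1 by auto
        qed auto
        then show ?thesis by (simp add: sum_distrib_right)
      qed
      have blk2: "\<bar>?S j (b j) (?len j) - (real (b (Suc j)) - real (b j)) * l (uj j)\<bar> \<le> - ln s + real n * (\<epsilon> / (2 * real J))" if j: "j < J" for j
      proof -
        have em: "emc K' (\<psi> (uj j))" using \<psi> uj01[OF j] by blast
        interpret hj: hmmseq s K' Q "em (\<psi> (uj j)) bb \<omega>" by (rule em_hmmseq[OF g K' Q em bb])
        have "b (Suc j) = b j + ?len j" using bm[of j] by simp
        then have 1: "\<bar>?S j 0 (b (Suc j)) - ?S j 0 (b j) - ?S j (b j) (?len j)\<bar> \<le> - ln s"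
          using hj.seglik_add_abs[of "b j" "?len j"] by simp
        have "\<bar>?S j 0 k - real k * l (uj j)\<bar> \<le> real n * (\<epsilon> / (4 * real J))" if "k \<le> n" for k
          using ub that Q em unfolding l_def by blast
        from this[OF bn[of j]] this[OF bn[of "Suc j"]]
        have "\<bar>?S j 0 (b j) - real (b j) * l (uj j)\<bar> \<le> real n * (\<epsilon> / (4 * real J))"
          "\<bar>?S j 0 (b (Suc j)) - real (b (Suc j)) * l (uj j)\<bar> \<le> real n * (\<epsilon> / (4 * real J))" using j by auto
        then have "\<bar>?S j (b j) (?len j) - (real (b (Suc j)) * l (uj j) - real (b j) * l (uj j))\<bar> \<le> - ln s + 2 * (real n * (\<epsilon> / (4 * real J)))"
          using 1 by linarith
        moreover have "2 * (real n * (\<epsilon> / (4 * real J))) = real n * (\<epsilon> / (2 * real J))" by simp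
        ultimately show ?thesis by (simp only: left_diff_distrib)
      qed
      have blk3: "\<bar>(real (b (Suc j)) - real (b j)) * l (uj j) - real n / real J * l (uj j)\<bar> \<le> CL" if j: "j < J" for j
      proof -
        have em: "emc K' (\<psi> (uj j))" using \<psi> uj01[OF j] by blast
        have "real (Suc j) * real n / real J = real j * real n / real J + real n / real J"
          by (simp add: add_divide_distrib distrib_right)
        then have "\<bar>real (b (Suc j)) - real (b j) - real n / real J\<bar> \<le> 1" using br[of j] br[of "Suc j"] by linarith
        then have "\<bar>real (b (Suc j)) - real (b j) - real n / real J\<bar> * \<bar>l (uj j)\<bar> \<le> 1 * CL"
          using lam_bound[OF K' Q em bb] unfolding l_def by (intro mult_mono) auto
        then show ?thesis by (simp add: abs_mult[symmetric] left_diff_distrib)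
      qed
      have c1: "\<bar>seglik K' Q e 0 n - (\<Sum>j<J. seglik K' Q e (b j) (?len j))\<bar> \<le> ln K' + real J * (- ln s)"
        using h.seglik_blocks[OF b0 bm, of J] unfolding bJ .
      have c2: "\<bar>(\<Sum>j<J. seglik K' Q e (b j) (?len j)) - (\<Sum>j<J. real n / real J * l (uj j))\<bar>
          \<le> real n * CV * \<eta> + real J * (- ln s + real n * (\<epsilon> / (2 * real J)) + CL)"
      proof -
        have "\<bar>(\<Sum>j<J. seglik K' Q e (b j) (?len j)) - (\<Sum>j<J. real n / real J * l (uj j))\<bar>
           \<le> (\<Sum>j<J. \<bar>seglik K' Q e (b j) (?len j) - real n / real J * l (uj j)\<bar>)"
          unfolding sum_subtractf[symmetric] by (rule sum_abs)
        also have "\<dots> \<le> (\<Sum>j<J. ?V j * \<eta> + (- ln s + real n * (\<epsilon> / (2 * real J)) + CL))"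
        proof (rule sum_mono)
          fix j assume "j \<in> {..<J}"
          then have j: "j < J" by simp
          show "\<bar>seglik K' Q e (b j) (?len j) - real n / real J * l (uj j)\<bar> \<le> ?V j * \<eta> + (- ln s + real n * (\<epsilon> / (2 * real J)) + CL)"
            using blk1[OF j] blk2[OF j] blk3[OF j] by linarith
        qed
        also have "\<dots> = (\<Sum>j<J. ?V j) * \<eta> + real J * (- ln s + real n * (\<epsilon> / (2 * real J)) + CL)"
          by (simp add: sum.distrib sum_distrib_right)
        also have "(\<Sum>j<J. ?V j) = (\<Sum>t=1..n. v (\<bar>Zt t \<omega>\<bar> + dl))"
        proof -
          have "(\<Sum>j<k. ?V j) = (\<Sum>t=1..b k. v (\<bar>Zt t \<omega>\<bar> + dl))" for k
          proof (induction k)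
            case (Suc k)
            have "{1..b (Suc k)} = {1..b k} \<union> {b k + 1..b k + ?len k}" using bm[of k] by auto
            then have "(\<Sum>t=1..b (Suc k). v (\<bar>Zt t \<omega>\<bar> + dl)) = (\<Sum>t=1..b k. v (\<bar>Zt t \<omega>\<bar> + dl)) + ?V k"
              by (simp only:) (rule sum.union_disjoint, auto)
            with Suc show ?case by simp
          qed (simp add: b0)
          then show ?thesis using bJ by simp
        qed
        also have "(\<Sum>t=1..n. v (\<bar>Zt t \<omega>\<bar> + dl)) * \<eta> \<le> real n * CV * \<eta>" using V \<eta> by (rule mult_right_mono)
        finally show ?thesis by simp
      qed
      have c3: "real n * \<bar>integral {0..1} l - (\<Sum>j<J. l (uj j)) / real J\<bar> \<le> real n * (CV * \<eta>)"
      proof (rule mult_left_mono)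
        show "\<bar>integral {0..1} l - (\<Sum>j<J. l (uj j)) / real J\<bar> \<le> CV * \<eta>"
          unfolding uj_def
        proof (rule integral_step_approx[OF J])
          show "continuous_on {0..1} l" using cont unfolding l_def .
          fix j u assume j: "j < J" and u: "real j / real J \<le> u" "u \<le> real (Suc j) / real J"
          have "real (Suc j) / real J \<le> 1" using j J by (simp add: divide_simps)
          then have "u \<le> 1" using u(2) by linarith
          moreover have "0 \<le> real j / real J" by simp
          then have "0 \<le> u" using u(1) by linarith
          ultimately have u01: "u \<in> {0..1}" by simp
          have "\<bar>u - uj j\<bar> \<le> 1 / real J" using u unfolding uj_def by (simp add: add_divide_distrib)
          then show "\<bar>l u - l (real j / real J)\<bar> \<le> CV * \<eta>"
            unfolding l_def uj_def[symmetric] using md u01 uj01[OF j] \<psi> \<eta> by (intro lam_diff_modulus K' Q bb) auto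
        qed
      qed simp
      have c4: "\<bar>(\<Sum>j<J. real n / real J * l (uj j)) - real n * integral {0..1} l\<bar> = real n * \<bar>integral {0..1} l - (\<Sum>j<J. l (uj j)) / real J\<bar>"
      proof -
        have "(\<Sum>j<J. real n / real J * l (uj j)) = real n * ((\<Sum>j<J. l (uj j)) / real J)"
          by (simp add: sum_distrib_left sum_divide_distrib)
        then have "(\<Sum>j<J. real n / real J * l (uj j)) - real n * integral {0..1} l = - (real n * (integral {0..1} l - (\<Sum>j<J. l (uj j)) / real J))"
          by (simp add: right_diff_distrib)
        then show ?thesis by (simp add: abs_mult)
      qed
      have tri: "\<bar>A - D\<bar> \<le> x + y + z"
        if "\<bar>A - B\<bar> \<le> x" "\<bar>B - C\<bar> \<le> y" "r \<le> z" "\<bar>C - D\<bar> = r" for A B C D x y z r :: real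
        using that by linarith
      have fin: "\<bar>seglik K' Q e 0 n - real n * integral {0..1} l\<bar>
         \<le> ln K' + real J * (- ln s) + (real n * CV * \<eta> + real J * (- ln s + real n * (\<epsilon> / (2 * real J)) + CL)) + real n * (CV * \<eta>)"
        by (rule tri[OF c1 c2 c3 c4])
      have "real J * (- ln s + real n * (\<epsilon> / (2 * real J)) + CL) = real J * (- ln s) + real n * (\<epsilon> / 2) + real J * CL"
        using J by (simp add: field_simps)
      with fin have "\<bar>seglik K' Q e 0 n - real n * integral {0..1} l\<bar> \<le> C + real n * (\<epsilon> / 2) + 2 * (real n * CV * \<eta>)"
        unfolding C_def by (simp add: algebra_simps)
      also have "\<dots> \<le> real n * (\<epsilon> + 2 * CV * \<eta>)" using Cn by (simp add: algebra_simps)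
      finally show "\<bar>seglik K' Q (\<lambda>t. em (\<psi> (min 1 (real t / real n))) bb \<omega> t) 0 n - real n * integral {0..1} (\<lambda>u. lam K' Q (\<psi> u) bb)\<bar>
       \<le> real n * (\<epsilon> + 2 * CV * \<eta>)"
        unfolding e_def l_def .
    qed
  qed
qed

end

section \<open>Polynomial trends\<close>

text \<open>Dividing by X - a lowers the degree. The quotient is bounded on the right half of the
  interval, where u - a is at least a' - a, and the coefficients of p are recovered from it and from
  the value at a. As the interval shrinks with each degree, the left end has to be general.\<close>

lemma poly_coeff_bound_interval:
  "0 \<le> a \<Longrightarrow> a < 1 \<Longrightarrow> \<exists>C\<ge>0. \<forall>(p :: real poly) B. degree p \<le> d \<longrightarrow> (\<forall>u\<in>{a..1}. \<bar>poly p u\<bar> \<le> B) \<longrightarrow> (\<forall>i. \<bar>coeff p i\<bar> \<le> C * B)"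
proof (induction d arbitrary: a)
  case 0
  show ?case
  proof (intro exI[of _ 1] conjI allI impI)
    fix p :: "real poly" and B i assume d: "degree p \<le> 0" and b: "\<forall>u\<in>{a..1}. \<bar>poly p u\<bar> \<le> B"
    then obtain c where p: "p = [:c:]" by (auto elim: degree_eq_zeroE)
    then have "\<bar>c\<bar> \<le> B" using b[rule_format, of 1] 0 by simp
    then show "\<bar>coeff p i\<bar> \<le> 1 * B" unfolding p by (cases i) auto
  qed simp
next
  case (Suc d)
  define a' where "a' = (a + 1) / 2"
  have a': "0 \<le> a'" "a' < 1" "a < a'" using Suc.prems by (auto simp: a'_def)
  obtain C where C: "0 \<le> C" "\<And>(p :: real poly) B. degree p \<le> d \<Longrightarrow> (\<forall>u\<in>{a'..1}. \<bar>poly p u\<bar> \<le> B) \<Longrightarrow> (\<forall>i. \<bar>coeff p i\<bar> \<le> C * B)"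
    using Suc.IH[OF a'(1,2)] by blast
  define k where "k = 2 / (a' - a)"
  have k: "0 < k" using a' by (simp add: k_def)
  show ?case
  proof (intro exI[of _ "2 * (C * k) + 1"] conjI allI impI)
    show "0 \<le> 2 * (C * k) + 1" using C k by simp
    fix p :: "real poly" and B i assume d: "degree p \<le> Suc d" and b: "\<forall>u\<in>{a..1}. \<bar>poly p u\<bar> \<le> B"
    let ?r = "synthetic_div p a"
    have dr: "degree ?r \<le> d" using d by (simp add: degree_synthetic_div)
    have pa: "\<bar>poly p a\<bar> \<le> B" using b Suc.prems by auto
    have peq: "p = [:- a, 1:] * ?r + [:poly p a:]" using synthetic_div_correct'[of a p] by simp
    have "\<bar>poly ?r u\<bar> \<le> k * B" if u: "u \<in> {a'..1}" for u
    proof -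
      have "poly p u = (u - a) * poly ?r u + poly p a"
        using arg_cong[OF peq, of "\<lambda>p. poly p u"] by (simp add: algebra_simps)
      then have "\<bar>u - a\<bar> * \<bar>poly ?r u\<bar> = \<bar>poly p u - poly p a\<bar>" by (simp add: abs_mult)
      also have "\<dots> \<le> 2 * B" using b[rule_format, of u] pa u a' by auto
      finally have "\<bar>u - a\<bar> * \<bar>poly ?r u\<bar> \<le> 2 * B" .
      moreover have "(a' - a) * \<bar>poly ?r u\<bar> \<le> \<bar>u - a\<bar> * \<bar>poly ?r u\<bar>" using u a' by (intro mult_right_mono) auto
      ultimately have "(a' - a) * \<bar>poly ?r u\<bar> \<le> 2 * B" by linarith
      then show ?thesis using a' by (simp add: k_def field_simps)
    qed
    then have ci: "\<bar>coeff ?r i\<bar> \<le> C * (k * B)" for i using C(2)[OF dr] by blast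
    have B: "0 \<le> B" using pa by linarith
    have e: "\<bar>a * coeff ?r j\<bar> \<le> C * (k * B)" for j
    proof -
      have "\<bar>a\<bar> * \<bar>coeff ?r j\<bar> \<le> 1 * (C * (k * B))" using ci[of j] Suc.prems by (intro mult_mono) auto
      then show ?thesis by (simp add: abs_mult)
    qed
    have "coeff p i = coeff ([:- a, 1:] * ?r + [:poly p a:]) i" by (rule arg_cong[OF peq])
    also have "\<dots> = - (a * coeff ?r i) + (case i of 0 \<Rightarrow> poly p a | Suc j \<Rightarrow> coeff ?r j)"
      by (cases i) (simp_all add: mult_pCons_left)
    finally have cf: "coeff p i = - (a * coeff ?r i) + (case i of 0 \<Rightarrow> poly p a | Suc j \<Rightarrow> coeff ?r j)" .
    have "\<bar>coeff p i\<bar> \<le> C * (k * B) + (C * (k * B) + B)"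
    proof -
      have "0 \<le> C * (k * B)" using B C k by simp
      show ?thesis
      proof (cases i)
        case 0
        then have "coeff p i = - (a * coeff ?r i) + poly p a" using cf by simp
        then show ?thesis using e[of i] pa \<open>0 \<le> C * (k * B)\<close> by linarith
      next
        case (Suc j)
        then have "coeff p i = - (a * coeff ?r i) + coeff ?r j" using cf by simp
        then show ?thesis using e[of i] ci[of j] B by linarith
      qed
    qed
    then show "\<bar>coeff p i\<bar> \<le> (2 * (C * k) + 1) * B" by (simp add: algebra_simps)
  qed
qed

lemma poly_uniform_Lipschitz:
  "\<exists>Lp\<ge>0. \<forall>p :: real poly. degree p \<le> d \<longrightarrow> (\<forall>u\<in>{0..1}. \<bar>poly p u\<bar> \<le> B) \<longrightarrow>
     (\<forall>u\<in>{0..1}. \<forall>u'\<in>{0..1}. \<bar>poly p u - poly p u'\<bar> \<le> Lp * \<bar>u - u'\<bar>)"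
proof -
  obtain C where C: "0 \<le> C" "\<And>p :: real poly. degree p \<le> d \<Longrightarrow> (\<forall>u\<in>{0..1}. \<bar>poly p u\<bar> \<le> B) \<Longrightarrow> (\<forall>i. \<bar>coeff p i\<bar> \<le> C * B)"
    using poly_coeff_bound_interval[of 0 d] by auto
  show ?thesis
  proof (intro exI[of _ "C * \<bar>B\<bar> * real (\<Sum>i\<le>d. i)"] conjI allI impI ballI)
    show "0 \<le> C * \<bar>B\<bar> * real (\<Sum>i\<le>d. i)" using C by (intro mult_nonneg_nonneg of_nat_0_le_iff) auto
    fix p :: "real poly" and u u' :: real
    assume d: "degree p \<le> d" and b: "\<forall>u\<in>{0..1}. \<bar>poly p u\<bar> \<le> B" and u: "u \<in> {0..1}" "u' \<in> {0..1}"
    have "poly p u - poly p u' = (\<Sum>i\<le>degree p. coeff p i * (u ^ i - u' ^ i))"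
      by (simp add: poly_altdef right_diff_distrib sum_subtractf)
    also have "\<bar>\<dots>\<bar> \<le> (\<Sum>i\<le>degree p. \<bar>coeff p i * (u ^ i - u' ^ i)\<bar>)" by (rule sum_abs)
    also have "\<dots> \<le> (\<Sum>i\<le>degree p. (C * \<bar>B\<bar>) * (real i * \<bar>u - u'\<bar>))"
    proof (rule sum_mono)
      fix i
      have 1: "\<bar>u ^ i - u' ^ i\<bar> \<le> real i * \<bar>u - u'\<bar>" using norm_power_diff[of u u' i] u by simp
      have 2: "\<bar>coeff p i\<bar> \<le> C * \<bar>B\<bar>" using C(2)[OF d b] C(1) by (meson abs_ge_self mult_left_mono order.trans)
      show "\<bar>coeff p i * (u ^ i - u' ^ i)\<bar> \<le> (C * \<bar>B\<bar>) * (real i * \<bar>u - u'\<bar>)"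
        unfolding abs_mult using 1 2 C by (intro mult_mono) auto
    qed
    also have "\<dots> \<le> (\<Sum>i\<le>d. (C * \<bar>B\<bar>) * (real i * \<bar>u - u'\<bar>))"
      using d C by (intro sum_mono2) auto
    also have "\<dots> = C * \<bar>B\<bar> * real (\<Sum>i\<le>d. i) * \<bar>u - u'\<bar>"
      by (simp add: sum_distrib_left sum_distrib_right mult.assoc)
    finally show "\<bar>poly p u - poly p u'\<bar> \<le> C * \<bar>B\<bar> * real (\<Sum>i\<le>d. i) * \<bar>u - u'\<bar>" .
  qed
qed

lemma poly_eventually_large:
  fixes p :: "real poly"
  assumes "\<not> (\<exists>c. \<forall>u\<ge>0. poly p u = c)"
  shows "\<exists>n. \<forall>t\<ge>n. H < \<bar>poly p (real t)\<bar>"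
proof -
  have "0 < degree p"
  proof (rule ccontr)
    assume "\<not> 0 < degree p"
    then obtain c where "p = [:c:]" by (auto elim: degree_eq_zeroE)
    then show False using assms by auto
  qed
  then have "filterlim (poly p) at_infinity at_infinity" by (rule filterlim_poly_at_infinity)
  moreover have "filterlim real at_infinity sequentially"
    using filterlim_real_sequentially by (rule filterlim_mono) (auto simp: at_top_le_at_infinity)
  ultimately have "filterlim (\<lambda>t. poly p (real t)) at_infinity sequentially"
    by (rule filterlim_compose)
  then have "\<forall>\<^sub>F t in sequentially. \<bar>H\<bar> + 1 \<le> norm (poly p (real t))"
    unfolding filterlim_at_infinity[OF order.refl] by (auto dest: spec[of _ "\<bar>H\<bar> + 1"])
  then obtain n where "\<And>t. n \<le> t \<Longrightarrow> \<bar>H\<bar> + 1 \<le> norm (poly p (real t))" by (auto simp: eventually_sequentially)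
  then have "H < \<bar>poly p (real t)\<bar>" if "n \<le> t" for t using that by fastforce
  then show ?thesis by blast
qed

section \<open>Blocks of trends\<close>

lemma rel_trend_refl: "rel_trend Ts x x" by (auto simp: rel_trend_def)

lemma rel_trend_sym: "rel_trend Ts x y \<Longrightarrow> rel_trend Ts y x"
  unfolding rel_trend_def
proof -
  assume "\<exists>c. \<forall>u\<ge>0. poly (Ts x) u - poly (Ts y) u = c"
  then obtain c where "\<forall>u\<ge>0. poly (Ts x) u - poly (Ts y) u = c" by blast
  then have "\<forall>u\<ge>0. poly (Ts y) u - poly (Ts x) u = - c" by (metis minus_diff_eq)
  then show "\<exists>c. \<forall>u\<ge>0. poly (Ts y) u - poly (Ts x) u = c" by blast
qed

lemma rel_trend_trans: "rel_trend Ts x y \<Longrightarrow> rel_trend Ts y z \<Longrightarrow> rel_trend Ts x z"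
  unfolding rel_trend_def
proof -
  assume "\<exists>c. \<forall>u\<ge>0. poly (Ts x) u - poly (Ts y) u = c" "\<exists>c. \<forall>u\<ge>0. poly (Ts y) u - poly (Ts z) u = c"
  then obtain c c' where "\<forall>u\<ge>0. poly (Ts x) u - poly (Ts y) u = c" "\<forall>u\<ge>0. poly (Ts y) u - poly (Ts z) u = c'" by blast
  then have "\<forall>u\<ge>0. poly (Ts x) u - poly (Ts z) u = c + c'" by (metis add_diff_eq diff_add_cancel)
  then show "\<exists>c. \<forall>u\<ge>0. poly (Ts x) u - poly (Ts z) u = c" by blast
qed

lemma blockof_eq: "rel_trend Ts x y \<Longrightarrow> blockof Ks Ts x = blockof Ks Ts y"
  unfolding blockof_def using rel_trend_sym rel_trend_trans by blast

lemma Min_block: "x \<in> {1..Ks} \<Longrightarrow> Min (blockof Ks Ts x) \<in> {1..Ks} \<and> rel_trend Ts x (Min (blockof Ks Ts x))"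
proof -
  assume "x \<in> {1..Ks}"
  then have "x \<in> blockof Ks Ts x" by (simp add: blockof_def rel_trend_refl)
  moreover have "finite (blockof Ks Ts x)" by (simp add: blockof_def)
  ultimately have "Min (blockof Ks Ts x) \<in> blockof Ks Ts x" by (intro Min_in) auto
  then show ?thesis by (auto simp: blockof_def)
qed

lemma finite_Blocks: "finite (Blocks Ks Ts)" by (simp add: Blocks_def)

lemma bigT_diff:
  assumes x: "x \<in> {1..Ks}" and u: "0 \<le> u"
  shows "poly (Ts x) u - poly (bigT Ts (blockof Ks Ts x)) u = Delta Ks Ts x"
proof -
  obtain c where c: "\<forall>u\<ge>0. poly (Ts x) u - poly (Ts (Min (blockof Ks Ts x))) u = c"
    using Min_block[OF x, of Ts] unfolding rel_trend_def by blast
  then show ?thesis using c[rule_format, OF u] c[rule_format, of 1] by (simp add: Delta_def bigT_def)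
qed

lemma Delta_le: "x \<in> {1..Ks} \<Longrightarrow> \<bar>Delta Ks Ts x\<bar> \<le> normDelta Ks Ts"
  unfolding normDelta_def by (intro Max_ge) auto

text \<open>Trends of distinct blocks differ by a nonconstant polynomial, and there are finitely
  many pairs. This also shows that the minimum in \<open>n1\<close> is attained, so that
  \<open>n1\<close> is not a default value.\<close>

lemma block_gap:
  "\<exists>n. \<forall>t\<ge>n. \<forall>b\<in>Blocks Ks Ts. \<forall>b'\<in>Blocks Ks Ts. b \<noteq> b' \<longrightarrow>
     H < \<bar>poly (bigT Ts b) (real t) - poly (bigT Ts b') (real t)\<bar>"
proof -
  have "\<exists>n. \<forall>t\<ge>n. H < \<bar>poly (bigT Ts b) (real t) - poly (bigT Ts b') (real t)\<bar>"
    if b: "b \<in> Blocks Ks Ts" "b' \<in> Blocks Ks Ts" "b \<noteq> b'" for b b'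
  proof -
    obtain x y where xy: "x \<in> {1..Ks}" "b = blockof Ks Ts x" "y \<in> {1..Ks}" "b' = blockof Ks Ts y"
      using b unfolding Blocks_def image_iff by blast
    have "\<not> rel_trend Ts (Min b) (Min b')"
    proof
      assume "rel_trend Ts (Min b) (Min b')"
      then have "rel_trend Ts x y"
        using Min_block[OF xy(1), of Ts] Min_block[OF xy(3), of Ts] xy rel_trend_sym rel_trend_trans by metis
      then show False using blockof_eq b(3) xy by metis
    qed
    then have "\<not> (\<exists>c. \<forall>u\<ge>0. poly (bigT Ts b - bigT Ts b') u = c)"
      by (simp add: rel_trend_def bigT_def)
    from poly_eventually_large[OF this, of H] show ?thesis by simp
  qed
  then have "\<forall>b\<in>Blocks Ks Ts. \<forall>b'\<in>Blocks Ks Ts. \<forall>\<^sub>F t in sequentially. b \<noteq> b' \<longrightarrow>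
     H < \<bar>poly (bigT Ts b) (real t) - poly (bigT Ts b') (real t)\<bar>"
    unfolding eventually_sequentially by blast
  then have "\<forall>\<^sub>F t in sequentially. \<forall>b\<in>Blocks Ks Ts. \<forall>b'\<in>Blocks Ks Ts. b \<noteq> b' \<longrightarrow>
     H < \<bar>poly (bigT Ts b) (real t) - poly (bigT Ts b') (real t)\<bar>"
    by (simp add: eventually_ball_finite_distrib finite_Blocks)
  then show ?thesis by (simp add: eventually_sequentially)
qed

lemma n1_gap:
  assumes "n1 Ks Ts H \<le> t" "b \<in> Blocks Ks Ts" "b' \<in> Blocks Ks Ts" "b \<noteq> b'"
  shows "2 * H < \<bar>poly (bigT Ts b) (real t) - poly (bigT Ts b') (real t)\<bar>"
proof -
  have "\<forall>t\<ge>n1 Ks Ts H. \<forall>b\<in>Blocks Ks Ts. \<forall>b'\<in>Blocks Ks Ts. b \<noteq> b' \<longrightarrow>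
     2 * H < \<bar>poly (bigT Ts b) (real t) - poly (bigT Ts b') (real t)\<bar>"
    unfolding n1_def by (rule LeastI_ex[OF block_gap])
  then show ?thesis using assms by blast
qed

text \<open>Time n alone decides the block: two block trends close to the same trend at n would be
  within \<open>2 * (M + normDelta Ks Ts)\<close> of each other, against \<open>n1_gap\<close>. So
  the description in \<open>bth\<close> has a unique solution.\<close>

lemma bth_eq:
  assumes n: "n1 Ks Ts (M + normDelta Ks Ts) \<le> n" "1 \<le> n"
    and xs: "xs \<in> {1..Ks}" and close: "\<forall>u\<in>{0..real n}. \<bar>poly (Ts xs) u - poly (Tp \<theta> x) u\<bar> \<le> M"
  shows "bth Ks Ts n M \<theta> x = blockof Ks Ts xs"
    and "u \<in> {0..1} \<Longrightarrow> \<bar>Dfun Ks Ts n M \<theta> x u\<bar> \<le> M + normDelta Ks Ts"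
proof -
  let ?b = "blockof Ks Ts xs"
  have b: "?b \<in> Blocks Ks Ts" using xs by (auto simp: Blocks_def)
  have le: "\<bar>poly (bigT Ts ?b) u - poly (Tp \<theta> x) u\<bar> \<le> M + normDelta Ks Ts" if "u \<in> {0..real n}" for u
  proof -
    have "poly (Ts xs) u - poly (bigT Ts ?b) u = Delta Ks Ts xs" using that by (intro bigT_diff xs) auto
    moreover have "\<bar>poly (Ts xs) u - poly (Tp \<theta> x) u\<bar> \<le> M" using close that by blast
    ultimately show ?thesis using Delta_le[OF xs, of Ts] by linarith
  qed
  show *: "bth Ks Ts n M \<theta> x = ?b" unfolding bth_def
  proof (rule the_equality)
    show "?b \<in> Blocks Ks Ts \<and> (\<forall>t\<in>{1..n}. \<bar>poly (bigT Ts ?b) (real t) - poly (Tp \<theta> x) (real t)\<bar> \<le> M + normDelta Ks Ts)"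
      using b le by auto
    fix b' assume b': "b' \<in> Blocks Ks Ts \<and> (\<forall>t\<in>{1..n}. \<bar>poly (bigT Ts b') (real t) - poly (Tp \<theta> x) (real t)\<bar> \<le> M + normDelta Ks Ts)"
    show "b' = ?b"
    proof (rule ccontr)
      assume "b' \<noteq> ?b"
      then have "2 * (M + normDelta Ks Ts) < \<bar>poly (bigT Ts b') (real n) - poly (bigT Ts ?b) (real n)\<bar>"
        using b b' n by (intro n1_gap) auto
      moreover have "\<bar>poly (bigT Ts b') (real n) - poly (Tp \<theta> x) (real n)\<bar> \<le> M + normDelta Ks Ts" using b' n by auto
      moreover have "\<bar>poly (bigT Ts ?b) (real n) - poly (Tp \<theta> x) (real n)\<bar> \<le> M + normDelta Ks Ts" by (rule le) simp
      moreover have "\<bar>\<alpha> - \<beta>\<bar> \<le> 2 * m" if "\<bar>\<alpha> - c\<bar> \<le> m" "\<bar>\<beta> - c\<bar> \<le> m" for \<alpha> \<beta> c m :: real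
        using that by linarith
      ultimately show False by fastforce
    qed
  qed
  show "\<bar>Dfun Ks Ts n M \<theta> x u\<bar> \<le> M + normDelta Ks Ts" if u: "u \<in> {0..1}"
  proof -
    have "real n * u \<in> {0..real n}" using u by (auto intro: mult_left_le)
    from le[OF this] show ?thesis unfolding Dfun_def * by linarith
  qed
qed

lemma Dfun_poly:
  assumes "degree (Tp \<theta> x) \<le> d" "\<forall>x\<in>{1..Ks}. degree (Ts x) \<le> d" "bth Ks Ts n M \<theta> x \<in> Blocks Ks Ts"
  shows "\<exists>p. degree p \<le> d \<and> Dfun Ks Ts n M \<theta> x = poly p"
proof (intro exI conjI)
  let ?q = "Tp \<theta> x - bigT Ts (bth Ks Ts n M \<theta> x)"
  have "bigT Ts (bth Ks Ts n M \<theta> x) \<in> Ts ` {1..Ks}"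
    using assms(3) Min_block by (auto simp: Blocks_def bigT_def)
  then have dq: "degree ?q \<le> d" using assms by (intro degree_diff_le) auto
  have "degree (pcompose ?q [:0, real n:]) \<le> degree ?q * degree [:0, real n:]" by (rule degree_pcompose_le)
  also have "\<dots> \<le> degree ?q * 1" by (intro mult_left_mono) auto
  finally show "degree (pcompose ?q [:0, real n:]) \<le> d" using dq by simp
  show "Dfun Ks Ts n M \<theta> x = poly (pcompose ?q [:0, real n:])"
    by (auto simp: Dfun_def poly_pcompose mult.commute)
qed

section \<open>The model with trends\<close>

lemma open_eval: "open S \<Longrightarrow> open {f :: nat \<Rightarrow> real \<Rightarrow> real. f x z \<in> S}"
proof -
  assume S: "open S"
  have "continuous_on UNIV (\<lambda>f :: nat \<Rightarrow> real \<Rightarrow> real. f x)" by simp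
  moreover have "continuous_on UNIV (\<lambda>f :: real \<Rightarrow> real. f z)" by simp
  ultimately have "continuous_on UNIV (\<lambda>f :: nat \<Rightarrow> real \<Rightarrow> real. f x z)"
    using continuous_on_compose2[of UNIV "\<lambda>f :: real \<Rightarrow> real. f z" UNIV "\<lambda>f :: nat \<Rightarrow> real \<Rightarrow> real. f x"] by simp
  from open_vimage[OF S this] show ?thesis by (simp add: vimage_def)
qed

lemma continuous_on_if_uniformly_approximated:
  fixes f :: "real \<Rightarrow> real"
  assumes "\<And>\<epsilon>. 0 < \<epsilon> \<Longrightarrow> \<exists>g. continuous_on S g \<and> (\<forall>u\<in>S. \<bar>f u - g u\<bar> < \<epsilon>)"
  shows "continuous_on S f"
  unfolding continuous_on_iff
proof (intro ballI allI impI)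
  fix x and e :: real assume x: "x \<in> S" and e: "0 < e"
  obtain g where g: "continuous_on S g" "\<forall>u\<in>S. \<bar>f u - g u\<bar> < e / 3" using assms[of "e / 3"] e by auto
  obtain d where d: "d > 0" "\<forall>x'\<in>S. dist x' x < d \<longrightarrow> dist (g x') (g x) < e / 3"
    using g(1)[unfolded continuous_on_iff, rule_format, OF x, of "e / 3"] e by auto
  show "\<exists>d>0. \<forall>x'\<in>S. dist x' x < d \<longrightarrow> dist (f x') (f x) < e"
  proof (intro exI[of _ d] conjI ballI impI d(1))
    fix x' assume x': "x' \<in> S" "dist x' x < d"
    then have "\<bar>g x' - g x\<bar> < e / 3" using d(2) by (simp add: dist_real_def)
    then show "dist (f x') (f x) < e" using g(2)[rule_format, OF x] g(2)[rule_format, OF x'(1)] unfolding dist_real_def by linarith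
  qed
qed

locale trend_hmm = prob_space P for P :: "'a measure" +
  fixes K d :: nat and sigma :: real and \<Gamma> :: "(real \<Rightarrow> real) set"
    and X :: "nat \<Rightarrow> 'a \<Rightarrow> nat" and Zx :: "nat \<Rightarrow> nat \<Rightarrow> 'a \<Rightarrow> real"
    and \<theta>s :: hmmpar and M :: real and g m w L :: "real \<Rightarrow> real"
  assumes K: "1 \<le> K" and sigma: "0 < sigma"
    and true_par: "\<theta>s \<in> Theta K d sigma \<Gamma>"
    and X_measurable: "\<forall>t. X t \<in> measurable P (count_space UNIV)"
    and X_markov: "\<forall>n\<ge>1. \<forall>xs\<in>paths n (Kp \<theta>s).
        measure P {\<omega>\<in>space P. \<forall>t\<in>{1..n}. X t \<omega> = xs t} =
        pip \<theta>s (xs 1) * (\<Prod>t\<in>{2..n}. Qp \<theta>s (xs (t - 1)) (xs t))"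
    and Z_density: "\<forall>x\<in>{1..Kp \<theta>s}. \<forall>t\<ge>1. distributed P lborel (Zx x t) (\<lambda>z. ennreal (gp \<theta>s x z))"
    and Z_independent: "indep_vars (\<lambda>_. borel) (\<lambda>(x, t). Zx x t) ({1..Kp \<theta>s} \<times> {1..})"
    and XZ_independent: "indep_set
        (sigma_sets (space P) {X t -` A \<inter> space P | t A. 1 \<le> t})
        (sigma_sets (space P) {Zx x t -` A \<inter> space P | x t A. x \<in> {1..Kp \<theta>s} \<and> 1 \<le> t \<and> A \<in> sets borel})"
    and g: "\<forall>s t. 0 \<le> s \<longrightarrow> s \<le> t \<longrightarrow> g t \<le> g s" "(g \<longlongrightarrow> 0) at_top" "\<forall>\<gamma>\<in>\<Gamma>. \<forall>z. \<gamma> z \<le> g \<bar>z\<bar>"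
    and m: "\<forall>s t. 0 \<le> s \<longrightarrow> s \<le> t \<longrightarrow> m t \<le> m s" "\<forall>s\<ge>0. 0 < m s" "\<forall>\<gamma>\<in>\<Gamma>. \<forall>z. m \<bar>z\<bar> \<le> \<gamma> z"
    and m_int: "\<forall>M'>0. integrable P (\<lambda>\<omega>. ln (m (M' + Zmax (Kp \<theta>s) Zx 1 \<omega>)))"
    and modulus: "\<forall>s t. 0 \<le> s \<longrightarrow> s \<le> t \<longrightarrow> w s \<le> w t" "w 0 = 0" "(w \<longlongrightarrow> 0) (at_right 0)"
    and L: "\<forall>s t. 0 \<le> s \<longrightarrow> s \<le> t \<longrightarrow> L s \<le> L t" "\<forall>\<gamma>\<in>\<Gamma>. \<forall>z \<eta>. \<bar>ln (\<gamma> (z + \<eta>) / \<gamma> z)\<bar> \<le> L \<bar>z\<bar> * w \<bar>\<eta>\<bar>"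
    and L_int: "\<forall>M'>0. integrable P (\<lambda>\<omega>. L (M' + Zmax (Kp \<theta>s) Zx 1 \<omega>))"
    and M_pos: "0 < M"
begin

definition dl :: real where "dl = normDelta (Kp \<theta>s) (Tp \<theta>s)"
definition M1 :: real where "M1 = M + dl"
definition G :: real where "G = max 1 (g 0)"
text \<open>After a translation by at most \<open>M1\<close>, a log-density lies between ln m(M1 +
  r) and ln G, and its modulus has factor L(M1 + r). One \<open>ln G\<close> compensates
  \<open>- ln m\<close> from below, since m \<le> G; the other is the upper bound. The summand 1
  gives v \<ge> 1, and the maxima make v monotone on the whole line.\<close>

definition v :: "real \<Rightarrow> real" where
  "v r = 1 + 2 * ln G - ln (m (M1 + max 0 r)) + max 0 (L (M1 + max 0 r))"

lemma Ks1: "1 \<le> Kp \<theta>s" using true_par by (auto simp: Theta_def)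

lemma dl0: "0 \<le> dl"
  using Delta_le[of 1 "Kp \<theta>s" "Tp \<theta>s"] Ks1 unfolding dl_def by fastforce

lemma M1_pos: "0 < M1" using dl0 M_pos by (simp add: M1_def)

lemma G1: "1 \<le> G" by (simp add: G_def)

lemma Gamma_bounds:
  assumes "\<gamma> \<in> \<Gamma>"
  shows "0 < \<gamma> z" "\<gamma> z \<le> G" "\<gamma> z \<le> g \<bar>z\<bar>" "m \<bar>z\<bar> \<le> \<gamma> z"
proof -
  show "\<gamma> z \<le> g \<bar>z\<bar>" "m \<bar>z\<bar> \<le> \<gamma> z" using g m assms by blast+
  then show "0 < \<gamma> z" using m(2) by (meson abs_ge_zero less_le_trans)
  have "g \<bar>z\<bar> \<le> g 0" using g(1) by auto
  then show "\<gamma> z \<le> G" using \<open>\<gamma> z \<le> g \<bar>z\<bar>\<close> by (simp add: G_def)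
qed

lemma true_Gamma: "x \<in> {1..Kp \<theta>s} \<Longrightarrow> gp \<theta>s x \<in> \<Gamma>" using true_par by (auto simp: Theta_def)

lemma m_le_G: "0 \<le> r \<Longrightarrow> m r \<le> G"
  using Gamma_bounds[OF true_Gamma[of 1], of r] Ks1 by fastforce

lemma ln_m_le: "0 \<le> r \<Longrightarrow> ln (m r) \<le> ln G"
  using m_le_G[of r] m(2) G1 by (subst ln_le_cancel_iff) auto

lemma ln_G: "0 \<le> ln G" using G1 by simp

lemma v_ge1: "1 \<le> v r"
  using ln_m_le[of "M1 + max 0 r"] ln_G M1_pos unfolding v_def by linarith

lemma v_mono: "mono v"
proof (rule monoI)
  fix r r' :: real assume "r \<le> r'"
  then have a: "0 \<le> M1 + max 0 r" "M1 + max 0 r \<le> M1 + max 0 r'" using M1_pos by auto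
  have "m (M1 + max 0 r') \<le> m (M1 + max 0 r)" using m(1) a by blast
  then have "ln (m (M1 + max 0 r')) \<le> ln (m (M1 + max 0 r))" using m(2) a by (subst ln_le_cancel_iff) auto
  moreover have "L (M1 + max 0 r) \<le> L (M1 + max 0 r')" using L(1) a by blast
  then have "max 0 (L (M1 + max 0 r)) \<le> max 0 (L (M1 + max 0 r'))" by simp
  ultimately show "v r \<le> v r'" unfolding v_def by linarith
qed

lemma Zx_le_Zmax: "x \<in> {1..Kp \<theta>s} \<Longrightarrow> \<bar>Zx x t \<omega>\<bar> \<le> Zmax (Kp \<theta>s) Zx t \<omega>"
  unfolding Zmax_def by (intro Max_ge) auto

lemma v_integrable:
  assumes x: "x \<in> {1..Kp \<theta>s}"
  shows "integrable P (\<lambda>\<omega>. v (\<bar>Zx x 1 \<omega>\<bar> + dl))"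
proof -
  have Zm: "random_variable borel (Zx x 1)" using Z_density x distributed_measurable by fastforce
  have [measurable]: "v \<in> borel_measurable borel" using v_mono by (rule borel_measurable_mono)
  have "integrable P (\<lambda>\<omega>. v (Zmax (Kp \<theta>s) Zx 1 \<omega> + dl))"
  proof -
    \<comment> \<open>This brings the envelope into the form of the integrability assumptions, with
      M' = \<open>M1 + dl\<close>.\<close>
    have eq: "v (Zmax (Kp \<theta>s) Zx 1 \<omega> + dl) = 1 + 2 * ln G - ln (m ((M1 + dl) + Zmax (Kp \<theta>s) Zx 1 \<omega>)) + max 0 (L ((M1 + dl) + Zmax (Kp \<theta>s) Zx 1 \<omega>))" for \<omega>
    proof -
      have "0 \<le> Zmax (Kp \<theta>s) Zx 1 \<omega>" using Zx_le_Zmax[OF x, of 1 \<omega>] by linarith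
      then have "max 0 (Zmax (Kp \<theta>s) Zx 1 \<omega> + dl) = Zmax (Kp \<theta>s) Zx 1 \<omega> + dl" using dl0 by simp
      then show ?thesis unfolding v_def by (simp add: ac_simps)
    qed
    have "0 < M1 + dl" using M1_pos dl0 by simp
    then show ?thesis unfolding eq using m_int L_int
      by (intro Bochner_Integration.integrable_add Bochner_Integration.integrable_diff integrable_max) auto
  qed
  then show ?thesis
  proof (rule Bochner_Integration.integrable_bound)
    show "(\<lambda>\<omega>. v (\<bar>Zx x 1 \<omega>\<bar> + dl)) \<in> borel_measurable P" using Zm by measurable
    show "AE \<omega> in P. norm (v (\<bar>Zx x 1 \<omega>\<bar> + dl)) \<le> norm (v (Zmax (Kp \<theta>s) Zx 1 \<omega> + dl))"
    proof (rule AE_I2)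
      fix \<omega>
      have "v (\<bar>Zx x 1 \<omega>\<bar> + dl) \<le> v (Zmax (Kp \<theta>s) Zx 1 \<omega> + dl)" using v_mono Zx_le_Zmax[OF x, of 1 \<omega>] by (simp add: mono_def)
      then show "norm (v (\<bar>Zx x 1 \<omega>\<bar> + dl)) \<le> norm (v (Zmax (Kp \<theta>s) Zx 1 \<omega> + dl))"
        using v_ge1[of "\<bar>Zx x 1 \<omega>\<bar> + dl"] by simp
    qed
  qed
qed

sublocale hidden_chain P "Kp \<theta>s" sigma "pip \<theta>s" "Qp \<theta>s" X Zx "gp \<theta>s" v w "blockof (Kp \<theta>s) (Tp \<theta>s)" "Delta (Kp \<theta>s) (Tp \<theta>s)" dl
proof
  show "1 \<le> Kp \<theta>s" "pvec (Kp \<theta>s) (pip \<theta>s)" "stochmat sigma (Kp \<theta>s) (Qp \<theta>s)" using true_par by (auto simp: Theta_def)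
  show "0 < sigma" by (fact sigma)
  show "X t \<in> measurable P (count_space UNIV)" for t using X_measurable by blast
  show "prob {\<omega>\<in>space P. \<forall>t\<in>{1..n}. X t \<omega> = xs t} = pip \<theta>s (xs 1) * (\<Prod>t\<in>{2..n}. Qp \<theta>s (xs (t - 1)) (xs t))"
    if "1 \<le> n" "xs \<in> paths n (Kp \<theta>s)" for n xs using X_markov that by blast
  show "distributed P lborel (Zx x t) (\<lambda>z. ennreal (gp \<theta>s x z))" if "x \<in> {1..Kp \<theta>s}" "1 \<le> t" for x t
    using Z_density that by blast
  show "indep_vars (\<lambda>_. borel) (\<lambda>(x, t). Zx x t) ({1..Kp \<theta>s} \<times> {1..})" by (fact Z_independent)
  show "indep_set (sigma_sets (space P) {X t -` A \<inter> space P | t A. 1 \<le> t})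
        (sigma_sets (space P) {Zx x t -` A \<inter> space P | x t A. x \<in> {1..Kp \<theta>s} \<and> 1 \<le> t \<and> A \<in> sets borel})"
    by (fact XZ_independent)
  show "mono v" by (fact v_mono)
  show "1 \<le> v r" for r by (fact v_ge1)
  show "integrable P (\<lambda>\<omega>. v (\<bar>Zx x 1 \<omega>\<bar> + dl))" if "x \<in> {1..Kp \<theta>s}" for x using that by (rule v_integrable)
  show "w r \<le> w r'" if "0 \<le> r" "r \<le> r'" for r r' using modulus(1) that by blast
  show "w 0 = 0" "(w \<longlongrightarrow> 0) (at_right 0)" by (fact modulus)+
  show "\<bar>Delta (Kp \<theta>s) (Tp \<theta>s) x\<bar> \<le> dl" if "x \<in> {1..Kp \<theta>s}" for x unfolding dl_def using that by (rule Delta_le)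
qed

section \<open>Translated densities are admissible\<close>

lemma Gamma_ln_bound:
  assumes "\<gamma> \<in> \<Gamma>" "\<bar>D\<bar> \<le> M1"
  shows "\<bar>ln (\<gamma> (z - D))\<bar> \<le> v \<bar>z\<bar>"
proof -
  have "m (M1 + \<bar>z\<bar>) \<le> m \<bar>z - D\<bar>" using m(1) assms(2) by (auto intro!: m(1)[rule_format])
  then have "m (M1 + \<bar>z\<bar>) \<le> \<gamma> (z - D)" using Gamma_bounds(4)[OF assms(1), of "z - D"] by linarith
  then have 1: "ln (m (M1 + \<bar>z\<bar>)) \<le> ln (\<gamma> (z - D))"
    using m(2) M1_pos Gamma_bounds(1)[OF assms(1)] by (subst ln_le_cancel_iff) auto
  have 2: "ln (\<gamma> (z - D)) \<le> ln G"
    using Gamma_bounds[OF assms(1)] G1 by (subst ln_le_cancel_iff) auto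
  have "v \<bar>z\<bar> = 1 + 2 * ln G - ln (m (M1 + \<bar>z\<bar>)) + max 0 (L (M1 + \<bar>z\<bar>))" by (simp add: v_def)
  moreover have "ln (m (M1 + \<bar>z\<bar>)) \<le> ln G" using M1_pos by (intro ln_m_le) simp
  moreover have "0 \<le> max 0 (L (M1 + \<bar>z\<bar>))" by simp
  ultimately show ?thesis using 1 2 ln_G by linarith
qed

lemma Gamma_modulus:
  assumes "\<gamma> \<in> \<Gamma>" "\<bar>D\<bar> \<le> M1"
  shows "\<bar>ln (\<gamma> (z - D)) - ln (\<gamma> y)\<bar> \<le> v \<bar>z\<bar> * w \<bar>y - (z - D)\<bar>"
proof -
  let ?a = "z - D"
  have "ln (\<gamma> (?a + (y - ?a)) / \<gamma> ?a) = ln (\<gamma> y) - ln (\<gamma> ?a)"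
    using Gamma_bounds(1)[OF assms(1), of y] Gamma_bounds(1)[OF assms(1), of ?a] by (simp add: ln_div)
  then have "\<bar>ln (\<gamma> ?a) - ln (\<gamma> y)\<bar> \<le> L \<bar>?a\<bar> * w \<bar>y - ?a\<bar>"
    using L(2)[rule_format, OF assms(1), of ?a "y - ?a"] by (simp add: abs_minus_commute)
  also have "\<dots> \<le> v \<bar>z\<bar> * w \<bar>y - ?a\<bar>"
  proof (rule mult_right_mono)
    have "L \<bar>?a\<bar> \<le> L (M1 + \<bar>z\<bar>)" using assms(2) by (intro L(1)[rule_format]) auto
    also have "\<dots> \<le> v \<bar>z\<bar>"
    proof -
      have "v \<bar>z\<bar> = 1 + 2 * ln G - ln (m (M1 + \<bar>z\<bar>)) + max 0 (L (M1 + \<bar>z\<bar>))" by (simp add: v_def)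
      moreover have "ln (m (M1 + \<bar>z\<bar>)) \<le> ln G" using M1_pos by (intro ln_m_le) simp
      moreover have "L (M1 + \<bar>z\<bar>) \<le> max 0 (L (M1 + \<bar>z\<bar>))" by simp
      ultimately show ?thesis using ln_G by linarith
    qed
    finally show "L \<bar>?a\<bar> \<le> v \<bar>z\<bar>" .
  qed (rule w_nonneg, simp)
  finally show ?thesis .
qed

lemma emc_translate:
  assumes "\<forall>x\<in>{1..K'}. \<gamma> x \<in> \<Gamma>" "\<forall>x\<in>{1..K'}. \<bar>D x\<bar> \<le> M1"
  shows "emc K' (\<lambda>x z. \<gamma> x (z - D x))"
  unfolding emc_def
proof (intro ballI conjI allI)
  fix x z z' assume x: "x \<in> {1..K'}"
  show "0 < \<gamma> x (z - D x)" using Gamma_bounds(1) assms(1) x by blast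
  show "\<bar>ln (\<gamma> x (z - D x))\<bar> \<le> v \<bar>z\<bar>" using Gamma_ln_bound assms x by blast
  show "\<bar>ln (\<gamma> x (z - D x)) - ln (\<gamma> x (z' - D x))\<bar> \<le> v \<bar>z\<bar> * w \<bar>z - z'\<bar>"
    using Gamma_modulus[of "\<gamma> x" "D x" z "z' - D x"] assms x by (simp add: abs_minus_commute)
qed

lemma translate_diff:
  assumes "\<gamma> \<in> \<Gamma>" "\<bar>D\<bar> \<le> M1" "\<bar>D - D'\<bar> \<le> \<delta>"
  shows "\<bar>ln (\<gamma> (z - D)) - ln (\<gamma> (z - D'))\<bar> \<le> v \<bar>z\<bar> * w \<delta>"
proof -
  have "\<bar>ln (\<gamma> (z - D)) - ln (\<gamma> (z - D'))\<bar> \<le> v \<bar>z\<bar> * w \<bar>D - D'\<bar>"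
    using Gamma_modulus[OF assms(1,2), of z "z - D'"] by simp
  also have "\<dots> \<le> v \<bar>z\<bar> * w \<delta>" using assms(3) by (intro mult_left_mono w(1) v_nonneg) auto
  finally show ?thesis .
qed

text \<open>Within a block the trends differ by constants, so subtracting the block trend leaves the
  noise shifted by an amount that does not depend on t.\<close>

lemma Zprime_eq: "X t \<omega> \<in> {1..Kp \<theta>s} \<Longrightarrow> Zprime \<theta>s X Zx t \<omega> = Zp t \<omega>"
  using bigT_diff[of "X t \<omega>" "Kp \<theta>s" "real t" "Tp \<theta>s"]
  by (simp add: Zprime_def Yobs_def Zobs_def Bproc_def Zp_def Zt_def)

section \<open>The homogeneous log-likelihood of the statement\<close>

lemma lhom_n_eq:
  assumes g: "good \<omega>" and K': "1 \<le> K'" and p: "stochmat sigma K' Q" "emc K' \<phi>" "covers K' bb" and n: "1 \<le> n"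
  shows "lhom_n n K' (\<lambda>_. 1 / real K') Q \<phi> bb (\<lambda>t. Zprime \<theta>s X Zx t \<omega>) (\<lambda>t. Bproc \<theta>s X t \<omega>)
     = seglik K' Q (em \<phi> bb \<omega>) 0 n - ln K'"
proof -
  interpret h: hmmseq sigma K' Q "em \<phi> bb \<omega>" by (rule em_hmmseq[OF g K' p])
  have "(\<Prod>t\<in>{1..n}. \<phi> (xs t) (Zprime \<theta>s X Zx t \<omega>) * (if bb (xs t) = Bproc \<theta>s X t \<omega> then 1 else 0)) = (\<Prod>t\<in>{1..n}. em \<phi> bb \<omega> t (xs t))" for xs
  proof (intro prod.cong refl)
    fix t assume "t \<in> {1..n}"
    then have "X t \<omega> \<in> {1..Kp \<theta>s}" using g unfolding good_def by auto
    then show "\<phi> (xs t) (Zprime \<theta>s X Zx t \<omega>) * (if bb (xs t) = Bproc \<theta>s X t \<omega> then 1 else 0) = em \<phi> bb \<omega> t (xs t)"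
      by (simp add: Zprime_eq em_def Bproc_def)
  qed
  then have "lhom_n n K' (\<lambda>_. 1 / real K') Q \<phi> bb (\<lambda>t. Zprime \<theta>s X Zx t \<omega>) (\<lambda>t. Bproc \<theta>s X t \<omega>)
     = ln (lik K' Q (em \<phi> bb \<omega>) (\<lambda>_. 1 / real K') n)"
    unfolding lhom_n_def using lik_paths[OF p(1) n, of "\<lambda>_. 1 / real K'" "em \<phi> bb \<omega>"] by simp
  also have "lik K' Q (em \<phi> bb \<omega>) (\<lambda>_. 1 / real K') n = 1 / real K' * lik K' Q (em \<phi> bb \<omega>) (\<lambda>_. 1) n"
    using lik_scale[of K' Q "em \<phi> bb \<omega>" "1 / real K'" "\<lambda>_. 1" n] by simp
  also have "ln \<dots> = ln (lik K' Q (em \<phi> bb \<omega>) (\<lambda>_. 1) n) - ln K'"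
    using h.lik1_pos[of n] K' by (simp add: ln_div)
  finally show ?thesis by (simp add: seglik_def)
qed

lemma lhom_eq_lam:
  assumes K': "1 \<le> K'" and p: "stochmat sigma K' Q" "emc K' \<phi>" "covers K' bb"
  shows "lhom P \<theta>s X Zx K' Q \<phi> bb = lam K' Q \<phi> bb"
proof -
  have "AE \<omega> in P. (\<lambda>n. lhom_n n K' (\<lambda>_. 1 / real K') Q \<phi> bb (\<lambda>t. Zprime \<theta>s X Zx t \<omega>) (\<lambda>t. Bproc \<theta>s X t \<omega>) / real n) \<longlonglongrightarrow> lam K' Q \<phi> bb"
    using lam_converges[OF K' p] AE_good
  proof eventually_elim
    fix \<omega> assume l: "(\<lambda>n. seglik K' Q (em \<phi> bb \<omega>) 0 n / real n) \<longlonglongrightarrow> lam K' Q \<phi> bb" and g: "good \<omega>"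
    have "(\<lambda>n. seglik K' Q (em \<phi> bb \<omega>) 0 n / real n - ln K' / real n) \<longlonglongrightarrow> lam K' Q \<phi> bb - 0"
      by (intro tendsto_diff l lim_const_over_n)
    moreover have "\<forall>\<^sub>F n in sequentially. seglik K' Q (em \<phi> bb \<omega>) 0 n / real n - ln K' / real n
       = lhom_n n K' (\<lambda>_. 1 / real K') Q \<phi> bb (\<lambda>t. Zprime \<theta>s X Zx t \<omega>) (\<lambda>t. Bproc \<theta>s X t \<omega>) / real n"
      using eventually_ge_at_top[of 1] by eventually_elim (simp add: lhom_n_eq[OF g K' p] diff_divide_distrib)
    ultimately show "(\<lambda>n. lhom_n n K' (\<lambda>_. 1 / real K') Q \<phi> bb (\<lambda>t. Zprime \<theta>s X Zx t \<omega>) (\<lambda>t. Bproc \<theta>s X t \<omega>) / real n) \<longlonglongrightarrow> lam K' Q \<phi> bb"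
      using Lim_transform_eventually[of _ "lam K' Q \<phi> bb"] by simp
  qed
  then show ?thesis unfolding lhom_def by (intro the_equality) (auto intro: AE_tendsto_unique)
qed

text \<open>If some block is missed by the block map, all path weights vanish once that block has been
  visited; the junk value of ln at 0 then makes the limit 0.\<close>
lemma lhom_not_covers:
  assumes "\<not> covers K' bb"
  shows "lhom P \<theta>s X Zx K' Q \<phi> bb = 0"
proof -
  obtain x0 where x0: "x0 \<in> {1..Kp \<theta>s}" "\<forall>y\<in>{1..K'}. bb y \<noteq> blockof (Kp \<theta>s) (Tp \<theta>s) x0"
    using assms unfolding covers_def by blast
  have "AE \<omega> in P. (\<lambda>n. lhom_n n K' (\<lambda>_. 1 / real K') Q \<phi> bb (\<lambda>t. Zprime \<theta>s X Zx t \<omega>) (\<lambda>t. Bproc \<theta>s X t \<omega>) / real n) \<longlonglongrightarrow> 0"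
    using AE_visits[OF x0(1)]
  proof eventually_elim
    fix \<omega> assume "\<exists>t\<ge>1. X t \<omega> = x0"
    then obtain t0 where t0: "1 \<le> t0" "X t0 \<omega> = x0" by blast
    have "\<forall>\<^sub>F n in sequentially. 0 = lhom_n n K' (\<lambda>_. 1 / real K') Q \<phi> bb (\<lambda>t. Zprime \<theta>s X Zx t \<omega>) (\<lambda>t. Bproc \<theta>s X t \<omega>) / real n"
      using eventually_ge_at_top[of t0]
    proof eventually_elim
      case (elim n)
      have z: "(\<Prod>t\<in>{1..n}. \<phi> (xs t) (Zprime \<theta>s X Zx t \<omega>) * (if bb (xs t) = Bproc \<theta>s X t \<omega> then 1 else 0)) = 0" if "xs \<in> paths n K'" for xs
      proof (rule prod_zero)
        have "xs t0 \<in> {1..K'}" using that t0 elim by (auto simp: paths_def)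
        then have "bb (xs t0) \<noteq> Bproc \<theta>s X t0 \<omega>" using x0 t0 by (auto simp: Bproc_def)
        then show "\<exists>t\<in>{1..n}. \<phi> (xs t) (Zprime \<theta>s X Zx t \<omega>) * (if bb (xs t) = Bproc \<theta>s X t \<omega> then 1 else 0) = 0"
          using t0 elim by (intro bexI[of _ t0]) auto
      qed simp
      have "lhom_n n K' (\<lambda>_. 1 / real K') Q \<phi> bb (\<lambda>t. Zprime \<theta>s X Zx t \<omega>) (\<lambda>t. Bproc \<theta>s X t \<omega>) = ln 0"
        unfolding lhom_n_def by (intro arg_cong[where f=ln] sum.neutral ballI) (simp only: z mult_zero_right)
      then show ?case by simp
    qed
    then show "(\<lambda>n. lhom_n n K' (\<lambda>_. 1 / real K') Q \<phi> bb (\<lambda>t. Zprime \<theta>s X Zx t \<omega>) (\<lambda>t. Bproc \<theta>s X t \<omega>) / real n) \<longlonglongrightarrow> 0"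
      by (rule Lim_transform_eventually[OF tendsto_const])
  qed
  then show ?thesis unfolding lhom_def by (intro the_equality) (auto intro: AE_tendsto_unique)
qed

section \<open>Continuity of the integrated log-likelihood\<close>

lemma lam_continuous:
  fixes D :: "nat \<Rightarrow> real \<Rightarrow> real"
  assumes K': "1 \<le> K'" and Q: "stochmat sigma K' Q" and \<gamma>: "\<forall>x\<in>{1..K'}. \<gamma> x \<in> \<Gamma>"
    and D: "\<forall>x\<in>{1..K'}. \<forall>u\<in>{0..1}. \<bar>D x u\<bar> \<le> M1" "\<forall>x\<in>{1..K'}. continuous_on {0..1} (D x)" and bb: "covers K' bb"
  shows "continuous_on {0..1} (\<lambda>u. lam K' Q (\<lambda>x z. \<gamma> x (z - D x u)) bb)"
  unfolding continuous_on
proof (intro ballI tendstoI)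
  fix u :: real and e :: real assume u: "u \<in> {0..1}" and e: "0 < e"
  obtain h where h: "0 < h" "w h \<le> e / (2 * CV)" using w_small[of "e / (2 * CV)"] e CV_pos by auto
  have em: "emc K' (\<lambda>x z. \<gamma> x (z - D x u))" if "u \<in> {0..1}" for u
    using \<gamma> D(1) that by (intro emc_translate) auto
  have "\<forall>\<^sub>F u' in at u within {0..1}. \<forall>x\<in>{1..K'}. dist (D x u') (D x u) < h"
    using D(2) u h unfolding continuous_on by (intro eventually_ball_finite ballI tendstoD) auto
  moreover have "\<forall>\<^sub>F u' in at u within {0..1}. u' \<in> {0..1}" by (simp add: eventually_at_filter)
  ultimately show "\<forall>\<^sub>F u' in at u within {0..1}. dist (lam K' Q (\<lambda>x z. \<gamma> x (z - D x u')) bb) (lam K' Q (\<lambda>x z. \<gamma> x (z - D x u)) bb) < e"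
  proof eventually_elim
    case (elim u')
    have "\<bar>lam K' Q (\<lambda>x z. \<gamma> x (z - D x u')) bb - lam K' Q (\<lambda>x z. \<gamma> x (z - D x u)) bb\<bar> \<le> CV * w h"
      using elim \<gamma> D(1) h by (intro lam_diff_modulus K' Q em u bb translate_diff w_nonneg) (auto simp: dist_real_def less_imp_le)
    also have "\<dots> \<le> CV * (e / (2 * CV))" using h CV_pos by (intro mult_left_mono) auto
    also have "\<dots> < e" using e CV_pos by simp
    finally show ?case by (simp add: dist_real_def)
  qed
qed

lemma lint_eq:
  fixes D :: "nat \<Rightarrow> real \<Rightarrow> real"
  assumes K': "1 \<le> K'" and Q: "stochmat sigma K' Q" and \<gamma>: "\<forall>x\<in>{1..K'}. \<gamma> x \<in> \<Gamma>"
    and D: "\<forall>x\<in>{1..K'}. \<forall>u\<in>{0..1}. \<bar>D x u\<bar> \<le> M1" and bb: "covers K' bb"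
  shows "lint P \<theta>s X Zx K' Q \<gamma> D bb = integral {0..1} (\<lambda>u. lam K' Q (\<lambda>x z. \<gamma> x (z - D x u)) bb)"
  unfolding lint_def using \<gamma> D
  by (intro integral_cong lhom_eq_lam K' Q bb emc_translate) auto

text \<open>The two halves of \<open>ThetaOK\<close> have different consequences. That each trend of
  the parameter is near a true one fixes its block and bounds \<open>Dfun\<close>; that each true
  trend is approximated makes the block map cover all blocks, which keeps the likelihood
  positive.\<close>

lemma ThetaOKD:
  assumes n: "n1 (Kp \<theta>s) (Tp \<theta>s) M1 \<le> n" "1 \<le> n" and \<theta>: "\<theta> \<in> ThetaOK K d sigma \<Gamma> (Kp \<theta>s) (Tp \<theta>s) n M"
  shows "1 \<le> Kp \<theta>" "Kp \<theta> \<le> K" "pvec (Kp \<theta>) (pip \<theta>)" "stochmat sigma (Kp \<theta>) (Qp \<theta>)"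
    "\<forall>x\<in>{1..Kp \<theta>}. gp \<theta> x \<in> \<Gamma>"
    "\<forall>x\<in>{1..Kp \<theta>}. bth (Kp \<theta>s) (Tp \<theta>s) n M \<theta> x \<in> Blocks (Kp \<theta>s) (Tp \<theta>s)"
    "\<forall>x\<in>{1..Kp \<theta>}. \<forall>u\<in>{0..1}. \<bar>Dfun (Kp \<theta>s) (Tp \<theta>s) n M \<theta> x u\<bar> \<le> M1"
    "covers (Kp \<theta>) (bth (Kp \<theta>s) (Tp \<theta>s) n M \<theta>)"
    "\<forall>x\<in>{1..Kp \<theta>}. \<exists>p. degree p \<le> d \<and> Dfun (Kp \<theta>s) (Tp \<theta>s) n M \<theta> x = poly p"
    "\<forall>x\<in>{1..Kp \<theta>}. \<exists>xs\<in>{1..Kp \<theta>s}. \<bar>poly (Tp \<theta>s xs) 1 - poly (Tp \<theta> x) 1\<bar> \<le> M"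
proof -
  have T: "\<theta> \<in> Theta K d sigma \<Gamma>" using \<theta> by (simp add: ThetaOK_def)
  then show "1 \<le> Kp \<theta>" "Kp \<theta> \<le> K" "pvec (Kp \<theta>) (pip \<theta>)" "stochmat sigma (Kp \<theta>) (Qp \<theta>)" "\<forall>x\<in>{1..Kp \<theta>}. gp \<theta> x \<in> \<Gamma>"
    by (auto simp: Theta_def)
  have n': "n1 (Kp \<theta>s) (Tp \<theta>s) (M + normDelta (Kp \<theta>s) (Tp \<theta>s)) \<le> n" using n by (simp add: M1_def dl_def)
  have c1: "\<exists>xs\<in>{1..Kp \<theta>s}. \<forall>u\<in>{0..real n}. \<bar>poly (Tp \<theta>s xs) u - poly (Tp \<theta> x) u\<bar> \<le> M" if "x \<in> {1..Kp \<theta>}" for x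
    using \<theta> that by (simp add: ThetaOK_def)
  have c2: "\<exists>x\<in>{1..Kp \<theta>}. \<forall>u\<in>{0..real n}. \<bar>poly (Tp \<theta>s xs) u - poly (Tp \<theta> x) u\<bar> \<le> M" if "xs \<in> {1..Kp \<theta>s}" for xs
    using \<theta> that by (simp add: ThetaOK_def)
  show B: "\<forall>x\<in>{1..Kp \<theta>}. bth (Kp \<theta>s) (Tp \<theta>s) n M \<theta> x \<in> Blocks (Kp \<theta>s) (Tp \<theta>s)"
  proof
    fix x assume "x \<in> {1..Kp \<theta>}"
    from c1[OF this] obtain xs where xs: "xs \<in> {1..Kp \<theta>s}" "\<forall>u\<in>{0..real n}. \<bar>poly (Tp \<theta>s xs) u - poly (Tp \<theta> x) u\<bar> \<le> M" by blast
    then show "bth (Kp \<theta>s) (Tp \<theta>s) n M \<theta> x \<in> Blocks (Kp \<theta>s) (Tp \<theta>s)"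
      using bth_eq(1)[OF n' n(2) xs] by (auto simp: Blocks_def)
  qed
  show "\<forall>x\<in>{1..Kp \<theta>}. \<forall>u\<in>{0..1}. \<bar>Dfun (Kp \<theta>s) (Tp \<theta>s) n M \<theta> x u\<bar> \<le> M1"
    unfolding M1_def dl_def using c1 bth_eq(2)[OF n' n(2)] by blast
  show "covers (Kp \<theta>) (bth (Kp \<theta>s) (Tp \<theta>s) n M \<theta>)"
    unfolding covers_def using c2 bth_eq(1)[OF n' n(2)] by blast
  show "\<forall>x\<in>{1..Kp \<theta>}. \<exists>p. degree p \<le> d \<and> Dfun (Kp \<theta>s) (Tp \<theta>s) n M \<theta> x = poly p"
    using B T true_par by (auto intro!: Dfun_poly simp: Theta_def)
  show "\<forall>x\<in>{1..Kp \<theta>}. \<exists>xs\<in>{1..Kp \<theta>s}. \<bar>poly (Tp \<theta>s xs) 1 - poly (Tp \<theta> x) 1\<bar> \<le> M"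
  proof
    fix x assume "x \<in> {1..Kp \<theta>}"
    from c1[OF this] obtain xs where xs: "xs \<in> {1..Kp \<theta>s}" "\<forall>u\<in>{0..real n}. \<bar>poly (Tp \<theta>s xs) u - poly (Tp \<theta> x) u\<bar> \<le> M" by blast
    then show "\<exists>xs\<in>{1..Kp \<theta>s}. \<bar>poly (Tp \<theta>s xs) 1 - poly (Tp \<theta> x) 1\<bar> \<le> M"
      using n by (intro bexI[of _ xs]) auto
  qed
qed

text \<open>Elements of \<open>DM\<close> are polynomials bounded by \<open>M1\<close> on [0,1], and
  both continuity and the bound survive uniform limits.\<close>

lemma supcl_DM:
  assumes "D \<in> supcl (DM K d sigma \<Gamma> (Kp \<theta>s) (Tp \<theta>s) M)"
  shows "continuous_on {0..1} D" "\<forall>u\<in>{0..1}. \<bar>D u\<bar> \<le> M1"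
proof -
  have DM: "continuous_on {0..1} f \<and> (\<forall>u\<in>{0..1}. \<bar>f u\<bar> \<le> M1)" if "f \<in> DM K d sigma \<Gamma> (Kp \<theta>s) (Tp \<theta>s) M" for f
  proof -
    obtain n \<theta> x where n: "max (4 * K * (d + 1)) (n1 (Kp \<theta>s) (Tp \<theta>s) (M + normDelta (Kp \<theta>s) (Tp \<theta>s))) \<le> n"
      and f: "f = Dfun (Kp \<theta>s) (Tp \<theta>s) n M \<theta> x" "\<theta> \<in> ThetaOK K d sigma \<Gamma> (Kp \<theta>s) (Tp \<theta>s) n M" "x \<in> {1..Kp \<theta>}"
      using \<open>f \<in> _\<close> unfolding DM_def by auto
    have n': "n1 (Kp \<theta>s) (Tp \<theta>s) M1 \<le> n" "1 \<le> n"
    proof -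
      show "n1 (Kp \<theta>s) (Tp \<theta>s) M1 \<le> n" using n by (simp add: M1_def dl_def)
      have "1 \<le> 4 * K * (d + 1)" using K by simp
      then show "1 \<le> n" using n by linarith
    qed
    obtain p where "f = poly p" using ThetaOKD(9)[OF n' f(2)] f by blast
    then have "continuous_on {0..1} f" by (simp add: continuous_intros)
    then show ?thesis using ThetaOKD(7)[OF n' f(2)] f by blast
  qed
  show "continuous_on {0..1} D"
    using assms DM unfolding supcl_def by (intro continuous_on_if_uniformly_approximated) blast
  show "\<forall>u\<in>{0..1}. \<bar>D u\<bar> \<le> M1"
  proof
    fix u :: real assume u: "u \<in> {0..1}"
    show "\<bar>D u\<bar> \<le> M1"
    proof (rule field_le_epsilon)
      fix e :: real assume "0 < e"
      then obtain f where "f \<in> DM K d sigma \<Gamma> (Kp \<theta>s) (Tp \<theta>s) M" "\<bar>D u - f u\<bar> < e"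
        using assms u unfolding supcl_def by blast
      then show "\<bar>D u\<bar> \<le> M1 + e" using DM[of f] u by fastforce
    qed
  qed
qed

text \<open>By equicontinuity it is enough to control the densities on a finite grid, which is an open
  condition for pointwise convergence.\<close>
lemma density_neighbourhood:
  fixes \<gamma> :: "nat \<Rightarrow> real \<Rightarrow> real"
  assumes \<gamma>: "\<forall>x\<in>{1..K'}. \<gamma> x \<in> \<Gamma>" and \<delta>: "0 < \<delta>" and R: "0 \<le> R"
  obtains U where "open U" "\<gamma> \<in> U"
    "\<And>\<gamma>' x y. \<gamma>' \<in> U \<Longrightarrow> \<forall>x\<in>{1..K'}. \<gamma>' x \<in> \<Gamma> \<Longrightarrow> x \<in> {1..K'} \<Longrightarrow> \<bar>y\<bar> \<le> R \<Longrightarrow> \<bar>ln (\<gamma>' x y) - ln (\<gamma> x y)\<bar> \<le> \<delta>"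
proof -
  obtain h where h: "0 < h" "w h \<le> (\<delta> / 3) / v R" using w_small[of "(\<delta> / 3) / v R"] v_ge1[of R] \<delta> by auto
  define I where "I = \<lceil>R / h\<rceil>"
  \<comment> \<open>Open windows of logarithmic radius \<open>\<delta> / 3\<close> at the grid
    points; the remaining two thirds of \<open>\<delta>\<close> move each of the two densities from
    y to the grid.\<close>
  define S where "S x i = {\<gamma> x (h * of_int i) * exp (- (\<delta> / 3)) <..< \<gamma> x (h * of_int i) * exp (\<delta> / 3)}" for x and i :: int
  define U where "U = (\<Inter>x\<in>{1..K'}. \<Inter>i\<in>{- I..I}. {f. f x (h * of_int i) \<in> S x i})"
  have oS: "open {f :: nat \<Rightarrow> real \<Rightarrow> real. f x (h * of_int i) \<in> S x i}" for x i
    by (rule open_eval) (simp add: S_def)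
  have "open U" unfolding U_def by (intro open_INT ballI oS finite_atLeastAtMost finite_atLeastAtMost_int)
  moreover have "\<gamma> \<in> U"
  proof -
    have "\<gamma> x z * exp (- (\<delta> / 3)) < \<gamma> x z * 1 \<and> \<gamma> x z * 1 < \<gamma> x z * exp (\<delta> / 3)" if "x \<in> {1..K'}" for x z
      using Gamma_bounds(1)[of "\<gamma> x" z] \<gamma> that \<delta> by (intro conjI mult_strict_left_mono) auto
    then show ?thesis by (auto simp: U_def S_def)
  qed
  moreover have "\<bar>ln (\<gamma>' x y) - ln (\<gamma> x y)\<bar> \<le> \<delta>"
    if \<gamma>': "\<gamma>' \<in> U" "\<forall>x\<in>{1..K'}. \<gamma>' x \<in> \<Gamma>" and x: "x \<in> {1..K'}" and y: "\<bar>y\<bar> \<le> R" for \<gamma>' x y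
  proof -
    define i where "i = \<lfloor>y / h\<rfloor>"
    have i: "i \<in> {- I..I}"
    proof -
      have "- (R / h) \<le> y / h" "y / h \<le> R / h" using y h by (simp_all add: field_simps abs_le_iff)
      moreover have "of_int i \<le> y / h" "R / h \<le> of_int I" "y / h < of_int i + 1" unfolding i_def I_def by linarith+
      ultimately have "of_int i \<le> (of_int I :: real)" "of_int (- I) < (of_int (i + 1) :: real)" by simp_all
      then show ?thesis unfolding of_int_le_iff of_int_less_iff by simp
    qed
    let ?z = "h * of_int i"
    have pos: "0 < \<gamma> x ?z" "0 < \<gamma>' x ?z" using Gamma_bounds(1) \<gamma> \<gamma>'(2) x by blast+
    have "\<gamma>' x ?z \<in> S x i" using \<gamma>'(1) x i unfolding U_def by blast
    then have "\<gamma> x ?z * exp (- (\<delta> / 3)) < \<gamma>' x ?z" "\<gamma>' x ?z < \<gamma> x ?z * exp (\<delta> / 3)" by (auto simp: S_def)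
    then have "ln (\<gamma> x ?z * exp (- (\<delta> / 3))) < ln (\<gamma>' x ?z)" "ln (\<gamma>' x ?z) < ln (\<gamma> x ?z * exp (\<delta> / 3))"
      using pos by (subst ln_less_cancel_iff; simp)+
    then have 1: "\<bar>ln (\<gamma>' x ?z) - ln (\<gamma> x ?z)\<bar> \<le> \<delta> / 3"
      using ln_mult_pos[OF pos(1) exp_gt_zero, of "\<delta> / 3"] ln_mult_pos[OF pos(1) exp_gt_zero, of "- (\<delta> / 3)"]
      unfolding ln_exp by linarith
    have 2: "\<bar>ln (f y) - ln (f ?z)\<bar> \<le> \<delta> / 3" if "f \<in> \<Gamma>" for f
    proof -
      have "\<bar>ln (f (y - 0)) - ln (f ?z)\<bar> \<le> v \<bar>y\<bar> * w \<bar>?z - (y - 0)\<bar>"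
        using that M1_pos by (intro Gamma_modulus) auto
      also have "\<dots> \<le> v R * w h"
        using y floor_grid_close[OF h(1), of y] unfolding i_def
        by (intro mult_mono v_le w(1) v_nonneg w_nonneg) (auto simp: abs_minus_commute)
      also have "\<dots> \<le> v R * ((\<delta> / 3) / v R)" using h v_nonneg by (intro mult_left_mono) auto
      also have "\<dots> = \<delta> / 3" using v_ge1[of R] by simp
      finally show ?thesis by simp
    qed
    have "\<gamma> x \<in> \<Gamma>" "\<gamma>' x \<in> \<Gamma>" using \<gamma> \<gamma>'(2) x by blast+
    then show ?thesis using 1 2[of "\<gamma> x"] 2[of "\<gamma>' x"] by linarith
  qed
  ultimately show ?thesis using that by blast
qed

lemma lint_continuous:
  "cont_on_dom K sigma \<Gamma> (supcl (DM K d sigma \<Gamma> (Kp \<theta>s) (Tp \<theta>s) M)) (Blocks (Kp \<theta>s) (Tp \<theta>s)) (lint P \<theta>s X Zx)"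
  unfolding cont_on_dom_def
proof (intro ballI allI impI)
  fix K' Q \<gamma> D bb and \<epsilon> :: real
  let ?C = "supcl (DM K d sigma \<Gamma> (Kp \<theta>s) (Tp \<theta>s) M)" and ?B = "Blocks (Kp \<theta>s) (Tp \<theta>s)"
  assume K': "K' \<in> {1..K}" and dom: "(Q, \<gamma>, D, bb) \<in> lint_dom sigma \<Gamma> ?C ?B K'" and \<epsilon>: "0 < \<epsilon>"
  have K1: "1 \<le> K'" using K' by simp
  have Q: "stochmat sigma K' Q" and \<gamma>: "\<forall>x\<in>{1..K'}. \<gamma> x \<in> \<Gamma>" and DC: "\<forall>x\<in>{1..K'}. D x \<in> ?C" using dom by (auto simp: lint_dom_def)
  show "\<exists>\<delta>>0. \<exists>U. open U \<and> \<gamma> \<in> U \<and>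
         (\<forall>Q' \<gamma>' D'. (Q', \<gamma>', D', bb) \<in> lint_dom sigma \<Gamma> ?C ?B K' \<and>
            (\<forall>x\<in>{1..K'}. \<forall>y\<in>{1..K'}. \<bar>Q' x y - Q x y\<bar> < \<delta>) \<and> \<gamma>' \<in> U \<and>
            (\<forall>x\<in>{1..K'}. \<forall>u\<in>{0..1}. \<bar>D' x u - D x u\<bar> < \<delta>) \<longrightarrow>
            \<bar>lint P \<theta>s X Zx K' Q' \<gamma>' D' bb - lint P \<theta>s X Zx K' Q \<gamma> D bb\<bar> < \<epsilon>)"
  proof (cases "covers K' bb")
    \<comment> \<open>With a block missed, the integrand is the default value 0 for all Q,
      \<open>\<gamma>\<close> and D, and continuity is trivial.\<close>
    case False
    then have "lint P \<theta>s X Zx K' Q \<gamma> D bb = 0" for Q \<gamma> D by (simp add: lint_def lhom_not_covers)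
    then show ?thesis using \<epsilon> by (intro exI[of _ 1] conjI exI[of _ UNIV]) auto
  next
    case bb: True
    have "\<forall>\<^sub>F j in sequentially. \<tau> j < \<epsilon> / 16" using tau_tendsto \<epsilon> by (intro order_tendstoD) auto
    then obtain j where j: "\<tau> j < \<epsilon> / 16" using eventually_happens'[OF trivial_limit_sequentially] by blast
    \<comment> \<open>Changing Q and \<open>\<gamma>\<close> costs
      \<open>2 * \<delta>0 + 2 * \<tau> j\<close>, at most a quarter of \<open>\<epsilon>\<close>,
      and changing D another quarter through the modulus w. The densities must be close up to
      \<open>real j + dl + M1\<close>, the largest argument after translation.\<close>
    define \<delta>0 where "\<delta>0 = \<epsilon> / 16"
    have \<delta>0: "0 < \<delta>0" using \<epsilon> by (simp add: \<delta>0_def)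
    have R0: "0 \<le> real j + dl + M1" using dl0 M1_pos by simp
    obtain U where U: "open U" "\<gamma> \<in> U"
      "\<And>\<gamma>' x y. \<gamma>' \<in> U \<Longrightarrow> \<forall>x\<in>{1..K'}. \<gamma>' x \<in> \<Gamma> \<Longrightarrow> x \<in> {1..K'} \<Longrightarrow> \<bar>y\<bar> \<le> real j + dl + M1 \<Longrightarrow> \<bar>ln (\<gamma>' x y) - ln (\<gamma> x y)\<bar> \<le> \<delta>0"
      by (rule density_neighbourhood[OF \<gamma> \<delta>0 R0]) (rule that)
    obtain h where h: "0 < h" "w h \<le> \<epsilon> / (4 * CV)" using w_small[of "\<epsilon> / (4 * CV)"] \<epsilon> CV_pos by auto
    define \<delta> where "\<delta> = min h (\<delta>0 * sigma)"
    have \<delta>: "0 < \<delta>" using h \<delta>0 sigma by (simp add: \<delta>_def)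
    show ?thesis
    proof (intro exI[of _ \<delta>] exI[of _ U] conjI allI impI \<delta> U(1,2))
      fix Q' \<gamma>' D'
      assume a: "(Q', \<gamma>', D', bb) \<in> lint_dom sigma \<Gamma> ?C ?B K' \<and>
            (\<forall>x\<in>{1..K'}. \<forall>y\<in>{1..K'}. \<bar>Q' x y - Q x y\<bar> < \<delta>) \<and> \<gamma>' \<in> U \<and>
            (\<forall>x\<in>{1..K'}. \<forall>u\<in>{0..1}. \<bar>D' x u - D x u\<bar> < \<delta>)"
      then have Q': "stochmat sigma K' Q'" and \<gamma>': "\<forall>x\<in>{1..K'}. \<gamma>' x \<in> \<Gamma>" and DC': "\<forall>x\<in>{1..K'}. D' x \<in> ?C"
        and \<gamma>U: "\<gamma>' \<in> U" by (auto simp: lint_dom_def)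
      have C: "\<forall>x\<in>{1..K'}. \<forall>u\<in>{0..1}. \<bar>F x u\<bar> \<le> M1" "\<forall>x\<in>{1..K'}. continuous_on {0..1} (F x)"
        if F: "\<forall>x\<in>{1..K'}. F x \<in> ?C" for F :: "nat \<Rightarrow> real \<Rightarrow> real"
      proof -
        show "\<forall>x\<in>{1..K'}. \<forall>u\<in>{0..1}. \<bar>F x u\<bar> \<le> M1"
        proof
          fix x assume "x \<in> {1..K'}"
          then have "F x \<in> ?C" using F by (rule bspec[rotated])
          then show "\<forall>u\<in>{0..1}. \<bar>F x u\<bar> \<le> M1" by (rule supcl_DM(2))
        qed
        show "\<forall>x\<in>{1..K'}. continuous_on {0..1} (F x)"
        proof
          fix x assume "x \<in> {1..K'}"
          then have "F x \<in> ?C" using F by (rule bspec[rotated])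
          then show "continuous_on {0..1} (F x)" by (rule supcl_DM(1))
        qed
      qed
      note D = C[OF DC] and D' = C[OF DC']
      let ?l = "\<lambda>u. lam K' Q (\<lambda>x z. \<gamma> x (z - D x u)) bb" and ?l' = "\<lambda>u. lam K' Q' (\<lambda>x z. \<gamma>' x (z - D' x u)) bb"
      have cl: "continuous_on {0..1} ?l" "continuous_on {0..1} ?l'"
        using lam_continuous[OF K1 Q \<gamma> D bb] lam_continuous[OF K1 Q' \<gamma>' D' bb] by blast+
      have "\<bar>?l' u - ?l u\<bar> \<le> \<epsilon> / 2" if u: "u \<in> {0..1}" for u
      proof -
        have em: "emc K' (\<lambda>x z. \<gamma> x (z - D x u))" "emc K' (\<lambda>x z. \<gamma>' x (z - D x u))" "emc K' (\<lambda>x z. \<gamma>' x (z - D' x u))"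
          using \<gamma> \<gamma>' D(1) D'(1) u by (intro emc_translate; auto)+
        have "\<bar>?l' u - lam K' Q' (\<lambda>x z. \<gamma>' x (z - D x u)) bb\<bar> \<le> CV * w h"
        proof (rule lam_diff_modulus[OF K1 Q' em(3) bb em(2)])
          fix x z assume x: "x \<in> {1..K'}"
          have "\<bar>D' x u - D x u\<bar> < \<delta>" using a x u by blast
          then have "\<bar>D' x u - D x u\<bar> \<le> h" unfolding \<delta>_def by linarith
          then show "\<bar>ln (\<gamma>' x (z - D' x u)) - ln (\<gamma>' x (z - D x u))\<bar> \<le> v \<bar>z\<bar> * w h"
            using \<gamma>' D'(1) x u by (intro translate_diff) auto
        qed (use h w_nonneg in auto)
        also have "\<dots> \<le> CV * (\<epsilon> / (4 * CV))" using h CV_pos by (intro mult_left_mono) auto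
        also have "\<dots> = \<epsilon> / 4" using CV_pos by simp
        finally have 1: "\<bar>?l' u - lam K' Q' (\<lambda>x z. \<gamma>' x (z - D x u)) bb\<bar> \<le> \<epsilon> / 4" .
        have 2: "\<bar>lam K' Q' (\<lambda>x z. \<gamma>' x (z - D x u)) bb - ?l u\<bar> \<le> 2 * \<delta>0 + 2 * \<tau> j"
        proof (rule lam_diff_close[OF K1 Q' em(2) bb Q em(1)])
          fix x y assume xy: "x \<in> {1..K'}" "y \<in> {1..K'}"
          have "\<bar>Q' x y - Q x y\<bar> < \<delta>" using a xy by blast
          then have "\<bar>Q' x y - Q x y\<bar> \<le> \<delta>0 * sigma" unfolding \<delta>_def by linarith
          then show "Q' x y \<le> exp \<delta>0 * Q x y \<and> Q x y \<le> exp \<delta>0 * Q' x y"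
            by (rule stochmat_exp_close[OF Q' Q \<delta>0 xy])
        next
          fix x z assume x: "x \<in> {1..K'}" and z: "\<bar>z\<bar> \<le> real j + dl"
          have "\<bar>D x u\<bar> \<le> M1" using D(1) x u by blast
          then have "\<bar>z - D x u\<bar> \<le> real j + dl + M1" using z by linarith
          then show "\<bar>ln (\<gamma>' x (z - D x u)) - ln (\<gamma> x (z - D x u))\<bar> \<le> \<delta>0"
            by (rule U(3)[OF \<gamma>U \<gamma>' x])
        qed (use \<delta>0 in auto)
        show ?thesis using 1 2 j unfolding \<delta>0_def by linarith
      qed
      then have "norm (integral {0..1} (\<lambda>u. ?l' u - ?l u)) \<le> (\<epsilon> / 2) * (1 - 0)"
        using cl by (intro integral_bound) (auto intro!: continuous_intros)
      moreover have "integral {0..1} (\<lambda>u. ?l' u - ?l u) = integral {0..1} ?l' - integral {0..1} ?l"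
        using cl by (intro Henstock_Kurzweil_Integration.integral_diff integrable_continuous_interval)
      ultimately show "\<bar>lint P \<theta>s X Zx K' Q' \<gamma>' D' bb - lint P \<theta>s X Zx K' Q \<gamma> D bb\<bar> < \<epsilon>"
        unfolding lint_eq[OF K1 Q \<gamma> D(1) bb] lint_eq[OF K1 Q' \<gamma>' D'(1) bb] using \<epsilon> by simp
    qed
  qed
qed

section \<open>Reduction of the trend model to varying homogeneous emissions\<close>

definition efull :: "hmmpar \<Rightarrow> 'a \<Rightarrow> nat \<Rightarrow> nat \<Rightarrow> real" where
  "efull \<theta> \<omega> t x = gp \<theta> x (Yobs \<theta>s X Zx t \<omega> - poly (Tp \<theta> x) (real t))"

abbreviation "TOK n \<equiv> ThetaOK K d sigma \<Gamma> (Kp \<theta>s) (Tp \<theta>s) n M"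
abbreviation "bt n \<theta> \<equiv> bth (Kp \<theta>s) (Tp \<theta>s) n M \<theta>"
abbreviation "Df n \<theta> \<equiv> Dfun (Kp \<theta>s) (Tp \<theta>s) n M \<theta>"
abbreviation "bl t \<omega> \<equiv> blockof (Kp \<theta>s) (Tp \<theta>s) (X t \<omega>)"
definition n0 :: nat where "n0 = max 1 (n1 (Kp \<theta>s) (Tp \<theta>s) M1)"

lemma efull_hmmseq:
  assumes n: "n0 \<le> n" and \<theta>: "\<theta> \<in> TOK n"
  shows "hmmseq sigma (Kp \<theta>) (Qp \<theta>) (efull \<theta> \<omega>)"
proof -
  have n': "n1 (Kp \<theta>s) (Tp \<theta>s) M1 \<le> n" "1 \<le> n" using n by (auto simp: n0_def)
  note T = ThetaOKD[OF n' \<theta>]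
  have "0 < efull \<theta> \<omega> t x" if "x \<in> {1..Kp \<theta>}" for t x
    unfolding efull_def using T(5) that by (intro Gamma_bounds(1)) auto
  then show ?thesis using T sigma by unfold_locales (force simp: less_imp_le intro!: bexI[of _ 1])+
qed

text \<open>Separates the gap between two block trends, which diverges for a wrong block and
  vanishes for the right one, from the noise and from \<open>Df\<close>, which is bounded by
  \<open>M1\<close>.\<close>

lemma efull_eq:
  assumes g: "good \<omega>" and n: "n0 \<le> n" and t: "t \<in> {1..n}"
  shows "efull \<theta> \<omega> t x = gp \<theta> x (Zp t \<omega> + (poly (bigT (Tp \<theta>s) (bl t \<omega>)) (real t) - poly (bigT (Tp \<theta>s) (bt n \<theta> x)) (real t)) - Df n \<theta> x (min 1 (real t / real n)))"
proof -
  have X: "X t \<omega> \<in> {1..Kp \<theta>s}" using g t unfolding good_def by auto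
  have "Yobs \<theta>s X Zx t \<omega> = Zp t \<omega> + poly (bigT (Tp \<theta>s) (bl t \<omega>)) (real t)"
    using Zprime_eq[OF X] unfolding Zprime_def Bproc_def by linarith
  moreover have "min 1 (real t / real n) = real t / real n" "real n * (real t / real n) = real t" using t by auto
  ultimately show ?thesis unfolding efull_def Dfun_def by (simp add: algebra_simps)
qed

lemma efull_right:
  assumes "good \<omega>" "n0 \<le> n" "t \<in> {1..n}" "bt n \<theta> x = bl t \<omega>"
  shows "efull \<theta> \<omega> t x = gp \<theta> x (Zp t \<omega> - Df n \<theta> x (min 1 (real t / real n)))"
  using efull_eq[OF assms(1-3), of \<theta> x] assms(4) by simp

text \<open>At time 1 the observation is a fixed number and every trend is within M of a true one,
  so all arguments are at most A in modulus. The emissions then lie between \<open>m A\<close> and G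
  uniformly in the parameter, and by \<open>lik_init\<close> the initial law costs a
  constant.\<close>

lemma initial_law_cost:
  assumes g: "good \<omega>" and \<epsilon>: "0 < \<epsilon>"
  shows "\<forall>\<^sub>F n in sequentially. \<forall>\<theta>\<in>TOK n. \<bar>loglik n \<theta> (\<lambda>t. Yobs \<theta>s X Zx t \<omega>) - seglik (Kp \<theta>) (Qp \<theta>) (efull \<theta> \<omega>) 0 n\<bar> \<le> real n * \<epsilon>"
proof -
  define A where "A = \<bar>Yobs \<theta>s X Zx 1 \<omega>\<bar> + (M + (\<Sum>xs=1..Kp \<theta>s. \<bar>poly (Tp \<theta>s xs) 1\<bar>))"
  define C where "C = \<bar>ln (m A * sigma / (G * real K))\<bar>"
  have A0: "0 \<le> A" unfolding A_def using M_pos by (intro add_nonneg_nonneg sum_nonneg) auto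
  have mA: "0 < m A" using m(2) A0 by blast
  obtain N :: nat where N: "C / \<epsilon> \<le> real N" using real_arch_simple by blast
  show ?thesis
  proof (rule eventually_sequentiallyI[of "max n0 N"], intro ballI)
    fix n \<theta> assume n: "max n0 N \<le> n" and \<theta>: "\<theta> \<in> TOK n"
    then have n': "n0 \<le> n" "n1 (Kp \<theta>s) (Tp \<theta>s) M1 \<le> n" "1 \<le> n" by (auto simp: n0_def)
    note T = ThetaOKD[OF n'(2,3) \<theta>]
    have h: "hmmseq sigma (Kp \<theta>) (Qp \<theta>) (efull \<theta> \<omega>)" by (rule efull_hmmseq[OF n'(1) \<theta>])
    have ab: "m A \<le> efull \<theta> \<omega> 1 x \<and> efull \<theta> \<omega> 1 x \<le> G" if x: "x \<in> {1..Kp \<theta>}" for x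
    proof -
      obtain xs where xs: "xs \<in> {1..Kp \<theta>s}" "\<bar>poly (Tp \<theta>s xs) 1 - poly (Tp \<theta> x) 1\<bar> \<le> M" using T(10) x by blast
      have "\<bar>poly (Tp \<theta>s xs) 1\<bar> \<le> (\<Sum>xs=1..Kp \<theta>s. \<bar>poly (Tp \<theta>s xs) 1\<bar>)" using xs by (intro member_le_sum) auto
      then have "\<bar>Yobs \<theta>s X Zx 1 \<omega> - poly (Tp \<theta> x) (real 1)\<bar> \<le> A" using xs(2) unfolding A_def by simp
      then have "m A \<le> m \<bar>Yobs \<theta>s X Zx 1 \<omega> - poly (Tp \<theta> x) (real 1)\<bar>" by (intro m(1)[rule_format]) auto
      moreover have "gp \<theta> x \<in> \<Gamma>" using T(5) x by blast
      ultimately show ?thesis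
        using Gamma_bounds(2,4)[of "gp \<theta> x" "Yobs \<theta>s X Zx 1 \<omega> - poly (Tp \<theta> x) (real 1)"] unfolding efull_def by linarith
    qed
    have ll: "loglik n \<theta> (\<lambda>t. Yobs \<theta>s X Zx t \<omega>) = ln (lik (Kp \<theta>) (Qp \<theta>) (efull \<theta> \<omega>) (pip \<theta>) n)"
      unfolding loglik_def using lik_paths[OF T(4) n'(3), of "pip \<theta>" "efull \<theta> \<omega>"] by (simp add: efull_def)
    have l1: "ln (lik (Kp \<theta>) (Qp \<theta>) (efull \<theta> \<omega>) (pip \<theta>) n) \<le> seglik (Kp \<theta>) (Qp \<theta>) (efull \<theta> \<omega>) 0 n"
      by (rule lik_init(1)[OF h T(3) n'(3) mA ab])
    have l2: "seglik (Kp \<theta>) (Qp \<theta>) (efull \<theta> \<omega>) 0 n + ln (m A * sigma / (G * real (Kp \<theta>))) \<le> ln (lik (Kp \<theta>) (Qp \<theta>) (efull \<theta> \<omega>) (pip \<theta>) n)"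
      by (rule lik_init(2)[OF h T(3) n'(3) mA ab])
    have "m A * sigma / (G * real K) \<le> m A * sigma / (G * real (Kp \<theta>))"
      using mA sigma G1 T(1,2) by (intro divide_left_mono mult_left_mono mult_pos_pos) auto
    then have "ln (m A * sigma / (G * real K)) \<le> ln (m A * sigma / (G * real (Kp \<theta>)))"
      using mA sigma G1 T(1,2) K by (subst ln_le_cancel_iff) auto
    then have "\<bar>ln (lik (Kp \<theta>) (Qp \<theta>) (efull \<theta> \<omega>) (pip \<theta>) n) - seglik (Kp \<theta>) (Qp \<theta>) (efull \<theta> \<omega>) 0 n\<bar> \<le> C"
      using l1 l2 unfolding C_def by linarith
    also have "C \<le> real n * \<epsilon>"
    proof -
      have "C / \<epsilon> \<le> real n" using N n by (meson max.boundedE of_nat_le_iff order.trans)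
      then show ?thesis using \<epsilon> by (simp add: field_simps)
    qed
    finally show "\<bar>loglik n \<theta> (\<lambda>t. Yobs \<theta>s X Zx t \<omega>) - seglik (Kp \<theta>) (Qp \<theta>) (efull \<theta> \<omega>) 0 n\<bar> \<le> real n * \<epsilon>" unfolding ll .
  qed
qed

text \<open>Once the block trends have drifted apart, a state in the wrong block has negligible likelihood
  unless the noise is large, which is rare.\<close>
lemma wrong_block_cost:
  assumes g: "good \<omega>" and \<epsilon>: "0 < \<epsilon>"
  shows "\<forall>\<^sub>F n in sequentially. \<forall>\<theta>\<in>TOK n.
    \<bar>seglik (Kp \<theta>) (Qp \<theta>) (efull \<theta> \<omega>) 0 n - seglik (Kp \<theta>) (Qp \<theta>) (\<lambda>t x. if bt n \<theta> x = bl t \<omega> then efull \<theta> \<omega> t x else 0) 0 n\<bar> \<le> real n * \<epsilon>"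
proof -
  \<comment> \<open>Constants of the crude bound for unfavourable times: using only that emissions
    are at most G, the ratio \<open>r t\<close> is at most \<open>c0\<close> times the exponential
    of the envelope. As the envelope is at least 1, \<open>ln (1 + r t)\<close> is then at most
    \<open>c1\<close> times the envelope.\<close>
  define c0 where "c0 = real K * G / sigma\<^sup>2"
  define c1 where "c1 = 1 + ln (1 + c0)"
  have c0: "0 \<le> c0" using G1 by (simp add: c0_def)
  then have c1: "1 \<le> c1" by (simp add: c1_def)
  have "\<forall>\<^sub>F j in sequentially. \<tau> j < \<epsilon> / (4 * c1)" using tau_tendsto \<epsilon> c1 by (intro order_tendstoD) auto
  then obtain j where j: "\<tau> j < \<epsilon> / (4 * c1)" using eventually_happens'[OF trivial_limit_sequentially] by blast
  \<comment> \<open>The size of a wrong-block emission for which the ratio \<open>r t\<close> is at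
    most \<open>\<epsilon> / 4\<close> while the noise is at most j.\<close>
  define q where "q = (\<epsilon> / 4) * sigma\<^sup>2 / (real K * exp (v (real j + dl)))"
  have q: "0 < q" using \<epsilon> sigma K by (simp add: q_def)
  have "\<forall>\<^sub>F H in at_top. g H < q" using trend_hmm.g(2)[OF trend_hmm_axioms] q by (intro order_tendstoD) auto
  then obtain H0 where H0: "\<And>H. H0 \<le> H \<Longrightarrow> g H < q" by (auto simp: eventually_at_top_linorder)
  define H where "H = max 0 H0"
  have H: "0 \<le> H" "g H < q" using H0[of H] by (auto simp: H_def)
  \<comment> \<open>From t0 on, noise of size \<open>real j + dl\<close> and a deviation
    \<open>M1\<close> cannot bring the argument of a wrong-block density below H in modulus.\<close>
  obtain t0 where t00: "\<forall>t\<ge>t0. \<forall>b\<in>Blocks (Kp \<theta>s) (Tp \<theta>s). \<forall>b'\<in>Blocks (Kp \<theta>s) (Tp \<theta>s). b \<noteq> b' \<longrightarrow>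
      H + (real j + dl) + M1 < \<bar>poly (bigT (Tp \<theta>s) b) (real t) - poly (bigT (Tp \<theta>s) b') (real t)\<bar>"
    using block_gap[of "Kp \<theta>s" "Tp \<theta>s" "H + (real j + dl) + M1"] ..
  have t0: "H + (real j + dl) + M1 < \<bar>poly (bigT (Tp \<theta>s) b) (real t) - poly (bigT (Tp \<theta>s) b') (real t)\<bar>"
    if "t0 \<le> t" "b \<in> Blocks (Kp \<theta>s) (Tp \<theta>s)" "b' \<in> Blocks (Kp \<theta>s) (Tp \<theta>s)" "b \<noteq> b'" for t b b'
    using t00 that by simp
  \<comment> \<open>The contribution of the finitely many times before the blocks have
    separated.\<close>
  define C where "C = c1 * (\<Sum>t<t0. v (\<bar>Zt t \<omega>\<bar> + dl))"
  obtain N :: nat where N: "4 * C / \<epsilon> \<le> real N" using real_arch_simple by blast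
  have "\<forall>\<^sub>F n in sequentially. (\<Sum>t=1..n. tail (real j) t \<omega>) / real n \<le> \<tau> j" using \<open>good \<omega>\<close> unfolding good_def by blast
  then show ?thesis using eventually_ge_at_top[of "max n0 N"]
  proof eventually_elim
    case (elim n)
    then have n': "n0 \<le> n" "n1 (Kp \<theta>s) (Tp \<theta>s) M1 \<le> n" "1 \<le> n" "N \<le> n" by (auto simp: n0_def)
    show ?case
    proof (intro ballI)
      fix \<theta> assume \<theta>: "\<theta> \<in> TOK n"
      note T = ThetaOKD[OF n'(2,3) \<theta>]
      let ?K = "Kp \<theta>" and ?e = "efull \<theta> \<omega>"
      define Gd where "Gd t x \<longleftrightarrow> bt n \<theta> x = bl t \<omega>" for t x
      have h1: "hmmseq sigma ?K (Qp \<theta>) ?e" by (rule efull_hmmseq[OF n'(1) \<theta>])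
      have epos: "0 < ?e t x" "?e t x \<le> G" if "x \<in> {1..?K}" for t x
        unfolding efull_def using T(5) that by (intro Gamma_bounds; auto)+
      have "\<forall>t. \<exists>y. 1 \<le> t \<longrightarrow> y \<in> {1..?K} \<and> Gd t y"
      proof
        fix t
        show "\<exists>y. 1 \<le> t \<longrightarrow> y \<in> {1..?K} \<and> Gd t y"
        proof (cases "1 \<le> t")
          case True
          then have "X t \<omega> \<in> {1..Kp \<theta>s}" using \<open>good \<omega>\<close> unfolding good_def by blast
          then show ?thesis using T(8) unfolding covers_def Gd_def by blast
        qed simp
      qed
      from choice[OF this] obtain y where "\<forall>t. 1 \<le> t \<longrightarrow> y t \<in> {1..?K} \<and> Gd t (y t)" ..
      then have y: "y t \<in> {1..?K}" "Gd t (y t)" if "1 \<le> t" for t using that by blast+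
      have h2: "hmmseq sigma ?K (Qp \<theta>) (\<lambda>t x. if Gd t x then ?e t x else 0)"
      proof
        show "\<exists>x\<in>{1..?K}. 0 < (if Gd t x then ?e t x else 0)" if "1 \<le> t" for t
          using y[OF that] epos(1) by (intro bexI[of _ "y t"]) auto
      qed (use T sigma epos(1) in \<open>auto simp: less_imp_le\<close>)
      \<comment> \<open>The ratio that \<open>seglik_restrict\<close> asks for, with y t as the
        allowed state replacing those in wrong blocks.\<close>
      define r where "r t = (\<Sum>x\<in>{x\<in>{1..?K}. \<not> Gd t x}. ?e t x) / (sigma\<^sup>2 * ?e t (y t))" for t
      have rprop: "0 \<le> r t \<and> (\<exists>x'\<in>{1..?K}. Gd t x' \<and> (\<Sum>x\<in>{x\<in>{1..?K}. \<not> Gd t x}. ?e t x) \<le> r t * sigma\<^sup>2 * ?e t x')" if t: "t \<in> {1..n}" for t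
      proof (intro conjI bexI[of _ "y t"])
        have t1: "1 \<le> t" using t by simp
        show "y t \<in> {1..?K}" "Gd t (y t)" using y[OF t1] by auto
        have p: "0 < sigma\<^sup>2 * ?e t (y t)" using epos(1) y(1)[OF t1] sigma by simp
        show "0 \<le> r t" unfolding r_def using p epos(1) by (intro divide_nonneg_pos sum_nonneg) (auto simp: less_imp_le)
        show "(\<Sum>x\<in>{x\<in>{1..?K}. \<not> Gd t x}. ?e t x) \<le> r t * sigma\<^sup>2 * ?e t (y t)"
        proof -
          have "S = S / p * p" if "0 < p" for S p :: real using that by simp
          from this[OF p] show ?thesis unfolding r_def mult.assoc by (rule eq_refl)
        qed
      qed
      have lnr: "ln (1 + r t) \<le> \<epsilon> / 4 + c1 * (tail (real j) t \<omega> + (if t < t0 then v (\<bar>Zt t \<omega>\<bar> + dl) else 0))" if t: "t \<in> {1..n}" for t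
      proof -
        have t1: "1 \<le> t" using t by simp
        let ?V = "v (\<bar>Zt t \<omega>\<bar> + dl)"
        have r0: "0 \<le> r t" using rprop[OF t] by blast
        have u01: "min 1 (real t / real n) \<in> {0..1}" by auto
        have XB: "bl t \<omega> \<in> Blocks (Kp \<theta>s) (Tp \<theta>s)" using \<open>good \<omega>\<close> t1 unfolding good_def Blocks_def by blast
        have "\<bar>ln (?e t (y t))\<bar> \<le> v \<bar>Zp t \<omega>\<bar>"
        proof -
          have "?e t (y t) = gp \<theta> (y t) (Zp t \<omega> - Df n \<theta> (y t) (min 1 (real t / real n)))"
            using y(2)[OF t1] by (intro efull_right \<open>good \<omega>\<close> n'(1) t) (simp add: Gd_def)
          then show ?thesis using T(5,7) y(1)[OF t1] u01 by (simp only:) (intro Gamma_ln_bound, auto)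
        qed
        then have ey: "exp (- ?V) \<le> ?e t (y t)"
          using abs_ln_leD(1)[OF epos(1)[OF y(1)[OF t1]]] v_Zp[OF \<open>good \<omega>\<close> t1] order.trans by blast
        have rle: "r t \<le> real K * B * exp ?V / sigma\<^sup>2" if B: "\<And>x. x \<in> {1..?K} \<Longrightarrow> \<not> Gd t x \<Longrightarrow> ?e t x \<le> B" "0 \<le> B" for B
        proof -
          have "(\<Sum>x\<in>{x\<in>{1..?K}. \<not> Gd t x}. ?e t x) \<le> (\<Sum>x\<in>{x\<in>{1..?K}. \<not> Gd t x}. B)" using B by (intro sum_mono) auto
          also have "\<dots> = real (card {x\<in>{1..?K}. \<not> Gd t x}) * B" by simp
          also have "\<dots> \<le> real K * B"
          proof (rule mult_right_mono)
            have "card {x\<in>{1..?K}. \<not> Gd t x} \<le> card {1..?K}" by (intro card_mono) auto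
            then show "real (card {x\<in>{1..?K}. \<not> Gd t x}) \<le> real K" using T(2) by simp
          qed (fact B(2))
          finally have "r t \<le> (real K * B) / (sigma\<^sup>2 * exp (- ?V))"
            unfolding r_def using ey sigma B(2) by (intro frac_le mult_left_mono) auto
          then show ?thesis by (simp add: exp_minus field_simps)
        qed
        show ?thesis
        proof (cases "\<bar>Zt t \<omega>\<bar> \<le> real j \<and> t0 \<le> t")
          case True
          have "?e t x \<le> g H" if x: "x \<in> {1..?K}" "\<not> Gd t x" for x
          proof -
            let ?a = "Zp t \<omega> + (poly (bigT (Tp \<theta>s) (bl t \<omega>)) (real t) - poly (bigT (Tp \<theta>s) (bt n \<theta> x)) (real t)) - Df n \<theta> x (min 1 (real t / real n))"
            have "bt n \<theta> x \<in> Blocks (Kp \<theta>s) (Tp \<theta>s)" using T(6) x by blast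
            then have gap: "H + (real j + dl) + M1 < \<bar>poly (bigT (Tp \<theta>s) (bl t \<omega>)) (real t) - poly (bigT (Tp \<theta>s) (bt n \<theta> x)) (real t)\<bar>"
              using True XB x(2) by (intro t0) (auto simp: Gd_def)
            have "\<bar>Df n \<theta> x (min 1 (real t / real n))\<bar> \<le> M1" using T(7) x(1) u01 by blast
            moreover have "\<bar>Zp t \<omega>\<bar> \<le> real j + dl" using good_Zp[OF \<open>good \<omega>\<close> t1] True by linarith
            ultimately have "H \<le> \<bar>?a\<bar>" using gap by linarith
            then have "g \<bar>?a\<bar> \<le> g H" using trend_hmm.g(1)[OF trend_hmm_axioms] H(1) by blast
            moreover have "?e t x = gp \<theta> x ?a" by (rule efull_eq[OF \<open>good \<omega>\<close> n'(1) t])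
            moreover have "gp \<theta> x ?a \<le> g \<bar>?a\<bar>" using T(5) x(1) by (intro Gamma_bounds) auto
            ultimately show ?thesis by linarith
          qed
          then have "?e t x \<le> q" if "x \<in> {1..?K}" "\<not> Gd t x" for x using that H(2) by fastforce
          then have "r t \<le> real K * q * exp ?V / sigma\<^sup>2" using q by (intro rle) auto
          also have "\<dots> \<le> real K * q * exp (v (real j + dl)) / sigma\<^sup>2"
            using True q sigma by (intro divide_right_mono mult_left_mono) (auto intro!: v_le)
          also have "\<dots> = \<epsilon> / 4" unfolding q_def using sigma K by simp
          finally have "ln (1 + r t) \<le> \<epsilon> / 4" using ln_add_one_self_le_self[OF r0] by linarith
          moreover have "0 \<le> c1 * (tail (real j) t \<omega> + (if t < t0 then ?V else 0))"
            using c1 tail_nonneg v_nonneg by (intro mult_nonneg_nonneg add_nonneg_nonneg) auto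
          ultimately show ?thesis by linarith
        next
          case False
          have "r t \<le> real K * G * exp ?V / sigma\<^sup>2" using epos(2) G1 by (intro rle) auto
          then have "r t \<le> c0 * exp ?V" by (simp add: c0_def)
          then have "1 + r t \<le> exp ?V + c0 * exp ?V" using v_nonneg[of "\<bar>Zt t \<omega>\<bar> + dl"] one_le_exp_iff[of ?V] by linarith
          then have "1 + r t \<le> (1 + c0) * exp ?V" by (simp add: distrib_right)
          then have "ln (1 + r t) \<le> ln ((1 + c0) * exp ?V)" using r0 c0 by (subst ln_le_cancel_iff) auto
          also have "\<dots> = ln (1 + c0) * 1 + ?V" using c0 by (simp add: ln_mult)
          also have "\<dots> \<le> ln (1 + c0) * ?V + ?V" using c0 v_ge1 by (intro add_right_mono mult_left_mono) auto
          also have "\<dots> = c1 * ?V" by (simp add: c1_def distrib_right)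
          also have "\<dots> \<le> c1 * (tail (real j) t \<omega> + (if t < t0 then ?V else 0))"
          proof (rule mult_left_mono)
            show "?V \<le> tail (real j) t \<omega> + (if t < t0 then ?V else 0)"
              using False good_tail[OF \<open>good \<omega>\<close> t1, of "real j"] tail_nonneg[of "real j" t \<omega>] by (cases "t < t0") auto
          qed (use c1 in simp)
          finally show ?thesis using \<epsilon> by linarith
        qed
      qed
      have "(\<Sum>t=1..n. ln (1 + r t)) \<le> (\<Sum>t=1..n. \<epsilon> / 4 + c1 * (tail (real j) t \<omega> + (if t < t0 then v (\<bar>Zt t \<omega>\<bar> + dl) else 0)))"
        by (intro sum_mono lnr)
      also have "\<dots> = real n * (\<epsilon> / 4) + c1 * (\<Sum>t=1..n. tail (real j) t \<omega>) + c1 * (\<Sum>t=1..n. if t < t0 then v (\<bar>Zt t \<omega>\<bar> + dl) else 0)"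
        by (simp add: sum.distrib distrib_left sum_distrib_left)
      also have "c1 * (\<Sum>t=1..n. tail (real j) t \<omega>) \<le> c1 * (real n * (\<epsilon> / (4 * c1)))"
      proof (rule mult_left_mono)
        have "(\<Sum>t=1..n. tail (real j) t \<omega>) / real n \<le> \<epsilon> / (4 * c1)" using elim(1) j by linarith
        then show "(\<Sum>t=1..n. tail (real j) t \<omega>) \<le> real n * (\<epsilon> / (4 * c1))" using n'(3) by (simp add: field_simps)
      qed (use c1 in simp)
      also have "c1 * (real n * (\<epsilon> / (4 * c1))) = real n * (\<epsilon> / 4)" using c1 by simp
      also have "c1 * (\<Sum>t=1..n. if t < t0 then v (\<bar>Zt t \<omega>\<bar> + dl) else 0) \<le> C"
        unfolding C_def
      proof (rule mult_left_mono)
        have "(\<Sum>t=1..n. if t < t0 then v (\<bar>Zt t \<omega>\<bar> + dl) else 0) = (\<Sum>t\<in>{t\<in>{1..n}. t < t0}. v (\<bar>Zt t \<omega>\<bar> + dl))"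
          by (subst sum.inter_filter) auto
        also have "\<dots> \<le> (\<Sum>t<t0. v (\<bar>Zt t \<omega>\<bar> + dl))" using v_nonneg by (intro sum_mono2) auto
        finally show "(\<Sum>t=1..n. if t < t0 then v (\<bar>Zt t \<omega>\<bar> + dl) else 0) \<le> (\<Sum>t<t0. v (\<bar>Zt t \<omega>\<bar> + dl))" .
      qed (use c1 in simp)
      also have "C \<le> real n * (\<epsilon> / 4)"
      proof -
        have "4 * C / \<epsilon> \<le> real n" using N n'(4) by (meson of_nat_le_iff order.trans)
        then show ?thesis using \<epsilon> by (simp add: field_simps)
      qed
      finally have "(\<Sum>t=1..n. ln (1 + r t)) \<le> 3 / 4 * (real n * \<epsilon>)" by (simp add: mult.commute)
      moreover have "0 \<le> real n * \<epsilon>" using \<epsilon> by simp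
      ultimately have "(\<Sum>t=1..n. ln (1 + r t)) \<le> real n * \<epsilon>" by linarith
      then have "\<bar>seglik ?K (Qp \<theta>) ?e 0 n - seglik ?K (Qp \<theta>) (\<lambda>t x. if Gd t x then ?e t x else 0) 0 n\<bar> \<le> real n * \<epsilon>"
        using seglik_restrict[where n=n and r=r and G=Gd, OF h1 h2 rprop] by linarith
      then show "\<bar>seglik ?K (Qp \<theta>) ?e 0 n - seglik ?K (Qp \<theta>) (\<lambda>t x. if bt n \<theta> x = bl t \<omega> then ?e t x else 0) 0 n\<bar> \<le> real n * \<epsilon>"
        unfolding Gd_def .
    qed
  qed
qed

text \<open>Restricting to block maps that are \<open>undefined\<close> out of range leaves finitely
  many, hence a single null set. \<open>seglik_block_cong\<close> and \<open>lam_block_cong\<close>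
  lead back to arbitrary maps.\<close>

definition all_uconv :: "'a \<Rightarrow> bool" where
  "all_uconv \<omega> \<longleftrightarrow> (\<forall>K'\<in>{1..K}. \<forall>bb\<in>PiE {1..K'} (\<lambda>_. Blocks (Kp \<theta>s) (Tp \<theta>s)). covers K' bb \<longrightarrow> uconv K' bb \<omega>)"

lemma AE_all_uconv: "AE \<omega> in P. all_uconv \<omega>"
proof -
  have "AE \<omega> in P. \<forall>bb\<in>PiE {1..K'} (\<lambda>_. Blocks (Kp \<theta>s) (Tp \<theta>s)). covers K' bb \<longrightarrow> uconv K' bb \<omega>" if "K' \<in> {1..K}" for K'
  proof (subst AE_finite_all)
    show "finite (PiE {1..K'} (\<lambda>_. Blocks (Kp \<theta>s) (Tp \<theta>s)))" by (intro finite_PiE finite_Blocks) auto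
    show "\<forall>bb\<in>PiE {1..K'} (\<lambda>_. Blocks (Kp \<theta>s) (Tp \<theta>s)). AE \<omega> in P. covers K' bb \<longrightarrow> uconv K' bb \<omega>"
    proof
      fix bb
      show "AE \<omega> in P. covers K' bb \<longrightarrow> uconv K' bb \<omega>"
      proof (cases "covers K' bb")
        case True
        have "AE \<omega> in P. uconv K' bb \<omega>" unfolding uconv_def by (rule uniform_convergence) (use that True in auto)
        then show ?thesis by eventually_elim simp
      qed simp
    qed
  qed
  then show ?thesis unfolding all_uconv_def by (subst AE_finite_all) auto
qed

section \<open>The uniform estimate and the supremum\<close>

lemma seglik_block_cong:
  assumes "\<And>x. x \<in> {1..K'} \<Longrightarrow> bb x = bb' x"
  shows "seglik K' Q (\<lambda>t. em (\<psi> t) bb \<omega> t) a k = seglik K' Q (\<lambda>t. em (\<psi> t) bb' \<omega> t) a k"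
  using assms by (intro seglik_cong) (simp add: em_def)

lemma lam_block_cong:
  assumes "\<And>x. x \<in> {1..K'} \<Longrightarrow> bb x = bb' x"
  shows "lam K' Q \<phi> bb = lam K' Q \<phi> bb'"
proof -
  have "em \<phi> bb \<omega> = (\<lambda>t. em \<phi> bb \<omega> t)" for bb \<omega> by (rule refl)
  then have "seglik K' Q (em \<phi> bb \<omega>) 0 n = seglik K' Q (em \<phi> bb' \<omega>) 0 n" for \<omega> n
    using seglik_block_cong[of K' bb bb' Q "\<lambda>_. \<phi>" \<omega> 0 n] assms by simp
  then show ?thesis unfolding lam_def by simp
qed

text \<open>The error is shared as follows: a quarter of \<open>\<epsilon>\<close> for the initial
  law, a quarter for states in wrong blocks, and half for the slowly varying emissions.\<close>

lemma uniform_estimate: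
  assumes g: "good \<omega>" and uc: "all_uconv \<omega>" and \<epsilon>: "0 < \<epsilon>"
  shows "\<forall>\<^sub>F n in sequentially. \<forall>\<theta>\<in>TOK n. \<bar>loglik n \<theta> (\<lambda>t. Yobs \<theta>s X Zx t \<omega>) / real n -
     lint P \<theta>s X Zx (Kp \<theta>) (Qp \<theta>) (gp \<theta>) (Df n \<theta>) (bt n \<theta>)\<bar> \<le> \<epsilon>"
proof -
  obtain Lp where Lp: "0 \<le> Lp" "\<And>p :: real poly. degree p \<le> d \<Longrightarrow> (\<forall>u\<in>{0..1}. \<bar>poly p u\<bar> \<le> M1) \<Longrightarrow>
     (\<forall>u\<in>{0..1}. \<forall>u'\<in>{0..1}. \<bar>poly p u - poly p u'\<bar> \<le> Lp * \<bar>u - u'\<bar>)"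
    using poly_uniform_Lipschitz[of d M1] by blast
  \<comment> \<open>Makes the term \<open>2 * CV * \<eta>\<close> of
    \<open>varying_emission\<close>, with \<open>\<eta>\<close> = \<open>w h\<close>, at most a
    quarter of \<open>\<epsilon>\<close>.\<close>
  obtain h where h: "0 < h" "w h \<le> \<epsilon> / (8 * CV)" using w_small[of "\<epsilon> / (8 * CV)"] \<epsilon> CV_pos by auto
  \<comment> \<open>The common Lipschitz constant of all \<open>Df\<close> yields one number J of
    time blocks for every parameter and every n: over a length 1 / J each \<open>Df\<close> moves by
    at most h.\<close>
  obtain J0 :: nat where J0: "Lp / h \<le> real J0" using real_arch_simple by blast
  define J where "J = Suc J0"
  have J: "0 < J" and LJ: "Lp * (1 / real J) \<le> h"
  proof -
    show "0 < J" by (simp add: J_def)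
    have "Lp / h \<le> real J" using J0 by (simp add: J_def)
    then show "Lp * (1 / real J) \<le> h" using h by (simp add: J_def field_simps)
  qed
  have \<epsilon>4: "0 < \<epsilon> / 4" using \<epsilon> by simp
  let ?PE = "\<lambda>K'. PiE {1..K'} (\<lambda>_. Blocks (Kp \<theta>s) (Tp \<theta>s))"
  let ?V = "\<lambda>K' bb n. \<forall>Q \<psi> \<eta>. stochmat sigma K' Q \<longrightarrow> (\<forall>u\<in>{0..1}. emc K' (\<psi> u)) \<longrightarrow> 0 \<le> \<eta> \<longrightarrow>
     (\<forall>u\<in>{0..1}. \<forall>u'\<in>{0..1}. \<bar>u - u'\<bar> \<le> 1 / real J \<longrightarrow> (\<forall>x\<in>{1..K'}. \<forall>z. \<bar>ln (\<psi> u x z) - ln (\<psi> u' x z)\<bar> \<le> v \<bar>z\<bar> * \<eta>)) \<longrightarrow>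
     continuous_on {0..1} (\<lambda>u. lam K' Q (\<psi> u) bb) \<longrightarrow>
     \<bar>seglik K' Q (\<lambda>t. em (\<psi> (min 1 (real t / real n))) bb \<omega> t) 0 n - real n * integral {0..1} (\<lambda>u. lam K' Q (\<psi> u) bb)\<bar>
       \<le> real n * (\<epsilon> / 4 + 2 * CV * \<eta>)"
  have "\<forall>\<^sub>F n in sequentially. \<forall>K'\<in>{1..K}. \<forall>bb\<in>?PE K'. covers K' bb \<longrightarrow> ?V K' bb n"
  proof (intro eventually_ball_finite ballI)
    show "finite (?PE K')" for K' :: nat by (intro finite_PiE finite_Blocks) auto
    fix K' bb assume K': "K' \<in> {1..K}" and bb: "bb \<in> ?PE K'"
    show "\<forall>\<^sub>F n in sequentially. covers K' bb \<longrightarrow> ?V K' bb n"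
    proof (cases "covers K' bb")
      case True
      then have "uconv K' bb \<omega>" using uc K' bb unfolding all_uconv_def by blast
      from varying_emission[OF g _ True this \<epsilon>4 J] K' show ?thesis
        by (auto elim: eventually_mono)
    qed simp
  qed simp
  then show ?thesis
    using initial_law_cost[OF g \<epsilon>4] wrong_block_cost[OF g \<epsilon>4] eventually_ge_at_top[of n0]
  proof eventually_elim
    case (elim n)
    then have n': "n1 (Kp \<theta>s) (Tp \<theta>s) M1 \<le> n" "1 \<le> n" by (auto simp: n0_def)
    show ?case
    proof
      fix \<theta> assume \<theta>: "\<theta> \<in> TOK n"
      note T = ThetaOKD[OF n' \<theta>]
      let ?K = "Kp \<theta>" and ?Q = "Qp \<theta>"
      define bb where "bb = restrict (bt n \<theta>) {1..?K}"
      have bbeq: "bb x = bt n \<theta> x" if "x \<in> {1..?K}" for x using that by (simp add: bb_def)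
      have bbP: "bb \<in> ?PE ?K" using T(6) by (auto simp: bb_def)
      have cov: "covers ?K bb" using T(8) bbeq unfolding covers_def by metis
      define \<psi> where "\<psi> u x z = gp \<theta> x (z - Df n \<theta> x u)" for u x z
      have em\<psi>: "emc ?K (\<psi> u)" if "u \<in> {0..1}" for u
        unfolding \<psi>_def[abs_def] using T(5,7) that by (intro emc_translate) auto
      have Dlip: "\<bar>Df n \<theta> x u - Df n \<theta> x u'\<bar> \<le> h" if x: "x \<in> {1..?K}" and u: "u \<in> {0..1}" "u' \<in> {0..1}" "\<bar>u - u'\<bar> \<le> 1 / real J" for x u u'
      proof -
        obtain p where p: "degree p \<le> d" "Df n \<theta> x = poly p" using T(9) x by blast
        have "\<forall>u\<in>{0..1}. \<bar>poly p u\<bar> \<le> M1" using T(7) x unfolding p(2)[symmetric] by blast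
        then have "\<bar>poly p u - poly p u'\<bar> \<le> Lp * \<bar>u - u'\<bar>" using Lp(2)[OF p(1)] u by blast
        also have "\<dots> \<le> Lp * (1 / real J)" using u(3) Lp(1) by (rule mult_left_mono)
        finally show ?thesis using LJ unfolding p(2) by linarith
      qed
      have contD: "\<forall>x\<in>{1..?K}. continuous_on {0..1} (Df n \<theta> x)"
      proof
        fix x assume "x \<in> {1..?K}"
        then obtain p where "Df n \<theta> x = poly p" using T(9) by blast
        then show "continuous_on {0..1} (Df n \<theta> x)" by (simp add: continuous_intros)
      qed
      have "\<bar>seglik ?K ?Q (\<lambda>t. em (\<psi> (min 1 (real t / real n))) bb \<omega> t) 0 n - real n * integral {0..1} (\<lambda>u. lam ?K ?Q (\<psi> u) bb)\<bar>
         \<le> real n * (\<epsilon> / 4 + 2 * CV * w h)"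
      proof -
        have "?V ?K bb n" using elim(1) T(1,2) bbP cov by auto
        moreover have "\<forall>u\<in>{0..1}. \<forall>u'\<in>{0..1}. \<bar>u - u'\<bar> \<le> 1 / real J \<longrightarrow> (\<forall>x\<in>{1..?K}. \<forall>z. \<bar>ln (\<psi> u x z) - ln (\<psi> u' x z)\<bar> \<le> v \<bar>z\<bar> * w h)"
          unfolding \<psi>_def using T(5,7) Dlip by (intro ballI impI allI translate_diff) auto
        moreover have "continuous_on {0..1} (\<lambda>u. lam ?K ?Q (\<psi> u) bb)"
          unfolding \<psi>_def[abs_def] by (rule lam_continuous[OF T(1,4,5,7) contD cov])
        moreover have "0 \<le> w h" using h by (intro w_nonneg) simp
        ultimately show ?thesis using T(4) em\<psi> by blast
      qed
      also have "real n * (\<epsilon> / 4 + 2 * CV * w h) \<le> real n * (\<epsilon> / 2)"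
      proof (rule mult_left_mono)
        have "CV * w h \<le> CV * (\<epsilon> / (8 * CV))" using h CV_pos by (intro mult_left_mono) auto
        then show "\<epsilon> / 4 + 2 * CV * w h \<le> \<epsilon> / 2" using CV_pos by simp
      qed simp
      finally have 3: "\<bar>seglik ?K ?Q (\<lambda>t. em (\<psi> (min 1 (real t / real n))) bb \<omega> t) 0 n - real n * integral {0..1} (\<lambda>u. lam ?K ?Q (\<psi> u) bb)\<bar> \<le> real n * (\<epsilon> / 2)" .
      have res: "seglik ?K ?Q (\<lambda>t x. if bt n \<theta> x = bl t \<omega> then efull \<theta> \<omega> t x else 0) 0 n
         = seglik ?K ?Q (\<lambda>t. em (\<psi> (min 1 (real t / real n))) bb \<omega> t) 0 n"
      proof (rule seglik_cong)
        fix t x assume t: "t \<in> {0+1..0+n}" and x: "x \<in> {1..?K}"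
        show "(if bt n \<theta> x = bl t \<omega> then efull \<theta> \<omega> t x else 0) = em (\<psi> (min 1 (real t / real n))) bb \<omega> t x"
          using efull_right[OF g elim(4), of t \<theta> x] t x by (simp add: em_def \<psi>_def bbeq)
      qed
      have int: "lint P \<theta>s X Zx ?K ?Q (gp \<theta>) (Df n \<theta>) (bt n \<theta>) = integral {0..1} (\<lambda>u. lam ?K ?Q (\<psi> u) bb)"
      proof -
        have "lam ?K ?Q (\<psi> u) bb = lam ?K ?Q (\<psi> u) (bt n \<theta>)" for u by (rule lam_block_cong) (rule bbeq)
        then show ?thesis unfolding lint_eq[OF T(1,4,5,7,8)] \<psi>_def[abs_def] by simp
      qed
      have 1: "\<bar>loglik n \<theta> (\<lambda>t. Yobs \<theta>s X Zx t \<omega>) - seglik ?K ?Q (efull \<theta> \<omega>) 0 n\<bar> \<le> real n * (\<epsilon> / 4)"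
        using elim(2) \<theta> by blast
      have 2: "\<bar>seglik ?K ?Q (efull \<theta> \<omega>) 0 n - seglik ?K ?Q (\<lambda>t x. if bt n \<theta> x = bl t \<omega> then efull \<theta> \<omega> t x else 0) 0 n\<bar> \<le> real n * (\<epsilon> / 4)"
        using elim(3) \<theta> by blast
      define I where "I = lint P \<theta>s X Zx ?K ?Q (gp \<theta>) (Df n \<theta>) (bt n \<theta>)"
      have "\<bar>loglik n \<theta> (\<lambda>t. Yobs \<theta>s X Zx t \<omega>) - real n * I\<bar> \<le> real n * (\<epsilon> / 4) + real n * (\<epsilon> / 4) + real n * (\<epsilon> / 2)"
        using 1 2 3 unfolding res int[symmetric] I_def by linarith
      also have "\<dots> = real n * \<epsilon>" by simp
      finally have fin: "\<bar>loglik n \<theta> (\<lambda>t. Yobs \<theta>s X Zx t \<omega>) - real n * I\<bar> \<le> real n * \<epsilon>" .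
      have "loglik n \<theta> (\<lambda>t. Yobs \<theta>s X Zx t \<omega>) / real n - I = (loglik n \<theta> (\<lambda>t. Yobs \<theta>s X Zx t \<omega>) - real n * I) / real n"
        using n'(2) by (simp add: diff_divide_distrib)
      then have "\<bar>loglik n \<theta> (\<lambda>t. Yobs \<theta>s X Zx t \<omega>) / real n - I\<bar> = \<bar>loglik n \<theta> (\<lambda>t. Yobs \<theta>s X Zx t \<omega>) - real n * I\<bar> / real n"
        by simp
      also have "\<dots> \<le> \<epsilon>" using fin n'(2) by (simp add: field_simps)
      finally show "\<bar>loglik n \<theta> (\<lambda>t. Yobs \<theta>s X Zx t \<omega>) / real n - lint P \<theta>s X Zx ?K ?Q (gp \<theta>) (Df n \<theta>) (bt n \<theta>)\<bar> \<le> \<epsilon>"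
        unfolding I_def .
    qed
  qed
qed

text \<open>Ensures that the supremum is taken over a nonempty set; in \<open>ereal\<close> an empty
  one would give minus infinity, which does not tend to 0.\<close>

lemma true_par_TOK: "\<theta>s \<in> TOK n"
  using true_par M_pos unfolding ThetaOK_def by (auto intro!: bexI)

lemma sup_converges:
  "AE \<omega> in P. (\<lambda>n. SUP \<theta>\<in>TOK n. ereal \<bar>loglik n \<theta> (\<lambda>t. Yobs \<theta>s X Zx t \<omega>) / real n -
     lint P \<theta>s X Zx (Kp \<theta>) (Qp \<theta>) (gp \<theta>) (Df n \<theta>) (bt n \<theta>)\<bar>) \<longlonglongrightarrow> 0"
  using AE_good AE_all_uconv
proof eventually_elim
  fix \<omega> assume a: "good \<omega>" "all_uconv \<omega>"
  let ?f = "\<lambda>n \<theta>. \<bar>loglik n \<theta> (\<lambda>t. Yobs \<theta>s X Zx t \<omega>) / real n -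
     lint P \<theta>s X Zx (Kp \<theta>) (Qp \<theta>) (gp \<theta>) (Df n \<theta>) (bt n \<theta>)\<bar>"
  have ge: "0 \<le> (SUP \<theta>\<in>TOK n. ereal (?f n \<theta>))" for n
    by (rule SUP_upper2[OF true_par_TOK]) simp
  show "(\<lambda>n. SUP \<theta>\<in>TOK n. ereal (?f n \<theta>)) \<longlonglongrightarrow> 0"
  proof (rule order_tendstoI)
    fix b :: ereal assume "b < 0"
    then show "\<forall>\<^sub>F n in sequentially. b < (SUP \<theta>\<in>TOK n. ereal (?f n \<theta>))"
      using ge by (auto intro!: always_eventually less_le_trans[of b 0])
  next
    fix b :: ereal assume "0 < b"
    then obtain e where e: "0 < ereal e" "ereal e < b" using ereal_dense2 by blast
    have "\<forall>\<^sub>F n in sequentially. \<forall>\<theta>\<in>TOK n. ?f n \<theta> \<le> e" using e by (intro uniform_estimate a) simp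
    then show "\<forall>\<^sub>F n in sequentially. (SUP \<theta>\<in>TOK n. ereal (?f n \<theta>)) < b"
    proof eventually_elim
      case (elim n)
      then have "(SUP \<theta>\<in>TOK n. ereal (?f n \<theta>)) \<le> ereal e" by (intro SUP_least) simp
      then show ?case using e(2) by (rule le_less_trans)
    qed
  qed
qed

end

theorem theorem6:
  fixes K d :: nat and sigma :: real and \<Gamma> :: "(real \<Rightarrow> real) set"
    and P :: "'a measure" and X :: "nat \<Rightarrow> 'a \<Rightarrow> nat" and Zx :: "nat \<Rightarrow> nat \<Rightarrow> 'a \<Rightarrow> real"
    and \<theta>s :: hmmpar and M :: real
  assumes K: "1 \<le> K" and d: "1 \<le> d" and sigma: "0 < sigma" "sigma < 1"
    and dens: "\<forall>\<gamma>\<in>\<Gamma>. (\<forall>z. 0 \<le> \<gamma> z) \<and> integrable lborel \<gamma> \<and> integral\<^sup>L lborel \<gamma> = 1"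
    and compact: "compact \<Gamma>"
    and true_par: "\<theta>s \<in> Theta K d sigma \<Gamma>"
    and P: "prob_space P"
    and X_meas: "\<forall>t. X t \<in> measurable P (count_space UNIV)"
    and markov: "\<forall>n\<ge>1. \<forall>xs\<in>paths n (Kp \<theta>s).
        measure P {\<omega>\<in>space P. \<forall>t\<in>{1..n}. X t \<omega> = xs t} =
        pip \<theta>s (xs 1) * (\<Prod>t\<in>{2..n}. Qp \<theta>s (xs (t - 1)) (xs t))"
    and Z_dens: "\<forall>x\<in>{1..Kp \<theta>s}. \<forall>t\<ge>1. distributed P lborel (Zx x t) (\<lambda>z. ennreal (gp \<theta>s x z))"
    and Z_indep: "prob_space.indep_vars P (\<lambda>_. borel) (\<lambda>(x, t). Zx x t) ({1..Kp \<theta>s} \<times> {1..})"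
    and XZ_indep: "prob_space.indep_set P
        (sigma_sets (space P) {X t -` A \<inter> space P | t A. 1 \<le> t})
        (sigma_sets (space P) {Zx x t -` A \<inter> space P | x t A. x \<in> {1..Kp \<theta>s} \<and> 1 \<le> t \<and> A \<in> sets borel})"
    and Amax: "\<exists>g. (\<forall>s t. 0 \<le> s \<longrightarrow> s \<le> t \<longrightarrow> g t \<le> g s) \<and> (\<forall>s\<ge>0. 0 \<le> g s) \<and>
        (g \<longlongrightarrow> 0) at_top \<and> (\<forall>\<gamma>\<in>\<Gamma>. \<forall>z. \<gamma> z \<le> g \<bar>z\<bar>)"
    and Amin_Aint: "\<exists>m. (\<forall>s t. 0 \<le> s \<longrightarrow> s \<le> t \<longrightarrow> m t \<le> m s) \<and> (\<forall>s\<ge>0. 0 < m s) \<and>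
        (\<forall>\<gamma>\<in>\<Gamma>. \<forall>z. m \<bar>z\<bar> \<le> \<gamma> z) \<and>
        (\<forall>M'>0. integrable P (\<lambda>\<omega>. ln (m (M' + Zmax (Kp \<theta>s) Zx 1 \<omega>))))"
    and Areg: "\<exists>w L. (\<forall>s t. 0 \<le> s \<longrightarrow> s \<le> t \<longrightarrow> w s \<le> w t) \<and> w 0 = 0 \<and> (w \<longlongrightarrow> 0) (at_right 0) \<and>
        (\<forall>s t. 0 \<le> s \<longrightarrow> s \<le> t \<longrightarrow> L s \<le> L t) \<and>
        (\<forall>\<gamma>\<in>\<Gamma>. \<forall>z \<eta>. \<bar>ln (\<gamma> (z + \<eta>) / \<gamma> z)\<bar> \<le> L \<bar>z\<bar> * w \<bar>\<eta>\<bar>) \<and>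
        (\<forall>M'>0. integrable P (\<lambda>\<omega>. L (M' + Zmax (Kp \<theta>s) Zx 1 \<omega>)))"
    and M: "0 < M"
  shows "cont_on_dom K sigma \<Gamma> (supcl (DM K d sigma \<Gamma> (Kp \<theta>s) (Tp \<theta>s) M))
           (Blocks (Kp \<theta>s) (Tp \<theta>s)) (lint P \<theta>s X Zx)
       \<and> (AE \<omega> in P. (\<lambda>n. SUP \<theta>\<in>ThetaOK K d sigma \<Gamma> (Kp \<theta>s) (Tp \<theta>s) n M.
             ereal \<bar>loglik n \<theta> (\<lambda>t. Yobs \<theta>s X Zx t \<omega>) / real n -
               lint P \<theta>s X Zx (Kp \<theta>) (Qp \<theta>) (gp \<theta>) (Dfun (Kp \<theta>s) (Tp \<theta>s) n M \<theta>)
                 (bth (Kp \<theta>s) (Tp \<theta>s) n M \<theta>)\<bar>) \<longlonglongrightarrow> 0)"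
proof -
  obtain g where g: "\<forall>s t. 0 \<le> s \<longrightarrow> s \<le> t \<longrightarrow> g t \<le> g s" "(g \<longlongrightarrow> 0) at_top" "\<forall>\<gamma>\<in>\<Gamma>. \<forall>z. \<gamma> z \<le> g \<bar>z\<bar>"
    using Amax by auto
  obtain m where m: "\<forall>s t. 0 \<le> s \<longrightarrow> s \<le> t \<longrightarrow> m t \<le> m s" "\<forall>s\<ge>0. 0 < m s" "\<forall>\<gamma>\<in>\<Gamma>. \<forall>z. m \<bar>z\<bar> \<le> \<gamma> z"
    "\<forall>M'>0. integrable P (\<lambda>\<omega>. ln (m (M' + Zmax (Kp \<theta>s) Zx 1 \<omega>)))"
    using Amin_Aint by auto
  obtain w L where w: "\<forall>s t. 0 \<le> s \<longrightarrow> s \<le> t \<longrightarrow> w s \<le> w t" "w 0 = 0" "(w \<longlongrightarrow> 0) (at_right 0)"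
    and L: "\<forall>s t. 0 \<le> s \<longrightarrow> s \<le> t \<longrightarrow> L s \<le> L t" "\<forall>\<gamma>\<in>\<Gamma>. \<forall>z \<eta>. \<bar>ln (\<gamma> (z + \<eta>) / \<gamma> z)\<bar> \<le> L \<bar>z\<bar> * w \<bar>\<eta>\<bar>"
      "\<forall>M'>0. integrable P (\<lambda>\<omega>. L (M' + Zmax (Kp \<theta>s) Zx 1 \<omega>))"
    using Areg by auto
  have "trend_hmm P K d sigma \<Gamma> X Zx \<theta>s M g m w L"
    unfolding trend_hmm_def trend_hmm_axioms_def
    by (intro conjI P K sigma(1) true_par X_meas markov Z_dens Z_indep XZ_indep g m w L M)
  then interpret trend_hmm P K d sigma \<Gamma> X Zx \<theta>s M g m w L .
  show ?thesis using lint_continuous sup_converges by (rule conjI)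
qed

end
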